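(* Let $\mathcal G$ be a compact, connected, finite metric graph with non-empty Dirichlet vertex set $\mathsf V_{\mathrm D}$. Then \[ \left(\frac{\pi}{\sqrt[3]{24}}\right)^2\le\lambda_1(\mathcal G;\mathsf V_{\mathrm D})\,T(\mathcal G;\mathsf V_{\mathrm D})^{\frac23}, \] with equality if and only if $\mathcal G$ is a path graph (interval) with mixed Dirichlet/Neumann boundary conditions. If, additionally, $\mathcal G$ is doubly connected after gluing all Dirichlet vertices, then \[ \left(\frac{\pi}{\sqrt[3]{12}}\right)^2\le\lambda_1(\mathcal G;\mathsf V_{\mathrm D})\,T(\mathcal G;\mathsf V_{\mathrm D})^{\frac23}, \] with equality if and only if $\mathcal G$ is a caterpillar graph.
   Context: A compact, connected, finite metric graph consists of finitely many edges $\mathsf e\simeq[0,\ell_{\mathsf e}]$, $0<\ell_{\mathsf e}<\infty$, glued at their endpoints (vertices) to form a connected space. $H^1_0(\mathcal G;\mathsf V_{\mathrm D})$ is the space of continuous functions on $\mathcal G$ that are edgewise $H^1$ and vanish on $\mathsf V_{\mathrm D}$. The ground-state energy is $\lambda_1(\mathcal G;\mathsf V_{\mathrm D})=\min_{0\ne f\in H^1_0(\mathcal G;\mathsf V_{\mathrm D})}\|f'\|_{L^2}^2/\|f\|_{L^2}^2$. The torsion function $v$ is the unique function in $H^1_0(\mathcal G;\mathsf V_{\mathrm D})$, edgewise $H^2$, with $-v_{\mathsf e}''=1$ on each edge and sum of normal derivatives over all incident edges equal to $0$ at each vertex not in $\mathsf V_{\mathrm D}$. The torsional rigidity is $T(\mathcal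 G;\mathsf V_{\mathrm D})=\int_{\mathcal G}v\,dx$. Mixed Dirichlet/Neumann conditions on an interval: Dirichlet at one endpoint, Neumann at the other. A graph is doubly connected if it has edge connectivity at least $2$, i.e. it stays connected when the interior of any one edge is removed. A caterpillar graph is a 2-regular pumpkin chain one of whose two end vertices (of degree two) carries the Dirichlet condition: there are vertices $\mathsf v_0,\dots,\mathsf v_m$ ($m\ge1$), for each $j$ the vertices $\mathsf v_{j-1},\mathsf v_j$ are joined by exactly two edges, of equal length, there are no other edges, and $\mathsf v_0$ is the Dirichlet vertex. Graphs are identified if they differ only by gluing or splitting Dirichlet vertices (which affects neither $\lambda_1$ nor $T$), or by insertion or removal of degree-two non-Dirichlet vertices in the interior of edges. *)

theory Defs
  imports "HOL-Analysis.Analysis" "Graph_Theory.Digraph_Component"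
begin

section \<open>Metric graphs with a Dirichlet vertex set\<close>

text \<open>
  The skeleton is a multigraph, loops allowed.  The orientation of an arc \<open>e\<close> only serves to
  identify the edge with the interval from \<open>0\<close> (at \<open>tail e\<close>) to \<open>len e\<close> (at \<open>head e\<close>);
  all notions below are independent of it.
\<close>

record ('v, 'e) metric_graph =
  skeleton :: "('v, 'e) pre_digraph"
  len :: "'e \<Rightarrow> real"
  dirichlet :: "'v set"

abbreviation mverts :: "('v, 'e) metric_graph \<Rightarrow> 'v set" where
  "mverts G \<equiv> verts (skeleton G)"

abbreviation medges :: "('v, 'e) metric_graph \<Rightarrow> 'e set" where
  "medges G \<equiv> arcs (skeleton G)"

abbreviation mtail :: "('v, 'e) metric_graph \<Rightarrow> 'e \<Rightarrow> 'v" where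
  "mtail G \<equiv> tail (skeleton G)"

abbreviation mhead :: "('v, 'e) metric_graph \<Rightarrow> 'e \<Rightarrow> 'v" where
  "mhead G \<equiv> head (skeleton G)"

definition ends :: "('v, 'e) metric_graph \<Rightarrow> 'e \<Rightarrow> 'v set" where
  "ends G e = {mtail G e, mhead G e}"

text \<open>
  The constant \<^const>\<open>Digraph_Component.connected\<close> is connectedness of the underlying
  undirected graph.
  Connectedness and the presence of edges are deliberately not part of the following predicate,
  since splitting Dirichlet vertices may disconnect a graph.
\<close>

definition finite_metric_graph :: "('v, 'e) metric_graph \<Rightarrow> bool" where
  "finite_metric_graph G \<longleftrightarrow>
     fin_digraph (skeleton G) \<and> (\<forall>e\<in>medges G. 0 < len G e) \<and> dirichlet G \<subseteq> mverts G"

text \<open>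
  The edge set is required to be non-empty: for a single point the space of test functions is
  zero and there is no ground-state energy.
\<close>

definition connected_metric_graph :: "('v, 'e) metric_graph \<Rightarrow> bool" where
  "connected_metric_graph G \<longleftrightarrow>
     finite_metric_graph G \<and> medges G \<noteq> {} \<and> Digraph_Component.connected (skeleton G)"

definition doubly_connected :: "('v, 'e) metric_graph \<Rightarrow> bool" where
  "doubly_connected G \<longleftrightarrow>
     Digraph_Component.connected (skeleton G) \<and>
     (\<forall>e\<in>medges G. Digraph_Component.connected (pre_digraph.del_arc (skeleton G) e))"

definition glue_map :: "('v, 'e) metric_graph \<Rightarrow> 'v \<Rightarrow> 'v" where
  "glue_map G w = (if w \<in> dirichlet G then SOME d. d \<in> dirichlet G else w)"

definition glue_dirichlet :: "('v, 'e) metric_graph \<Rightarrow> ('v, 'e) metric_graph" where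
  "glue_dirichlet G =
     \<lparr> skeleton = \<lparr> verts = glue_map G ` mverts G, arcs = medges G,
                    tail = glue_map G \<circ> mtail G, head = glue_map G \<circ> mhead G \<rparr>,
       len = len G,
       dirichlet = glue_map G ` dirichlet G \<rparr>"


section \<open>Sobolev functions on an interval and on a metric graph\<close>

definition L2_on :: "real \<Rightarrow> (real \<Rightarrow> real) \<Rightarrow> bool" where
  "L2_on l f \<longleftrightarrow> set_borel_measurable lborel {0<..<l} f \<and>
                 set_integrable lborel {0<..<l} (\<lambda>x. (f x)\<^sup>2)"

text \<open>\<open>\<phi>\<close> is continuously differentiable with derivative \<open>\<phi>'\<close> and its support is a
  compact subset of the open interval from \<open>0\<close> to \<open>l\<close>.\<close>

definition C1_test :: "real \<Rightarrow> (real \<Rightarrow> real) \<Rightarrow> (real \<Rightarrow> real) \<Rightarrow> bool" where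
  "C1_test l \<phi> \<phi>' \<longleftrightarrow>
     (\<forall>x. (\<phi> has_real_derivative \<phi>' x) (at x)) \<and> continuous_on UNIV \<phi>' \<and>
     (\<exists>a b. 0 < a \<and> b < l \<and> (\<forall>x. x \<notin> {a..b} \<longrightarrow> \<phi> x = 0))"

definition has_weak_deriv :: "real \<Rightarrow> (real \<Rightarrow> real) \<Rightarrow> (real \<Rightarrow> real) \<Rightarrow> bool" where
  "has_weak_deriv l f g \<longleftrightarrow>
     (\<forall>\<phi> \<phi>'. C1_test l \<phi> \<phi>' \<longrightarrow>
        (LINT x:{0<..<l}|lborel. f x * \<phi>' x) = - (LINT x:{0<..<l}|lborel. g x * \<phi> x))"

definition H1_on :: "real \<Rightarrow> (real \<Rightarrow> real) \<Rightarrow> bool" where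
  "H1_on l f \<longleftrightarrow> L2_on l f \<and> (\<exists>g. L2_on l g \<and> has_weak_deriv l f g)"

text \<open>For \<open>f\<close> in \<^const>\<open>H1_on\<close> this is determined up to null sets.\<close>

definition weak_deriv :: "real \<Rightarrow> (real \<Rightarrow> real) \<Rightarrow> real \<Rightarrow> real" where
  "weak_deriv l f = (SOME g. L2_on l g \<and> has_weak_deriv l f g)"

definition H2_on :: "real \<Rightarrow> (real \<Rightarrow> real) \<Rightarrow> bool" where
  "H2_on l f \<longleftrightarrow> H1_on l f \<and> H1_on l (weak_deriv l f)"

text \<open>
  A function on the graph is given edgewise; the values of \<open>f e\<close> outside the interval from
  \<open>0\<close> to \<open>len G e\<close>, and those for \<open>e\<close> not in the graph, are irrelevant.  Continuity on the
  graph is continuity on each closed edge together with common values \<open>u w\<close> at the vertices.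
\<close>

definition H10 :: "('v, 'e) metric_graph \<Rightarrow> ('e \<Rightarrow> real \<Rightarrow> real) set" where
  "H10 G = {f.
     (\<forall>e\<in>medges G. continuous_on {0..len G e} (f e) \<and> H1_on (len G e) (f e)) \<and>
     (\<exists>u. (\<forall>e\<in>medges G. f e 0 = u (mtail G e) \<and> f e (len G e) = u (mhead G e)) \<and>
          (\<forall>w\<in>dirichlet G. u w = 0))}"

definition nonzero_on :: "('v, 'e) metric_graph \<Rightarrow> ('e \<Rightarrow> real \<Rightarrow> real) \<Rightarrow> bool" where
  "nonzero_on G f \<longleftrightarrow> (\<exists>e\<in>medges G. \<exists>x\<in>{0..len G e}. f e x \<noteq> 0)"

definition graph_integral :: "('v, 'e) metric_graph \<Rightarrow> ('e \<Rightarrow> real \<Rightarrow> real) \<Rightarrow> real" where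
  "graph_integral G f = (\<Sum>e\<in>medges G. LINT x:{0..len G e}|lborel. f e x)"

definition rayleigh :: "('v, 'e) metric_graph \<Rightarrow> ('e \<Rightarrow> real \<Rightarrow> real) \<Rightarrow> real" where
  "rayleigh G f =
     graph_integral G (\<lambda>e x. (weak_deriv (len G e) (f e) x)\<^sup>2) / graph_integral G (\<lambda>e x. (f e x)\<^sup>2)"

text \<open>Any value characterised by \<^const>\<open>Least\<close> is attained: this is a minimum, not just an infimum.\<close>

definition ground_state_energy :: "('v, 'e) metric_graph \<Rightarrow> real" where
  "ground_state_energy G = (LEAST q. \<exists>f\<in>H10 G. nonzero_on G f \<and> q = rayleigh G f)"


section \<open>Torsion function and torsional rigidity\<close>

text \<open>
  Normal derivatives are taken pointing from the vertex into the edge; an edge of length \<open>l\<close>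
  carrying \<open>f\<close> contributes \<open>f' 0\<close> at its tail and \<open>- f' l\<close> at its head, so that
  a loop contributes both.
\<close>

definition normal_deriv_sum ::
    "('v, 'e) metric_graph \<Rightarrow> ('e \<Rightarrow> real \<Rightarrow> real) \<Rightarrow> 'v \<Rightarrow> real" where
  "normal_deriv_sum G f w =
     (\<Sum>e\<in>{e\<in>medges G. mtail G e = w}.
        vector_derivative (f e) (at 0 within {0..len G e})) +
     (\<Sum>e\<in>{e\<in>medges G. mhead G e = w}.
        - vector_derivative (f e) (at (len G e) within {0..len G e}))"

definition is_torsion_function :: "('v, 'e) metric_graph \<Rightarrow> ('e \<Rightarrow> real \<Rightarrow> real) \<Rightarrow> bool" where
  "is_torsion_function G v \<longleftrightarrow>
     v \<in> H10 G \<and>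
     (\<forall>e\<in>medges G. H2_on (len G e) (v e) \<and>
        (AE x in lborel. x \<in> {0<..<len G e} \<longrightarrow>
           - weak_deriv (len G e) (weak_deriv (len G e) (v e)) x = 1)) \<and>
     (\<forall>w\<in>mverts G - dirichlet G. normal_deriv_sum G v w = 0)"

text \<open>Unique up to the irrelevant values off the edges.\<close>

definition torsion_function :: "('v, 'e) metric_graph \<Rightarrow> 'e \<Rightarrow> real \<Rightarrow> real" where
  "torsion_function G = (SOME v. is_torsion_function G v)"

definition torsional_rigidity :: "('v, 'e) metric_graph \<Rightarrow> real" where
  "torsional_rigidity G = graph_integral G (torsion_function G)"


section \<open>Identification of metric graphs\<close>

text \<open>
  \<open>H\<close> arises from \<open>G\<close>, up to isomorphism (and orientation of edges), by gluing some (possibly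
  no) Dirichlet vertices; the vertex map is injective off the Dirichlet set.
\<close>

definition glues_to :: "('v, 'e) metric_graph \<Rightarrow> ('w, 'f) metric_graph \<Rightarrow> bool" where
  "glues_to G H \<longleftrightarrow>
     finite_metric_graph G \<and> finite_metric_graph H \<and>
     (\<exists>p q. p ` dirichlet G = dirichlet H \<and>
        bij_betw p (mverts G - dirichlet G) (mverts H - dirichlet H) \<and>
        bij_betw q (medges G) (medges H) \<and>
        (\<forall>e\<in>medges G. ends H (q e) = p ` ends G e \<and> len H (q e) = len G e))"

text \<open>
  \<open>H\<close> arises from \<open>G\<close> by inserting one new non-Dirichlet vertex \<open>w\<close> (of degree two) at distance
  \<open>s\<close> from the tail of \<open>e\<close>; \<open>e'\<close> becomes the part of \<open>e\<close> adjacent to its head.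
\<close>

definition subdivides_to :: "('v, 'e) metric_graph \<Rightarrow> ('v, 'e) metric_graph \<Rightarrow> bool" where
  "subdivides_to G H \<longleftrightarrow>
     finite_metric_graph G \<and>
     (\<exists>e e' w s. e \<in> medges G \<and> e' \<notin> medges G \<and> w \<notin> mverts G \<and> 0 < s \<and> s < len G e \<and>
        H = \<lparr> skeleton = \<lparr> verts = insert w (mverts G), arcs = insert e' (medges G),
                           tail = (mtail G)(e' := w),
                           head = (mhead G)(e := w, e' := mhead G e) \<rparr>,
              len = (len G)(e := s, e' := len G e - s),
              dirichlet = dirichlet G \<rparr>)"

text \<open>
  The generated equivalence relation.  It lives on graphs whose vertices and edges are natural
  numbers, so that new vertices and edges are always available; a graph over arbitrary types
  enters through a copy.
\<close>

definition identified :: "('v, 'e) metric_graph \<Rightarrow> (nat, nat) metric_graph \<Rightarrow> bool" where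
  "identified G H \<longleftrightarrow>
     (\<exists>G' :: (nat, nat) metric_graph.
        glues_to G G' \<and> equivclp (\<lambda>A B. glues_to A B \<or> subdivides_to A B) G' H)"


section \<open>The extremal graphs\<close>

text \<open>A path graph with several edges is identified with one of this form.\<close>

definition mixed_interval :: "('v, 'e) metric_graph \<Rightarrow> bool" where
  "mixed_interval G \<longleftrightarrow>
     finite_metric_graph G \<and>
     (\<exists>a b e. a \<noteq> b \<and> mverts G = {a, b} \<and> medges G = {e} \<and> ends G e = {a, b} \<and>
        dirichlet G = {a})"

definition caterpillar :: "('v, 'e) metric_graph \<Rightarrow> bool" where
  "caterpillar G \<longleftrightarrow>
     finite_metric_graph G \<and>
     (\<exists>(m::nat) (v :: nat \<Rightarrow> 'v). m \<ge> 1 \<and> inj_on v {0..m} \<and> mverts G = v ` {0..m} \<and>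
        dirichlet G = {v 0} \<and>
        (\<forall>j\<in>{1..m}. \<exists>a b. a \<noteq> b \<and> {e\<in>medges G. ends G e = {v (j - 1), v j}} = {a, b} \<and>
           len G a = len G b) \<and>
        (\<forall>e\<in>medges G. \<exists>j\<in>{1..m}. ends G e = {v (j - 1), v j}))"

end

theory Submission
  imports Defs
begin

text \<open>
  The proof is the rearrangement argument of Kohler-Jobin, carried out in the level variable.  Let
  \<open>u \<ge> 0\<close> be a ground state with eigenvalue \<open>\<lambda>\<close>.  After subdividing at critical points
  and at levels of vertices, and reorienting, \<open>u\<close> is increasing or zero along each edge.  Let
  \<open>\<mu> t\<close> be the length of \<open>{u > t}\<close> and \<open>P t\<close> the integral of \<open>\<lambda> u\<close> over
  this set; by Kirchhoff's law \<open>P t\<close> is the sum of the slopes of \<open>u\<close> at the points of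
  level \<open>t\<close>, while \<open>- \<mu>' t\<close> is the sum of their inverses.  There are at least
  \<open>N\<close> such points, where \<open>N = 1\<close> in general and \<open>N = 2\<close> in the doubly connected
  case, so \<open>- \<mu>' P \<ge> N\<^sup>2\<close>.

  The competitor \<open>g \<circ> u\<close> with \<open>g' = \<mu> / P\<close> bounds the torsional rigidity from below by
  \<open>T\<^sub>0 = \<integral> \<mu>\<^sup>2 / P\<close>.  Writing \<open>T\<^sub>0 = N R\<^sup>3 / 3\<close>, one compares with \<open>N\<close> copies of
  the mixed interval of length \<open>R\<close>, whose lowest eigenvalue \<open>(\<pi> / (2 R))\<^sup>2\<close> turns out to
  be at most \<open>\<lambda>\<close>.  Equality forces exactly \<open>N\<close> points at almost every level, with equal slopes,
  which makes the graph a path or a caterpillar.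
\<close>

text \<open>The slope \<open>\<mu> / P\<close> is forced: for a competitor
  \<open>g \<circ> u\<close>, twice the integral minus the energy equals the integral of
  \<open>2 * g' * \<mu> - g'\<^sup>2 * P\<close> over the levels, and this choice maximises the
  integrand pointwise. All geometry enters through \<open>s * P \<ge> N\<^sup>2\<close>, which says
  that the part of the graph above a level is at least as long as \<open>N\<close> intervals with
  the same remaining torsion. Two obstacles shape the rest. First, both quantities are defined
  through weak derivatives and choice, and identifications may disconnect the graph. Hence
  eigenvalue and torsion are read off from a set of number triples that identifications preserve,
  and connectivity is replaced by lower bounds for the number of edges leaving vertex sets free of
  Dirichlet vertices. Second, a ground state has to exist and be smooth on edges. This needs no
  compactness in function spaces: once all edges are short, the eigenvalue problem becomes a
  quadratic form in the vertex values, and a form on a finite-dimensional space either is coercive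
  or has a nonzero vector on which it is not positive.\<close>

section \<open>Functions on an interval with square integrable derivative\<close>

lemma set_integrable_lborel_iff:
  fixes g :: "real \<Rightarrow> real"
  assumes "g \<in> borel_measurable borel" "S \<in> sets borel"
  shows "set_integrable lborel S g \<longleftrightarrow> g absolutely_integrable_on S"
  unfolding set_integrable_def using assms by (subst integrable_completion) auto

text \<open>The working form of \<open>H1_on\<close>: \<open>f\<close> is the primitive of a square
  integrable Borel function. It bypasses the choice in \<open>weak_deriv\<close> and pins down
  \<open>f\<close> at every point of the closed interval. The passage in both directions is made by
  \<open>H1_deriv_weak\<close> and \<open>H1_derivI_weak\<close>.\<close>

definition H1_deriv :: "real \<Rightarrow> (real \<Rightarrow> real) \<Rightarrow> (real \<Rightarrow> real) \<Rightarrow> bool" where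
  "H1_deriv l f g \<longleftrightarrow> g \<in> borel_measurable borel \<and> (\<lambda>x. (g x)\<^sup>2) integrable_on {0..l} \<and>
     (\<forall>x\<in>{0..l}. (g has_integral f x - f 0) {0..x})"

lemma H1_derivD:
  assumes "H1_deriv l f g"
  shows "g \<in> borel_measurable borel" "(\<lambda>x. (g x)\<^sup>2) integrable_on {0..l}"
    "\<And>x. 0 \<le> x \<Longrightarrow> x \<le> l \<Longrightarrow> (g has_integral f x - f 0) {0..x}"
  using assms by (auto simp: H1_deriv_def)

lemma abs_integrable_of_square:
  fixes g :: "real \<Rightarrow> real"
  assumes "g \<in> borel_measurable borel" "(\<lambda>x. (g x)\<^sup>2) integrable_on {a..b}"
  shows "g absolutely_integrable_on {a..b}"
proof (rule measurable_bounded_by_integrable_imp_absolutely_integrable)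
  show "g \<in> borel_measurable (lebesgue_on {a..b})"
    using assms(1) by (simp add: measurable_completion measurable_restrict_space1)
  show "(\<lambda>x. 1 + (g x)\<^sup>2) integrable_on {a..b}"
    by (intro integrable_add assms) auto
  show "norm (g x) \<le> 1 + (g x)\<^sup>2" for x
  proof -
    have "0 \<le> (\<bar>g x\<bar> - 1)\<^sup>2" by simp
    then have "2 * \<bar>g x\<bar> \<le> 1 + (g x)\<^sup>2" by (simp add: power2_eq_square algebra_simps)
    then show ?thesis by simp
  qed
qed auto

lemma H1_deriv_abs_integrable:
  assumes "H1_deriv l f g" shows "g absolutely_integrable_on {0..l}"
  using abs_integrable_of_square H1_derivD[OF assms] by blast

lemma H1_deriv_abs_integrable_sub:
  assumes "H1_deriv l f g" "0 \<le> a" "b \<le> l" shows "g absolutely_integrable_on {a..b}"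
  using H1_deriv_abs_integrable[OF assms(1)]
  by (rule set_integrable_subset) (use assms in auto)

lemma H1_deriv_has_integral:
  assumes "H1_deriv l f g" "0 \<le> a" "a \<le> b" "b \<le> l"
  shows "(g has_integral f b - f a) {a..b}"
proof -
  have gi: "g integrable_on {a..b}"
    using H1_deriv_abs_integrable_sub[OF assms(1,2,4)] by (simp add: set_lebesgue_integral_eq_integral(1))
  have "(g has_integral (f a - f 0) + integral {a..b} g) {0..b}"
    by (rule has_integral_combine[OF assms(2,3) H1_derivD(3)[OF assms(1)] integrable_integral[OF gi]]) (use assms in auto)
  moreover have "(g has_integral f b - f 0) {0..b}" using H1_derivD(3)[OF assms(1), of b] assms by auto
  ultimately have "f a - f 0 + integral {a..b} g = f b - f 0" by (rule has_integral_unique)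
  then have "integral {a..b} g = f b - f a" by simp
  then show ?thesis using gi by (simp add: has_integral_iff)
qed

lemma H1_deriv_continuous:
  assumes "H1_deriv l f g" shows "continuous_on {0..l} f"
proof -
  have "continuous_on {0..l} (\<lambda>x. f 0 + integral {0..x} g)"
    using H1_deriv_abs_integrable[OF assms]
    by (intro continuous_intros indefinite_integral_continuous_1 set_lebesgue_integral_eq_integral(1))
  then show ?thesis
    by (rule continuous_on_eq) (use H1_derivD(3)[OF assms] in \<open>auto simp: has_integral_iff\<close>)
qed

lemma abs_integrable_mult_continuous:
  fixes g h :: "real \<Rightarrow> real"
  assumes "g absolutely_integrable_on {a..b}" "continuous_on {a..b} h"
  shows "(\<lambda>x. h x * g x) absolutely_integrable_on {a..b}"
proof (rule absolutely_integrable_bounded_measurable_product_real[OF _ _ _ assms(1)])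
  show "h \<in> borel_measurable (lebesgue_on {a..b})"
    using assms(2) by (simp add: continuous_imp_measurable_on_sets_lebesgue)
  show "bounded (h ` {a..b})"
    using assms(2) by (simp add: compact_continuous_image compact_imp_bounded)
qed auto

lemma H1_deriv_C1:
  assumes d: "\<And>x. (f has_real_derivative g x) (at x)" and c: "continuous_on UNIV g" and l: "0 \<le> l"
  shows "H1_deriv l f g"
  unfolding H1_deriv_def
proof (intro conjI ballI)
  show "g \<in> borel_measurable borel" using c by (rule borel_measurable_continuous_onI)
  show "(\<lambda>x. (g x)\<^sup>2) integrable_on {0..l}"
    by (intro integrable_continuous_real continuous_intros continuous_on_subset[OF c]) auto
  fix x assume "x \<in> {0..l}"
  then show "(g has_integral f x - f 0) {0..x}"
    by (intro fundamental_theorem_of_calculus)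
      (auto intro!: has_field_derivative_at_within d simp: has_real_derivative_iff_has_vector_derivative[symmetric])
qed

lemma cross_integrable:
  assumes "H1_deriv l f g" "H1_deriv l p q"
  shows "(\<lambda>x. g x * q x) integrable_on {0..l}"
proof -
  have "(\<lambda>x. g x * q x) absolutely_integrable_on {0..l}"
  proof (rule measurable_bounded_by_integrable_imp_absolutely_integrable)
    show "(\<lambda>x. g x * q x) \<in> borel_measurable (lebesgue_on {0..l})"
      using H1_derivD(1)[OF assms(1)] H1_derivD(1)[OF assms(2)]
      by (intro measurable_restrict_space1 measurable_completion) simp
    show "(\<lambda>x. (g x)\<^sup>2 + (q x)\<^sup>2) integrable_on {0..l}"
      by (intro integrable_add H1_derivD(2)[OF assms(1)] H1_derivD(2)[OF assms(2)])
    show "norm (g x * q x) \<le> (g x)\<^sup>2 + (q x)\<^sup>2" for x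
    proof -
      have "0 \<le> (\<bar>g x\<bar> - \<bar>q x\<bar>)\<^sup>2" by simp
      then have "2 * \<bar>g x\<bar> * \<bar>q x\<bar> \<le> (g x)\<^sup>2 + (q x)\<^sup>2"
        by (simp add: power2_diff)
      moreover have "0 \<le> \<bar>g x\<bar> * \<bar>q x\<bar>" by simp
      ultimately show ?thesis by (simp only: real_norm_def abs_mult)
    qed
  qed auto
  then show ?thesis by (simp add: set_lebesgue_integral_eq_integral(1))
qed

lemma H1_deriv_lin:
  assumes "H1_deriv l f g" "H1_deriv l p q"
  shows "H1_deriv l (\<lambda>x. a * f x + b * p x) (\<lambda>x. a * g x + b * q x)"
  unfolding H1_deriv_def
proof (intro conjI ballI)
  show "(\<lambda>x. a * g x + b * q x) \<in> borel_measurable borel"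
    using H1_derivD(1)[OF assms(1)] H1_derivD(1)[OF assms(2)] by simp
  have "(\<lambda>x. a\<^sup>2 * (g x)\<^sup>2 + b\<^sup>2 * (q x)\<^sup>2 + 2*a*b * (g x * q x)) integrable_on {0..l}"
    by (intro integrable_add integrable_on_mult_right H1_derivD(2)[OF assms(1)] H1_derivD(2)[OF assms(2)] cross_integrable[OF assms])
  then show "(\<lambda>x. (a * g x + b * q x)\<^sup>2) integrable_on {0..l}"
    by (simp add: power2_eq_square algebra_simps)
  fix x assume "x \<in> {0..l}"
  then have "((\<lambda>x. a * g x + b * q x) has_integral a * (f x - f 0) + b * (p x - p 0)) {0..x}"
    by (intro has_integral_add has_integral_mult_right H1_derivD(3)[OF assms(1)] H1_derivD(3)[OF assms(2)]) auto
  then show "((\<lambda>x. a * g x + b * q x) has_integral a * f x + b * p x - (a * f 0 + b * p 0)) {0..x}"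
    by (simp add: algebra_simps)
qed

text \<open>Together with translation, reflection and concatenation below, this describes how
  cutting, reversing and rejoining edges act on functions.\<close>

lemma H1_deriv_restrict:
  assumes "H1_deriv l f g" "0 \<le> s" "s \<le> l" shows "H1_deriv s f g"
  using assms integrable_subinterval_real[of "\<lambda>x. (g x)\<^sup>2" 0 l 0 s] by (auto simp: H1_deriv_def)

lemma H1_deriv_shift:
  assumes "H1_deriv l f g" "0 \<le> s" "s \<le> l"
  shows "H1_deriv (l - s) (\<lambda>x. f (x + s)) (\<lambda>x. g (x + s))"
  unfolding H1_deriv_def
proof (intro conjI ballI)
  show "(\<lambda>x. g (x + s)) \<in> borel_measurable borel" using H1_derivD(1)[OF assms(1)] by simp
  have "(\<lambda>x. (g x)\<^sup>2) integrable_on {s..l}"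
    by (rule integrable_subinterval_real[OF H1_derivD(2)[OF assms(1)]]) (use assms in auto)
  from integrable_shift_real_ivl[OF this, of s] show "(\<lambda>x. (g (x + s))\<^sup>2) integrable_on {0..l - s}" by simp
  fix x assume x: "x \<in> {0..l - s}"
  have "(g has_integral f (x + s) - f s) {s..x+s}"
    by (rule H1_deriv_has_integral[OF assms(1)]) (use x assms in auto)
  from has_integral_shift_real_ivl[OF this, of s]
  show "((\<lambda>x. g (x + s)) has_integral f (x + s) - f (0 + s)) {0..x}" by simp
qed

lemma H1_deriv_reflect:
  assumes "H1_deriv l f g" "0 \<le> l"
  shows "H1_deriv l (\<lambda>x. f (l - x)) (\<lambda>x. - g (l - x))"
  unfolding H1_deriv_def
proof (intro conjI ballI)
  show "(\<lambda>x. - g (l - x)) \<in> borel_measurable borel" using H1_derivD(1)[OF assms(1)] by simp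
  have "(\<lambda>x. (g (-x))\<^sup>2) integrable_on {-l..-0}"
    using H1_derivD(2)[OF assms(1)] Henstock_Kurzweil_Integration.integrable_reflect_real[of "\<lambda>x. (g x)\<^sup>2" l 0] by simp
  from integrable_shift_real_ivl[OF this, of "-l"] show "(\<lambda>x. (- g (l - x))\<^sup>2) integrable_on {0..l}" by simp
  fix x assume x: "x \<in> {0..l}"
  have "(g has_integral f l - f (l - x)) {l-x..l}"
    by (rule H1_deriv_has_integral[OF assms(1)]) (use x assms in auto)
  then have "((\<lambda>y. g (-y)) has_integral f l - f (l - x)) {-l..-(l-x)}"
    by (subst has_integral_reflect_real)
  from has_integral_neg[OF has_integral_shift_real_ivl[OF this, of "-l"]]
  show "((\<lambda>x. - g (l - x)) has_integral f (l - x) - f (l - 0)) {0..x}" by simp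
qed

lemma integrable_on_concat:
  fixes f g :: "real \<Rightarrow> real"
  assumes "(f has_integral a) {0..s}" "(g has_integral b) {0..t}" "0 \<le> s" "0 \<le> t"
  shows "((\<lambda>x. if x \<le> s then f x else g (x - s)) has_integral a + b) {0..s + t}"
proof (rule has_integral_combine[where c = s])
  show "((\<lambda>x. if x \<le> s then f x else g (x - s)) has_integral a) {0..s}"
    by (rule has_integral_eq[OF _ assms(1)]) auto
  have "((\<lambda>x. g (x - s)) has_integral b) {s..s+t}"
    using has_integral_shift_real_ivl[OF assms(2), of "-s"] by (simp add: add.commute)
  then show "((\<lambda>x. if x \<le> s then f x else g (x - s)) has_integral b) {s..s+t}"
    by (rule has_integral_spike_finite[of "{s}", rotated 2]) auto
qed (use assms in auto)

lemma H1_deriv_concat: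
  assumes "H1_deriv s f g" "H1_deriv t p q" "0 \<le> s" "0 \<le> t" "f s = p 0"
  shows "H1_deriv (s + t) (\<lambda>x. if x \<le> s then f x else p (x - s)) (\<lambda>x. if x \<le> s then g x else q (x - s))"
  unfolding H1_deriv_def
proof (intro conjI ballI)
  note [measurable] = H1_derivD(1)[OF assms(1)] H1_derivD(1)[OF assms(2)]
  show "(\<lambda>x. if x \<le> s then g x else q (x - s)) \<in> borel_measurable borel"
    by measurable
  have "(\<lambda>x. if x \<le> s then (g x)\<^sup>2 else (q (x - s))\<^sup>2) integrable_on {0..s+t}"
    using integrable_on_concat[of "\<lambda>x. (g x)\<^sup>2" _ s "\<lambda>x. (q x)\<^sup>2" _ t] assms(3,4)
      H1_derivD(2)[OF assms(1)] H1_derivD(2)[OF assms(2)] unfolding integrable_on_def by blast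
  then show "(\<lambda>x. (if x \<le> s then g x else q (x - s))\<^sup>2) integrable_on {0..s+t}"
    by (simp add: if_distrib[of "\<lambda>x. x\<^sup>2"] cong: if_cong)
  fix x assume x: "x \<in> {0..s+t}"
  show "((\<lambda>x. if x \<le> s then g x else q (x - s)) has_integral
        (if x \<le> s then f x else p (x - s)) - (if 0 \<le> s then f 0 else p (0 - s))) {0..x}"
  proof (cases "x \<le> s")
    case True
    have "((\<lambda>x. if x \<le> s then g x else q (x - s)) has_integral f x - f 0) {0..x}"
      by (rule has_integral_eq[OF _ H1_derivD(3)[OF assms(1), of x]]) (use x True in auto)
    then show ?thesis using True assms(3) by simp
  next
    case False
    have "((\<lambda>x. if x \<le> s then g x else q (x - s)) has_integral (f s - f 0) + (p (x - s) - p 0)) {0..s+(x-s)}"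
      by (rule integrable_on_concat[OF H1_derivD(3)[OF assms(1)] H1_derivD(3)[OF assms(2)]]) (use x False assms in auto)
    then show ?thesis using False assms(3,5) by simp
  qed
qed

text \<open>The proof uses no pointwise derivative of \<open>f\<close>. The defect \<open>D\<close>
  between the primitive of the integrand and the product has derivative zero everywhere, because its
  increment over \<open>[a, b]\<close> is at most a constant times
  \<open>(b - a) * (A b - A a)\<close>, where \<open>A\<close> is the continuous primitive of the
  absolute value of \<open>g\<close>.\<close>

lemma H1_deriv_by_parts:
  assumes H: "H1_deriv l f g" and d: "\<And>x. (p has_real_derivative p' x) (at x)"
    and c: "continuous_on UNIV p'" and l: "0 \<le> l"
  shows "((\<lambda>x. f x * p' x + g x * p x) has_integral f l * p l - f 0 * p 0) {0..l}"
proof -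
  have gi: "g absolutely_integrable_on {0..l}" using H by (rule H1_deriv_abs_integrable)
  have cf: "continuous_on {0..l} f" using H by (rule H1_deriv_continuous)
  have cp: "continuous_on UNIV p" using d DERIV_continuous_on by blast
  define k where "k x = f x * p' x + g x * p x" for x
  have "bounded (p' ` {0..l})"
    by (intro compact_imp_bounded compact_continuous_image continuous_on_subset[OF c]) auto
  then obtain C where C: "\<And>x. x \<in> {0..l} \<Longrightarrow> \<bar>p' x\<bar> \<le> C" "C > 0"
    unfolding bounded_pos by (metis imageI real_norm_def)
  define A where "A x = integral {0..x} (\<lambda>x. \<bar>g x\<bar>)" for x
  have agi: "(\<lambda>x. \<bar>g x\<bar>) integrable_on {0..l}"
    using gi unfolding absolutely_integrable_on_def by simp
  have cA: "continuous_on {0..l} A" unfolding A_def by (rule indefinite_integral_continuous_1[OF agi])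
  have "(\<lambda>x. p x * g x) absolutely_integrable_on {0..l}"
    by (rule abs_integrable_mult_continuous[OF gi continuous_on_subset[OF cp]]) auto
  then have pgi: "(\<lambda>x. g x * p x) integrable_on {0..l}"
    by (simp add: set_lebesgue_integral_eq_integral(1) mult.commute)
  have fpi: "(\<lambda>x. f x * p' x) integrable_on {0..l}"
    by (intro integrable_continuous_real continuous_intros cf continuous_on_subset[OF c]) auto
  have ki: "k integrable_on {0..l}" unfolding k_def by (intro integrable_add fpi pgi)
  define D where "D x = integral {0..x} k - f x * p x" for x
  have est: "\<bar>D b - D a\<bar> \<le> 2 * C * (b - a) * (A b - A a)" if ab: "0 \<le> a" "a \<le> b" "b \<le> l" for a b
  proof -
    have sub: "{a..b} \<subseteq> {0..l}" using ab by auto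
    have I1: "integral {0..b} k - integral {0..a} k = integral {a..b} k"
      using Henstock_Kurzweil_Integration.integral_combine[of 0 a b k] integrable_subinterval_real[OF ki, of 0 b] ab by auto
    have I2: "A b - A a = integral {a..b} (\<lambda>x. \<bar>g x\<bar>)"
      using Henstock_Kurzweil_Integration.integral_combine[of 0 a b "\<lambda>x. \<bar>g x\<bar>"] integrable_subinterval_real[OF agi, of 0 b] ab
      unfolding A_def by auto
    have ki': "(k has_integral integral {a..b} k) {a..b}" using integrable_subinterval_real[OF ki sub] by auto
    have p': "(p' has_integral p b - p a) {a..b}"
      by (intro fundamental_theorem_of_calculus ab)
        (auto intro!: has_field_derivative_at_within d simp: has_real_derivative_iff_has_vector_derivative[symmetric])
    have g': "(g has_integral f b - f a) {a..b}" using H1_deriv_has_integral[OF H ab] .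
    \<comment> \<open>The subtracted function integrates exactly to
      \<open>f b * p b - f a * p a\<close>. In each product that remains, one factor is an increment
      of \<open>f\<close> or of \<open>p\<close> inside \<open>[a, b]\<close>.\<close>
    have "((\<lambda>x. k x - (f b * p' x + g x * p a)) has_integral (integral {a..b} k - (f b * (p b - p a) + (f b - f a) * p a))) {a..b}"
      by (intro has_integral_diff ki' has_integral_add has_integral_mult_right has_integral_mult_left p' g')
    then have hi: "((\<lambda>x. (f x - f b) * p' x + g x * (p x - p a)) has_integral D b - D a) {a..b}"
      using I1 by (simp add: k_def D_def algebra_simps)
    have ag': "((\<lambda>x. \<bar>g x\<bar>) has_integral (A b - A a)) {a..b}"
      using integrable_subinterval_real[OF agi sub] I2 by (simp add: has_integral_iff)
    have bi: "((\<lambda>x. (A b - A a) * C + \<bar>g x\<bar> * (C * (b - a))) has_integral ((A b - A a) * C * (b - a) + (A b - A a) * (C * (b - a)))) {a..b}"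
      using has_integral_add[OF has_integral_const_real[of "(A b - A a) * C" a b] has_integral_mult_left[OF ag', of "C * (b-a)"]] ab
      by (simp add: mult.commute)
    have bd: "norm ((f x - f b) * p' x + g x * (p x - p a)) \<le> (A b - A a) * C + \<bar>g x\<bar> * (C * (b - a))" if x: "x \<in> {a..b}" for x
    proof -
      have "(g has_integral f b - f x) {x..b}" using H1_deriv_has_integral[OF H, of x b] x ab by auto
      then have "\<bar>f b - f x\<bar> \<le> integral {x..b} (\<lambda>x. \<bar>g x\<bar>)"
        using integral_norm_bound_integral[of g "{x..b}" "\<lambda>x. \<bar>g x\<bar>"] integrable_subinterval_real[OF agi, of x b] x ab
        by (auto simp: has_integral_iff)
      also have "\<dots> \<le> integral {a..b} (\<lambda>x. \<bar>g x\<bar>)"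
        by (rule integral_subset_le) (use x ab integrable_subinterval_real[OF agi] in auto)
      finally have f1: "\<bar>f x - f b\<bar> \<le> A b - A a" using I2 by simp
      have "\<bar>p x - p a\<bar> \<le> C * (x - a)"
      proof (cases "a = x")
        case False
        then obtain z where "z > a" "z < x" "p x - p a = (x - a) * p' z"
          using MVT2[of a x p p'] d x by auto
        then show ?thesis using C(1)[of z] x ab False by (simp add: abs_mult mult.commute)
      qed auto
      also have "\<dots> \<le> C * (b - a)" using C x by simp
      finally have f2: "\<bar>p x - p a\<bar> \<le> C * (b - a)" .
      have "norm ((f x - f b) * p' x + g x * (p x - p a)) \<le> \<bar>f x - f b\<bar> * \<bar>p' x\<bar> + \<bar>g x\<bar> * \<bar>p x - p a\<bar>"
        by (metis abs_mult abs_triangle_ineq real_norm_def)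
      also have "\<dots> \<le> (A b - A a) * C + \<bar>g x\<bar> * (C * (b - a))"
        by (intro add_mono mult_mono f1 f2 C) (use f1 x ab in auto)
      finally show ?thesis .
    qed
    have "norm (D b - D a) \<le> (A b - A a) * C * (b - a) + (A b - A a) * (C * (b - a))"
    proof -
      have "norm (integral {a..b} (\<lambda>x. (f x - f b) * p' x + g x * (p x - p a))) \<le> integral {a..b} (\<lambda>x. (A b - A a) * C + \<bar>g x\<bar> * (C * (b - a)))"
        by (rule integral_norm_bound_integral[OF _ _ bd]) (use hi bi in \<open>auto simp: has_integral_iff\<close>)
      then show ?thesis using hi bi by (simp add: has_integral_iff)
    qed
    then show ?thesis by (simp add: algebra_simps)
  qed
  have "(D has_field_derivative 0) (at x within {0..l})" if x: "x \<in> {0..l}" for x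
    unfolding has_field_derivative_iff
  proof (rule Lim_null_comparison)
    show "\<forall>\<^sub>F y in at x within {0..l}. norm ((D y - D x) / (y - x)) \<le> 2 * C * \<bar>A y - A x\<bar>"
      unfolding eventually_at_filter
    proof (rule always_eventually, intro allI impI)
      fix y assume y: "y \<noteq> x" "y \<in> {0..l}"
      have "\<bar>D y - D x\<bar> \<le> 2 * C * \<bar>A y - A x\<bar> * \<bar>y - x\<bar>"
      proof (cases "x \<le> y")
        case True
        have "\<bar>D y - D x\<bar> \<le> 2 * C * (y - x) * (A y - A x)" by (rule est) (use x y True in auto)
        also have "\<dots> \<le> 2 * C * (y - x) * \<bar>A y - A x\<bar>"
          by (intro mult_left_mono) (use C True in auto)
        finally show ?thesis using True by (simp add: algebra_simps)
      next
        case False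
        have "\<bar>D x - D y\<bar> \<le> 2 * C * (x - y) * (A x - A y)" by (rule est) (use x y False in auto)
        also have "\<dots> \<le> 2 * C * (x - y) * \<bar>A x - A y\<bar>"
          by (intro mult_left_mono) (use C False in auto)
        finally show ?thesis using False by (simp add: algebra_simps abs_minus_commute)
      qed
      then show "norm ((D y - D x) / (y - x)) \<le> 2 * C * \<bar>A y - A x\<bar>"
        using y by (simp add: abs_divide pos_divide_le_eq)
    qed
    have "(A \<longlongrightarrow> A x) (at x within {0..l})" using cA x unfolding continuous_on_def by blast
    then have "((\<lambda>y. 2 * C * \<bar>A y - A x\<bar>) \<longlongrightarrow> 2 * C * \<bar>A x - A x\<bar>) (at x within {0..l})"
      by (intro tendsto_intros) auto
    then show "((\<lambda>y. 2 * C * \<bar>A y - A x\<bar>) \<longlongrightarrow> 0) (at x within {0..l})" by simp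
  qed
  then obtain c where "\<And>x. x \<in> {0..l} \<Longrightarrow> D x = c"
    using has_field_derivative_zero_constant[of "{0..l}" D] by auto
  then have "D l = D 0" using l by auto
  then have "integral {0..l} k = f l * p l - f 0 * p 0" by (simp add: D_def)
  then show ?thesis using ki by (simp add: has_integral_iff k_def[abs_def])
qed

section \<open>Weak derivatives and primitives\<close>

lemma set_integral_open_eq_integral:
  fixes f :: "real \<Rightarrow> real"
  assumes "set_integrable lborel {0<..<l} f"
  shows "(LINT x:{0<..<l}|lborel. f x) = integral {0..l} f"
  using set_borel_integral_eq_integral(2)[OF assms] by (simp add: integral_open_interval_real)

lemma C1_testE:
  assumes "C1_test l p p'"
  obtains a b where "0 < a" "b < l" "\<And>x. x \<notin> {a..b} \<Longrightarrow> p x = 0"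
    "\<And>x. (p has_real_derivative p' x) (at x)" "continuous_on UNIV p'" "continuous_on UNIV p"
    "0 < l \<Longrightarrow> p 0 = 0" "0 < l \<Longrightarrow> p l = 0"
proof -
  obtain a b where *: "0 < a" "b < l" "\<And>x. x \<notin> {a..b} \<Longrightarrow> p x = 0"
    "\<And>x. (p has_real_derivative p' x) (at x)" "continuous_on UNIV p'"
    using assms unfolding C1_test_def by blast
  moreover have "continuous_on UNIV p" using * DERIV_continuous_on by blast
  moreover have "p 0 = 0" "p l = 0" using * by auto
  ultimately show ?thesis using that by blast
qed

text \<open>\<open>L2_on\<close> says nothing about \<open>g\<close> off the open interval. The
  cut-off function \<open>h\<close> is Borel on the whole line and carries the same integrals, so
  that the lemmas on primitives apply to it.\<close>

lemma L2_onD: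
  assumes "L2_on l g"
  defines "h \<equiv> \<lambda>x. indicator {0<..<l} x * g x"
  shows "h \<in> borel_measurable borel" "(\<lambda>x. (h x)\<^sup>2) integrable_on {0..l}"
    "h absolutely_integrable_on {0..l}" "set_integrable lborel {0<..<l} g"
    "(LINT x:{0..l}|lborel. (g x)\<^sup>2) = integral {0..l} (\<lambda>x. (h x)\<^sup>2)"
    "integral {0..l} (\<lambda>x. (h x)\<^sup>2) = integral {0..l} (\<lambda>x. (g x)\<^sup>2)"
proof -
  show m: "h \<in> borel_measurable borel"
    using assms(1) by (simp add: L2_on_def set_borel_measurable_def h_def)
  have si: "set_integrable lborel {0<..<l} (\<lambda>x. (g x)\<^sup>2)" using assms by (simp add: L2_on_def)
  then have "(\<lambda>x. (g x)\<^sup>2) integrable_on {0<..<l}"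
    by (rule set_borel_integral_eq_integral(1))
  then have gi: "(\<lambda>x. (g x)\<^sup>2) integrable_on {0..l}" by (simp add: integrable_on_open_interval_real)
  show hi: "(\<lambda>x. (h x)\<^sup>2) integrable_on {0..l}"
    by (rule integrable_spike_finite[of "{0,l}", OF _ _ gi]) (auto simp: h_def indicator_def)
  show ha: "h absolutely_integrable_on {0..l}"
    using abs_integrable_of_square[OF m hi] .
  then have "set_integrable lborel {0..l} h" using m by (simp add: set_integrable_lborel_iff)
  then have "set_integrable lborel {0<..<l} h" by (rule set_integrable_subset) auto
  then show "set_integrable lborel {0<..<l} g"
    by (rule set_integrable_cong[THEN iffD1, rotated -1]) (auto simp: h_def)
  show e: "integral {0..l} (\<lambda>x. (h x)\<^sup>2) = integral {0..l} (\<lambda>x. (g x)\<^sup>2)"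
    by (rule integral_spike[of "{0,l}"]) (auto simp: h_def indicator_def)
  have "AE x in lborel. x \<noteq> (0::real)" "AE x in lborel. x \<noteq> l" by (rule AE_lborel_singleton)+
  then have "AE x in lborel. indicator {0..l} x *\<^sub>R (g x)\<^sup>2 = indicator {0<..<l} x *\<^sub>R (g x)\<^sup>2"
    by eventually_elim (auto simp: indicator_def)
  \<comment> \<open>The square on the closed interval differs from that of \<open>h\<close> at most
    at the two endpoints.\<close>
  moreover have "(\<lambda>x. indicator {0..l} x *\<^sub>R (g x)\<^sup>2) \<in> borel_measurable borel"
  proof -
    have "(\<lambda>x. indicator {0..l} x *\<^sub>R (g x)\<^sup>2) = (\<lambda>x. (h x)\<^sup>2 + indicator ({0,l} \<inter> {0..l}) x * (if x = 0 then (g 0)\<^sup>2 else (g l)\<^sup>2))"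
      by (auto simp: h_def indicator_def fun_eq_iff)
    then show ?thesis using m by simp
  qed
  moreover have "(\<lambda>x. indicator {0<..<l} x *\<^sub>R (g x)\<^sup>2) \<in> borel_measurable borel"
    using si by (auto simp: set_integrable_def)
  ultimately have "(LINT x:{0..l}|lborel. (g x)\<^sup>2) = (LINT x:{0<..<l}|lborel. (g x)\<^sup>2)"
    unfolding set_lebesgue_integral_def by (intro integral_cong_AE) auto
  also have "\<dots> = integral {0..l} (\<lambda>x. (g x)\<^sup>2)"
    by (rule set_integral_open_eq_integral[OF si])
  finally show "(LINT x:{0..l}|lborel. (g x)\<^sup>2) = integral {0..l} (\<lambda>x. (h x)\<^sup>2)" using e by simp
qed

lemma abs_integrable_test:
  assumes "L2_on l g" "continuous_on UNIV p"
  shows "set_integrable lborel {0<..<l} (\<lambda>x. g x * p x)"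
proof -
  let ?h = "\<lambda>x. indicator {0<..<l} x * g x"
  have "(\<lambda>x. p x * ?h x) absolutely_integrable_on {0..l}"
    by (rule abs_integrable_mult_continuous[OF L2_onD(3)[OF assms(1)] continuous_on_subset[OF assms(2)]]) auto
  moreover have "(\<lambda>x. p x * ?h x) \<in> borel_measurable borel"
    by (intro borel_measurable_times L2_onD(1)[OF assms(1)] borel_measurable_continuous_onI[OF assms(2)])
  ultimately have "set_integrable lborel {0..l} (\<lambda>x. p x * ?h x)" by (simp add: set_integrable_lborel_iff)
  then have "set_integrable lborel {0<..<l} (\<lambda>x. p x * ?h x)" by (rule set_integrable_subset) auto
  then show ?thesis
    by (rule set_integrable_cong[THEN iffD1, rotated -1]) auto
qed

lemma continuous_set_integrable_open:
  fixes f :: "real \<Rightarrow> real"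
  assumes "continuous_on {0..l} f" shows "set_integrable lborel {0<..<l} f"
  by (rule set_integrable_subset[OF borel_integrable_atLeastAtMost'[OF assms]]) auto

lemma continuous_L2_on:
  assumes "continuous_on {0..l} f" shows "L2_on l f"
  unfolding L2_on_def
proof
  show "set_integrable lborel {0<..<l} (\<lambda>x. (f x)\<^sup>2)"
    by (intro continuous_set_integrable_open continuous_intros assms)
  show "set_borel_measurable lborel {0<..<l} f"
    using continuous_set_integrable_open[OF assms] by (auto simp: set_borel_measurable_def set_integrable_def)
qed

lemma H1_deriv_L2_on:
  assumes "H1_deriv l f g" shows "L2_on l g"
  unfolding L2_on_def
proof
  show "set_borel_measurable lborel {0<..<l} g"
    using H1_derivD(1)[OF assms] by (simp add: set_borel_measurable_def)
  have "(\<lambda>x. (g x)\<^sup>2) absolutely_integrable_on {0..l}"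
    using H1_derivD(2)[OF assms] by (rule nonnegative_absolutely_integrable_1) auto
  then have "set_integrable lborel {0..l} (\<lambda>x. (g x)\<^sup>2)"
    using H1_derivD(1)[OF assms] by (simp add: set_integrable_lborel_iff)
  then show "set_integrable lborel {0<..<l} (\<lambda>x. (g x)\<^sup>2)"
    by (rule set_integrable_subset) auto
qed

lemma H1_deriv_weak:
  assumes "H1_deriv l f g" "0 < l" shows "has_weak_deriv l f g"
  unfolding has_weak_deriv_def
proof (intro allI impI)
  fix p p' assume t: "C1_test l p p'"
  obtain a b where ab: "\<And>x. (p has_real_derivative p' x) (at x)" "continuous_on UNIV p'" "continuous_on UNIV p"
    "p 0 = 0" "p l = 0" using C1_testE[OF t] assms(2) by metis
  have cf: "continuous_on {0..l} f" using assms(1) by (rule H1_deriv_continuous)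
  have 1: "set_integrable lborel {0<..<l} (\<lambda>x. f x * p' x)"
    by (intro continuous_set_integrable_open continuous_intros cf continuous_on_subset[OF ab(2)]) auto
  have 2: "set_integrable lborel {0<..<l} (\<lambda>x. g x * p x)"
    by (rule abs_integrable_test[OF H1_deriv_L2_on[OF assms(1)] ab(3)])
  have "((\<lambda>x. f x * p' x + g x * p x) has_integral f l * p l - f 0 * p 0) {0..l}"
    by (rule H1_deriv_by_parts[OF assms(1) ab(1,2)]) (use assms in auto)
  then have "integral {0..l} (\<lambda>x. f x * p' x + g x * p x) = 0" using ab by (simp add: has_integral_iff)
  moreover have "integral {0..l} (\<lambda>x. f x * p' x + g x * p x) = integral {0..l} (\<lambda>x. f x * p' x) + integral {0..l} (\<lambda>x. g x * p x)"
    using set_borel_integral_eq_integral(1)[OF 1] set_borel_integral_eq_integral(1)[OF 2]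
    by (intro Henstock_Kurzweil_Integration.integral_add) (auto simp: integrable_on_open_interval_real)
  ultimately show "(LINT x:{0<..<l}|lborel. f x * p' x) = - (LINT x:{0<..<l}|lborel. g x * p x)"
    using set_integral_open_eq_integral[OF 1] set_integral_open_eq_integral[OF 2] by simp
qed

lemma H1_deriv_H1_on:
  assumes "H1_deriv l f g" "0 < l" shows "H1_on l f"
  unfolding H1_on_def
  using continuous_L2_on[OF H1_deriv_continuous[OF assms(1)]] H1_deriv_L2_on[OF assms(1)] H1_deriv_weak[OF assms] by blast

text \<open>The primitive of \<open>q\<close> is constant on either side of the support of
  \<open>q\<close>, and the vanishing integral makes the two constants agree. Subtracting this
  constant leaves a function of compact support.\<close>

lemma C1_test_mean_zero:
  assumes c: "continuous_on UNIV q" and ab: "0 < a" "a \<le> b" "b < l" and z: "\<And>x. x \<notin> {a..b} \<Longrightarrow> q x = 0"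
    and i: "integral {0..l} q = 0"
  obtains p where "C1_test l p q"
proof -
  have "\<exists>F. \<forall>x :: real. -\<infinity> < ereal x \<longrightarrow> ereal x < \<infinity> \<longrightarrow> (F has_vector_derivative q x) (at x)"
    by (rule einterval_antiderivative) (use c in \<open>auto simp: continuous_on_eq_continuous_at\<close>)
  then obtain F where F: "\<And>x. (F has_real_derivative q x) (at x)"
    by (auto simp: has_real_derivative_iff_has_vector_derivative)
  have ftc: "(q has_integral F y - F x) {x..y}" if "x \<le> y" for x y
    by (rule fundamental_theorem_of_calculus[OF that])
      (simp add: has_real_derivative_iff_has_vector_derivative[symmetric] has_field_derivative_at_within[OF F])
  have const: "F x = F y" if xy: "x \<le> y" and no: "\<And>z. x \<le> z \<Longrightarrow> z \<le> y \<Longrightarrow> q z = 0" for x y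
  proof -
    have "(q has_integral F y - F x) {x..y}"
      by (rule ftc[OF xy])
    moreover have "(q has_integral 0) {x..y}" by (rule has_integral_is_0) (use no in auto)
    ultimately have "F y - F x = 0" by (rule has_integral_unique)
    then show ?thesis by simp
  qed
  have "(q has_integral F l - F 0) {0..l}"
    by (rule ftc) (use ab in auto)
  then have F0l: "F l = F 0" using i by (simp add: has_integral_iff)
  have outs: "F x = F 0" if "x \<notin> {a/2..(b+l)/2}" for x
  proof (cases "x < a")
    case True
    then show ?thesis using const[of x 0] const[of 0 x] z ab by (cases "x \<le> 0") auto
  next
    case False
    then have "x > (b+l)/2" using that ab by auto
    moreover have "(b + l)/2 > b" using ab by simp
    ultimately have "x > b" by linarith
    then show ?thesis using const[of x l] const[of l x] z ab F0l by (cases "x \<le> l") auto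
  qed
  have "((\<lambda>x. F x - F 0) has_real_derivative q x) (at x)" for x
    using DERIV_diff[OF F[of x] DERIV_const[of "F 0"]] by simp
  moreover have "\<forall>x. x \<notin> {a/2..(b+l)/2} \<longrightarrow> F x - F 0 = 0" using outs by simp
  moreover have "0 < a/2" "(b+l)/2 < l" using ab by auto
  ultimately have "C1_test l (\<lambda>x. F x - F 0) q"
    unfolding C1_test_def using c by blast
  then show ?thesis using that by blast
qed

text \<open>Test functions are only required to be continuously differentiable, so their derivatives
  can be assembled from continuous, piecewise linear bumps.\<close>

definition tent :: "real \<Rightarrow> real \<Rightarrow> real \<Rightarrow> real" where
  "tent e c x = max 0 (e - \<bar>x - c\<bar>)"

lemma continuous_on_tent: "continuous_on S (tent e c)"
  unfolding tent_def by (intro continuous_intros)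

lemma tent_integral:
  assumes "0 < e" "0 \<le> c - e" "c + e \<le> l"
  shows "(tent e c has_integral integral {-e..e} (tent e 0)) {0..l}"
proof -
  have "(tent e 0 has_integral integral {-e..e} (tent e 0)) {-e..e}"
    by (intro integrable_integral integrable_continuous_real continuous_on_tent)
  from has_integral_shift_real_ivl[OF this, of "-c"]
  have "((\<lambda>x. tent e 0 (x - c)) has_integral integral {-e..e} (tent e 0)) {c-e..c+e}"
    by (simp add: algebra_simps)
  then have "(tent e c has_integral integral {-e..e} (tent e 0)) {c-e..c+e}"
    by (simp add: tent_def[abs_def])
  then show ?thesis
    by (rule has_integral_on_superset) (use assms in \<open>auto simp: tent_def\<close>)
qed

lemma tent_integral_pos:
  assumes "0 < e" shows "0 < integral {-e..e} (tent e 0)"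
proof -
  have "0 \<le> integral {-e..e} (tent e 0)"
    by (rule Henstock_Kurzweil_Integration.integral_nonneg) (auto simp: tent_def intro!: integrable_continuous_real continuous_intros)
  moreover have "integral {-e..e} (tent e 0) \<noteq> 0"
  proof
    assume "integral {-e..e} (tent e 0) = 0"
    then have "\<forall>x\<in>{-e..e}. tent e 0 x = 0"
      by (subst (asm) integral_eq_0_iff) (use assms in \<open>auto simp: continuous_on_tent\<close>, auto simp: tent_def)
    then show False using assms by (auto simp: tent_def dest!: bspec[of _ _ "0::real"])
  qed
  ultimately show ?thesis by simp
qed

text \<open>If \<open>F a < F b\<close>, test with a primitive of the difference \<open>q\<close> of
  a narrow tent at \<open>b\<close> and one at \<open>a\<close>. With \<open>m\<close> halfway
  between the two values, \<open>(F - m) * q\<close> is nonnegative with integral zero, hence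
  identically zero, although it is positive at \<open>b\<close>.\<close>

lemma du_Bois_Reymond_less:
  assumes c: "continuous_on {0..l} F"
    and w: "\<And>p p'. C1_test l p p' \<Longrightarrow> integral {0..l} (\<lambda>x. F x * p' x) = 0"
    and ab: "0 < a" "a < l" "0 < b" "b < l"
  shows "\<not> F a < F b"
proof
  assume less: "F a < F b"
  define m where "m = (F a + F b) / 2"
  have m: "F a < m" "m < F b" using less by (auto simp: m_def)
  have "isCont F a" "isCont F b"
    using c ab by (auto intro!: continuous_on_interior[of "{0..l}"])
  then have "\<forall>\<^sub>F x in nhds a. F x < m" "\<forall>\<^sub>F x in nhds b. m < F x"
    using m by (auto simp: isCont_def tendsto_at_iff_tendsto_nhds intro: order_tendstoD)
  then obtain d1 d2 where d: "0 < d1" "\<And>x. dist x a < d1 \<Longrightarrow> F x < m" "0 < d2" "\<And>x. dist x b < d2 \<Longrightarrow> m < F x"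
    by (auto simp: eventually_nhds_metric)
  define e where "e = min (min d1 d2) (min (min a b) (min (l - a) (l - b))) / 2"
  have e: "0 < e" "e < d1" "e < d2" "e < a" "e < b" "e < l - a" "e < l - b"
    using d ab by (auto simp: e_def min_def)
  define q where "q x = tent e b x - tent e a x" for x
  have ca: "continuous_on S q" for S unfolding q_def[abs_def] by (intro continuous_intros continuous_on_tent)
  have qi: "(q has_integral 0) {0..l}"
    using has_integral_diff[OF tent_integral[of e b l] tent_integral[of e a l]] e ab unfolding q_def by simp
  obtain p where "C1_test l p q"
  proof (rule C1_test_mean_zero[of q "min (a-e) (b-e)" "max (a+e) (b+e)" l])
    show "integral {0..l} q = 0" using qi by (simp add: has_integral_iff)
    show "q x = 0" if "x \<notin> {min (a-e) (b-e)..max (a+e) (b+e)}" for x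
      using that by (auto simp: q_def tent_def)
  qed (use e ab ca in auto)
  then have 0: "integral {0..l} (\<lambda>x. F x * q x) = 0" by (rule w)
  have "((\<lambda>x. F x * q x - m * q x) has_integral 0 - m * 0) {0..l}"
    using 0 by (intro has_integral_diff has_integral_mult_right qi)
      (auto simp: has_integral_iff intro!: integrable_continuous_real continuous_intros c ca)
  then have "integral {0..l} (\<lambda>x. (F x - m) * q x) = 0" by (simp add: algebra_simps has_integral_iff)
  moreover have nn: "0 \<le> (F x - m) * q x" if "x \<in> {0..l}" for x
  proof -
    have "tent e b x = 0 \<or> F x > m" using d(4)[of x] e by (cases "\<bar>x - b\<bar> < e") (auto simp: tent_def dist_real_def)
    moreover have "tent e a x = 0 \<or> F x < m" using d(2)[of x] e by (cases "\<bar>x - a\<bar> < e") (auto simp: tent_def dist_real_def)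
    moreover have "tent e a x \<ge> 0" "tent e b x \<ge> 0" by (auto simp: tent_def)
    ultimately show ?thesis unfolding q_def by (auto simp: mult_nonpos_nonpos mult_nonpos_nonneg)
  qed
  ultimately have "\<forall>x\<in>{0..l}. (F x - m) * q x = 0"
    using ab by (subst integral_eq_0_iff[symmetric]) (auto intro!: continuous_intros c ca)
  then have "q b = 0" using ab m by auto
  then have "tent e a b = e" using e by (simp add: q_def tent_def)
  then show False using e less by (auto simp: tent_def max_def split: if_splits)
qed

lemma du_Bois_Reymond:
  assumes c: "continuous_on {0..l} F" and l: "0 < l"
    and w: "\<And>p p'. C1_test l p p' \<Longrightarrow> integral {0..l} (\<lambda>x. F x * p' x) = 0"
    and x: "x \<in> {0..l}"
  shows "F x = F 0"
proof -
  have eq: "F y = F (l/2)" if "y \<in> {0<..<l}" for y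
  proof -
    have "\<not> F y < F (l/2)" by (rule du_Bois_Reymond_less[OF c w]) (use that l in auto)
    moreover have "\<not> F (l/2) < F y" by (rule du_Bois_Reymond_less[OF c w]) (use that l in auto)
    ultimately show ?thesis by simp
  qed
  have cl: "F y = F (l/2)" if "y \<in> {0..l}" for y
  proof (rule continuous_constant_on_closure[of "{0<..<l}" F])
    show "continuous_on (closure {0<..<l}) F" using c l by simp
    show "y \<in> closure {0<..<l}" using that l by simp
  qed (rule eq)
  show ?thesis using cl[OF x] cl[of 0] l by simp
qed

text \<open>Let \<open>G\<close> be the primitive of the weak derivative. It has the same weak
  derivative as \<open>f\<close>, so \<open>f - G\<close> is constant by the lemma of du
  Bois-Reymond.\<close>

lemma H1_derivI_weak:
  assumes c: "continuous_on {0..l} f" and l: "0 < l" and g: "L2_on l g" "has_weak_deriv l f g"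
  shows "H1_deriv l f (\<lambda>x. indicator {0<..<l} x * g x)"
proof -
  define h where "h x = indicator {0<..<l} x * g x" for x
  define G where "G x = integral {0..x} h" for x
  note D = L2_onD[OF g(1), folded h_def[abs_def]]
  have hi: "h integrable_on {0..x}" if "x \<le> l" for x
    using integrable_subinterval_real[OF set_lebesgue_integral_eq_integral(1)[OF D(3)], of 0 x] that by auto
  have HG: "H1_deriv l G h"
    unfolding H1_deriv_def G_def using D(1) D(2)[folded h_def] hi by auto
  have cG: "continuous_on {0..l} G" using HG by (rule H1_deriv_continuous)
  have "f x - G x = f 0 - G 0" if "x \<in> {0..l}" for x
  proof (rule du_Bois_Reymond[OF _ l _ that, of "\<lambda>x. f x - G x"])
    show "continuous_on {0..l} (\<lambda>x. f x - G x)" by (intro continuous_intros c cG)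
    fix p p' assume t: "C1_test l p p'"
    obtain ab: "continuous_on UNIV p'" "continuous_on UNIV p" using C1_testE[OF t] by metis
    have 1: "set_integrable lborel {0<..<l} (\<lambda>x. f x * p' x)"
      by (intro continuous_set_integrable_open continuous_intros c continuous_on_subset[OF ab(1)]) auto
    have 2: "set_integrable lborel {0<..<l} (\<lambda>x. G x * p' x)"
      by (intro continuous_set_integrable_open continuous_intros cG continuous_on_subset[OF ab(1)]) auto
    have 3: "(LINT x:{0<..<l}|lborel. h x * p x) = (LINT x:{0<..<l}|lborel. g x * p x)"
      by (rule set_lebesgue_integral_cong) (auto simp: h_def)
    have "(LINT x:{0<..<l}|lborel. f x * p' x) = (LINT x:{0<..<l}|lborel. G x * p' x)"
      using g(2)[unfolded has_weak_deriv_def, rule_format, OF t] H1_deriv_weak[OF HG l, unfolded has_weak_deriv_def, rule_format, OF t] 3 by simp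
    then have "integral {0..l} (\<lambda>x. f x * p' x) = integral {0..l} (\<lambda>x. G x * p' x)"
      by (simp add: set_integral_open_eq_integral[OF 1] set_integral_open_eq_integral[OF 2])
    moreover have "integral {0..l} (\<lambda>x. f x * p' x - G x * p' x) = integral {0..l} (\<lambda>x. f x * p' x) - integral {0..l} (\<lambda>x. G x * p' x)"
      using set_borel_integral_eq_integral(1)[OF 1] set_borel_integral_eq_integral(1)[OF 2]
      by (intro Henstock_Kurzweil_Integration.integral_diff) (auto simp: integrable_on_open_interval_real)
    ultimately show "integral {0..l} (\<lambda>x. (f x - G x) * p' x) = 0" by (simp add: algebra_simps)
  qed
  then have "G x = f x - f 0" if "x \<in> {0..l}" for x using that by (fastforce simp: G_def)
  then show ?thesis
    unfolding H1_deriv_def h_def[symmetric] using D(1) D(2)[folded h_def] hi by (auto simp: G_def has_integral_iff)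
qed

text \<open>Cut \<open>q\<close> off to the interval. The measures whose densities are its positive
  and its negative part agree on every ray, hence are equal, and densities are unique almost
  everywhere.\<close>

lemma AE_zero_of_integral_zero:
  fixes q :: "real \<Rightarrow> real"
  assumes m: "q \<in> borel_measurable borel" and i: "q absolutely_integrable_on {0..l}"
    and z: "\<And>x. 0 \<le> x \<Longrightarrow> x \<le> l \<Longrightarrow> integral {0..x} q = 0"
  shows "AE x in lborel. x \<in> {0<..<l} \<longrightarrow> q x = 0"
proof (cases "0 < l")
  case l: True
  define r where "r x = indicator {0..l} x * q x" for x
  have rm[measurable]: "r \<in> borel_measurable borel" unfolding r_def[abs_def] using m by simp
  have ri: "integrable lborel r"
    using i set_integrable_lborel_iff[OF m, of "{0..l}"] by (simp add: set_integrable_def r_def[abs_def])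
  have qi: "q integrable_on {0..l}" using i by (rule set_lebesgue_integral_eq_integral(1))
  define p n where "p x = max 0 (r x)" and "n x = max 0 (- r x)" for x
  have pm[measurable]: "p \<in> borel_measurable borel" "n \<in> borel_measurable borel"
    unfolding p_def[abs_def] n_def[abs_def] by measurable
  have pi: "integrable lborel p" "integrable lborel n"
    unfolding p_def[abs_def] n_def[abs_def] using ri by (auto intro!: integrable_max)
  have seti: "set_integrable lborel S p" "set_integrable lborel S n" "set_integrable lborel S r" if "S \<in> sets borel" for S
    unfolding set_integrable_def using pi ri that by (auto intro!: integrable_mult_indicator[where 'b=real, simplified])
  have eq0: "(LINT x:{a<..}|lborel. r x) = 0" for a
  proof -
    have "(LINT x:{a<..}|lborel. r x) = integral {a<..} r"
      by (rule set_borel_integral_eq_integral(2)[OF seti(3)]) auto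
    also have "\<dots> = integral {a<..} (\<lambda>x. if x \<in> {0..l} then q x else 0)"
      by (rule Henstock_Kurzweil_Integration.integral_cong) (auto simp: r_def)
    also have "\<dots> = integral ({a<..} \<inter> {0..l}) q"
      by (subst Henstock_Kurzweil_Integration.integral_restrict_Int) (simp add: Int_commute)
    also have "\<dots> = 0"
    proof (cases "a < 0")
      case True
      then have "{a<..} \<inter> {0..l} = {0..l}" by auto
      then show ?thesis using z[of l] l by simp
    next
      case a: False
      show ?thesis
      proof (cases "a \<le> l")
        case True
        have "integral ({a<..} \<inter> {0..l}) q = integral {a..l} q"
        proof -
          have "(q has_integral integral {a..l} q) {a..l}"
            using integrable_subinterval_real[OF qi, of a l] a by auto
          moreover have "(q has_integral y) ({a<..} \<inter> {0..l}) \<longleftrightarrow> (q has_integral y) {a..l}" for y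
            by (rule has_integral_spike_set_eq; rule negligible_subset[of "{a}"]) (use a in auto)
          ultimately have "(q has_integral integral {a..l} q) ({a<..} \<inter> {0..l})" by simp
          then show ?thesis by (rule integral_unique)
        qed
        moreover have "integral {0..a} q + integral {a..l} q = integral {0..l} q"
          by (rule Henstock_Kurzweil_Integration.integral_combine) (use a True qi in auto)
        ultimately show ?thesis using z[of a] z[of l] a True by simp
      next
        case False
        then have "{a<..} \<inter> {0..l} = {}" by auto
        then show ?thesis by simp
      qed
    qed
    finally show ?thesis .
  qed
  have em: "emeasure (density lborel p) {a<..} = ennreal (LINT x:{a<..}|lborel. p x)"
    "emeasure (density lborel n) {a<..} = ennreal (LINT x:{a<..}|lborel. n x)" for a
    using nn_set_integral_eq_set_integral[OF pi(1), of "{a<..}"] nn_set_integral_eq_set_integral[OF pi(2), of "{a<..}"]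
    by (auto simp: emeasure_density p_def n_def)
  have eq: "(LINT x:{a<..}|lborel. p x) = (LINT x:{a<..}|lborel. n x)" for a
  proof -
    have "(LINT x:{a<..}|lborel. r x) = (LINT x:{a<..}|lborel. p x - n x)"
      by (rule set_lebesgue_integral_cong) (auto simp: p_def n_def)
    also have "\<dots> = (LINT x:{a<..}|lborel. p x) - (LINT x:{a<..}|lborel. n x)"
      by (rule set_integral_diff) (auto intro: seti)
    finally show ?thesis using eq0 by simp
  qed
  have "density lborel (\<lambda>x. ennreal (p x)) = density lborel (\<lambda>x. ennreal (n x))"
    by (rule measure_eqI_lessThan) (auto simp: em eq less_top[symmetric])
  then have "AE x in lborel. ennreal (p x) = ennreal (n x)"
    by (subst (asm) sigma_finite_measure.density_unique_iff[OF lborel.sigma_finite_measure_axioms]) auto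
  then show ?thesis
  proof eventually_elim
    case (elim x)
    then have "p x = n x" by (simp add: p_def n_def)
    then show ?case by (auto simp: p_def n_def r_def max_def split: if_splits)
  qed
qed auto

lemma H1_deriv_unique_AE:
  assumes "H1_deriv l f g" "H1_deriv l f h"
  shows "AE x in lborel. x \<in> {0<..<l} \<longrightarrow> g x = h x"
proof -
  have "AE x in lborel. x \<in> {0<..<l} \<longrightarrow> (\<lambda>x. g x - h x) x = 0"
  proof (rule AE_zero_of_integral_zero)
    show "(\<lambda>x. g x - h x) \<in> borel_measurable borel"
      using H1_derivD(1)[OF assms(1)] H1_derivD(1)[OF assms(2)] by simp
    show "(\<lambda>x. g x - h x) absolutely_integrable_on {0..l}"
      by (intro set_integral_diff H1_deriv_abs_integrable[OF assms(1)] H1_deriv_abs_integrable[OF assms(2)])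
    fix x assume "0 \<le> x" "x \<le> l"
    then have "((\<lambda>x. g x - h x) has_integral (f x - f 0) - (f x - f 0)) {0..x}"
      by (intro has_integral_diff H1_derivD(3)[OF assms(1)] H1_derivD(3)[OF assms(2)])
    then show "integral {0..x} (\<lambda>x. g x - h x) = 0" by (simp add: has_integral_iff)
  qed
  then show ?thesis by simp
qed

text \<open>The difference of the two is a weak derivative of the zero function, which is therefore
  a primitive of it; uniqueness for primitives then applies.\<close>

lemma weak_deriv_unique_AE:
  assumes l: "0 < l" and "L2_on l g" "L2_on l h" "has_weak_deriv l f g" "has_weak_deriv l f h"
  shows "AE x in lborel. x \<in> {0<..<l} \<longrightarrow> g x = h x"
proof -
  let ?G = "\<lambda>x. indicator {0<..<l} x * g x" and ?H = "\<lambda>x. indicator {0<..<l} x * h x"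
  define k where "k x = ?G x - ?H x" for x
  note gi = L2_onD[OF assms(2)] and hi = L2_onD[OF assms(3)]
  have km: "k \<in> borel_measurable borel"
    unfolding k_def[abs_def] by (intro borel_measurable_diff gi(1) hi(1))
  have "(\<lambda>x. (?G x - ?H x)\<^sup>2) absolutely_integrable_on {0..l}"
  proof (rule measurable_bounded_by_integrable_imp_absolutely_integrable)
    show "(\<lambda>x. (?G x - ?H x)\<^sup>2) \<in> borel_measurable (lebesgue_on {0..l})"
      using km unfolding k_def[abs_def] by (intro measurable_restrict_space1 measurable_completion) simp
    show "(\<lambda>x. 2 * (?G x)\<^sup>2 + 2 * (?H x)\<^sup>2) integrable_on {0..l}"
      by (intro integrable_add integrable_on_mult_right gi(2) hi(2))
    show "norm ((?G x - ?H x)\<^sup>2) \<le> 2 * (?G x)\<^sup>2 + 2 * (?H x)\<^sup>2" for x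
    proof -
      have "norm ((?G x - ?H x)\<^sup>2) = (?G x - ?H x)\<^sup>2" by (simp only: real_norm_def abs_power2)
      then show ?thesis using zero_le_power2[of "?G x + ?H x"] by (simp only: power2_sum power2_diff)
    qed
  qed auto
  then have k2: "(\<lambda>x. (k x)\<^sup>2) integrable_on {0..l}" unfolding k_def by (rule set_lebesgue_integral_eq_integral(1))
  have kL: "L2_on l k" unfolding L2_on_def
  proof
    show "set_borel_measurable lborel {0<..<l} k" using km by (simp add: set_borel_measurable_def)
    have "(\<lambda>x. (k x)\<^sup>2) absolutely_integrable_on {0..l}"
      using k2 by (rule nonnegative_absolutely_integrable_1) auto
    then have "set_integrable lborel {0..l} (\<lambda>x. (k x)\<^sup>2)" using km by (simp add: set_integrable_lborel_iff)
    then show "set_integrable lborel {0<..<l} (\<lambda>x. (k x)\<^sup>2)" by (rule set_integrable_subset) auto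
  qed
  have "has_weak_deriv l (\<lambda>x. 0) k"
    unfolding has_weak_deriv_def
  proof (intro allI impI)
    fix p p' assume t: "C1_test l p p'"
    then have cp: "continuous_on UNIV p" using C1_testE[OF t] by metis
    have "(LINT x:{0<..<l}|lborel. k x * p x) = (LINT x:{0<..<l}|lborel. g x * p x - h x * p x)"
      by (rule set_lebesgue_integral_cong) (auto simp: k_def algebra_simps)
    also have "\<dots> = (LINT x:{0<..<l}|lborel. g x * p x) - (LINT x:{0<..<l}|lborel. h x * p x)"
      by (rule set_integral_diff) (auto intro: abs_integrable_test assms cp)
    also have "\<dots> = 0" using assms(4)[unfolded has_weak_deriv_def, rule_format, OF t] assms(5)[unfolded has_weak_deriv_def, rule_format, OF t] by simp
    finally show "(LINT x:{0<..<l}|lborel. 0 * p' x) = - (LINT x:{0<..<l}|lborel. k x * p x)"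
      by (simp add: set_lebesgue_integral_def)
  qed
  from H1_derivI_weak[OF _ l kL this] have "H1_deriv l (\<lambda>x. 0) (\<lambda>x. indicator {0<..<l} x * k x)" by simp
  moreover have "H1_deriv l (\<lambda>x. 0) (\<lambda>x. 0)" using l by (intro H1_deriv_C1) auto
  ultimately have "AE x in lborel. x \<in> {0<..<l} \<longrightarrow> indicator {0<..<l} x * k x = 0" by (rule H1_deriv_unique_AE)
  then show ?thesis by eventually_elim (auto simp: k_def)
qed

lemma weak_deriv_of_H1_deriv:
  assumes "H1_deriv l f g" "0 < l"
  shows "L2_on l (weak_deriv l f)" "has_weak_deriv l f (weak_deriv l f)"
    "AE x in lborel. x \<in> {0<..<l} \<longrightarrow> weak_deriv l f x = g x"
proof -
  have "L2_on l (weak_deriv l f) \<and> has_weak_deriv l f (weak_deriv l f)"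
    unfolding weak_deriv_def by (rule someI[of _ g]) (use assms H1_deriv_L2_on H1_deriv_weak in blast)
  then show *: "L2_on l (weak_deriv l f)" "has_weak_deriv l f (weak_deriv l f)" by auto
  show "AE x in lborel. x \<in> {0<..<l} \<longrightarrow> weak_deriv l f x = g x"
    by (rule weak_deriv_unique_AE[OF assms(2) *(1) _ *(2)]) (use assms H1_deriv_L2_on H1_deriv_weak in blast)+
qed

text \<open>Removes the choice operator from the Rayleigh quotient: any concrete derivative may be
  used to compute the energy.\<close>

lemma weak_deriv_energy:
  assumes "H1_deriv l f g" "0 < l"
  shows "(LINT x:{0..l}|lborel. (weak_deriv l f x)\<^sup>2) = integral {0..l} (\<lambda>x. (g x)\<^sup>2)"
proof -
  let ?w = "\<lambda>x. indicator {0<..<l} x * weak_deriv l f x"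
  let ?g = "\<lambda>x. indicator {0<..<l} x * g x"
  note w = weak_deriv_of_H1_deriv[OF assms]
  note D = L2_onD[OF w(1)] and Dg = L2_onD[OF H1_deriv_L2_on[OF assms(1)]]
  have si: "set_integrable lborel {0..l} (\<lambda>x. (?w x)\<^sup>2)" "set_integrable lborel {0..l} (\<lambda>x. (?g x)\<^sup>2)"
    using nonnegative_absolutely_integrable_1[OF D(2)] nonnegative_absolutely_integrable_1[OF Dg(2)] D(1) Dg(1)
    by (simp_all add: set_integrable_lborel_iff)
  have "(LINT x:{0..l}|lborel. (?w x)\<^sup>2) = (LINT x:{0..l}|lborel. (?g x)\<^sup>2)"
    unfolding set_lebesgue_integral_def
  proof (rule integral_cong_AE)
    show "AE x in lborel. indicat_real {0..l} x *\<^sub>R (?w x)\<^sup>2 = indicat_real {0..l} x *\<^sub>R (?g x)\<^sup>2"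
      using w(3) by eventually_elim (auto simp: indicator_def)
  qed (use si in \<open>auto simp: set_integrable_def\<close>)
  then show ?thesis
    using set_borel_integral_eq_integral(2)[OF si(1)] set_borel_integral_eq_integral(2)[OF si(2)] D(5) Dg(6) by simp
qed

section \<open>The torsion equation on a single edge\<close>

lemma torsion_edge_H2:
  assumes l: "0 < l" and v: "\<And>x. x \<in> {0..l} \<Longrightarrow> v x = a + c * x - x\<^sup>2 / 2"
  shows "H1_deriv l v (\<lambda>x. c - x)" "H2_on l v"
    "AE x in lborel. x \<in> {0<..<l} \<longrightarrow> - weak_deriv l (weak_deriv l v) x = 1"
proof -
  have 0: "H1_deriv l (\<lambda>x. a + c * x - x\<^sup>2 / 2) (\<lambda>x. c - x)"
    by (rule H1_deriv_C1) (use l in \<open>auto intro!: derivative_eq_intros continuous_intros\<close>)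
  then show H: "H1_deriv l v (\<lambda>x. c - x)" using v l unfolding H1_deriv_def by force
  note w = weak_deriv_of_H1_deriv[OF H l]
  have "has_weak_deriv l (\<lambda>x. c - x) (\<lambda>x. -1)"
    by (rule H1_deriv_weak[OF _ l], rule H1_deriv_C1) (use l in \<open>auto intro!: derivative_eq_intros continuous_intros\<close>)
  have L1: "L2_on l (\<lambda>x. -1)" by (intro continuous_L2_on continuous_intros)
  \<comment> \<open>\<open>weak_deriv l v\<close> is an arbitrary representative that equals
    \<open>c - x\<close> only almost everywhere, but integrals against test functions do not see the
    difference.\<close>
  have W: "has_weak_deriv l (weak_deriv l v) (\<lambda>x. -1)"
    unfolding has_weak_deriv_def
  proof (intro allI impI)
    fix p p' assume t: "C1_test l p p'"
    then have cp: "continuous_on UNIV p'" using C1_testE[OF t] by metis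
    have "(LINT x:{0<..<l}|lborel. weak_deriv l v x * p' x) = (LINT x:{0<..<l}|lborel. (c - x) * p' x)"
      unfolding set_lebesgue_integral_def
    proof (rule integral_cong_AE)
      show "AE x in lborel. indicat_real {0<..<l} x *\<^sub>R (weak_deriv l v x * p' x) = indicat_real {0<..<l} x *\<^sub>R ((c - x) * p' x)"
        using w(3) by eventually_elim (auto simp: indicator_def)
      show "(\<lambda>x. indicat_real {0<..<l} x *\<^sub>R (weak_deriv l v x * p' x)) \<in> borel_measurable lborel"
        using abs_integrable_test[OF w(1) cp] by (auto simp: set_integrable_def)
      show "(\<lambda>x. indicat_real {0<..<l} x *\<^sub>R ((c - x) * p' x)) \<in> borel_measurable lborel"
        using abs_integrable_test[OF H1_deriv_L2_on[OF H] cp] by (auto simp: set_integrable_def)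
    qed
    also have "\<dots> = - (LINT x:{0<..<l}|lborel. -1 * p x)"
      using \<open>has_weak_deriv l (\<lambda>x. c - x) (\<lambda>x. -1)\<close> t unfolding has_weak_deriv_def by blast
    finally show "(LINT x:{0<..<l}|lborel. weak_deriv l v x * p' x) = - (LINT x:{0<..<l}|lborel. -1 * p x)" .
  qed
  have H1: "H1_on l (weak_deriv l v)" unfolding H1_on_def using w(1) L1 W by blast
  then show "H2_on l v" unfolding H2_on_def using H1_deriv_H1_on[OF H l] by blast
  have "L2_on l (weak_deriv l (weak_deriv l v)) \<and> has_weak_deriv l (weak_deriv l v) (weak_deriv l (weak_deriv l v))"
    unfolding weak_deriv_def[of l "weak_deriv l v"] using H1[unfolded H1_on_def] by (metis (mono_tags, lifting) someI_ex)
  then have "AE x in lborel. x \<in> {0<..<l} \<longrightarrow> weak_deriv l (weak_deriv l v) x = -1"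
    using weak_deriv_unique_AE[OF l _ L1 _ W] by blast
  then show "AE x in lborel. x \<in> {0<..<l} \<longrightarrow> - weak_deriv l (weak_deriv l v) x = 1"
    by eventually_elim auto
qed

text \<open>The chosen weak derivative \<open>p\<close> need not be continuous, so the equation for
  its own weak derivative is not integrated pointwise. Instead every test function is split into a
  multiple of a fixed bump of integral one and a function of integral zero, and the latter is itself
  the derivative of a test function. This exhibits \<open>K - x\<close> as a weak derivative of
  \<open>v\<close>.\<close>

lemma torsion_edge_quadratic:
  assumes l: "0 < l" and c: "continuous_on {0..l} v" and H2: "H2_on l v"
    and ae: "AE x in lborel. x \<in> {0<..<l} \<longrightarrow> - weak_deriv l (weak_deriv l v) x = 1"
  obtains K where "\<And>x. x \<in> {0..l} \<Longrightarrow> v x = v 0 + K * x - x\<^sup>2 / 2"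
proof -
  define p where "p = weak_deriv l v"
  have p: "L2_on l p" "has_weak_deriv l v p"
    using H2 someI_ex[of "\<lambda>g. L2_on l g \<and> has_weak_deriv l v g"] by (auto simp: H2_on_def H1_on_def p_def weak_deriv_def)
  define q where "q = weak_deriv l p"
  have q: "L2_on l q" "has_weak_deriv l p q"
    using H2 someI_ex[of "\<lambda>g. L2_on l g \<and> has_weak_deriv l p g"] by (auto simp: H2_on_def H1_on_def p_def q_def weak_deriv_def[of l "weak_deriv l v"])
  have p1: "(LINT x:{0<..<l}|lborel. p x * f' x) = integral {0..l} f" if t: "C1_test l f f'" for f f'
  proof -
    have cp: "continuous_on UNIV f" using C1_testE[OF t] by metis
    have s: "set_integrable lborel {0<..<l} f" by (intro continuous_set_integrable_open continuous_on_subset[OF cp]) auto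
    have "(LINT x:{0<..<l}|lborel. q x * f x) = (LINT x:{0<..<l}|lborel. - f x)"
      unfolding set_lebesgue_integral_def
    proof (rule integral_cong_AE)
      show "AE x in lborel. indicat_real {0<..<l} x *\<^sub>R (q x * f x) = indicat_real {0<..<l} x *\<^sub>R (- f x)"
        using ae by eventually_elim (auto simp: indicator_def p_def q_def)
      show "(\<lambda>x. indicat_real {0<..<l} x *\<^sub>R (q x * f x)) \<in> borel_measurable lborel"
        using abs_integrable_test[OF q(1) cp] by (auto simp: set_integrable_def)
      show "(\<lambda>x. indicat_real {0<..<l} x *\<^sub>R (- f x)) \<in> borel_measurable lborel"
        using s by (auto simp: set_integrable_def)
    qed
    then show ?thesis using q(2) t set_integral_open_eq_integral[OF s] unfolding has_weak_deriv_def
      by (simp add: set_lebesgue_integral_def)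
  qed
  define e where "e = l / 4"
  define b where "b x = tent e (l/2) x / integral {-e..e} (tent e 0)" for x
  have e: "0 < e" "e < l/2" using l by (auto simp: e_def)
  have bi: "(b has_integral 1) {0..l}"
    using has_integral_divide[OF tent_integral[of e "l/2" l], of "integral {-e..e} (tent e 0)"] e l tent_integral_pos[of e]
    by (simp add: b_def[abs_def])
  have cb: "continuous_on S b" for S unfolding b_def[abs_def] using tent_integral_pos[of e] e
    by (intro continuous_intros continuous_on_tent) auto
  \<comment> \<open>Against test functions \<open>p x + x\<close> acts like a constant;
    \<open>K\<close> is that constant, measured on the bump \<open>b\<close> of integral
    one.\<close>
  define K where "K = (LINT x:{0<..<l}|lborel. p x * b x) + integral {0..l} (\<lambda>x. x * b x)"
  have "has_weak_deriv l v (\<lambda>x. K - x)"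
    unfolding has_weak_deriv_def
  proof (intro allI impI)
    fix f f' assume t: "C1_test l f f'"
    obtain a1 b1 where ab: "0 < a1" "b1 < l" "\<And>x. x \<notin> {a1..b1} \<Longrightarrow> f x = 0"
      "continuous_on UNIV f" using C1_testE[OF t] by metis
    define m where "m = integral {0..l} f"
    define d where "d x = f x - m * b x" for x
    have cd: "continuous_on S d" for S unfolding d_def[abs_def] by (intro continuous_intros cb continuous_on_subset[OF ab(4)]) auto
    have di: "(d has_integral 0) {0..l}"
    proof -
      have "(d has_integral m - m * 1) {0..l}" unfolding d_def m_def
        by (intro has_integral_diff has_integral_mult_right bi integrable_integral integrable_continuous_real continuous_on_subset[OF ab(4)]) auto
      then show ?thesis by simp
    qed
    obtain P where P: "C1_test l P d"
    proof (rule C1_test_mean_zero[of d "min a1 (l/4)" "max b1 (3*l/4)" l])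
      show "d x = 0" if "x \<notin> {min a1 (l/4)..max b1 (3*l/4)}" for x
      proof -
        have "f x = 0" using that by (intro ab(3)) auto
        moreover have "e - \<bar>x - l/2\<bar> \<le> 0" using that by (auto simp: e_def abs_if)
        ultimately show ?thesis by (simp add: d_def b_def tent_def)
      qed
      show "integral {0..l} d = 0" using di by (simp add: has_integral_iff)
    qed (use ab l cd in auto)
    have "((\<lambda>x. x * d x + 1 * P x) has_integral l * P l - 0 * P 0) {0..l}"
      by (rule H1_deriv_by_parts[OF H1_deriv_C1]) (use P cd l in \<open>auto simp: C1_test_def intro!: derivative_eq_intros\<close>)
    moreover have "P l = 0" using C1_testE[OF P] l by metis
    ultimately have "integral {0..l} (\<lambda>x. x * d x + P x) = 0" by (simp add: has_integral_iff)
    moreover have cP: "continuous_on UNIV P" using C1_testE[OF P] by metis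
    ultimately have xd: "integral {0..l} (\<lambda>x. x * d x) + integral {0..l} P = 0"
      by (subst Henstock_Kurzweil_Integration.integral_add[symmetric]) (auto intro!: integrable_continuous_real continuous_intros cd intro: continuous_on_subset)
    have "(LINT x:{0<..<l}|lborel. p x * f x) = (LINT x:{0<..<l}|lborel. p x * d x + m * (p x * b x))"
      by (rule set_lebesgue_integral_cong) (auto simp: d_def algebra_simps)
    also have "\<dots> = (LINT x:{0<..<l}|lborel. p x * d x) + m * (LINT x:{0<..<l}|lborel. p x * b x)"
      using abs_integrable_test[OF p(1) cb] abs_integrable_test[OF p(1) cd] by (simp add: set_integral_add)
    also have "(LINT x:{0<..<l}|lborel. p x * d x) = - integral {0..l} (\<lambda>x. x * d x)"
      using p1[OF P] xd by simp
    also have "integral {0..l} (\<lambda>x. x * d x) = integral {0..l} (\<lambda>x. x * f x - m * (x * b x))"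
      by (rule Henstock_Kurzweil_Integration.integral_cong) (auto simp: d_def algebra_simps)
    also have "\<dots> = integral {0..l} (\<lambda>x. x * f x) - m * integral {0..l} (\<lambda>x. x * b x)"
      by (subst Henstock_Kurzweil_Integration.integral_diff) (auto intro!: integrable_continuous_real continuous_intros cb intro: continuous_on_subset[OF ab(4)])
    finally have pf: "(LINT x:{0<..<l}|lborel. p x * f x) = K * m - integral {0..l} (\<lambda>x. x * f x)"
      by (simp add: K_def algebra_simps)
    have s: "set_integrable lborel {0<..<l} (\<lambda>x. (K - x) * f x)"
      by (intro continuous_set_integrable_open continuous_intros continuous_on_subset[OF ab(4)]) auto
    have "(LINT x:{0<..<l}|lborel. (K - x) * f x) = integral {0..l} (\<lambda>x. K * f x - x * f x)"
      by (subst set_integral_open_eq_integral[OF s]) (simp add: algebra_simps)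
    also have "\<dots> = K * m - integral {0..l} (\<lambda>x. x * f x)"
      unfolding m_def
      by (subst Henstock_Kurzweil_Integration.integral_diff) (auto intro!: integrable_continuous_real continuous_intros intro: continuous_on_subset[OF ab(4)])
    finally show "(LINT x:{0<..<l}|lborel. v x * f' x) = - (LINT x:{0<..<l}|lborel. (K - x) * f x)"
      using p(2) t pf unfolding has_weak_deriv_def by simp
  qed
  then have H: "H1_deriv l v (\<lambda>x. indicator {0<..<l} x * (K - x))"
    by (intro H1_derivI_weak c l continuous_L2_on continuous_intros)
  have "v x = v 0 + K * x - x\<^sup>2 / 2" if x: "x \<in> {0..l}" for x
  proof -
    have "((\<lambda>x. indicator {0<..<l} x * (K - x)) has_integral v x - v 0) {0..x}"
      using H1_derivD(3)[OF H] x by auto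
    then have "((\<lambda>x. K - x) has_integral v x - v 0) {0..x}"
      by (rule has_integral_spike_finite[of "{0,l}", rotated 2]) (use x in auto)
    moreover have "((\<lambda>x. K - x) has_integral (K * x - x\<^sup>2/2) - (K * 0 - 0\<^sup>2/2)) {0..x}"
      by (rule fundamental_theorem_of_calculus)
        (use x in \<open>auto intro!: derivative_eq_intros simp: has_real_derivative_iff_has_vector_derivative[symmetric]\<close>)
    ultimately have "v x - v 0 = (K * x - x\<^sup>2/2) - (K * 0 - 0\<^sup>2/2)" by (rule has_integral_unique)
    then show ?thesis by simp
  qed
  then show ?thesis using that by blast
qed

section \<open>The forms of a metric graph and its identifications\<close>

definition vertex_values :: "('v, 'e) metric_graph \<Rightarrow> ('e \<Rightarrow> real \<Rightarrow> real) \<Rightarrow> ('v \<Rightarrow> real) \<Rightarrow> bool" where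
  "vertex_values G f u \<longleftrightarrow>
     (\<forall>e\<in>medges G. f e 0 = u (mtail G e) \<and> f e (len G e) = u (mhead G e)) \<and> (\<forall>w\<in>dirichlet G. u w = 0)"

definition H10_deriv ::
    "('v, 'e) metric_graph \<Rightarrow> ('e \<Rightarrow> real \<Rightarrow> real) \<Rightarrow> ('e \<Rightarrow> real \<Rightarrow> real) \<Rightarrow> ('v \<Rightarrow> real) \<Rightarrow> bool" where
  "H10_deriv G f f' u \<longleftrightarrow> (\<forall>e\<in>medges G. H1_deriv (len G e) (f e) (f' e)) \<and> vertex_values G f u"

definition gint :: "('v, 'e) metric_graph \<Rightarrow> ('e \<Rightarrow> real \<Rightarrow> real) \<Rightarrow> real" where
  "gint G f = (\<Sum>e\<in>medges G. integral {0..len G e} (f e))"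

text \<open>The triples consist of Dirichlet energy, squared norm and integral. The ground-state
  energy is the least quotient of the first two entries, and the torsional rigidity is the maximum
  of twice the third minus the first. Hence invariance of both quantities under the identifications
  reduces to invariance of this one set.\<close>

definition forms :: "('v, 'e) metric_graph \<Rightarrow> (real \<times> real \<times> real) set" where
  "forms G = {(gint G (\<lambda>e x. (f' e x)\<^sup>2), gint G (\<lambda>e x. (f e x)\<^sup>2), gint G f) | f f' u. H10_deriv G f f' u}"

lemma finite_metric_graphD:
  assumes "finite_metric_graph G"
  shows "finite (mverts G)" "finite (medges G)" "\<And>e. e \<in> medges G \<Longrightarrow> 0 < len G e"
    "\<And>e. e \<in> medges G \<Longrightarrow> mtail G e \<in> mverts G" "\<And>e. e \<in> medges G \<Longrightarrow> mhead G e \<in> mverts G"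
    "dirichlet G \<subseteq> mverts G"
proof -
  interpret fin_digraph "skeleton G" using assms unfolding finite_metric_graph_def by blast
  show "finite (mverts G)" "finite (medges G)" "\<And>e. e \<in> medges G \<Longrightarrow> mtail G e \<in> mverts G"
    "\<And>e. e \<in> medges G \<Longrightarrow> mhead G e \<in> mverts G"
    by (rule finite_verts finite_arcs tail_in_verts head_in_verts; assumption)+
qed (use assms in \<open>simp_all add: finite_metric_graph_def\<close>)

lemma H10_derivD:
  assumes "H10_deriv G f f' u"
  shows "\<And>e. e \<in> medges G \<Longrightarrow> H1_deriv (len G e) (f e) (f' e)"
    "\<And>e. e \<in> medges G \<Longrightarrow> f e 0 = u (mtail G e)" "\<And>e. e \<in> medges G \<Longrightarrow> f e (len G e) = u (mhead G e)"
    "\<And>w. w \<in> dirichlet G \<Longrightarrow> u w = 0"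
    "\<And>e. e \<in> medges G \<Longrightarrow> continuous_on {0..len G e} (f e)"
proof -
  note * = assms[unfolded H10_deriv_def vertex_values_def]
  show 1: "\<And>e. e \<in> medges G \<Longrightarrow> H1_deriv (len G e) (f e) (f' e)"
    "\<And>e. e \<in> medges G \<Longrightarrow> f e 0 = u (mtail G e)" "\<And>e. e \<in> medges G \<Longrightarrow> f e (len G e) = u (mhead G e)"
    "\<And>w. w \<in> dirichlet G \<Longrightarrow> u w = 0"
    using * by blast+
  show "\<And>e. e \<in> medges G \<Longrightarrow> continuous_on {0..len G e} (f e)"
    using 1(1) by (rule H1_deriv_continuous)
qed

lemma H10_iff:
  assumes "finite_metric_graph G"
  shows "f \<in> H10 G \<longleftrightarrow> (\<exists>f' u. H10_deriv G f f' u)"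
proof
  assume "f \<in> H10 G"
  then obtain u where e: "\<And>e. e \<in> medges G \<Longrightarrow> continuous_on {0..len G e} (f e) \<and> H1_on (len G e) (f e)"
    and u: "vertex_values G f u" unfolding H10_def vertex_values_def by auto
  have "\<forall>e\<in>medges G. \<exists>g. H1_deriv (len G e) (f e) g"
    using e H1_derivI_weak finite_metric_graphD(3)[OF assms] unfolding H1_on_def by meson
  then show "\<exists>f' u. H10_deriv G f f' u" using u unfolding H10_deriv_def by (metis (no_types))
next
  assume "\<exists>f' u. H10_deriv G f f' u"
  then obtain f' u where f: "H10_deriv G f f' u" by blast
  have "H1_on (len G e) (f e)" if "e \<in> medges G" for e
    by (rule H1_deriv_H1_on[OF H10_derivD(1)[OF f that] finite_metric_graphD(3)[OF assms that]])
  then show "f \<in> H10 G" unfolding H10_def using H10_derivD[OF f] by blast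
qed

lemma graph_integral_continuous:
  assumes "\<And>e. e \<in> medges G \<Longrightarrow> continuous_on {0..len G e} (f e)"
  shows "graph_integral G f = gint G f"
  unfolding graph_integral_def gint_def
  by (intro sum.cong refl set_borel_integral_eq_integral(2) borel_integrable_atLeastAtMost' assms)

lemma rayleigh_eq:
  assumes "finite_metric_graph G" "H10_deriv G f f' u"
  shows "rayleigh G f = gint G (\<lambda>e x. (f' e x)\<^sup>2) / gint G (\<lambda>e x. (f e x)\<^sup>2)"
proof -
  have "graph_integral G (\<lambda>e x. (f e x)\<^sup>2) = gint G (\<lambda>e x. (f e x)\<^sup>2)"
    by (intro graph_integral_continuous continuous_intros H10_derivD(5)[OF assms(2)])
  moreover have "graph_integral G (\<lambda>e x. (weak_deriv (len G e) (f e) x)\<^sup>2) = gint G (\<lambda>e x. (f' e x)\<^sup>2)"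
    unfolding graph_integral_def gint_def
    by (intro sum.cong refl weak_deriv_energy H10_derivD(1)[OF assms(2)] finite_metric_graphD(3)[OF assms(1)])
  ultimately show ?thesis by (simp add: rayleigh_def)
qed

lemma gint_nonneg:
  assumes "\<And>e x. e \<in> medges G \<Longrightarrow> 0 \<le> x \<Longrightarrow> x \<le> len G e \<Longrightarrow> 0 \<le> f e x"
  shows "0 \<le> gint G f"
proof -
  have "0 \<le> integral {0..len G e} (f e)" if "e \<in> medges G" for e
    using assms[OF that] by (cases "f e integrable_on {0..len G e}")
      (auto intro: Henstock_Kurzweil_Integration.integral_nonneg simp: not_integrable_integral)
  then show ?thesis unfolding gint_def by (intro sum_nonneg) auto
qed

lemma gint_square_eq_0_iff:
  assumes "finite_metric_graph G" "\<And>e. e \<in> medges G \<Longrightarrow> continuous_on {0..len G e} (f e)"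
  shows "gint G (\<lambda>e x. (f e x)\<^sup>2) = 0 \<longleftrightarrow> \<not> nonzero_on G f"
proof -
  have i: "(\<lambda>x. (f e x)\<^sup>2) integrable_on {0..len G e}" if "e \<in> medges G" for e
    by (intro integrable_continuous_real continuous_intros assms that)
  have "gint G (\<lambda>e x. (f e x)\<^sup>2) = 0 \<longleftrightarrow> (\<forall>e\<in>medges G. integral {0..len G e} (\<lambda>x. (f e x)\<^sup>2) = 0)"
    unfolding gint_def
    by (rule sum_nonneg_eq_0_iff) (auto intro: i Henstock_Kurzweil_Integration.integral_nonneg finite_metric_graphD(2)[OF assms(1)])
  also have "\<dots> \<longleftrightarrow> (\<forall>e\<in>medges G. \<forall>x\<in>{0..len G e}. (f e x)\<^sup>2 = 0)"
    by (intro ball_cong refl integral_eq_0_iff continuous_intros assms) (auto dest: finite_metric_graphD(3)[OF assms(1)])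
  finally show ?thesis by (auto simp: nonzero_on_def)
qed

lemma ground_state_forms:
  assumes "finite_metric_graph G"
  shows "ground_state_energy G = (LEAST q. \<exists>(a, b, c)\<in>forms G. b \<noteq> 0 \<and> q = a / b)"
proof -
  have "(\<exists>f\<in>H10 G. nonzero_on G f \<and> q = rayleigh G f) \<longleftrightarrow> (\<exists>(a, b, c)\<in>forms G. b \<noteq> 0 \<and> q = a / b)" for q
  proof
    assume "\<exists>f\<in>H10 G. nonzero_on G f \<and> q = rayleigh G f"
    then obtain f f' u where "H10_deriv G f f' u" "nonzero_on G f" "q = rayleigh G f"
      using H10_iff[OF assms] by blast
    then have "(gint G (\<lambda>e x. (f' e x)\<^sup>2), gint G (\<lambda>e x. (f e x)\<^sup>2), gint G f) \<in> forms G"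
      "gint G (\<lambda>e x. (f e x)\<^sup>2) \<noteq> 0" "q = gint G (\<lambda>e x. (f' e x)\<^sup>2) / gint G (\<lambda>e x. (f e x)\<^sup>2)"
      using rayleigh_eq[OF assms, of f f' u] gint_square_eq_0_iff[OF assms, of f] H10_derivD(5)[of G f f' u]
      unfolding forms_def by (blast, simp, simp)
    then show "\<exists>(a, b, c)\<in>forms G. b \<noteq> 0 \<and> q = a / b" by blast
  next
    assume "\<exists>(a, b, c)\<in>forms G. b \<noteq> 0 \<and> q = a / b"
    then obtain f f' u where f: "H10_deriv G f f' u" "gint G (\<lambda>e x. (f e x)\<^sup>2) \<noteq> 0"
       "q = gint G (\<lambda>e x. (f' e x)\<^sup>2) / gint G (\<lambda>e x. (f e x)\<^sup>2)"
      unfolding forms_def by blast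
    then have "f \<in> H10 G" "nonzero_on G f" "q = rayleigh G f"
      using H10_iff[OF assms, of f] rayleigh_eq[OF assms f(1)] gint_square_eq_0_iff[OF assms, of f] H10_derivD(5)[OF f(1)] by auto
    then show "\<exists>f\<in>H10 G. nonzero_on G f \<and> q = rayleigh G f" by blast
  qed
  then show ?thesis unfolding ground_state_energy_def by simp
qed

lemma integral_reflect_Icc:
  fixes f :: "real \<Rightarrow> real"
  shows "integral {0..l} (\<lambda>x. f (l - x)) = integral {0..l} f"
proof -
  have "integral {-l..-0} (\<lambda>x. f (- x)) = integral {0..l} f" by (rule Henstock_Kurzweil_Integration.integral_reflect_real)
  moreover have "integral {0..l} (\<lambda>x. f (l - x)) = integral {-l..-0} (\<lambda>x. f (- x))"
    using integral_shift_real_ivl[of "-l" "-l" 0 "\<lambda>x. f (-x)"] by simp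
  ultimately show ?thesis by simp
qed

definition same_orientation :: "('v, 'e) metric_graph \<Rightarrow> ('w, 'f) metric_graph \<Rightarrow> ('v \<Rightarrow> 'w) \<Rightarrow> ('e \<Rightarrow> 'f) \<Rightarrow> 'e \<Rightarrow> bool" where
  "same_orientation G H p q e \<longleftrightarrow> mtail H (q e) = p (mtail G e) \<and> mhead H (q e) = p (mhead G e)"

lemma ends_orientation:
  assumes "ends H (q e) = p ` ends G e" "\<not> same_orientation G H p q e"
  shows "mtail H (q e) = p (mhead G e)" "mhead H (q e) = p (mtail G e)"
  using assms by (auto simp: ends_def same_orientation_def doubleton_eq_iff)

text \<open>Reversing an edge reflects the integrands and flips the sign of the derivative, neither
  of which is visible in the three integrals.\<close>

lemma forms_subset_of_edge_map:
  assumes G: "finite_metric_graph G" and H: "finite_metric_graph H" and q: "bij_betw q (medges G) (medges H)"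
    and l: "\<And>e. e \<in> medges G \<Longrightarrow> len H (q e) = len G e"
    and tr: "\<And>f f' u. H10_deriv G f f' u \<Longrightarrow> \<exists>h h' w. H10_deriv H h h' w \<and>
        (\<forall>e\<in>medges G. h (q e) = f e \<and> h' (q e) = f' e \<or>
            h (q e) = (\<lambda>x. f e (len G e - x)) \<and> h' (q e) = (\<lambda>x. - f' e (len G e - x)))"
  shows "forms G \<subseteq> forms H"
proof
  fix z assume "z \<in> forms G"
  then obtain f f' u where z: "H10_deriv G f f' u"
    "z = (gint G (\<lambda>e x. (f' e x)\<^sup>2), gint G (\<lambda>e x. (f e x)\<^sup>2), gint G f)"
    unfolding forms_def by blast
  obtain h h' w where h: "H10_deriv H h h' w"
    "\<And>e. e \<in> medges G \<Longrightarrow> h (q e) = f e \<and> h' (q e) = f' e \<or>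
            h (q e) = (\<lambda>x. f e (len G e - x)) \<and> h' (q e) = (\<lambda>x. - f' e (len G e - x))"
    using tr[OF z(1)] by blast
  have "integral {0..len H (q e)} (\<lambda>x. (h' (q e) x)\<^sup>2) = integral {0..len G e} (\<lambda>x. (f' e x)\<^sup>2)"
    "integral {0..len H (q e)} (\<lambda>x. (h (q e) x)\<^sup>2) = integral {0..len G e} (\<lambda>x. (f e x)\<^sup>2)"
    "integral {0..len H (q e)} (h (q e)) = integral {0..len G e} (f e)" if e: "e \<in> medges G" for e
    using h(2)[OF e] l[OF e] integral_reflect_Icc[of "len G e" "\<lambda>x. (f' e x)\<^sup>2"]
      integral_reflect_Icc[of "len G e" "\<lambda>x. (f e x)\<^sup>2"] integral_reflect_Icc[of "len G e" "f e"] by auto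
  then have "z = (gint H (\<lambda>e x. (h' e x)\<^sup>2), gint H (\<lambda>e x. (h e x)\<^sup>2), gint H h)"
    unfolding z(2) gint_def by (simp add: sum.reindex_bij_betw[OF q, symmetric])
  then show "z \<in> forms H" using h(1) unfolding forms_def by blast
qed

text \<open>Vertex values at Dirichlet vertices are all zero, so nothing is lost where
  \<open>p\<close> fails to be injective: the vertex function on \<open>H\<close> is set to zero
  there and pulled back along the bijection elsewhere.\<close>

lemma glues_to_forms:
  assumes "glues_to G H" shows "forms G = forms H"
proof -
  obtain p q where G: "finite_metric_graph G" and H: "finite_metric_graph H" and D: "p ` dirichlet G = dirichlet H"
    and p: "bij_betw p (mverts G - dirichlet G) (mverts H - dirichlet H)"
    and q: "bij_betw q (medges G) (medges H)"
    and e: "\<And>e. e \<in> medges G \<Longrightarrow> ends H (q e) = p ` ends G e" "\<And>e. e \<in> medges G \<Longrightarrow> len H (q e) = len G e"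
    using assms unfolding glues_to_def by blast
  let ?s = "same_orientation G H p q"
  define qi where "qi = inv_into (medges G) q"
  have qi: "qi (q a) = a" if "a \<in> medges G" for a
    unfolding qi_def using q that by (simp add: bij_betw_inv_into_left)
  have qi': "qi b \<in> medges G" "q (qi b) = b" if "b \<in> medges H" for b
    unfolding qi_def using q that by (auto simp: bij_betw_inv_into_right bij_betw_def inv_into_into)
  have bq: "bij_betw qi (medges H) (medges G)" unfolding qi_def by (rule bij_betw_inv_into[OF q])
  note fG = finite_metric_graphD[OF G]
  show ?thesis
  proof
    show "forms G \<subseteq> forms H"
    proof (rule forms_subset_of_edge_map[OF G H q e(2)])
      fix f f' u assume f: "H10_deriv G f f' u"
      note fD = H10_derivD[OF f]
      define h where "h b = (if ?s (qi b) then f (qi b) else (\<lambda>x. f (qi b) (len G (qi b) - x)))" for b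
      define h' where "h' b = (if ?s (qi b) then f' (qi b) else (\<lambda>x. - f' (qi b) (len G (qi b) - x)))" for b
      define w where "w v = (if v \<in> dirichlet H then 0 else u (inv_into (mverts G - dirichlet G) p v))" for v
      have wp: "w (p v) = u v" if "v \<in> mverts G" for v
      proof (cases "v \<in> dirichlet G")
        case True then show ?thesis using D fD(4) by (auto simp: w_def)
      next
        case False
        then have "p v \<notin> dirichlet H" using p that by (auto simp: bij_betw_def)
        then show ?thesis using False that p by (simp add: w_def bij_betw_inv_into_left)
      qed
      have "H10_deriv H h h' w"
        unfolding H10_deriv_def vertex_values_def
      proof (intro conjI ballI)
        fix b assume b: "b \<in> medges H"
        note a = qi'[OF b]
        show "H1_deriv (len H b) (h b) (h' b)"
          using fD(1)[OF a(1)] H1_deriv_reflect[OF fD(1)[OF a(1)]] fG(3)[OF a(1)] e(2)[OF a(1)] a(2)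
          by (auto simp: h_def h'_def)
        show "h b 0 = w (mtail H b)"
          using fD(2,3)[OF a(1)] a wp[OF fG(4)[OF a(1)]] wp[OF fG(5)[OF a(1)]] ends_orientation[of H q "qi b" p G, OF e(1)[OF a(1)]]
          by (cases "?s (qi b)") (auto simp: h_def same_orientation_def)
        show "h b (len H b) = w (mhead H b)"
          using fD(2,3)[OF a(1)] a wp[OF fG(4)[OF a(1)]] wp[OF fG(5)[OF a(1)]] ends_orientation[of H q "qi b" p G, OF e(1)[OF a(1)]] e(2)[OF a(1)]
          by (cases "?s (qi b)") (auto simp: h_def same_orientation_def)
      qed (auto simp: w_def)
      then show "\<exists>h h' w. H10_deriv H h h' w \<and> (\<forall>e\<in>medges G. h (q e) = f e \<and> h' (q e) = f' e \<or>
            h (q e) = (\<lambda>x. f e (len G e - x)) \<and> h' (q e) = (\<lambda>x. - f' e (len G e - x)))"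
        by (intro exI[of _ h] exI[of _ h'] exI[of _ w]) (auto simp: h_def h'_def qi)
    qed
    show "forms H \<subseteq> forms G"
    proof (rule forms_subset_of_edge_map[OF H G bq])
      show "len G (qi b) = len H b" if "b \<in> medges H" for b using e(2)[OF qi'(1)[OF that]] qi'(2)[OF that] by simp
      fix f f' u assume f: "H10_deriv H f f' u"
      note fD = H10_derivD[OF f]
      define h where "h a = (if ?s a then f (q a) else (\<lambda>x. f (q a) (len H (q a) - x)))" for a
      define h' where "h' a = (if ?s a then f' (q a) else (\<lambda>x. - f' (q a) (len H (q a) - x)))" for a
      have "H10_deriv G h h' (u \<circ> p)"
        unfolding H10_deriv_def vertex_values_def
      proof (intro conjI ballI)
        fix a assume a: "a \<in> medges G"
        then have qa: "q a \<in> medges H" using q by (auto simp: bij_betw_def)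
        show "H1_deriv (len G a) (h a) (h' a)"
          using fD(1)[OF qa] H1_deriv_reflect[OF fD(1)[OF qa]] fG(3)[OF a] e(2)[OF a]
          by (auto simp: h_def h'_def)
        show "h a 0 = (u \<circ> p) (mtail G a)"
        proof (cases "?s a")
          case True then show ?thesis using fD(2)[OF qa] by (simp add: h_def same_orientation_def)
        next
          case False then show ?thesis using fD(3)[OF qa] ends_orientation(2)[of H q a p G, OF e(1)[OF a] False] by (simp add: h_def)
        qed
        show "h a (len G a) = (u \<circ> p) (mhead G a)"
        proof (cases "?s a")
          case True then show ?thesis using fD(3)[OF qa] e(2)[OF a] by (simp add: h_def same_orientation_def)
        next
          case False then show ?thesis using fD(2)[OF qa] e(2)[OF a] ends_orientation(1)[of H q a p G, OF e(1)[OF a] False] by (simp add: h_def)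
        qed
      qed (use D fD(4) in auto)
      then show "\<exists>h h' w. H10_deriv G h h' w \<and> (\<forall>e\<in>medges H. h (qi e) = f e \<and> h' (qi e) = f' e \<or>
            h (qi e) = (\<lambda>x. f e (len H e - x)) \<and> h' (qi e) = (\<lambda>x. - f' e (len H e - x)))"
        by (intro exI[of _ h] exI[of _ h'] exI[of _ "u \<circ> p"]) (auto simp: h_def h'_def qi'(2))
    qed
  qed
qed

definition subdivide :: "('v, 'e) metric_graph \<Rightarrow> 'e \<Rightarrow> 'e \<Rightarrow> 'v \<Rightarrow> real \<Rightarrow> ('v, 'e) metric_graph" where
  "subdivide G e e' w s =
     \<lparr> skeleton = \<lparr> verts = insert w (mverts G), arcs = insert e' (medges G),
                    tail = (mtail G)(e' := w),
                    head = (mhead G)(e := w, e' := mhead G e) \<rparr>,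
       len = (len G)(e := s, e' := len G e - s),
       dirichlet = dirichlet G \<rparr>"

lemma subdivide_simps [simp]:
  "mverts (subdivide G e e' w s) = insert w (mverts G)" "medges (subdivide G e e' w s) = insert e' (medges G)"
  "mtail (subdivide G e e' w s) = (mtail G)(e' := w)" "mhead (subdivide G e e' w s) = (mhead G)(e := w, e' := mhead G e)"
  "len (subdivide G e e' w s) = (len G)(e := s, e' := len G e - s)" "dirichlet (subdivide G e e' w s) = dirichlet G"
  by (auto simp: subdivide_def)

definition subdivision_point :: "('v, 'e) metric_graph \<Rightarrow> 'e \<Rightarrow> 'e \<Rightarrow> 'v \<Rightarrow> real \<Rightarrow> bool" where
  "subdivision_point G e e' w s \<longleftrightarrow> finite_metric_graph G \<and> e \<in> medges G \<and> e' \<notin> medges G \<and> w \<notin> mverts G \<and> 0 < s \<and> s < len G e"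

lemma subdivides_to_iff:
  "subdivides_to G H \<longleftrightarrow> (\<exists>e e' w s. subdivision_point G e e' w s \<and> H = subdivide G e e' w s)"
  unfolding subdivides_to_def subdivision_point_def subdivide_def by blast

lemma finite_metric_graph_subdivide:
  assumes "subdivision_point G e e' w s" shows "finite_metric_graph (subdivide G e e' w s)"
proof -
  have G: "finite_metric_graph G" and *: "e \<in> medges G" "e' \<notin> medges G" "w \<notin> mverts G" "0 < s" "s < len G e"
    using assms by (auto simp: subdivision_point_def)
  note f = finite_metric_graphD[OF G]
  have "fin_digraph (skeleton (subdivide G e e' w s))"
    by unfold_locales (use f * in auto)
  then show ?thesis unfolding finite_metric_graph_def using f * by auto
qed

lemma subdivide_H10_deriv:
  assumes sp: "subdivision_point G e e' w s" and f: "H10_deriv G f f' u"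
  defines "h \<equiv> f(e' := \<lambda>x. f e (x + s))" and "h' \<equiv> f'(e' := \<lambda>x. f' e (x + s))"
  shows "H10_deriv (subdivide G e e' w s) h h' (u(w := f e s))"
    "gint (subdivide G e e' w s) (\<lambda>e x. (h' e x)\<^sup>2) = gint G (\<lambda>e x. (f' e x)\<^sup>2)"
    "gint (subdivide G e e' w s) (\<lambda>e x. (h e x)\<^sup>2) = gint G (\<lambda>e x. (f e x)\<^sup>2)"
    "gint (subdivide G e e' w s) h = gint G f"
proof -
  have G: "finite_metric_graph G" and *: "e \<in> medges G" "e' \<notin> medges G" "w \<notin> mverts G" "0 < s" "s < len G e"
    using assms by (auto simp: subdivision_point_def)
  have ne: "e \<noteq> e'" using * by auto
  note fG = finite_metric_graphD[OF G] and fD = H10_derivD[OF f]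
  show "H10_deriv (subdivide G e e' w s) h h' (u(w := f e s))"
    unfolding H10_deriv_def vertex_values_def
  proof (intro conjI ballI)
    fix a assume "a \<in> medges (subdivide G e e' w s)"
    then have a: "a = e' \<or> a = e \<or> a \<in> medges G \<and> a \<noteq> e' \<and> a \<noteq> e" using * by auto
    show "H1_deriv (len (subdivide G e e' w s) a) (h a) (h' a)"
      using a ne fD(1) * H1_deriv_restrict[OF fD(1)[OF *(1)], of s] H1_deriv_shift[OF fD(1)[OF *(1)], of s] by (auto simp: h_def h'_def)
    have nw: "mtail G a \<noteq> w" "mhead G a \<noteq> w" if "a \<in> medges G" for a using fG(4,5)[OF that] * by auto
    show "h a 0 = (u(w := f e s)) (mtail (subdivide G e e' w s) a)" "h a (len (subdivide G e e' w s) a) = (u(w := f e s)) (mhead (subdivide G e e' w s) a)"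
      using a ne fD(2,3) * nw by (auto simp: h_def)
  next
    fix v assume "v \<in> dirichlet (subdivide G e e' w s)"
    then show "(u(w := f e s)) v = 0" using fG(6) * fD(4) by auto
  qed
  have split: "gint (subdivide G e e' w s) (\<lambda>a x. if a = e' then k e (x + s) else k a x) = gint G k"
    if k: "k e integrable_on {0..len G e}" for k :: "'b \<Rightarrow> real \<Rightarrow> real"
  proof -
    have "integral {0..len G e - s} (\<lambda>x. k e (x + s)) = integral {s..len G e} (k e)"
      using integral_shift_real_ivl[of s s "len G e" "k e"] by simp
    moreover have "integral {0..s} (k e) + integral {s..len G e} (k e) = integral {0..len G e} (k e)"
      by (rule Henstock_Kurzweil_Integration.integral_combine) (use * k in auto)
    moreover have "gint (subdivide G e e' w s) (\<lambda>a x. if a = e' then k e (x + s) else k a x) =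
      integral {0..len G e - s} (\<lambda>x. k e (x + s)) + (integral {0..s} (k e) + (\<Sum>a\<in>medges G - {e}. integral {0..len G a} (k a)))"
    proof -
      have "(\<Sum>a\<in>medges G. integral {0..((len G)(e := s, e' := len G e - s)) a} (\<lambda>x. if a = e' then k e (x + s) else k a x))
        = integral {0..s} (k e) + (\<Sum>a\<in>medges G - {e}. integral {0..len G a} (k a))"
      proof -
        have "(\<Sum>a\<in>medges G - {e}. integral {0..((len G)(e := s, e' := len G e - s)) a} (\<lambda>x. if a = e' then k e (x + s) else k a x))
          = (\<Sum>a\<in>medges G - {e}. integral {0..len G a} (k a))"
        proof (rule sum.cong)
          fix a assume "a \<in> medges G - {e}"
          then have "a \<noteq> e" "a \<noteq> e'" using *(2) by auto
          then show "integral {0..((len G)(e := s, e' := len G e - s)) a} (\<lambda>x. if a = e' then k e (x + s) else k a x) = integral {0..len G a} (k a)"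
            by simp
        qed simp
        then show ?thesis using fG(2) *(1) ne by (subst sum.remove[of _ e]) auto
      qed
      then show ?thesis unfolding gint_def using fG(2) * ne by simp
    qed
    moreover have "gint G k = integral {0..len G e} (k e) + (\<Sum>a\<in>medges G - {e}. integral {0..len G a} (k a))"
      unfolding gint_def using fG(2) *(1) by (subst sum.remove[of _ e]) auto
    ultimately show ?thesis by simp
  qed
  have "(\<lambda>x. (f' e x)\<^sup>2) integrable_on {0..len G e}" using H1_derivD(2)[OF fD(1)[OF *(1)]] .
  note 1 = split[of "\<lambda>e x. (f' e x)\<^sup>2", OF this]
  have "(\<lambda>x. (f e x)\<^sup>2) integrable_on {0..len G e}" by (intro integrable_continuous_real continuous_intros fD(5) *(1))
  note 2 = split[of "\<lambda>e x. (f e x)\<^sup>2", OF this]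
  have "f e integrable_on {0..len G e}" by (intro integrable_continuous_real fD(5) *(1))
  note 3 = split[of f, OF this]
  have "(\<lambda>a x. (h' a x)\<^sup>2) = (\<lambda>a x. if a = e' then (f' e (x + s))\<^sup>2 else (f' a x)\<^sup>2)"
    "(\<lambda>a x. (h a x)\<^sup>2) = (\<lambda>a x. if a = e' then (f e (x + s))\<^sup>2 else (f a x)\<^sup>2)"
    "h = (\<lambda>a x. if a = e' then f e (x + s) else f a x)"
    by (auto simp: fun_eq_iff h_def h'_def)
  then show "gint (subdivide G e e' w s) (\<lambda>e x. (h' e x)\<^sup>2) = gint G (\<lambda>e x. (f' e x)\<^sup>2)"
    "gint (subdivide G e e' w s) (\<lambda>e x. (h e x)\<^sup>2) = gint G (\<lambda>e x. (f e x)\<^sup>2)"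
    "gint (subdivide G e e' w s) h = gint G f"
    using 1 2 3 by simp_all
qed

text \<open>The form domain asks for continuity at the new vertex but imposes no condition on
  derivatives there. Therefore a function on the two pieces concatenates to one on the original
  edge, with the same integrals.\<close>

lemma subdivides_to_forms:
  assumes "subdivides_to G H" shows "forms G = forms H"
proof -
  obtain e e' w s where sp: "subdivision_point G e e' w s" and H: "H = subdivide G e e' w s"
    using assms unfolding subdivides_to_iff by blast
  have G: "finite_metric_graph G" and *: "e \<in> medges G" "e' \<notin> medges G" "w \<notin> mverts G" "0 < s" "s < len G e"
    using sp by (auto simp: subdivision_point_def)
  have ne: "e \<noteq> e'" using * by auto
  note fG = finite_metric_graphD[OF G]
  show ?thesis
  proof
    show "forms G \<subseteq> forms H"
    proof
      fix z assume "z \<in> forms G"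
      then obtain f f' u where z: "H10_deriv G f f' u"
        "z = (gint G (\<lambda>e x. (f' e x)\<^sup>2), gint G (\<lambda>e x. (f e x)\<^sup>2), gint G f)"
        unfolding forms_def by blast
      show "z \<in> forms H" unfolding H forms_def z(2)
        using subdivide_H10_deriv[OF sp z(1)] by (auto intro!: exI)
    qed
    show "forms H \<subseteq> forms G"
    proof
      fix z assume "z \<in> forms H"
      then obtain f f' u where z: "H10_deriv H f f' u"
        "z = (gint H (\<lambda>e x. (f' e x)\<^sup>2), gint H (\<lambda>e x. (f e x)\<^sup>2), gint H f)"
        unfolding forms_def by blast
      note fD = H10_derivD[OF z(1), unfolded H, simplified]
      define h where "h = f(e := \<lambda>x. if x \<le> s then f e x else f e' (x - s))"
      define h' where "h' = f'(e := \<lambda>x. if x \<le> s then f' e x else f' e' (x - s))"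
      have j: "f e s = f e' 0" using fD(2)[of e'] fD(3)[of e] * ne by auto
      have h: "H10_deriv G h h' u"
        unfolding H10_deriv_def vertex_values_def
      proof (intro conjI ballI)
        fix a assume a: "a \<in> medges G"
        have ae: "a \<noteq> e'" using a * by auto
        have "H1_deriv (s + (len G e - s)) (\<lambda>x. if x \<le> s then f e x else f e' (x - s)) (\<lambda>x. if x \<le> s then f' e x else f' e' (x - s))"
          by (rule H1_deriv_concat) (use fD(1)[of e] fD(1)[of e'] * ne j in auto)
        then show "H1_deriv (len G a) (h a) (h' a)"
          using fD(1)[of a] a ae by (auto simp: h_def h'_def split: if_splits)
        show "h a 0 = u (mtail G a)" using fD(2)[of a] a ae * by (auto simp: h_def)
        show "h a (len G a) = u (mhead G a)" using fD(3)[of a] fD(3)[of e'] a ae * ne by (auto simp: h_def)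
      qed (use fD(4) in auto)
      have r: "gint H k = gint G (k(e := \<lambda>x. if x \<le> s then k e x else k e' (x - s)))"
        if k: "k e integrable_on {0..s}" "k e' integrable_on {0..len G e - s}" for k :: "'b \<Rightarrow> real \<Rightarrow> real"
      proof -
        have "((\<lambda>x. if x \<le> s then k e x else k e' (x - s)) has_integral (integral {0..s} (k e) + integral {0..len G e - s} (k e'))) {0..s + (len G e - s)}"
          by (rule integrable_on_concat) (use k * in auto)
        then have 1: "integral {0..len G e} (\<lambda>x. if x \<le> s then k e x else k e' (x - s)) = integral {0..s} (k e) + integral {0..len G e - s} (k e')"
          by (simp add: has_integral_iff)
        have "(\<Sum>a\<in>medges G. integral {0..((len G)(e := s, e' := len G e - s)) a} (k a))
          = integral {0..s} (k e) + (\<Sum>a\<in>medges G - {e}. integral {0..len G a} (k a))"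
        proof -
          have "(\<Sum>a\<in>medges G - {e}. integral {0..((len G)(e := s, e' := len G e - s)) a} (k a))
            = (\<Sum>a\<in>medges G - {e}. integral {0..len G a} (k a))"
          proof (rule sum.cong)
            fix a assume "a \<in> medges G - {e}"
            then have "a \<noteq> e" "a \<noteq> e'" using *(2) by auto
            then show "integral {0..((len G)(e := s, e' := len G e - s)) a} (k a) = integral {0..len G a} (k a)"
              by simp
          qed simp
          then show ?thesis using fG(2) *(1) ne by (subst sum.remove[of _ e]) auto
        qed
        moreover have "gint G (k(e := \<lambda>x. if x \<le> s then k e x else k e' (x - s))) =
            integral {0..len G e} (\<lambda>x. if x \<le> s then k e x else k e' (x - s)) + (\<Sum>a\<in>medges G - {e}. integral {0..len G a} (k a))"
          unfolding gint_def using fG(2) *(1) by (subst sum.remove[of _ e]) (auto intro!: sum.cong)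
        ultimately show ?thesis using 1 unfolding gint_def H using fG(2) * ne by simp
      qed
      have e1: "H1_deriv s (f e) (f' e)" "H1_deriv (len G e - s) (f e') (f' e')" using fD(1)[of e] fD(1)[of e'] * ne by auto
      have "gint H (\<lambda>e x. (f' e x)\<^sup>2) = gint G (\<lambda>e x. (h' e x)\<^sup>2)"
        by (subst r) (use H1_derivD(2)[OF e1(1)] H1_derivD(2)[OF e1(2)] in \<open>auto simp: h'_def gint_def intro!: sum.cong Henstock_Kurzweil_Integration.integral_cong\<close>)
      moreover have "gint H (\<lambda>e x. (f e x)\<^sup>2) = gint G (\<lambda>e x. (h e x)\<^sup>2)"
        by (subst r) (use H1_deriv_continuous[OF e1(1)] H1_deriv_continuous[OF e1(2)] in
           \<open>auto simp: h_def gint_def intro!: sum.cong Henstock_Kurzweil_Integration.integral_cong integrable_continuous_real continuous_intros\<close>)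
      moreover have "gint H f = gint G h"
        unfolding h_def by (rule r) (use H1_deriv_continuous[OF e1(1)] H1_deriv_continuous[OF e1(2)] in \<open>auto intro!: integrable_continuous_real\<close>)
      ultimately show "z \<in> forms G" using h unfolding z(2) forms_def by auto
    qed
  qed
qed

section \<open>Edge cuts\<close>

definition boundary :: "('v, 'e) metric_graph \<Rightarrow> 'v set \<Rightarrow> 'e set" where
  "boundary G S = {e\<in>medges G. (mtail G e \<in> S) \<noteq> (mhead G e \<in> S)}"

text \<open>Edge connectivity as seen from the Dirichlet set. Unlike connectedness of the skeleton
  it survives the splitting of Dirichlet vertices, and it is the form in which connectivity bounds
  the number of points on a level.\<close>

definition cut_ge :: "nat \<Rightarrow> ('v, 'e) metric_graph \<Rightarrow> bool" where
  "cut_ge n G \<longleftrightarrow> (\<forall>S. S \<subseteq> mverts G - dirichlet G \<longrightarrow> S \<noteq> {} \<longrightarrow> n \<le> card (boundary G S))"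

lemma finite_boundary: "finite_metric_graph G \<Longrightarrow> finite (boundary G S)"
  by (simp add: boundary_def finite_metric_graphD(2))

lemma cut_ge_mono: "cut_ge n G \<Longrightarrow> m \<le> n \<Longrightarrow> cut_ge m G"
  unfolding cut_ge_def by (meson le_trans)

lemma connected_closed_set:
  assumes c: "Digraph_Component.connected K" and x: "x \<in> S" "x \<in> verts K"
    and cl: "\<And>e. e \<in> arcs K \<Longrightarrow> tail K e \<in> S \<longleftrightarrow> head K e \<in> S"
  shows "verts K \<subseteq> S"
proof
  fix y assume y: "y \<in> verts K"
  have "x \<rightarrow>\<^sup>*\<^bsub>with_proj (mk_symmetric K)\<^esub> y"
    using c x y unfolding Digraph_Component.connected_def strongly_connected_def by simp
  then have "(x, y) \<in> (parcs (mk_symmetric K))\<^sup>*"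
    by (auto dest: reachable_rtranclI)
  then show "y \<in> S"
  proof induction
    case (step y z)
    then show ?case using cl by (auto simp: parcs_mk_symmetric)
  qed (use x in simp)
qed

lemma cut_ge_1_connected:
  assumes "connected_metric_graph G" "dirichlet G \<noteq> {}"
  shows "cut_ge 1 G"
  unfolding cut_ge_def
proof (intro allI impI)
  fix S assume S: "S \<subseteq> mverts G - dirichlet G" "S \<noteq> {}"
  have G: "finite_metric_graph G" using assms by (simp add: connected_metric_graph_def)
  have "boundary G S \<noteq> {}"
  proof
    assume "boundary G S = {}"
    then have "mverts G \<subseteq> S"
      using connected_closed_set[of "skeleton G" _ S] assms(1) S unfolding boundary_def connected_metric_graph_def by blast
    then show False using S finite_metric_graphD(6)[OF G] assms(2) by blast
  qed
  then show "1 \<le> card (boundary G S)" using finite_boundary[OF G, of S] by (simp add: Suc_le_eq card_gt_0_iff)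
qed

text \<open>A set without Dirichlet vertices has the same boundary before and after gluing. A single
  boundary edge could be deleted, and the set would then be separated from the glued Dirichlet
  vertex.\<close>

lemma cut_ge_2_doubly_connected:
  assumes "connected_metric_graph G" and D: "dirichlet G \<noteq> {}" and dc: "doubly_connected (glue_dirichlet G)"
  shows "cut_ge 2 G"
  unfolding cut_ge_def
proof (intro allI impI)
  fix S assume S: "S \<subseteq> mverts G - dirichlet G" "S \<noteq> {}"
  have G: "finite_metric_graph G" using assms by (simp add: connected_metric_graph_def)
  note fG = finite_metric_graphD[OF G]
  define d where "d = (SOME d. d \<in> dirichlet G)"
  have d: "d \<in> dirichlet G" unfolding d_def using D some_in_eq by blast
  have gm: "glue_map G w = (if w \<in> dirichlet G then d else w)" for w by (simp add: glue_map_def d_def)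
  have gS: "glue_map G w \<in> S \<longleftrightarrow> w \<in> S" for w using S d by (auto simp: gm)
  obtain x where x: "x \<in> S" using S by blast
  have xv: "x \<in> mverts (glue_dirichlet G)" using x S by (auto simp: glue_dirichlet_def gm intro!: rev_image_eqI)
  have dv: "d \<in> mverts (glue_dirichlet G)" using d fG(6) by (auto simp: glue_dirichlet_def gm intro!: rev_image_eqI)
  have ar: "medges (glue_dirichlet G) = medges G" by (simp add: glue_dirichlet_def)
  have th: "mtail (glue_dirichlet G) e = glue_map G (mtail G e)" "mhead (glue_dirichlet G) e = glue_map G (mhead G e)" for e
    by (auto simp: glue_dirichlet_def)
  \<comment> \<open>\<open>F\<close> is the set of deleted edges. It is used twice, with
    \<open>F = {}\<close> for a first boundary edge and with that edge deleted for a second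
    one.\<close>
  have ex: "\<exists>e\<in>boundary G S. e \<notin> F" if F: "F = {} \<or> (\<exists>a\<in>medges G. F = {a})" for F
  proof (rule ccontr)
    assume no: "\<not> ?thesis"
    define K where "K = (if F = {} then skeleton (glue_dirichlet G) else pre_digraph.del_arc (skeleton (glue_dirichlet G)) (the_elem F))"
    have K: "verts K = mverts (glue_dirichlet G)" "arcs K = medges G - F" "tail K = mtail (glue_dirichlet G)" "head K = mhead (glue_dirichlet G)"
      using F ar by (auto simp: K_def pre_digraph.del_arc_simps)
    have "Digraph_Component.connected K" using F dc ar by (auto simp: K_def doubly_connected_def)
    then have "verts K \<subseteq> S"
    proof (rule connected_closed_set[OF _ x])
      show "x \<in> verts K" using xv K by simp
      show "tail K e \<in> S \<longleftrightarrow> head K e \<in> S" if "e \<in> arcs K" for e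
        using that no K th gS by (auto simp: boundary_def)
    qed
    then show False using K dv d S by auto
  qed
  obtain e1 where e1: "e1 \<in> boundary G S" using ex[of "{}"] by blast
  obtain e2 where e2: "e2 \<in> boundary G S" "e2 \<noteq> e1" using ex[of "{e1}"] e1 by (auto simp: boundary_def)
  have "card {e1, e2} \<le> card (boundary G S)"
    by (rule card_mono) (use e1 e2 finite_boundary[OF G] in auto)
  then show "2 \<le> card (boundary G S)" using e2 by simp
qed

text \<open>The sets in question avoid the Dirichlet vertices, and off these \<open>p\<close> is a
  bijection that neither creates nor destroys boundary edges.\<close>

lemma cut_ge_glues_to:
  assumes "glues_to G H" shows "cut_ge n G \<longleftrightarrow> cut_ge n H"
proof -
  obtain p q where G: "finite_metric_graph G" and H: "finite_metric_graph H" and D: "p ` dirichlet G = dirichlet H"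
    and p: "bij_betw p (mverts G - dirichlet G) (mverts H - dirichlet H)"
    and q: "bij_betw q (medges G) (medges H)"
    and e: "\<And>e. e \<in> medges G \<Longrightarrow> ends H (q e) = p ` ends G e"
    using assms unfolding glues_to_def by blast
  note fG = finite_metric_graphD[OF G]
  have pS: "p v \<in> p ` S \<longleftrightarrow> v \<in> S" if S: "S \<subseteq> mverts G - dirichlet G" and v: "v \<in> mverts G" for S v
  proof
    assume pv: "p v \<in> p ` S"
    then have "p v \<in> mverts H - dirichlet H" using S p by (auto simp: bij_betw_def)
    then have "v \<notin> dirichlet G" using D by auto
    then show "v \<in> S" using pv S v p by (metis DiffI bij_betw_imp_inj_on inj_on_image_mem_iff)
  qed simp
  have b: "card (boundary H (p ` S)) = card (boundary G S)" if S: "S \<subseteq> mverts G - dirichlet G" for S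
  proof -
    have iff: "q a \<in> boundary H (p ` S) \<longleftrightarrow> a \<in> boundary G S" if a: "a \<in> medges G" for a
    proof -
      have "q a \<in> medges H" using q a by (auto simp: bij_betw_def)
      moreover have "(mtail H (q a) = p (mtail G a) \<and> mhead H (q a) = p (mhead G a)) \<or> (mtail H (q a) = p (mhead G a) \<and> mhead H (q a) = p (mtail G a))"
        using e[OF a] by (auto simp: ends_def doubleton_eq_iff)
      ultimately show ?thesis using a
        by (elim disjE) (simp_all add: boundary_def pS[OF S fG(4)[OF a]] pS[OF S fG(5)[OF a]], blast)
    qed
    have "boundary H (p ` S) = q ` boundary G S"
    proof
      show "boundary H (p ` S) \<subseteq> q ` boundary G S"
      proof
        fix b assume b: "b \<in> boundary H (p ` S)"
        then have "b \<in> medges H" by (auto simp: boundary_def)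
        then obtain a where "a \<in> medges G" "b = q a" using q by (auto simp: bij_betw_def)
        then show "b \<in> q ` boundary G S" using iff b by auto
      qed
      show "q ` boundary G S \<subseteq> boundary H (p ` S)" using iff by (auto simp: boundary_def)
    qed
    moreover have "inj_on q (boundary G S)" using q by (auto simp: bij_betw_def boundary_def intro: inj_on_subset)
    ultimately show ?thesis by (simp add: card_image)
  qed
  show ?thesis
  proof
    assume c: "cut_ge n G"
    show "cut_ge n H" unfolding cut_ge_def
    proof (intro allI impI)
      fix T assume T: "T \<subseteq> mverts H - dirichlet H" "T \<noteq> {}"
      then obtain S where "S \<subseteq> mverts G - dirichlet G" "T = p ` S"
        using p by (metis bij_betw_def subset_imageE)
      moreover from this have "S \<noteq> {}" using T by auto
      ultimately have "n \<le> card (boundary G S)" using c unfolding cut_ge_def by blast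
      then show "n \<le> card (boundary H T)" using b[OF \<open>S \<subseteq> mverts G - dirichlet G\<close>] \<open>T = p ` S\<close> by simp
    qed
  next
    assume c: "cut_ge n H"
    show "cut_ge n G" unfolding cut_ge_def
    proof (intro allI impI)
      fix S assume S: "S \<subseteq> mverts G - dirichlet G" "S \<noteq> {}"
      then have "p ` S \<subseteq> mverts H - dirichlet H" using p by (auto simp: bij_betw_def)
      moreover have "p ` S \<noteq> {}" using S by simp
      ultimately have "n \<le> card (boundary H (p ` S))" using c unfolding cut_ge_def by blast
      then show "n \<le> card (boundary G S)" using b[OF S(1)] by simp
    qed
  qed
qed

text \<open>The bound on \<open>n\<close> is caused by the set consisting of the new vertex alone,
  whose boundary has exactly two edges. All other sets are compared with sets of old
  vertices.\<close>

lemma cut_ge_subdivide: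
  assumes sp: "subdivision_point G e e' w s" and n: "n \<le> 2"
  shows "cut_ge n (subdivide G e e' w s) \<longleftrightarrow> cut_ge n G"
proof -
  let ?H = "subdivide G e e' w s"
  have G: "finite_metric_graph G" and *: "e \<in> medges G" "e' \<notin> medges G" "w \<notin> mverts G" "0 < s" "s < len G e"
    using sp by (auto simp: subdivision_point_def)
  have ne: "e \<noteq> e'" using * by auto
  note fG = finite_metric_graphD[OF G]
  have nw: "mtail G a \<noteq> w" "mhead G a \<noteq> w" if "a \<in> medges G" for a using fG(4,5)[OF that] * by auto
  show ?thesis
  proof
    assume c: "cut_ge n ?H"
    show "cut_ge n G" unfolding cut_ge_def
    proof (intro allI impI)
      fix S assume S: "S \<subseteq> mverts G - dirichlet G" "S \<noteq> {}"
      \<comment> \<open>The new vertex joins the side of the tail of \<open>e\<close>: then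
        \<open>e\<close> is never cut, and \<open>e'\<close> is cut exactly when \<open>e\<close>
        was cut before.\<close>
      define T where "T = (if mtail G e \<in> S then insert w S else S)"
      have wS: "w \<notin> S" using S * by auto
      have "T \<subseteq> mverts ?H - dirichlet ?H" "T \<noteq> {}" using S fG(6) * by (auto simp: T_def)
      then have "n \<le> card (boundary ?H T)" using c unfolding cut_ge_def by blast
      also have "\<dots> \<le> card ((\<lambda>a. if a = e then e' else a) ` boundary G S)"
      proof (rule card_mono)
        show "boundary ?H T \<subseteq> (\<lambda>a. if a = e then e' else a) ` boundary G S"
        proof
          fix a assume a: "a \<in> boundary ?H T"
          show "a \<in> (\<lambda>a. if a = e then e' else a) ` boundary G S"
          proof (cases "a = e'")
            case True
            then have "e \<in> boundary G S" using a * ne wS nw by (auto simp: boundary_def T_def split: if_splits)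
            then show ?thesis using True by (intro rev_image_eqI) auto
          next
            case False
            then have "a \<in> boundary G S" "a \<noteq> e" using a * ne wS nw[of a] by (auto simp: boundary_def T_def split: if_splits)
            then show ?thesis using False by (intro rev_image_eqI[of a]) auto
          qed
        qed
      qed (use finite_boundary[OF G] in auto)
      also have "\<dots> \<le> card (boundary G S)" by (rule card_image_le[OF finite_boundary[OF G]])
      finally show "n \<le> card (boundary G S)" .
    qed
  next
    assume c: "cut_ge n G"
    show "cut_ge n ?H" unfolding cut_ge_def
    proof (intro allI impI)
      fix T assume T: "T \<subseteq> mverts ?H - dirichlet ?H" "T \<noteq> {}"
      have fin: "finite (boundary ?H T)" by (rule finite_boundary[OF finite_metric_graph_subdivide[OF sp]])
      show "n \<le> card (boundary ?H T)"
      proof (cases "T = {w}")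
        case True
        then have "{e, e'} \<subseteq> boundary ?H T" using * ne nw[OF *(1)] by (auto simp: boundary_def)
        then have "card {e, e'} \<le> card (boundary ?H T)" by (rule card_mono[OF fin])
        then show ?thesis using ne n by simp
      next
        case False
        define S where "S = T - {w}"
        have "S \<subseteq> mverts G - dirichlet G" "S \<noteq> {}" using T False by (auto simp: S_def)
        then have "n \<le> card (boundary G S)" using c unfolding cut_ge_def by blast
        also have "\<dots> \<le> card ((\<lambda>a. if a = e' then e else a) ` boundary ?H T)"
        proof (rule card_mono)
          show "boundary G S \<subseteq> (\<lambda>a. if a = e' then e else a) ` boundary ?H T"
          proof
            fix a assume a: "a \<in> boundary G S"
            then have ae: "a \<noteq> e'" using * by (auto simp: boundary_def)
            show "a \<in> (\<lambda>a. if a = e' then e else a) ` boundary ?H T"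
            proof (cases "a = e")
              case True
              then have "e \<in> boundary ?H T \<or> e' \<in> boundary ?H T" using a * ne nw[OF *(1)] by (auto simp: boundary_def S_def)
              then show ?thesis using True ne by (elim disjE) (force intro: rev_image_eqI)+
            next
              case False
              then have "a \<in> boundary ?H T" using a ae * nw[of a] by (auto simp: boundary_def S_def)
              then show ?thesis using ae by (intro rev_image_eqI[of a]) auto
            qed
          qed
        qed (use fin in auto)
        also have "\<dots> \<le> card (boundary ?H T)" by (rule card_image_le[OF fin])
        finally show ?thesis .
      qed
    qed
  qed
qed

lemma cut_ge_subdivides_to:
  assumes "subdivides_to G H" "n \<le> 2" shows "cut_ge n H \<longleftrightarrow> cut_ge n G"
proof -
  obtain e e' w s where sp: "subdivision_point G e e' w s" and H: "H = subdivide G e e' w s"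
    using assms(1) unfolding subdivides_to_iff by blast
  show ?thesis unfolding H by (rule cut_ge_subdivide[OF sp assms(2)])
qed

section \<open>Functions of the vertices\<close>

definition vertex_space :: "('v, 'e) metric_graph \<Rightarrow> ('v \<Rightarrow> real) set" where
  "vertex_space G = {u. \<forall>v. v \<notin> mverts G - dirichlet G \<longrightarrow> u v = 0}"

definition sqnorm :: "('v, 'e) metric_graph \<Rightarrow> ('v \<Rightarrow> real) \<Rightarrow> real" where
  "sqnorm G u = (\<Sum>v\<in>mverts G. (u v)\<^sup>2)"

text \<open>Compactness is that of a product of intervals in the function space over all of
  \<open>'v\<close>. Functions in \<open>vertex_space\<close> vanish off the finitely many free
  vertices, so it does not matter whether the vertex type is finite.\<close>

lemma compact_vertex_ball:
  assumes "finite_metric_graph G"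
  shows "compact {u \<in> vertex_space G. sqnorm G u \<le> r}"
proof -
  define B where "B v = (if v \<in> mverts G - dirichlet G then {-sqrt r..sqrt r} else {0::real})" for v
  have "compactin (product_topology (\<lambda>v. euclidean) UNIV) (PiE UNIV B)"
    by (subst compactin_PiE) (auto simp: B_def)
  then have c: "compact (PiE UNIV B)" by (simp add: euclidean_product_topology)
  have "closed {u. sqnorm G u \<le> r}"
    unfolding sqnorm_def by (intro closed_Collect_le continuous_intros continuous_on_product_coordinates)
  then have "compact (PiE UNIV B \<inter> {u. sqnorm G u \<le> r})" using c by blast
  moreover have "PiE UNIV B \<inter> {u. sqnorm G u \<le> r} = {u \<in> vertex_space G. sqnorm G u \<le> r}"
  proof (intro set_eqI iffI)
    fix u assume u: "u \<in> {u \<in> vertex_space G. sqnorm G u \<le> r}"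
    have "u v \<in> B v" for v
    proof (cases "v \<in> mverts G - dirichlet G")
      case True
      have "(u v)\<^sup>2 \<le> sqnorm G u" unfolding sqnorm_def
        by (rule member_le_sum) (use True finite_metric_graphD(1)[OF assms] in auto)
      then have "(u v)\<^sup>2 \<le> r" using u by auto
      then have "\<bar>u v\<bar> \<le> sqrt r" using real_le_rsqrt by fastforce
      then show ?thesis using True by (auto simp: B_def)
    next
      case False
      then show ?thesis using u by (auto simp: B_def vertex_space_def)
    qed
    then show "u \<in> PiE UNIV B \<inter> {u. sqnorm G u \<le> r}" using u by auto
  next
    fix u assume "u \<in> PiE UNIV B \<inter> {u. sqnorm G u \<le> r}"
    moreover have "u v = 0" if "u \<in> PiE UNIV B" "v \<notin> mverts G - dirichlet G" for v
      using PiE_mem[OF that(1), of v] that(2) by (auto simp: B_def split: if_splits)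
    ultimately show "u \<in> {u \<in> vertex_space G. sqnorm G u \<le> r}" by (auto simp: vertex_space_def)
  qed
  ultimately show ?thesis by simp
qed

text \<open>The minimum of \<open>Q\<close> over the unit sphere is attained and positive;
  homogeneity carries the bound to all other vectors.\<close>

lemma quadratic_coercive:
  assumes G: "finite_metric_graph G" and c: "continuous_on UNIV Q"
    and h: "\<And>a u. Q (\<lambda>v. a * u v) = a\<^sup>2 * Q u"
    and pos: "\<And>u v. u \<in> vertex_space G \<Longrightarrow> u v \<noteq> 0 \<Longrightarrow> 0 < Q u"
  obtains m :: real where "m > 0" "\<And>u. u \<in> vertex_space G \<Longrightarrow> m * sqnorm G u \<le> Q u"
proof -
  define K where "K = {u \<in> vertex_space G. sqnorm G u \<le> 1} \<inter> {u. sqnorm G u = 1}"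
  have "closed {u. sqnorm G u = 1}"
    unfolding sqnorm_def by (intro closed_Collect_eq continuous_intros continuous_on_product_coordinates)
  then have K: "compact K" unfolding K_def using compact_vertex_ball[OF G] by blast
  have Q0: "0 \<le> Q u" if "u \<in> vertex_space G" for u
  proof (cases "\<exists>v. u v \<noteq> 0")
    case False
    then have "u = (\<lambda>v. 0 * u v)" by auto
    then have "Q u = 0" using h[of 0 u] by simp
    then show ?thesis by simp
  qed (use pos[OF that] in force)
  obtain m where m: "m > 0" "\<And>u. u \<in> K \<Longrightarrow> m \<le> Q u"
  proof (cases "K = {}")
    case True then show ?thesis using that[of 1] by auto
  next
    case False
    then obtain u0 where u0: "u0 \<in> K" "\<And>u. u \<in> K \<Longrightarrow> Q u0 \<le> Q u"
      using continuous_attains_inf[OF K False continuous_on_subset[OF c]] by auto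
    have "\<exists>v. u0 v \<noteq> 0"
    proof (rule ccontr)
      assume "\<not> ?thesis"
      then have "sqnorm G u0 = 0" by (simp add: sqnorm_def)
      then show False using u0 by (simp add: K_def)
    qed
    then have "0 < Q u0" using pos u0 by (auto simp: K_def)
    then show ?thesis using that u0 by blast
  qed
  have "m * sqnorm G u \<le> Q u" if u: "u \<in> vertex_space G" for u
  proof (cases "sqnorm G u = 0")
    case True then show ?thesis using Q0[OF u] by simp
  next
    case False
    then have n: "0 < sqnorm G u" unfolding sqnorm_def by (smt (verit) sum_nonneg zero_le_power2)
    define a where "a = 1 / sqrt (sqnorm G u)"
    have a2: "a\<^sup>2 = 1 / sqnorm G u" using n by (simp add: a_def power_divide)
    have "sqnorm G (\<lambda>v. a * u v) = a\<^sup>2 * sqnorm G u"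
      unfolding sqnorm_def by (simp add: sum_distrib_left power_mult_distrib)
    then have "(\<lambda>v. a * u v) \<in> K" using u n a2 by (simp add: K_def vertex_space_def)
    then have "m \<le> a\<^sup>2 * Q u" using m(2) h[of a u] by fastforce
    then show ?thesis using n a2 by (simp add: field_simps)
  qed
  then show ?thesis using that m by blast
qed

text \<open>Some edge leaves the support of \<open>u\<close>, and across that edge the value
  changes.\<close>

lemma dirichlet_energy_pos:
  assumes G: "finite_metric_graph G" and c: "cut_ge 1 G" and u: "u \<in> vertex_space G" "u v \<noteq> 0"
    and k: "\<And>e. e \<in> medges G \<Longrightarrow> 0 < k e"
  shows "0 < (\<Sum>e\<in>medges G. (u (mhead G e) - u (mtail G e))\<^sup>2 / k e)"
proof -
  define S where "S = {v. u v \<noteq> 0}"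
  have "S \<subseteq> mverts G - dirichlet G" using u by (auto simp: S_def vertex_space_def)
  moreover have "S \<noteq> {}" using u by (auto simp: S_def)
  ultimately have "1 \<le> card (boundary G S)" using c unfolding cut_ge_def by blast
  then have "boundary G S \<noteq> {}" by auto
  then obtain e where "e \<in> boundary G S" by blast
  then have e: "e \<in> medges G" "u (mhead G e) \<noteq> u (mtail G e)" by (auto simp: boundary_def S_def)
  then show ?thesis
    using k by (intro sum_pos2[of _ e] finite_metric_graphD(2)[OF G]) (auto intro!: divide_nonneg_pos)
qed

section \<open>The torsion function\<close>

text \<open>With \<open>v' = K - x\<close> on each edge, integration by parts and the vertex
  conditions give \<open>\<integral> f' v' = \<integral> f\<close> for every admissible
  \<open>f\<close>. The bound is then \<open>2 * f' * v' \<le> f'\<^sup>2 + v'\<^sup>2\<close>, with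
  equality for \<open>f = v\<close>.\<close>

lemma torsion_variational:
  assumes G: "finite_metric_graph G" and v: "is_torsion_function G v"
  shows "\<And>a b c. (a, b, c) \<in> forms G \<Longrightarrow> 2 * c - a \<le> graph_integral G v"
    "\<exists>a b c. (a, b, c) \<in> forms G \<and> graph_integral G v = 2 * c - a"
proof -
  note fG = finite_metric_graphD[OF G]
  have vH: "v \<in> H10 G" using v by (simp add: is_torsion_function_def)
  then obtain v0 uv where v0: "H10_deriv G v v0 uv" using H10_iff[OF G] by blast
  note vD = H10_derivD[OF v0]
  have "\<exists>K. \<forall>x\<in>{0..len G e}. v e x = v e 0 + K * x - x\<^sup>2 / 2" if e: "e \<in> medges G" for e
  proof -
    have "H2_on (len G e) (v e)" "AE x in lborel. x \<in> {0<..<len G e} \<longrightarrow> - weak_deriv (len G e) (weak_deriv (len G e) (v e)) x = 1"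
      using v e unfolding is_torsion_function_def by blast+
    then show ?thesis by (rule torsion_edge_quadratic[OF fG(3)[OF e] vD(5)[OF e]]) blast
  qed
  then have "\<forall>e. \<exists>K. e \<in> medges G \<longrightarrow> (\<forall>x\<in>{0..len G e}. v e x = v e 0 + K * x - x\<^sup>2 / 2)" by blast
  then obtain K where K: "\<And>e x. e \<in> medges G \<Longrightarrow> x \<in> {0..len G e} \<Longrightarrow> v e x = v e 0 + K e * x - x\<^sup>2 / 2"
    unfolding choice_iff by blast
  have vd: "((v e) has_vector_derivative (K e - x)) (at x within {0..len G e})" if e: "e \<in> medges G" and x: "x \<in> {0..len G e}" for e x
  proof -
    have "((\<lambda>x. v e 0 + K e * x - x\<^sup>2 / 2) has_vector_derivative (K e - x)) (at x within {0..len G e})"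
      unfolding has_real_derivative_iff_has_vector_derivative[symmetric] by (auto intro!: derivative_eq_intros)
    then show ?thesis by (rule has_vector_derivative_transform[OF x, rotated]) (rule K[OF e])
  qed
  have vd0: "vector_derivative (v e) (at 0 within {0..len G e}) = K e"
     "vector_derivative (v e) (at (len G e) within {0..len G e}) = K e - len G e" if e: "e \<in> medges G" for e
    using vector_derivative_within_closed_interval[OF fG(3)[OF e] _ vd[OF e], of 0]
      vector_derivative_within_closed_interval[OF fG(3)[OF e] _ vd[OF e], of "len G e"] fG(3)[OF e] by auto
  have n: "normal_deriv_sum G v w = (\<Sum>e\<in>{e\<in>medges G. mtail G e = w}. K e) + (\<Sum>e\<in>{e\<in>medges G. mhead G e = w}. - (K e - len G e))" for w
    unfolding normal_deriv_sum_def by (simp add: vd0)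
  \<comment> \<open>The boundary terms of the integration by parts, regrouped by vertices: each
    vertex contributes its value times its sum of normal derivatives, and one of the two factors is
    zero.\<close>
  have kirch: "(\<Sum>e\<in>medges G. u (mhead G e) * (K e - len G e) - u (mtail G e) * K e) = 0"
    if u: "\<And>w. w \<in> dirichlet G \<Longrightarrow> u w = 0" for u
  proof -
    have "(\<Sum>e\<in>medges G. u (mtail G e) * K e) = (\<Sum>w\<in>mverts G. \<Sum>e\<in>{e\<in>medges G. mtail G e = w}. u (mtail G e) * K e)"
      by (rule sum.group[symmetric]) (use fG in auto)
    moreover have "(\<Sum>e\<in>medges G. u (mhead G e) * (K e - len G e)) = (\<Sum>w\<in>mverts G. \<Sum>e\<in>{e\<in>medges G. mhead G e = w}. u (mhead G e) * (K e - len G e))"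
      by (rule sum.group[symmetric]) (use fG in auto)
    ultimately have "(\<Sum>e\<in>medges G. u (mhead G e) * (K e - len G e) - u (mtail G e) * K e)
      = (\<Sum>w\<in>mverts G. (\<Sum>e\<in>{e\<in>medges G. mhead G e = w}. u (mhead G e) * (K e - len G e)) - (\<Sum>e\<in>{e\<in>medges G. mtail G e = w}. u (mtail G e) * K e))"
      by (simp add: sum_subtractf)
    also have "\<dots> = (\<Sum>w\<in>mverts G. - u w * normal_deriv_sum G v w)"
      by (intro sum.cong refl) (simp add: n sum_distrib_left sum_negf algebra_simps)
    also have "\<dots> = 0"
      using v u by (intro sum.neutral) (auto simp: is_torsion_function_def)
    finally show ?thesis .
  qed
  have cross: "(\<Sum>e\<in>medges G. integral {0..len G e} (\<lambda>x. f' e x * (K e - x))) = gint G f"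
    and cint: "\<And>e. e \<in> medges G \<Longrightarrow> (\<lambda>x. f' e x * (K e - x)) integrable_on {0..len G e}"
    if f: "H10_deriv G f f' u" for f f' u
  proof -
    note fD = H10_derivD[OF f]
    have ci: "(\<lambda>x. f' e x * (K e - x)) integrable_on {0..len G e} \<and> integral {0..len G e} (\<lambda>x. f' e x * (K e - x)) = integral {0..len G e} (f e) + (u (mhead G e) * (K e - len G e) - u (mtail G e) * K e)"
      if e: "e \<in> medges G" for e
    proof -
      have "((\<lambda>x. f e x * (-1) + f' e x * (K e - x)) has_integral f e (len G e) * (K e - len G e) - f e 0 * (K e - 0)) {0..len G e}"
        by (rule H1_deriv_by_parts[OF fD(1)[OF e]]) (use fG(3)[OF e] in \<open>auto intro!: derivative_eq_intros\<close>)
      moreover have "((f e) has_integral integral {0..len G e} (f e)) {0..len G e}"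
        by (intro integrable_integral integrable_continuous_real fD(5) e)
      ultimately have "((\<lambda>x. f e x * (-1) + f' e x * (K e - x) + f e x) has_integral (f e (len G e) * (K e - len G e) - f e 0 * (K e - 0)) + integral {0..len G e} (f e)) {0..len G e}"
        by (rule has_integral_add)
      then show ?thesis using fD(2,3)[OF e] by (simp add: has_integral_iff algebra_simps)
    qed
    then show "\<And>e. e \<in> medges G \<Longrightarrow> (\<lambda>x. f' e x * (K e - x)) integrable_on {0..len G e}" by blast
    have "(\<Sum>e\<in>medges G. integral {0..len G e} (\<lambda>x. f' e x * (K e - x))) =
        (\<Sum>e\<in>medges G. integral {0..len G e} (f e) + (u (mhead G e) * (K e - len G e) - u (mtail G e) * K e))"
      using ci by (intro sum.cong) auto
    then show "(\<Sum>e\<in>medges G. integral {0..len G e} (\<lambda>x. f' e x * (K e - x))) = gint G f"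
      using kirch[OF fD(4)] by (simp add: sum.distrib gint_def)
  qed
  define v' where "v' e x = K e - x" for e x
  have vH1: "H10_deriv G v v' uv"
    using torsion_edge_H2(1)[OF fG(3) K] v0 unfolding H10_deriv_def v'_def by blast
  have E: "gint G (\<lambda>e x. (v' e x)\<^sup>2) = gint G v"
    using cross[OF vH1] unfolding gint_def v'_def power2_eq_square by simp
  have gv: "graph_integral G v = gint G v" by (rule graph_integral_continuous[OF vD(5)])
  show "\<exists>a b c. (a, b, c) \<in> forms G \<and> graph_integral G v = 2 * c - a"
    using vH1 E gv unfolding forms_def by (intro exI[of _ "gint G v"] exI[of _ "gint G (\<lambda>e x. (v e x)\<^sup>2)"]) force
  fix a b c assume "(a, b, c) \<in> forms G"
  then obtain f f' u where f: "H10_deriv G f f' u" "a = gint G (\<lambda>e x. (f' e x)\<^sup>2)" "c = gint G f"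
    unfolding forms_def by blast
  have "2 * (\<Sum>e\<in>medges G. integral {0..len G e} (\<lambda>x. f' e x * (K e - x))) \<le> (\<Sum>e\<in>medges G. integral {0..len G e} (\<lambda>x. (f' e x)\<^sup>2) + integral {0..len G e} (\<lambda>x. (v' e x)\<^sup>2))"
    unfolding sum_distrib_left
  proof (rule sum_mono)
    fix e assume e: "e \<in> medges G"
    have i1: "(\<lambda>x. (f' e x)\<^sup>2) integrable_on {0..len G e}" by (rule H1_derivD(2)[OF H10_derivD(1)[OF f(1) e]])
    have i2: "(\<lambda>x. (v' e x)\<^sup>2) integrable_on {0..len G e}" by (rule H1_derivD(2)[OF H10_derivD(1)[OF vH1 e]])
    have "2 * integral {0..len G e} (\<lambda>x. f' e x * (K e - x)) = integral {0..len G e} (\<lambda>x. 2 * (f' e x * (K e - x)))"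
      by simp
    also have "\<dots> \<le> integral {0..len G e} (\<lambda>x. (f' e x)\<^sup>2 + (v' e x)\<^sup>2)"
    proof (rule integral_le)
      show "(\<lambda>x. 2 * (f' e x * (K e - x))) integrable_on {0..len G e}" using cint[OF f(1) e] by (rule integrable_on_mult_right)
      show "2 * (f' e x * (K e - x)) \<le> (f' e x)\<^sup>2 + (v' e x)\<^sup>2" for x
        using zero_le_power2[of "f' e x - v' e x"] by (simp add: v'_def power2_diff)
    qed (intro integrable_add i1 i2)
    also have "\<dots> = integral {0..len G e} (\<lambda>x. (f' e x)\<^sup>2) + integral {0..len G e} (\<lambda>x. (v' e x)\<^sup>2)"
      by (rule Henstock_Kurzweil_Integration.integral_add[OF i1 i2])
    finally show "2 * integral {0..len G e} (\<lambda>x. f' e x * (K e - x)) \<le> integral {0..len G e} (\<lambda>x. (f' e x)\<^sup>2) + integral {0..len G e} (\<lambda>x. (v' e x)\<^sup>2)" .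
  qed
  then show "2 * c - a \<le> graph_integral G v"
    using cross[OF f(1)] E f gv by (simp add: sum.distrib gint_def)
qed

text \<open>On an edge the torsion function is the parabola determined by its two end values, so
  only the vertex values \<open>u\<close> are unknown. They minimise \<open>B u u - 2 * L u\<close>,
  where \<open>B\<close> is the energy and \<open>L\<close> the integral of the function
  interpolating \<open>u\<close> linearly. The stationarity equations of this problem are the vertex
  conditions.\<close>

lemma torsion_function_exists:
  assumes G: "finite_metric_graph G" and c: "cut_ge 1 G"
  shows "\<exists>v. is_torsion_function G v"
proof -
  note fG = finite_metric_graphD[OF G]
  define B where "B u x = (\<Sum>e\<in>medges G. (u (mhead G e) - u (mtail G e)) * (x (mhead G e) - x (mtail G e)) / len G e)" for u x :: "'a \<Rightarrow> real"
  define L where "L u = (\<Sum>e\<in>medges G. len G e / 2 * (u (mhead G e) + u (mtail G e)))" for u :: "'a \<Rightarrow> real"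
  have BQ: "B u u = (\<Sum>e\<in>medges G. (u (mhead G e) - u (mtail G e))\<^sup>2 / len G e)" for u by (simp add: B_def power2_eq_square)
  have cB: "continuous_on UNIV (\<lambda>u. B u u)" unfolding BQ
    by (intro continuous_intros continuous_on_product_coordinates) (use fG(3) in force)
  have cL: "continuous_on UNIV L" unfolding L_def
    by (intro continuous_intros continuous_on_product_coordinates)
  obtain m where m: "m > 0" "\<And>u. u \<in> vertex_space G \<Longrightarrow> m * sqnorm G u \<le> B u u"
  proof (rule quadratic_coercive[OF G cB])
    show "B (\<lambda>v. a * u v) (\<lambda>v. a * u v) = a\<^sup>2 * B u u" for a u
      unfolding BQ sum_distrib_left by (intro sum.cong refl) (simp add: power2_eq_square algebra_simps)
    show "0 < B u u" if "u \<in> vertex_space G" "u v \<noteq> 0" for u v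
      unfolding BQ using dirichlet_energy_pos[OF G c that fG(3)] .
  qed (rule that)
  define n where "n = real (card (medges G))"
  \<comment> \<open>Small enough that the linear term, estimated on each edge by
    \<open>4 * t * sqnorm G u\<close> plus a constant, uses up at most half of the coercivity of
    \<open>B\<close>.\<close>
  define t where "t = m / (8 * (n + 1))"
  have n: "0 \<le> n" by (simp add: n_def)
  have t: "t > 0" using m n by (simp add: t_def)
  define C where "C = (\<Sum>e\<in>medges G. (len G e)\<^sup>2 / (2 * t))"
  have Lb: "2 * L u \<le> m / 2 * sqnorm G u + C" for u
  proof -
    have sq: "(u v)\<^sup>2 \<le> sqnorm G u" if "v \<in> mverts G" for v unfolding sqnorm_def
      by (intro member_le_sum) (use fG that in auto)
    have "2 * L u = (\<Sum>e\<in>medges G. len G e * u (mhead G e) + len G e * u (mtail G e))"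
      unfolding L_def sum_distrib_left by (intro sum.cong) (auto simp: algebra_simps)
    also have "\<dots> \<le> (\<Sum>e\<in>medges G. 4 * t * sqnorm G u + (len G e)\<^sup>2 / (2 * t))"
    proof (rule sum_mono)
      fix e assume e: "e \<in> medges G"
      have am: "a * y \<le> t * y\<^sup>2 + a\<^sup>2 / (4 * t)" for a y :: real
      proof -
        have "0 \<le> t * (y - a / (2 * t))\<^sup>2" using t by simp
        moreover have "t * (y - a / (2 * t))\<^sup>2 = t * y\<^sup>2 - a * y + a\<^sup>2 / (4 * t)"
          using t by (simp add: power2_eq_square field_simps)
        ultimately show ?thesis by linarith
      qed
      have "len G e * u (mhead G e) \<le> t * sqnorm G u + (len G e)\<^sup>2 / (4 * t)"
        using am[of "len G e" "u (mhead G e)"] mult_left_mono[OF sq[OF fG(5)[OF e]], of t] t by linarith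
      moreover have "len G e * u (mtail G e) \<le> t * sqnorm G u + (len G e)\<^sup>2 / (4 * t)"
        using am[of "len G e" "u (mtail G e)"] mult_left_mono[OF sq[OF fG(4)[OF e]], of t] t by linarith
      moreover have "0 \<le> sqnorm G u" by (simp add: sqnorm_def sum_nonneg)
      moreover have "0 \<le> t * sqnorm G u" using t \<open>0 \<le> sqnorm G u\<close> by simp
      moreover have "(len G e)\<^sup>2 / (4 * t) + (len G e)\<^sup>2 / (4 * t) = (len G e)\<^sup>2 / (2 * t)" by (simp add: field_simps)
      ultimately show "len G e * u (mhead G e) + len G e * u (mtail G e) \<le> 4 * t * sqnorm G u + (len G e)\<^sup>2 / (2 * t)"
        by linarith
    qed
    also have "\<dots> = n * 4 * t * sqnorm G u + C" by (simp add: sum.distrib n_def C_def)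
    also have "n * 4 * t * sqnorm G u \<le> m / 2 * sqnorm G u"
    proof (rule mult_right_mono)
      show "n * 4 * t \<le> m / 2" using m n by (simp add: t_def field_simps)
      show "0 \<le> sqnorm G u" by (simp add: sqnorm_def sum_nonneg)
    qed
    finally show ?thesis by simp
  qed
  define P where "P u = B u u - 2 * L u" for u
  have cP: "continuous_on S P" for S unfolding P_def
    by (intro continuous_intros continuous_on_subset[OF cB] continuous_on_subset[OF cL]) auto
  \<comment> \<open>Outside this ball \<open>P\<close> is positive, whereas \<open>P\<close> is zero
    at the origin; a minimiser over the ball is therefore a global one.\<close>
  define K where "K = {u \<in> vertex_space G. sqnorm G u \<le> 2 * C / m}"
  have C: "0 \<le> C" unfolding C_def using t by (intro sum_nonneg) auto
  have z: "(\<lambda>v. 0) \<in> K" using C m by (auto simp: K_def vertex_space_def sqnorm_def)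
  obtain u where u: "u \<in> K" "\<And>x. x \<in> K \<Longrightarrow> P u \<le> P x"
    using continuous_attains_inf[OF compact_vertex_ball[OF G] _ cP, of "2 * C / m"] z unfolding K_def by blast
  have uX: "u \<in> vertex_space G" using u by (simp add: K_def)
  have P0: "P (\<lambda>v. 0) = 0" by (simp add: P_def B_def L_def)
  have min: "P u \<le> P x" if x: "x \<in> vertex_space G" for x
  proof (cases "x \<in> K")
    case False
    then have "sqnorm G x > 2 * C / m" using x by (auto simp: K_def)
    then have "m / 2 * sqnorm G x > C" using m by (simp add: field_simps)
    moreover have "P x \<ge> m * sqnorm G x - (m / 2 * sqnorm G x + C)" unfolding P_def using m(2)[OF x] Lb[of x] by linarith
    ultimately have "P x > 0" by simp
    then show ?thesis using u(2)[OF z] P0 by simp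
  qed (rule u)
  have EL: "B u x = L x" if x: "x \<in> vertex_space G" for x
  proof -
    have ex: "P (\<lambda>v. u v + r * x v) = P u + 2 * r * (B u x - L x) + r\<^sup>2 * B x x" for r
    proof -
      have "B (\<lambda>v. u v + r * x v) (\<lambda>v. u v + r * x v) = B u u + 2 * r * B u x + r\<^sup>2 * B x x"
        unfolding B_def sum_distrib_left sum.distrib[symmetric]
        by (intro sum.cong refl) (simp add: power2_eq_square add_divide_distrib[symmetric] algebra_simps)
      moreover have "L (\<lambda>v. u v + r * x v) = L u + r * L x"
        unfolding L_def sum_distrib_left sum.distrib[symmetric] by (intro sum.cong refl) (simp add: algebra_simps)
      ultimately show ?thesis by (simp add: P_def algebra_simps)
    qed
    define d where "d = B u x - L x"
    have q: "0 \<le> 2 * r * d + r\<^sup>2 * B x x" for r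
      using min[of "\<lambda>v. u v + r * x v"] ex[of r] uX x by (simp add: vertex_space_def d_def)
    have bx: "0 \<le> B x x" unfolding BQ using fG(3) by (intro sum_nonneg divide_nonneg_pos) auto
    \<comment> \<open>Close to the minimiser in \<open>r\<close>; the added one keeps the
      denominator positive.\<close>
    have "0 \<le> 2 * (- d / (B x x + 1)) * d + (- d / (B x x + 1))\<^sup>2 * B x x" by (rule q)
    also have "\<dots> = - (d\<^sup>2) * (B x x + 2) / (B x x + 1)\<^sup>2"
      using bx by (simp add: power2_eq_square divide_simps) (simp add: algebra_simps)
    finally have "d\<^sup>2 * (B x x + 2) / (B x x + 1)\<^sup>2 \<le> 0" by simp
    moreover have "0 < (B x x + 2) / (B x x + 1)\<^sup>2" using bx by (intro divide_pos_pos) auto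
    ultimately have "d\<^sup>2 \<le> 0" by (metis less_eq_real_def mult_pos_pos not_less times_divide_eq_right zero_le_power2)
    then show ?thesis by (simp add: d_def)
  qed
  \<comment> \<open>The slope at the tail of the parabola with second derivative \<open>-1\<close>
    that joins the two vertex values.\<close>
  define k where "k e = (u (mhead G e) - u (mtail G e)) / len G e + len G e / 2" for e
  define v where "v e x = u (mtail G e) + k e * x - x\<^sup>2 / 2" for e x
  have vq: "\<And>x. x \<in> {0..len G e} \<Longrightarrow> v e x = u (mtail G e) + k e * x - x\<^sup>2 / 2" for e by (simp add: v_def)
  have "H10_deriv G v (\<lambda>e x. k e - x) u"
    unfolding H10_deriv_def vertex_values_def
  proof (intro conjI ballI)
    fix e assume e: "e \<in> medges G"
    show "H1_deriv (len G e) (v e) (\<lambda>x. k e - x)" by (rule torsion_edge_H2(1)[OF fG(3)[OF e] vq])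
    show "v e 0 = u (mtail G e)" by (simp add: v_def)
    show "v e (len G e) = u (mhead G e)" using fG(3)[OF e] by (simp add: v_def k_def power2_eq_square field_simps)
  qed (use uX in \<open>auto simp: vertex_space_def\<close>)
  then have vH: "v \<in> H10 G" using H10_iff[OF G] by blast
  have vd: "((v e) has_vector_derivative (k e - x)) (at x within S)" for e x S
    unfolding has_real_derivative_iff_has_vector_derivative[symmetric] v_def by (auto intro!: derivative_eq_intros)
  have vd0: "vector_derivative (v e) (at 0 within {0..len G e}) = k e"
     "vector_derivative (v e) (at (len G e) within {0..len G e}) = k e - len G e" if e: "e \<in> medges G" for e
    using vector_derivative_within_closed_interval[OF fG(3)[OF e] _ vd, of 0]
      vector_derivative_within_closed_interval[OF fG(3)[OF e] _ vd, of "len G e"] fG(3)[OF e] by auto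
  have "normal_deriv_sum G v w = 0" if w: "w \<in> mverts G - dirichlet G" for w
  proof -
    \<comment> \<open>Tested with the indicator of \<open>w\<close>, the stationarity equation is
      the vertex condition at \<open>w\<close>.\<close>
    define x where "x y = (if y = w then 1 else 0 :: real)" for y
    have x: "x \<in> vertex_space G" using w by (auto simp: x_def vertex_space_def)
    have "normal_deriv_sum G v w = (\<Sum>e\<in>{e\<in>medges G. mtail G e = w}. k e) + (\<Sum>e\<in>{e\<in>medges G. mhead G e = w}. - (k e - len G e))"
      unfolding normal_deriv_sum_def by (simp add: vd0)
    also have "\<dots> = (\<Sum>e\<in>medges G. x (mtail G e) * k e) + (\<Sum>e\<in>medges G. x (mhead G e) * (- (k e - len G e)))"
      by (intro arg_cong2[where f="(+)"] sum.mono_neutral_cong_left) (use fG in \<open>auto simp: x_def\<close>)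
    also have "\<dots> = L x - B u x"
      unfolding L_def B_def sum_subtractf[symmetric] sum.distrib[symmetric]
    proof (intro sum.cong refl)
      fix e assume e: "e \<in> medges G"
      then show "x (mtail G e) * k e + x (mhead G e) * - (k e - len G e) = len G e / 2 * (x (mhead G e) + x (mtail G e)) - (u (mhead G e) - u (mtail G e)) * (x (mhead G e) - x (mtail G e)) / len G e"
        using fG(3)[OF e] by (simp add: k_def field_simps)
    qed
    finally show ?thesis using EL[OF x] by simp
  qed
  then have "is_torsion_function G v"
    unfolding is_torsion_function_def using vH torsion_edge_H2(2,3)[OF fG(3) vq] by blast
  then show ?thesis by blast
qed

lemma torsional_rigidity_max:
  assumes G: "finite_metric_graph G" and c: "cut_ge 1 G"
  shows "\<And>a b c. (a, b, c) \<in> forms G \<Longrightarrow> 2 * c - a \<le> torsional_rigidity G"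
    "\<exists>a b c. (a, b, c) \<in> forms G \<and> torsional_rigidity G = 2 * c - a"
proof -
  have v: "is_torsion_function G (torsion_function G)"
    unfolding torsion_function_def using torsion_function_exists[OF assms] by (rule someI_ex)
  show "\<And>a b c. (a, b, c) \<in> forms G \<Longrightarrow> 2 * c - a \<le> torsional_rigidity G"
    "\<exists>a b c. (a, b, c) \<in> forms G \<and> torsional_rigidity G = 2 * c - a"
    unfolding torsional_rigidity_def using torsion_variational[OF G v] by blast+
qed

lemma torsional_rigidity_forms_eq:
  assumes "finite_metric_graph G" "cut_ge 1 G" "finite_metric_graph H" "cut_ge 1 H" "forms G = forms H"
  shows "torsional_rigidity G = torsional_rigidity H"
  using torsional_rigidity_max[OF assms(1,2)] torsional_rigidity_max[OF assms(3,4)] assms(5)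
  by (metis order_antisym)

lemma ground_state_energy_forms_eq:
  assumes "finite_metric_graph G" "finite_metric_graph H" "forms G = forms H"
  shows "ground_state_energy G = ground_state_energy H"
  using ground_state_forms[OF assms(1)] ground_state_forms[OF assms(2)] assms(3) by simp

section \<open>Solutions of the eigenvalue equation on short edges\<close>

text \<open>The solution of \<open>y'' = - \<kappa> * y\<close> with \<open>y 0 = 0\<close> and
  \<open>y' 0 = 1\<close>. Including \<open>\<kappa> = 0\<close> lets the positivity of the lowest
  eigenvalue and the existence of a ground state come from the same lemma.\<close>

definition scaled_sin :: "real \<Rightarrow> real \<Rightarrow> real" where
  "scaled_sin \<kappa> x = (if \<kappa> = 0 then x else sin (sqrt \<kappa> * x) / sqrt \<kappa>)"

definition scaled_cos :: "real \<Rightarrow> real \<Rightarrow> real" where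
  "scaled_cos \<kappa> x = cos (sqrt \<kappa> * x)"

lemma scaled_sin_deriv:
  assumes "0 \<le> \<kappa>" shows "(scaled_sin \<kappa> has_real_derivative scaled_cos \<kappa> x) (at x)"
proof (cases "\<kappa> = 0")
  case True then show ?thesis by (simp add: scaled_sin_def[abs_def] scaled_cos_def)
next
  case False
  have "((\<lambda>x. sin (sqrt \<kappa> * x) / sqrt \<kappa>) has_real_derivative scaled_cos \<kappa> x) (at x)"
    using False assms by (auto intro!: derivative_eq_intros simp: scaled_cos_def mult.assoc)
  then show ?thesis using False by (simp add: scaled_sin_def[abs_def])
qed

lemma scaled_cos_deriv:
  assumes "0 \<le> \<kappa>" shows "(scaled_cos \<kappa> has_real_derivative - \<kappa> * scaled_sin \<kappa> x) (at x)"
proof -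
  have "((\<lambda>x. cos (sqrt \<kappa> * x)) has_real_derivative - sin (sqrt \<kappa> * x) * sqrt \<kappa>) (at x)"
    by (auto intro!: derivative_eq_intros)
  moreover have "- sin (sqrt \<kappa> * x) * sqrt \<kappa> = - \<kappa> * scaled_sin \<kappa> x"
    using assms by (simp add: scaled_sin_def field_simps flip: power2_eq_square)
  ultimately show ?thesis by (simp add: scaled_cos_def[abs_def])
qed

text \<open>The condition \<open>\<kappa> * d\<^sup>2 \<le> 1\<close> expresses that edges are
  short: the arguments of sine and cosine stay between \<open>0\<close> and \<open>1\<close>, hence
  below \<open>pi / 2\<close>, where sine is increasing and cosine nonnegative.\<close>

lemma sqrt_mult_le_1:
  assumes "0 \<le> \<kappa>" "\<kappa> * d\<^sup>2 \<le> 1" "0 \<le> x" "x \<le> d" shows "sqrt \<kappa> * x \<le> 1"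
proof -
  have "sqrt \<kappa> * x \<le> sqrt \<kappa> * d" by (intro mult_left_mono) (use assms in auto)
  also have "\<dots> = sqrt (\<kappa> * d\<^sup>2)" using assms by (simp add: real_sqrt_mult)
  also have "\<dots> \<le> 1" using assms by simp
  finally show ?thesis .
qed

lemma scaled_sin_pos:
  assumes "0 \<le> \<kappa>" "\<kappa> * d\<^sup>2 \<le> 1" "0 < x" "x \<le> d" shows "0 < scaled_sin \<kappa> x"
  using sqrt_mult_le_1[OF assms(1,2) less_imp_le[OF assms(3)] assms(4)] assms pi_gt3
  by (auto simp: scaled_sin_def intro!: divide_pos_pos sin_gt_zero mult_pos_pos)

lemma scaled_sin_nonneg:
  assumes "0 \<le> \<kappa>" "\<kappa> * d\<^sup>2 \<le> 1" "0 \<le> x" "x \<le> d" shows "0 \<le> scaled_sin \<kappa> x"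
  using scaled_sin_pos[OF assms(1,2), of x] assms by (cases "x = 0") (auto simp: scaled_sin_def)

lemma scaled_sin_mono:
  assumes "0 \<le> \<kappa>" "\<kappa> * d\<^sup>2 \<le> 1" "0 \<le> x" "x \<le> y" "y \<le> d" shows "scaled_sin \<kappa> x \<le> scaled_sin \<kappa> y"
proof (rule DERIV_nonneg_imp_nondecreasing[OF assms(4)])
  fix z assume z: "x \<le> z" "z \<le> y"
  have "sqrt \<kappa> * z \<le> 1" by (rule sqrt_mult_le_1[OF assms(1,2)]) (use z assms in auto)
  moreover have "0 \<le> sqrt \<kappa> * z" using z assms by auto
  ultimately have "0 \<le> scaled_cos \<kappa> z" unfolding scaled_cos_def using pi_gt3 by (intro cos_ge_zero) auto
  then show "\<exists>y. (scaled_sin \<kappa> has_real_derivative y) (at z) \<and> 0 \<le> y" using scaled_sin_deriv[OF assms(1)] by blast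
qed

section \<open>Reduction of the eigenvalue problem to the vertices\<close>

text \<open>The solution of \<open>- f'' = \<kappa> f\<close> on an edge with prescribed values at the ends.\<close>
definition edge_solution :: "real \<Rightarrow> real \<Rightarrow> real \<Rightarrow> real \<Rightarrow> real \<Rightarrow> real" where
  "edge_solution \<kappa> l a b x = (a * scaled_sin \<kappa> (l - x) + b * scaled_sin \<kappa> x) / scaled_sin \<kappa> l"

definition edge_solution' :: "real \<Rightarrow> real \<Rightarrow> real \<Rightarrow> real \<Rightarrow> real \<Rightarrow> real" where
  "edge_solution' \<kappa> l a b x = (b * scaled_cos \<kappa> x - a * scaled_cos \<kappa> (l - x)) / scaled_sin \<kappa> l"

text \<open>The energy of the edge solution minus \<open>\<kappa>\<close> times its squared norm, as
  a quadratic form in the two end values; see \<open>edge_solution_energy\<close>.\<close>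

definition edge_energy :: "real \<Rightarrow> real \<Rightarrow> real \<Rightarrow> real \<Rightarrow> real" where
  "edge_energy \<kappa> l a b = ((a\<^sup>2 + b\<^sup>2) * scaled_cos \<kappa> l - 2 * a * b) / scaled_sin \<kappa> l"

lemma edge_solution_deriv:
  assumes "0 \<le> \<kappa>"
  shows "(edge_solution \<kappa> l a b has_real_derivative edge_solution' \<kappa> l a b x) (at x)"
    "(edge_solution' \<kappa> l a b has_real_derivative - \<kappa> * edge_solution \<kappa> l a b x) (at x)"
proof -
  have m: "((\<lambda>x. l - x) has_real_derivative - 1) (at x)" by (auto intro!: derivative_eq_intros)
  have 1: "((\<lambda>x. scaled_sin \<kappa> (l - x)) has_real_derivative - scaled_cos \<kappa> (l - x)) (at x)"
    using DERIV_chain2[OF scaled_sin_deriv[OF assms] m] by simp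
  have 2: "((\<lambda>x. scaled_cos \<kappa> (l - x)) has_real_derivative \<kappa> * scaled_sin \<kappa> (l - x)) (at x)"
    using DERIV_chain2[OF scaled_cos_deriv[OF assms] m] by simp
  have "((\<lambda>x. (a * scaled_sin \<kappa> (l - x) + b * scaled_sin \<kappa> x) / scaled_sin \<kappa> l) has_real_derivative (a * (- scaled_cos \<kappa> (l - x)) + b * scaled_cos \<kappa> x) / scaled_sin \<kappa> l) (at x)"
    by (intro DERIV_cdivide DERIV_add DERIV_cmult 1 scaled_sin_deriv assms)
  then show "(edge_solution \<kappa> l a b has_real_derivative edge_solution' \<kappa> l a b x) (at x)"
    by (simp add: edge_solution_def[abs_def] edge_solution'_def)
  have "((\<lambda>x. (b * scaled_cos \<kappa> x - a * scaled_cos \<kappa> (l - x)) / scaled_sin \<kappa> l) has_real_derivative (b * (- \<kappa> * scaled_sin \<kappa> x) - a * (\<kappa> * scaled_sin \<kappa> (l - x))) / scaled_sin \<kappa> l) (at x)"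
    by (intro DERIV_cdivide DERIV_diff DERIV_cmult 2 scaled_cos_deriv assms)
  moreover have "(b * (- \<kappa> * scaled_sin \<kappa> x) - a * (\<kappa> * scaled_sin \<kappa> (l - x))) / scaled_sin \<kappa> l = - \<kappa> * edge_solution \<kappa> l a b x"
    by (simp add: edge_solution_def algebra_simps diff_divide_distrib add_divide_distrib)
  ultimately show "(edge_solution' \<kappa> l a b has_real_derivative - \<kappa> * edge_solution \<kappa> l a b x) (at x)"
    by (simp add: edge_solution'_def[abs_def])
qed

lemma continuous_on_edge_solution:
  assumes "0 \<le> \<kappa>" shows "continuous_on S (edge_solution \<kappa> l a b)" "continuous_on S (edge_solution' \<kappa> l a b)"
  using edge_solution_deriv[OF assms] by (meson DERIV_isCont continuous_at_imp_continuous_on)+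

lemma H1_deriv_edge_solution:
  assumes "0 \<le> \<kappa>" "0 \<le> l" shows "H1_deriv l (edge_solution \<kappa> l a b) (edge_solution' \<kappa> l a b)"
  using assms by (intro H1_deriv_C1 edge_solution_deriv(1) continuous_on_edge_solution)

lemma edge_solution_ends:
  assumes "scaled_sin \<kappa> l \<noteq> 0"
  shows "edge_solution \<kappa> l a b 0 = a" "edge_solution \<kappa> l a b l = b"
    "b * edge_solution' \<kappa> l a b l - a * edge_solution' \<kappa> l a b 0 = edge_energy \<kappa> l a b"
proof -
  have "scaled_sin \<kappa> 0 = 0" "scaled_cos \<kappa> 0 = 1" by (auto simp: scaled_sin_def scaled_cos_def)
  then show "edge_solution \<kappa> l a b 0 = a" "edge_solution \<kappa> l a b l = b"
    "b * edge_solution' \<kappa> l a b l - a * edge_solution' \<kappa> l a b 0 = edge_energy \<kappa> l a b"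
    using assms by (auto simp: edge_solution_def edge_solution'_def edge_energy_def field_simps power2_eq_square)
qed

text \<open>A crude constant suffices here. It comes from the Cauchy-Schwarz bound for
  \<open>h x\<close> as an integral of \<open>g\<close>, obtained by expanding the square of
  \<open>g - h x / x\<close>.\<close>

lemma H1_deriv_wirtinger:
  assumes H: "H1_deriv l h g" and l: "0 \<le> l" and h: "h 0 = 0"
  shows "integral {0..l} (\<lambda>x. (h x)\<^sup>2) \<le> l\<^sup>2 * integral {0..l} (\<lambda>x. (g x)\<^sup>2)"
proof -
  let ?E = "integral {0..l} (\<lambda>x. (g x)\<^sup>2)"
  note D = H1_derivD[OF H]
  have E0: "0 \<le> ?E" by (rule Henstock_Kurzweil_Integration.integral_nonneg[OF D(2)]) auto
  have bd: "(h x)\<^sup>2 \<le> l * ?E" if x: "x \<in> {0..l}" for x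
  proof (cases "x = 0")
    case True then show ?thesis using h E0 l by simp
  next
    case False
    then have x0: "0 < x" using x by auto
    define c where "c = h x / x"
    have gi: "(g has_integral h x) {0..x}" using D(3)[of x] x h by auto
    have g2: "(\<lambda>x. (g x)\<^sup>2) integrable_on {0..x}"
      by (rule integrable_subinterval_real[OF D(2)]) (use x in auto)
    have "((\<lambda>y. (g y)\<^sup>2 - 2 * c * g y + c\<^sup>2) has_integral integral {0..x} (\<lambda>x. (g x)\<^sup>2) - 2 * c * h x + c\<^sup>2 * x) {0..x}"
      using has_integral_const_real[of "c\<^sup>2" 0 x] x0
      by (intro has_integral_add has_integral_diff has_integral_mult_right gi integrable_integral[OF g2]) (auto simp: mult.commute)
    moreover have "0 \<le> (g y)\<^sup>2 - 2 * c * g y + c\<^sup>2" for y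
      using zero_le_power2[of "g y - c"] by (simp add: power2_diff mult.commute mult.left_commute)
    ultimately have "0 \<le> integral {0..x} (\<lambda>x. (g x)\<^sup>2) - 2 * c * h x + c\<^sup>2 * x"
      by (rule has_integral_nonneg)
    also have "\<dots> = integral {0..x} (\<lambda>x. (g x)\<^sup>2) - (h x)\<^sup>2 / x"
      using x0 by (simp add: c_def power2_eq_square field_simps)
    finally have "(h x)\<^sup>2 \<le> x * integral {0..x} (\<lambda>x. (g x)\<^sup>2)" using x0 by (simp add: field_simps)
    also have "\<dots> \<le> l * ?E"
      by (intro mult_mono integral_subset_le g2 D(2) l) (use x in \<open>auto intro!: Henstock_Kurzweil_Integration.integral_nonneg g2\<close>)
    finally show ?thesis .
  qed
  have "integral {0..l} (\<lambda>x. (h x)\<^sup>2) \<le> integral {0..l} (\<lambda>x. l * ?E)"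
    by (rule integral_le) (use bd H1_deriv_continuous[OF H] in \<open>auto intro!: integrable_continuous_real continuous_intros\<close>)
  also have "\<dots> = l\<^sup>2 * ?E" using l by (simp add: power2_eq_square)
  finally show ?thesis .
qed

lemma edge_solution_energy:
  assumes k: "0 \<le> \<kappa>" and l: "0 \<le> l" and s: "scaled_sin \<kappa> l \<noteq> 0"
  shows "integral {0..l} (\<lambda>x. (edge_solution' \<kappa> l a b x)\<^sup>2) - \<kappa> * integral {0..l} (\<lambda>x. (edge_solution \<kappa> l a b x)\<^sup>2) = edge_energy \<kappa> l a b"
proof -
  let ?w = "edge_solution \<kappa> l a b" and ?w' = "edge_solution' \<kappa> l a b"
  have "((\<lambda>x. ?w x * (- \<kappa> * ?w x) + ?w' x * ?w' x) has_integral ?w l * ?w' l - ?w 0 * ?w' 0) {0..l}"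
    by (rule H1_deriv_by_parts[OF H1_deriv_edge_solution[OF k l] edge_solution_deriv(2)[OF k]]) (auto intro!: continuous_intros continuous_on_edge_solution k l)
  then have "integral {0..l} (\<lambda>x. (?w' x)\<^sup>2 - \<kappa> * (?w x)\<^sup>2) = edge_energy \<kappa> l a b"
    using edge_solution_ends[OF s] by (simp add: has_integral_iff power2_eq_square algebra_simps)
  moreover have "integral {0..l} (\<lambda>x. (?w' x)\<^sup>2 - \<kappa> * (?w x)\<^sup>2) = integral {0..l} (\<lambda>x. (?w' x)\<^sup>2) - \<kappa> * integral {0..l} (\<lambda>x. (?w x)\<^sup>2)"
    by (subst Henstock_Kurzweil_Integration.integral_diff) (auto intro!: integrable_continuous_real continuous_intros continuous_on_edge_solution k)
  ultimately show ?thesis by simp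
qed

text \<open>Split \<open>f\<close> into the edge solution with the same end values and a rest
  \<open>h\<close> vanishing at both ends. The two are orthogonal for the form
  \<open>E - \<kappa> * F\<close>. The first contributes \<open>edge_energy\<close>, and on the
  second the form is at least \<open>2 * c\<close> times the squared norm because the edge is short.
  The term with \<open>4 * c * d\<close> pays for the norm of the edge solution.\<close>

lemma edge_energy_lower_bound:
  assumes H: "H1_deriv l f g" and k: "0 \<le> \<kappa>" and l: "0 < l" "l \<le> d" and c: "0 \<le> c" "(\<kappa> + 2 * c) * d\<^sup>2 \<le> 1"
  shows "c * integral {0..l} (\<lambda>x. (f x)\<^sup>2) + edge_energy \<kappa> l (f 0) (f l) - 4 * c * d * ((f 0)\<^sup>2 + (f l)\<^sup>2)
     \<le> integral {0..l} (\<lambda>x. (g x)\<^sup>2) - \<kappa> * integral {0..l} (\<lambda>x. (f x)\<^sup>2)"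
proof -
  define a b where "a = f 0" "b = f l"
  have kd: "\<kappa> * d\<^sup>2 \<le> 1" using c(2) mult_nonneg_nonneg[OF c(1) zero_le_power2[of d]] by (simp add: algebra_simps)
  have sl: "0 < scaled_sin \<kappa> l" by (rule scaled_sin_pos[OF k kd l])
  then have sl': "scaled_sin \<kappa> l \<noteq> 0" by simp
  let ?w = "edge_solution \<kappa> l a b" and ?w' = "edge_solution' \<kappa> l a b"
  have Hw: "H1_deriv l ?w ?w'" using k l by (intro H1_deriv_edge_solution) auto
  define h where "h x = f x - ?w x" for x
  define h' where "h' x = g x - ?w' x" for x
  have Hh: "H1_deriv l h h'" unfolding h_def[abs_def] h'_def[abs_def]
    using H1_deriv_lin[OF H Hw, of 1 "-1"] by simp
  have h0: "h 0 = 0" "h l = 0" using edge_solution_ends[OF sl'] by (auto simp: h_def a_b_def)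
  have cf: "continuous_on {0..l} f" by (rule H1_deriv_continuous[OF H])
  have i: "(\<lambda>x. (f x)\<^sup>2) integrable_on {0..l}" "(\<lambda>x. (?w x)\<^sup>2) integrable_on {0..l}" "(\<lambda>x. f x * ?w x) integrable_on {0..l}"
      "(\<lambda>x. (h x)\<^sup>2) integrable_on {0..l}"
    using H1_deriv_continuous[OF Hh] by (auto intro!: integrable_continuous_real continuous_intros cf continuous_on_edge_solution k)
  have i': "(\<lambda>x. (g x)\<^sup>2) integrable_on {0..l}" "(\<lambda>x. (?w' x)\<^sup>2) integrable_on {0..l}" "(\<lambda>x. g x * ?w' x) integrable_on {0..l}"
    by (rule H1_derivD(2)[OF H] H1_derivD(2)[OF Hw] cross_integrable[OF H Hw])+
  define F E Fw Ew Fh Eh X Y where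
    "F = integral {0..l} (\<lambda>x. (f x)\<^sup>2)" "E = integral {0..l} (\<lambda>x. (g x)\<^sup>2)"
    "Fw = integral {0..l} (\<lambda>x. (?w x)\<^sup>2)" "Ew = integral {0..l} (\<lambda>x. (?w' x)\<^sup>2)"
    "Fh = integral {0..l} (\<lambda>x. (h x)\<^sup>2)" "Eh = integral {0..l} (\<lambda>x. (h' x)\<^sup>2)"
    "X = integral {0..l} (\<lambda>x. f x * ?w x)" "Y = integral {0..l} (\<lambda>x. g x * ?w' x)"
  note defs = this
  have Fh: "Fh = F - 2 * X + Fw"
  proof -
    have "((\<lambda>x. (f x)\<^sup>2 - 2 * (f x * ?w x) + (?w x)\<^sup>2) has_integral F - 2 * X + Fw) {0..l}"
      unfolding defs by (intro has_integral_add has_integral_diff has_integral_mult_right integrable_integral i)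
    then have "((\<lambda>x. (h x)\<^sup>2) has_integral F - 2 * X + Fw) {0..l}"
      by (simp add: h_def power2_diff algebra_simps)
    then show ?thesis by (simp add: defs has_integral_iff)
  qed
  have Eh: "Eh = E - 2 * Y + Ew"
  proof -
    have "((\<lambda>x. (g x)\<^sup>2 - 2 * (g x * ?w' x) + (?w' x)\<^sup>2) has_integral E - 2 * Y + Ew) {0..l}"
      unfolding defs by (intro has_integral_add has_integral_diff has_integral_mult_right integrable_integral i')
    then have "((\<lambda>x. (h' x)\<^sup>2) has_integral E - 2 * Y + Ew) {0..l}"
      by (simp add: h'_def power2_diff algebra_simps)
    then show ?thesis by (simp add: defs has_integral_iff)
  qed
  have Ew: "Ew - \<kappa> * Fw = edge_energy \<kappa> l a b" unfolding defs using edge_solution_energy[OF k _ sl'] l by simp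
  \<comment> \<open>Orthogonality: the mixed term of \<open>f\<close> and the edge solution depends
    only on the end values, so it equals the value of the form at the edge solution itself.\<close>
  have XY: "Y - \<kappa> * X = edge_energy \<kappa> l a b"
  proof -
    have "((\<lambda>x. f x * (- \<kappa> * ?w x) + g x * ?w' x) has_integral f l * ?w' l - f 0 * ?w' 0) {0..l}"
      by (rule H1_deriv_by_parts[OF H edge_solution_deriv(2)[OF k]]) (use l in \<open>auto intro!: continuous_intros continuous_on_edge_solution k\<close>)
    moreover have "((\<lambda>x. - \<kappa> * (f x * ?w x) + g x * ?w' x) has_integral - \<kappa> * X + Y) {0..l}"
      unfolding defs by (intro has_integral_add has_integral_mult_right integrable_integral i i')
    ultimately have "f l * ?w' l - f 0 * ?w' 0 = - \<kappa> * X + Y"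
      by (intro has_integral_unique[of "\<lambda>x. f x * (- \<kappa> * ?w x) + g x * ?w' x" _ "{0..l}"]) (auto simp: algebra_simps)
    then show ?thesis using edge_solution_ends(3)[OF sl', of b a] by (simp add: a_b_def)
  qed
  have Fh_le: "Fh \<le> d\<^sup>2 * Eh"
  proof -
    have "Fh \<le> l\<^sup>2 * Eh" unfolding defs using H1_deriv_wirtinger[OF Hh _ h0(1)] l by simp
    also have "\<dots> \<le> d\<^sup>2 * Eh"
      by (rule mult_right_mono) (use l in \<open>auto simp: defs intro!: power_mono Henstock_Kurzweil_Integration.integral_nonneg H1_derivD(2)[OF Hh]\<close>)
    finally show ?thesis .
  qed
  have Fh0: "0 \<le> Fh" unfolding defs by (rule Henstock_Kurzweil_Integration.integral_nonneg[OF i(4)]) auto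
  have Eh0: "0 \<le> Eh" unfolding defs by (rule Henstock_Kurzweil_Integration.integral_nonneg[OF H1_derivD(2)[OF Hh]]) auto
  have Fw: "Fw \<le> 2 * d * (a\<^sup>2 + b\<^sup>2)"
  proof -
    have "(?w x)\<^sup>2 \<le> 2 * (a\<^sup>2 + b\<^sup>2)" if x: "x \<in> {0..l}" for x
    proof -
      have "0 \<le> scaled_sin \<kappa> (l - x)" "scaled_sin \<kappa> (l - x) \<le> scaled_sin \<kappa> l" "0 \<le> scaled_sin \<kappa> x" "scaled_sin \<kappa> x \<le> scaled_sin \<kappa> l"
        using x l by (auto intro!: scaled_sin_nonneg[OF k kd] scaled_sin_mono[OF k kd])
      then have s: "0 \<le> scaled_sin \<kappa> (l - x) / scaled_sin \<kappa> l" "scaled_sin \<kappa> (l - x) / scaled_sin \<kappa> l \<le> 1" "0 \<le> scaled_sin \<kappa> x / scaled_sin \<kappa> l" "scaled_sin \<kappa> x / scaled_sin \<kappa> l \<le> 1"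
        using sl by auto
      have "\<bar>?w x\<bar> \<le> \<bar>a\<bar> * (scaled_sin \<kappa> (l - x) / scaled_sin \<kappa> l) + \<bar>b\<bar> * (scaled_sin \<kappa> x / scaled_sin \<kappa> l)"
      proof -
        have "?w x = a * (scaled_sin \<kappa> (l - x) / scaled_sin \<kappa> l) + b * (scaled_sin \<kappa> x / scaled_sin \<kappa> l)" by (simp add: edge_solution_def add_divide_distrib)
        then have "\<bar>?w x\<bar> \<le> \<bar>a * (scaled_sin \<kappa> (l - x) / scaled_sin \<kappa> l)\<bar> + \<bar>b * (scaled_sin \<kappa> x / scaled_sin \<kappa> l)\<bar>" by (metis abs_triangle_ineq)
        then show ?thesis using s by (simp only: abs_mult abs_of_nonneg)
      qed
      also have "\<dots> \<le> \<bar>a\<bar> + \<bar>b\<bar>"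
        using mult_left_le[OF s(2), of "\<bar>a\<bar>"] mult_left_le[OF s(4), of "\<bar>b\<bar>"] by simp
      finally have "(?w x)\<^sup>2 \<le> (\<bar>a\<bar> + \<bar>b\<bar>)\<^sup>2" by (metis abs_ge_zero power2_abs power_mono)
      also have "\<dots> \<le> 2 * (a\<^sup>2 + b\<^sup>2)"
        using zero_le_power2[of "\<bar>a\<bar> - \<bar>b\<bar>"] by (simp add: power2_sum power2_diff)
      finally show ?thesis .
    qed
    then have "Fw \<le> integral {0..l} (\<lambda>x. 2 * (a\<^sup>2 + b\<^sup>2))" unfolding defs by (intro integral_le i) auto
    also have "\<dots> = l * (2 * (a\<^sup>2 + b\<^sup>2))" using l by simp
    also have "\<dots> \<le> d * (2 * (a\<^sup>2 + b\<^sup>2))" by (rule mult_right_mono) (use l in auto)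
    finally show ?thesis by (simp add: algebra_simps)
  qed
  have F: "F \<le> 2 * Fw + 2 * Fh"
  proof -
    have "F \<le> integral {0..l} (\<lambda>x. 2 * (?w x)\<^sup>2 + 2 * (h x)\<^sup>2)"
      unfolding defs
    proof (rule integral_le)
      show "(\<lambda>x. 2 * (?w x)\<^sup>2 + 2 * (h x)\<^sup>2) integrable_on {0..l}" by (intro integrable_add integrable_on_mult_right i)
      show "(f x)\<^sup>2 \<le> 2 * (?w x)\<^sup>2 + 2 * (h x)\<^sup>2" for x
        using zero_le_power2[of "?w x - h x"] unfolding h_def by (simp add: power2_eq_square algebra_simps)
    qed (rule i)
    also have "\<dots> = 2 * Fw + 2 * Fh"
      unfolding defs by (subst Henstock_Kurzweil_Integration.integral_add) (auto intro!: i integrable_on_mult_right)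
    finally show ?thesis .
  qed
  have cF: "c * F \<le> 4 * c * d * (a\<^sup>2 + b\<^sup>2) + 2 * c * Fh"
  proof -
    have "F \<le> 2 * (2 * d * (a\<^sup>2 + b\<^sup>2)) + 2 * Fh" using F Fw by linarith
    then have "c * F \<le> c * (2 * (2 * d * (a\<^sup>2 + b\<^sup>2)) + 2 * Fh)" by (rule mult_left_mono[OF _ c(1)])
    then show ?thesis by (simp add: algebra_simps)
  qed
  have "(\<kappa> + 2 * c) * Fh \<le> (\<kappa> + 2 * c) * (d\<^sup>2 * Eh)" by (rule mult_left_mono[OF Fh_le]) (use k c in auto)
  also have "\<dots> = ((\<kappa> + 2 * c) * d\<^sup>2) * Eh" by simp
  also have "\<dots> \<le> 1 * Eh" by (rule mult_right_mono[OF c(2) Eh0])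
  finally have 1: "2 * c * Fh \<le> Eh - \<kappa> * Fh" by (simp add: algebra_simps)
  have "Eh - \<kappa> * Fh = (E - \<kappa> * F) - 2 * (Y - \<kappa> * X) + (Ew - \<kappa> * Fw)"
    unfolding Eh Fh by (simp add: algebra_simps)
  then have 2: "E - \<kappa> * F = (Eh - \<kappa> * Fh) + edge_energy \<kappa> l a b" unfolding XY Ew by simp
  have "c * F + edge_energy \<kappa> l a b - 4 * c * d * (a\<^sup>2 + b\<^sup>2) \<le> 2 * c * Fh + edge_energy \<kappa> l a b" using cF by simp
  also have "\<dots> \<le> E - \<kappa> * F" unfolding 2 using 1 by simp
  finally have "c * F + edge_energy \<kappa> l a b - 4 * c * d * (a\<^sup>2 + b\<^sup>2) \<le> E - \<kappa> * F" .
  then show ?thesis by (simp only: defs a_b_def)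
qed

text \<open>For short edges this is the least value of energy minus \<open>\<kappa>\<close> times
  squared norm among all functions with vertex values \<open>u\<close>.\<close>

definition reduced_form :: "real \<Rightarrow> ('v, 'e) metric_graph \<Rightarrow> ('v \<Rightarrow> real) \<Rightarrow> real" where
  "reduced_form \<kappa> G u = (\<Sum>e\<in>medges G. edge_energy \<kappa> (len G e) (u (mtail G e)) (u (mhead G e)))"

text \<open>A positive definite reduced form is coercive, and the coercivity leaves room to raise
  \<open>\<kappa>\<close>. Contrapositively, at the infimum of the Rayleigh quotients the reduced
  form cannot be positive definite.\<close>

lemma spectral_gap:
  assumes G: "finite_metric_graph G" and d: "\<And>e. e \<in> medges G \<Longrightarrow> len G e \<le> d" "0 < d" and k: "0 \<le> \<kappa>" "\<kappa> * d\<^sup>2 < 1"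
    and pos: "\<And>u v. u \<in> vertex_space G \<Longrightarrow> u v \<noteq> 0 \<Longrightarrow> 0 < reduced_form \<kappa> G u"
  obtains c :: real where "0 < c" "\<And>E F I. (E, F, I) \<in> forms G \<Longrightarrow> (\<kappa> + c) * F \<le> E"
proof -
  note fG = finite_metric_graphD[OF G]
  have cQ: "continuous_on UNIV (reduced_form \<kappa> G)"
  proof -
    have "scaled_sin \<kappa> (len G e) \<noteq> 0" if "e \<in> medges G" for e
      using scaled_sin_pos[OF k(1) less_imp_le[OF k(2)] fG(3)[OF that] d(1)[OF that]] by simp
    then show ?thesis unfolding reduced_form_def[abs_def] edge_energy_def
      by (intro continuous_intros continuous_on_product_coordinates) auto
  qed
  obtain m where m: "m > 0" "\<And>u. u \<in> vertex_space G \<Longrightarrow> m * sqnorm G u \<le> reduced_form \<kappa> G u"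
  proof (rule quadratic_coercive[OF G cQ])
    show "reduced_form \<kappa> G (\<lambda>v. a * u v) = a\<^sup>2 * reduced_form \<kappa> G u" for a u
      unfolding reduced_form_def edge_energy_def sum_distrib_left by (intro sum.cong refl) (simp add: power2_eq_square algebra_simps)
  qed (use pos in auto)
  define n where "n = real (card (medges G))"
  have n: "0 \<le> n" by (simp add: n_def)
  \<comment> \<open>The first entry keeps edges short for \<open>\<kappa> + 2 * c\<close>. The
    second makes the loss in terms of vertex values, at most \<open>8 * c * d * n\<close> times the
    squared norm, absorbable by the coercivity constant \<open>m\<close>.\<close>
  define c where "c = min ((1 - \<kappa> * d\<^sup>2) / (2 * d\<^sup>2)) (m / (8 * d * n + 1))"
  have c: "0 < c" unfolding c_def using k d m n by (auto intro!: divide_pos_pos add_nonneg_pos)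
  have "c \<le> (1 - \<kappa> * d\<^sup>2) / (2 * d\<^sup>2)" by (simp add: c_def)
  then have c1: "(\<kappa> + 2 * c) * d\<^sup>2 \<le> 1" using d by (simp add: field_simps)
  have "c \<le> m / (8 * d * n + 1)" by (simp add: c_def)
  then have "c * (8 * d * n + 1) \<le> m" using d n by (subst (asm) pos_le_divide_eq) (auto intro!: add_nonneg_pos)
  then have c2: "c * (8 * d * n) \<le> m" using c by (simp add: algebra_simps)
  show ?thesis
  proof (rule that[OF c])
    fix E F I assume "(E, F, I) \<in> forms G"
    then obtain f f' u where f: "H10_deriv G f f' u" "E = gint G (\<lambda>e x. (f' e x)\<^sup>2)" "F = gint G (\<lambda>e x. (f e x)\<^sup>2)"
      unfolding forms_def by blast
    note fD = H10_derivD[OF f(1)]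
    define w where "w v = (if v \<in> mverts G then u v else 0)" for v
    have w: "w \<in> vertex_space G" using fD(4) by (auto simp: w_def vertex_space_def)
    have ends: "f e 0 = w (mtail G e)" "f e (len G e) = w (mhead G e)" if "e \<in> medges G" for e
      using fD(2,3)[OF that] fG(4,5)[OF that] by (auto simp: w_def)
    have sq: "(w v)\<^sup>2 \<le> sqnorm G w" if "v \<in> mverts G" for v unfolding sqnorm_def
      by (intro member_le_sum) (use fG that in auto)
    have "c * F + reduced_form \<kappa> G w - 4 * c * d * (\<Sum>e\<in>medges G. (w (mtail G e))\<^sup>2 + (w (mhead G e))\<^sup>2) \<le> E - \<kappa> * F"
      unfolding f(2,3) gint_def reduced_form_def sum_distrib_left sum.distrib[symmetric] sum_subtractf[symmetric]
    proof (rule sum_mono)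
      fix e assume e: "e \<in> medges G"
      show "c * integral {0..len G e} (\<lambda>x. (f e x)\<^sup>2) + edge_energy \<kappa> (len G e) (w (mtail G e)) (w (mhead G e))
          - 4 * c * d * ((w (mtail G e))\<^sup>2 + (w (mhead G e))\<^sup>2)
         \<le> integral {0..len G e} (\<lambda>x. (f' e x)\<^sup>2) - \<kappa> * integral {0..len G e} (\<lambda>x. (f e x)\<^sup>2)"
        using edge_energy_lower_bound[OF fD(1)[OF e] k(1) fG(3)[OF e] d(1)[OF e] less_imp_le[OF c] c1]
        by (simp only: ends[OF e])
    qed
    moreover have "(\<Sum>e\<in>medges G. (w (mtail G e))\<^sup>2 + (w (mhead G e))\<^sup>2) \<le> n * (2 * sqnorm G w)"
    proof -
      have "(\<Sum>e\<in>medges G. (w (mtail G e))\<^sup>2 + (w (mhead G e))\<^sup>2) \<le> (\<Sum>e\<in>medges G. 2 * sqnorm G w)"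
      proof (rule sum_mono)
        fix e assume "e \<in> medges G"
        then show "(w (mtail G e))\<^sup>2 + (w (mhead G e))\<^sup>2 \<le> 2 * sqnorm G w"
          using sq[OF fG(4)] sq[OF fG(5)] by (simp only: mult_2 add_mono)
      qed
      then show ?thesis by (simp add: n_def)
    qed
    then have "4 * c * d * (\<Sum>e\<in>medges G. (w (mtail G e))\<^sup>2 + (w (mhead G e))\<^sup>2) \<le> 4 * c * d * (n * (2 * sqnorm G w))"
      by (rule mult_left_mono) (use c d in auto)
    moreover have "4 * c * d * (n * (2 * sqnorm G w)) \<le> m * sqnorm G w"
    proof -
      have "c * (8 * d * n) * sqnorm G w \<le> m * sqnorm G w"
        by (rule mult_right_mono[OF c2]) (simp add: sqnorm_def sum_nonneg)
      then show ?thesis by (simp add: algebra_simps)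
    qed
    ultimately have "c * F \<le> E - \<kappa> * F" using m(2)[OF w] by linarith
    then show "(\<kappa> + c) * F \<le> E" by (simp add: algebra_simps)
  qed
qed

lemma edge_energy_abs_le:
  assumes "0 < scaled_sin \<kappa> l" shows "edge_energy \<kappa> l \<bar>a\<bar> \<bar>b\<bar> \<le> edge_energy \<kappa> l a b"
proof -
  have "a * b \<le> \<bar>a\<bar> * \<bar>b\<bar>" by (metis abs_ge_self abs_mult)
  then show ?thesis unfolding edge_energy_def using assms by (intro divide_right_mono) auto
qed

lemma edge_solution_sign:
  assumes k: "0 \<le> \<kappa>" "\<kappa> * d\<^sup>2 \<le> 1" and l: "0 < l" "l \<le> d" and ab: "0 \<le> a" "0 \<le> b"
  shows "\<And>x. 0 \<le> x \<Longrightarrow> x \<le> l \<Longrightarrow> 0 \<le> edge_solution \<kappa> l a b x"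
    "(\<forall>x. 0 < x \<longrightarrow> x < l \<longrightarrow> 0 < edge_solution \<kappa> l a b x) \<or> (\<forall>x. edge_solution \<kappa> l a b x = 0)"
proof -
  have sl: "0 < scaled_sin \<kappa> l" by (rule scaled_sin_pos[OF k l])
  show "0 \<le> edge_solution \<kappa> l a b x" if "0 \<le> x" "x \<le> l" for x
    unfolding edge_solution_def using that l ab sl
    by (intro divide_nonneg_pos add_nonneg_nonneg mult_nonneg_nonneg scaled_sin_nonneg[OF k]) auto
  show "(\<forall>x. 0 < x \<longrightarrow> x < l \<longrightarrow> 0 < edge_solution \<kappa> l a b x) \<or> (\<forall>x. edge_solution \<kappa> l a b x = 0)"
  proof (cases "a = 0 \<and> b = 0")
    case True then show ?thesis by (simp add: edge_solution_def)
  next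
    case False
    have "0 < edge_solution \<kappa> l a b x" if x: "0 < x" "x < l" for x
    proof -
      have s: "0 < scaled_sin \<kappa> x" "0 < scaled_sin \<kappa> (l - x)" using x l by (auto intro!: scaled_sin_pos[OF k])
      have "0 < a * scaled_sin \<kappa> (l - x) + b * scaled_sin \<kappa> x"
        using False ab s by (metis add_nonneg_pos add_pos_nonneg less_eq_real_def mult_nonneg_nonneg mult_pos_pos)
      then show ?thesis unfolding edge_solution_def using sl by simp
    qed
    then show ?thesis by blast
  qed
qed

text \<open>The derivatives are required on the whole line so that they survive subdivision without
  any one-sided notions.\<close>
definition ground_state :: "('v, 'e) metric_graph \<Rightarrow> real \<Rightarrow> ('e \<Rightarrow> real \<Rightarrow> real) \<Rightarrow> ('e \<Rightarrow> real \<Rightarrow> real) \<Rightarrow> ('v \<Rightarrow> real) \<Rightarrow> bool" where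
  "ground_state G \<kappa> f f' u \<longleftrightarrow> 0 < \<kappa> \<and> H10_deriv G f f' u \<and>
     (\<forall>e\<in>medges G. \<forall>x. (f e has_real_derivative f' e x) (at x) \<and> (f' e has_real_derivative - \<kappa> * f e x) (at x)) \<and>
     (\<forall>e\<in>medges G. (\<forall>x\<in>{0..len G e}. 0 \<le> f e x) \<and>
        ((\<forall>x\<in>{0<..<len G e}. 0 < f e x) \<or> (\<forall>x\<in>{0..len G e}. f e x = 0))) \<and>
     0 < gint G (\<lambda>e x. (f e x)\<^sup>2) \<and> gint G (\<lambda>e x. (f' e x)\<^sup>2) = \<kappa> * gint G (\<lambda>e x. (f e x)\<^sup>2) \<and>
     (\<forall>(E, F, I)\<in>forms G. \<kappa> * F \<le> E)"

lemma ground_state_energy_eq: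
  assumes "finite_metric_graph G" "ground_state G \<kappa> f f' u"
  shows "ground_state_energy G = \<kappa>"
  unfolding ground_state_forms[OF assms(1)]
proof (rule Least_equality)
  let ?E = "gint G (\<lambda>e x. (f' e x)\<^sup>2)" and ?F = "gint G (\<lambda>e x. (f e x)\<^sup>2)"
  have "H10_deriv G f f' u" "?F \<noteq> 0" "\<kappa> = ?E / ?F"
    using assms(2) unfolding ground_state_def by auto
  then have "(?E, ?F, gint G f) \<in> forms G" "?F \<noteq> 0" "\<kappa> = ?E / ?F" unfolding forms_def by blast+
  then show "\<exists>(a, b, c)\<in>forms G. b \<noteq> 0 \<and> \<kappa> = a / b" by blast
next
  fix y assume "\<exists>(a, b, c)\<in>forms G. b \<noteq> 0 \<and> y = a / b"
  then obtain a b c where z: "(a, b, c) \<in> forms G" "b \<noteq> 0" "y = a / b" by blast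
  have "0 \<le> b" using z(1) by (auto simp: forms_def intro!: gint_nonneg)
  then have "0 < b" using z by simp
  moreover have "\<kappa> * b \<le> a" using assms(2) z(1) unfolding ground_state_def by blast
  ultimately show "\<kappa> \<le> y" unfolding z(3) by (simp add: pos_le_divide_eq)
qed

text \<open>At the infimum \<open>\<kappa>\<close> of the Rayleigh quotients a spectral gap is
  impossible, so some nonzero vertex vector has nonpositive reduced form. Extending it along the
  edges by edge solutions gives a function whose quotient is at most \<open>\<kappa>\<close>, that
  is, a minimiser.\<close>

lemma ground_state_exists:
  assumes G: "finite_metric_graph G" and cut: "cut_ge 1 G" and d: "\<And>e. e \<in> medges G \<Longrightarrow> len G e \<le> d" "0 < d"
    and t: "(E0, F0, I0) \<in> forms G" "0 < F0" "E0 * d\<^sup>2 < F0"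
  shows "\<exists>\<kappa> f f' u. ground_state G \<kappa> f f' u"
proof -
  note fG = finite_metric_graphD[OF G]
  \<comment> \<open>The gap at level zero, where the reduced form is the discrete Dirichlet energy,
    shows that the infimum is positive.\<close>
  obtain p where p: "0 < p" "\<And>E F I. (E, F, I) \<in> forms G \<Longrightarrow> (0 + p) * F \<le> E"
  proof (rule spectral_gap[OF G d])
    fix u v assume u: "u \<in> vertex_space G" "u v \<noteq> 0"
    have "reduced_form 0 G u = (\<Sum>e\<in>medges G. (u (mhead G e) - u (mtail G e))\<^sup>2 / len G e)"
      unfolding reduced_form_def by (intro sum.cong refl) (simp add: edge_energy_def scaled_sin_def scaled_cos_def power2_diff algebra_simps)
    then show "0 < reduced_form 0 G u" using dirichlet_energy_pos[OF G cut u fG(3)] by simp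
  qed auto
  define R where "R = {E / F | E F I. (E, F, I) \<in> forms G \<and> 0 < F}"
  define \<kappa> where "\<kappa> = Inf R"
  have R: "p \<le> r" if "r \<in> R" for r
    using that p unfolding R_def by (auto simp: field_simps)
  have Rne: "E0 / F0 \<in> R" using t unfolding R_def by blast
  have kp: "p \<le> \<kappa>" unfolding \<kappa>_def by (rule cInf_greatest) (use Rne R in auto)
  have k0: "0 < \<kappa>" using kp p by simp
  \<comment> \<open>The trial triple keeps the infimum below \<open>1 / d\<^sup>2\<close>, so the
    edges are short for \<open>\<kappa>\<close>.\<close>
  have "\<kappa> \<le> E0 / F0" unfolding \<kappa>_def by (rule cInf_lower[OF Rne]) (use R in \<open>auto intro!: bdd_belowI\<close>)
  then have "\<kappa> * d\<^sup>2 \<le> E0 / F0 * d\<^sup>2" by (rule mult_right_mono) simp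
  also have "\<dots> < 1" using t by (simp add: field_simps)
  finally have kd: "\<kappa> * d\<^sup>2 < 1" .
  have kmin: "\<kappa> * F \<le> E" if z: "(E, F, I) \<in> forms G" for E F I
  proof (cases "0 < F")
    case True
    then have "E / F \<in> R" using z unfolding R_def by blast
    then have "\<kappa> \<le> E / F" unfolding \<kappa>_def by (rule cInf_lower) (use R in \<open>auto intro!: bdd_belowI\<close>)
    then show ?thesis using True by (simp add: field_simps)
  next
    case False
    have "0 \<le> F" "0 \<le> E" using z by (auto simp: forms_def intro!: gint_nonneg)
    then show ?thesis using False by simp
  qed
  have "\<exists>u v. u \<in> vertex_space G \<and> u v \<noteq> 0 \<and> reduced_form \<kappa> G u \<le> 0"
  proof (rule ccontr)
    assume no: "\<not> ?thesis"
    obtain c where c: "0 < c" "\<And>E F I. (E, F, I) \<in> forms G \<Longrightarrow> (\<kappa> + c) * F \<le> E"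
      by (rule spectral_gap[OF G d less_imp_le[OF k0] kd]) (use no in force)+
    have "\<kappa> + c \<le> r" if "r \<in> R" for r
      using that c(2) unfolding R_def by (auto simp: field_simps)
    then have "\<kappa> + c \<le> \<kappa>" unfolding \<kappa>_def[symmetric] by (subst (2) \<kappa>_def, intro cInf_greatest) (use Rne in auto)
    then show False using c by simp
  qed
  then obtain u0 v where u0: "u0 \<in> vertex_space G" "u0 v \<noteq> 0" "reduced_form \<kappa> G u0 \<le> 0" by blast
  define u where "u w = \<bar>u0 w\<bar>" for w
  have sl: "0 < scaled_sin \<kappa> (len G e)" if "e \<in> medges G" for e
    using scaled_sin_pos[OF less_imp_le[OF k0] less_imp_le[OF kd] fG(3)[OF that] d(1)[OF that]] .
  have "reduced_form \<kappa> G u \<le> reduced_form \<kappa> G u0" unfolding reduced_form_def u_def by (intro sum_mono edge_energy_abs_le sl)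
  then have Qu: "reduced_form \<kappa> G u \<le> 0" using u0 by simp
  define f f' where "f e = edge_solution \<kappa> (len G e) (u (mtail G e)) (u (mhead G e))" and
    "f' e = edge_solution' \<kappa> (len G e) (u (mtail G e)) (u (mhead G e))" for e
  have H: "H10_deriv G f f' u"
    unfolding H10_deriv_def vertex_values_def
  proof (intro conjI ballI)
    fix e assume e: "e \<in> medges G"
    show "H1_deriv (len G e) (f e) (f' e)" unfolding f_def f'_def
      by (rule H1_deriv_edge_solution) (use k0 fG(3)[OF e] in auto)
    have "scaled_sin \<kappa> (len G e) \<noteq> 0" using sl[OF e] by simp
    then show "f e 0 = u (mtail G e)" "f e (len G e) = u (mhead G e)" unfolding f_def by (rule edge_solution_ends)+
  qed (use u0 in \<open>auto simp: u_def vertex_space_def\<close>)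
  let ?E = "gint G (\<lambda>e x. (f' e x)\<^sup>2)" and ?F = "gint G (\<lambda>e x. (f e x)\<^sup>2)"
  have "?E - \<kappa> * ?F = reduced_form \<kappa> G u"
    unfolding gint_def reduced_form_def sum_distrib_left sum_subtractf[symmetric] f_def f'_def
  proof (rule sum.cong[OF refl])
    fix e assume e: "e \<in> medges G"
    show "integral {0..len G e} (\<lambda>x. (edge_solution' \<kappa> (len G e) (u (mtail G e)) (u (mhead G e)) x)\<^sup>2) - \<kappa> * integral {0..len G e} (\<lambda>x. (edge_solution \<kappa> (len G e) (u (mtail G e)) (u (mhead G e)) x)\<^sup>2) =
      edge_energy \<kappa> (len G e) (u (mtail G e)) (u (mhead G e))"
      by (rule edge_solution_energy) (use sl[OF e] k0 fG(3)[OF e] in auto)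
  qed
  moreover have "\<kappa> * ?F \<le> ?E" by (rule kmin[of _ _ "gint G f"]) (use H in \<open>auto simp: forms_def\<close>)
  ultimately have EF: "?E = \<kappa> * ?F" using Qu by simp
  \<comment> \<open>The vector \<open>u\<close> is nonzero, but the extension could be blind to an
    isolated vertex; the cut condition provides an edge leaving the support of
    \<open>u\<close>.\<close>
  have "0 < ?F"
  proof -
    have "?F \<noteq> 0"
    proof
      assume "?F = 0"
      then have nz: "\<not> nonzero_on G f" using gint_square_eq_0_iff[OF G H10_derivD(5)[OF H]] by simp
      have "boundary G {w. u w \<noteq> 0} \<noteq> {}"
      proof -
        have "{w. u w \<noteq> 0} \<subseteq> mverts G - dirichlet G" "{w. u w \<noteq> 0} \<noteq> {}" using u0 by (auto simp: u_def vertex_space_def)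
        then have "1 \<le> card (boundary G {w. u w \<noteq> 0})" using cut unfolding cut_ge_def by blast
        then show ?thesis by auto
      qed
      then obtain e where e: "e \<in> boundary G {w. u w \<noteq> 0}" by blast
      then have "e \<in> medges G" "f e 0 \<noteq> 0 \<or> f e (len G e) \<noteq> 0"
        using H10_derivD(2,3)[OF H, of e] by (auto simp: boundary_def)
      then show False using nz fG(3)[of e] unfolding nonzero_on_def by fastforce
    qed
    moreover have "0 \<le> ?F" by (intro gint_nonneg) auto
    ultimately show ?thesis by simp
  qed
  moreover have "(f e has_real_derivative f' e x) (at x)" "(f' e has_real_derivative - \<kappa> * f e x) (at x)" for e x
    unfolding f_def f'_def using edge_solution_deriv[OF less_imp_le[OF k0]] by auto
  moreover have "(\<forall>x\<in>{0..len G e}. 0 \<le> f e x) \<and> ((\<forall>x\<in>{0<..<len G e}. 0 < f e x) \<or> (\<forall>x\<in>{0..len G e}. f e x = 0))"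
    if e: "e \<in> medges G" for e
    using edge_solution_sign[OF less_imp_le[OF k0] less_imp_le[OF kd] fG(3)[OF e] d(1)[OF e], of "u (mtail G e)" "u (mhead G e)"]
    unfolding f_def u_def by auto
  ultimately show ?thesis using H EF k0 kmin unfolding ground_state_def by blast
qed

section \<open>Monotonicity and integration with finitely many exceptional points\<close>

lemma mono_finite_exceptions:
  fixes F :: "real \<Rightarrow> real"
  assumes ab: "a \<le> b" and C: "finite C" and c: "continuous_on {a..b} F"
    and d: "\<And>x. a < x \<Longrightarrow> x < b \<Longrightarrow> x \<notin> C \<Longrightarrow> \<exists>d\<ge>0. (F has_real_derivative d) (at x)"
  shows "F a \<le> F b"
proof -
  obtain D where D: "\<And>x. a < x \<Longrightarrow> x < b \<Longrightarrow> x \<notin> C \<Longrightarrow> 0 \<le> D x \<and> (F has_real_derivative D x) (at x)"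
    using d by metis
  define E where "E x = (if a < x \<and> x < b \<and> x \<notin> C then D x else 0)" for x
  have "(E has_integral F b - F a) {a..b}"
    by (rule fundamental_theorem_of_calculus_interior_strong[OF C ab _ c])
      (use D in \<open>auto simp: E_def has_real_derivative_iff_has_vector_derivative[symmetric]\<close>)
  then have "0 \<le> F b - F a"
    by (rule has_integral_nonneg) (use D in \<open>auto simp: E_def\<close>)
  then show ?thesis by simp
qed

lemma integral_eq_finite_exceptions:
  fixes F :: "real \<Rightarrow> real"
  assumes ab: "a \<le> b" and C: "finite C" and c: "continuous_on {a..b} F"
    and d: "\<And>x. a < x \<Longrightarrow> x < b \<Longrightarrow> x \<notin> C \<Longrightarrow> (F has_real_derivative D x) (at x)"
  shows "(D has_integral F b - F a) {a..b}"
  by (rule fundamental_theorem_of_calculus_interior_strong[OF C ab _ c])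
    (use d in \<open>auto simp: has_real_derivative_iff_has_vector_derivative[symmetric]\<close>)

lemma integral_deriv_interior:
  fixes g :: "real \<Rightarrow> real"
  assumes "continuous_on {a..b} g" "a < t" "t < b"
  shows "((\<lambda>x. integral {a..x} g) has_real_derivative g t) (at t)"
proof -
  have "((\<lambda>x. integral {a..x} g) has_real_derivative g t) (at t within {a..b})"
    by (rule integral_has_real_derivative) (use assms in auto)
  then show ?thesis using assms by (simp add: at_within_Icc_at)
qed

lemma le_tan:
  fixes x :: real assumes "0 \<le> x" "x < pi / 2" shows "x \<le> tan x"
proof -
  have "(\<lambda>x. tan x - x) 0 \<le> (\<lambda>x. tan x - x) x"
  proof (rule DERIV_nonneg_imp_nondecreasing[OF assms(1)])
    fix y assume y: "0 \<le> y" "y \<le> x"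
    then have cy: "cos y \<noteq> 0" using cos_gt_zero_pi[of y] assms by simp
    have "((\<lambda>x. tan x - x) has_real_derivative inverse ((cos y)\<^sup>2) - 1) (at y)"
      by (intro DERIV_diff DERIV_tan[OF cy] DERIV_ident)
    moreover have "inverse ((cos y)\<^sup>2) - 1 = (tan y)\<^sup>2"
      using tan_sec[OF cy] by (simp add: power_inverse)
    ultimately show "\<exists>d. ((\<lambda>x. tan x - x) has_real_derivative d) (at y) \<and> 0 \<le> d" by (metis zero_le_power2)
  qed
  then show ?thesis by simp
qed

section \<open>The comparison argument\<close>

text \<open>The Kohler-Jobin argument as a statement about two functions of the level: \<open>\<mu>\<close> is the
  measure of the superlevel set and \<open>P\<close> the flux through the level set.\<close>
locale level_functions =
  fixes M \<kappa> n :: real and \<mu> P s \<gamma> :: "real \<Rightarrow> real" and C :: "real set"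
  assumes pos: "0 < M" "0 < \<kappa>" "0 < n" and C: "finite C"
    and cont: "continuous_on {0..M} \<mu>" "continuous_on {0..M} P" "continuous_on {0..M} \<gamma>"
    and mP: "\<And>t. 0 \<le> t \<Longrightarrow> t < M \<Longrightarrow> 0 < \<mu> t" "\<And>t. 0 \<le> t \<Longrightarrow> t < M \<Longrightarrow> 0 < P t" "\<mu> M = 0"
    and \<gamma>: "\<And>t. 0 \<le> t \<Longrightarrow> t < M \<Longrightarrow> \<gamma> t = \<mu> t / P t"
    and deriv: "\<And>t. 0 < t \<Longrightarrow> t < M \<Longrightarrow> t \<notin> C \<Longrightarrow> (\<mu> has_real_derivative - s t) (at t)"
    and iso: "\<And>t. 0 < t \<Longrightarrow> t < M \<Longrightarrow> t \<notin> C \<Longrightarrow> n\<^sup>2 \<le> s t * P t"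
    and energy: "integral {0..M} P = 2 * \<kappa> * integral {0..M} (\<lambda>t. t * \<mu> t)"
begin

definition T0 :: real where "T0 = integral {0..M} (\<lambda>t. \<gamma> t * \<mu> t)"

text \<open>The contribution to \<open>T0\<close> of the levels above \<open>t\<close>.\<close>

definition T :: "real \<Rightarrow> real" where "T t = T0 - integral {0..t} (\<lambda>t. \<gamma> t * \<mu> t)"

lemma cont_gm: "continuous_on {0..M} (\<lambda>t. \<gamma> t * \<mu> t)"
  by (intro continuous_intros cont)

lemma T_M: "T M = 0" by (simp add: T_def T0_def)

lemma T_0: "T 0 = T0" by (simp add: T_def)

lemma cont_T: "continuous_on {0..M} T"
  unfolding T_def by (intro continuous_intros indefinite_integral_continuous_1 integrable_continuous_real cont_gm)

lemma T_deriv: "0 < t \<Longrightarrow> t < M \<Longrightarrow> (T has_real_derivative - (\<gamma> t * \<mu> t)) (at t)"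
  unfolding T_def using integral_deriv_interior[OF cont_gm] by (auto intro!: derivative_eq_intros)

lemma gm_pos: "0 \<le> t \<Longrightarrow> t < M \<Longrightarrow> 0 < \<gamma> t * \<mu> t"
  using mP \<gamma> by simp

lemma T_pos:
  assumes "0 \<le> t" "t < M" shows "0 < T t"
proof -
  have "\<exists>l z. t < z \<and> z < M \<and> (T has_real_derivative l) (at z) \<and> T M - T t = (M - t) * l"
  proof (rule MVT[OF assms(2)])
    show "continuous_on {t..M} T" by (rule continuous_on_subset[OF cont_T]) (use assms in auto)
    show "T differentiable (at x)" if "t < x" "x < M" for x
      using T_deriv[of x] that assms real_differentiable_def by force
  qed
  then obtain l z where z: "t < z" "z < M" "(T has_real_derivative l) (at z)" "T M - T t = (M - t) * l" by blast
  then have "l = - (\<gamma> z * \<mu> z)" using T_deriv[of z] assms DERIV_unique by fastforce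
  then show ?thesis using gm_pos[of z] z assms T_M mult_pos_pos[of "M - t" "\<gamma> z * \<mu> z"] by simp
qed

text \<open>Both sides vanish at \<open>M\<close>, and \<open>s * P \<ge> n\<^sup>2\<close> makes
  the right-hand side decrease at least as fast as the left-hand side. Geometrically, the set above
  level \<open>t\<close> is at least as long as \<open>n\<close> mixed intervals of torsional
  rigidity \<open>T t\<close> in total.\<close>

lemma cube_le:
  assumes "0 \<le> t" "t \<le> M" shows "3 * n\<^sup>2 * T t \<le> \<mu> t ^ 3"
proof -
  have "(\<lambda>t. 3 * n\<^sup>2 * T t - \<mu> t ^ 3) t \<le> (\<lambda>t. 3 * n\<^sup>2 * T t - \<mu> t ^ 3) M"
  proof (rule mono_finite_exceptions[OF assms(2) C])
    show "continuous_on {t..M} (\<lambda>t. 3 * n\<^sup>2 * T t - \<mu> t ^ 3)"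
      by (intro continuous_intros continuous_on_subset[OF cont_T] continuous_on_subset[OF cont(1)]) (use assms in auto)
    fix x assume x: "t < x" "x < M" "x \<notin> C"
    have "((\<lambda>t. 3 * n\<^sup>2 * T t - \<mu> t ^ 3) has_real_derivative 3 * n\<^sup>2 * - (\<gamma> x * \<mu> x) - 3 * \<mu> x ^ 2 * - s x) (at x)"
      using T_deriv[of x] deriv[of x] x assms by (auto intro!: derivative_eq_intros)
    moreover have "0 \<le> 3 * n\<^sup>2 * - (\<gamma> x * \<mu> x) - 3 * \<mu> x ^ 2 * - s x"
    proof -
      have p: "0 < P x" "0 < \<mu> x" using mP x assms by auto
      have "3 * n\<^sup>2 * - (\<gamma> x * \<mu> x) - 3 * \<mu> x ^ 2 * - s x = 3 * \<mu> x ^ 2 / P x * (s x * P x - n\<^sup>2)"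
        using \<gamma>[of x] x assms p by (simp add: field_simps power2_eq_square)
      then show ?thesis using iso[of x] x assms p by simp
    qed
    ultimately show "\<exists>d\<ge>0. ((\<lambda>t. 3 * n\<^sup>2 * T t - \<mu> t ^ 3) has_real_derivative d) (at x)" by blast
  qed
  then show ?thesis using T_M mP(3) by simp
qed

text \<open>A mixed interval of length \<open>R\<close> has torsional rigidity
  \<open>R ^ 3 / 3\<close>; here \<open>n\<close> copies together have rigidity
  \<open>T t\<close>.\<close>

definition R :: "real \<Rightarrow> real" where "R t = root 3 (3 * T t / n)"

lemma R_cube: "R t ^ 3 = 3 * T t / n"
  unfolding R_def by (simp add: odd_real_root_pow)

lemma R_pos: "0 \<le> t \<Longrightarrow> t < M \<Longrightarrow> 0 < R t"
  unfolding R_def using T_pos pos by simp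

lemma cont_R: "continuous_on {0..M} R"
  unfolding R_def by (intro continuous_intros cont_T) (use pos in auto)

lemma nR_le:
  assumes "0 \<le> t" "t < M" shows "n * R t \<le> \<mu> t"
proof (rule power_le_imp_le_base[of _ 2])
  have "(n * R t) ^ 3 = 3 * n\<^sup>2 * T t"
    using pos by (simp add: power_mult_distrib R_cube) (simp add: power2_eq_square power3_eq_cube)
  then show "(n * R t) ^ Suc 2 \<le> \<mu> t ^ Suc 2" using cube_le[of t] assms by (simp add: numeral_3_eq_3)
  show "0 \<le> \<mu> t" using mP(1) assms by (simp add: less_imp_le)
qed

lemma R_deriv:
  assumes "0 < t" "t < M" shows "(R has_real_derivative - (\<gamma> t * \<mu> t) / (n * (R t)\<^sup>2)) (at t)"
proof -
  have p: "0 < 3 * T t / n" using T_pos[of t] assms pos by simp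
  have "((\<lambda>t. 3 * T t / n) has_real_derivative 3 * - (\<gamma> t * \<mu> t) / n) (at t)"
    by (intro DERIV_cdivide DERIV_cmult T_deriv assms)
  from DERIV_chain2[OF DERIV_real_root[OF _ p] this, of 3]
  have "(R has_real_derivative inverse (real 3 * root 3 (3 * T t / n) ^ (3 - Suc 0)) * (3 * - (\<gamma> t * \<mu> t) / n)) (at t)"
    unfolding R_def[abs_def] by simp
  moreover have "inverse (real 3 * root 3 (3 * T t / n) ^ (3 - Suc 0)) * (3 * - (\<gamma> t * \<mu> t) / n) = - (\<gamma> t * \<mu> t) / (n * (R t)\<^sup>2)"
    unfolding R_def[symmetric] using R_pos[of t] assms pos by (simp add: field_simps numeral_2_eq_2)
  ultimately show ?thesis by simp
qed

text \<open>The rearranged function takes the value \<open>\<tau> t\<close> at distance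
  \<open>R t\<close> from the Neumann end of each of the \<open>n\<close> intervals. Its slope
  \<open>\<rho>\<close> in the level variable is chosen so that the rearranged energy is again the
  integral of \<open>P\<close>; its squared norm becomes twice the integral of
  \<open>\<tau> * \<mu>\<close>. Since \<open>\<rho> \<ge> 1\<close>, rearranging raises values and
  with them the norm.\<close>

definition \<rho> :: "real \<Rightarrow> real" where "\<rho> t = \<mu> t / (n * R t)"

definition \<tau> :: "real \<Rightarrow> real" where "\<tau> t = integral {0..t} \<rho>"

lemma rho_ge_1: "0 \<le> t \<Longrightarrow> t < M \<Longrightarrow> 1 \<le> \<rho> t"
  unfolding \<rho>_def using nR_le R_pos pos by (simp add: pos_le_divide_eq)

lemma cont_rho: "r < M \<Longrightarrow> continuous_on {0..r} \<rho>"
  unfolding \<rho>_def by (intro continuous_intros continuous_on_subset[OF cont(1)] continuous_on_subset[OF cont_R])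
    (use R_pos pos in \<open>auto simp: less_imp_neq[symmetric]\<close>)

lemma cont_tau: "r < M \<Longrightarrow> continuous_on {0..r} \<tau>"
  unfolding \<tau>_def by (intro indefinite_integral_continuous_1 integrable_continuous_real cont_rho)

lemma tau_deriv:
  assumes "0 < t" "t < M" shows "(\<tau> has_real_derivative \<rho> t) (at t)"
  unfolding \<tau>_def by (rule integral_deriv_interior[OF cont_rho[of "(t + M) / 2"]]) (use assms in auto)

lemma tau_ge:
  assumes "0 \<le> t" "t < M" shows "t \<le> \<tau> t"
proof -
  have "integral {0..t} (\<lambda>x. 1) \<le> integral {0..t} \<rho>"
    by (rule integral_le) (use assms rho_ge_1 in \<open>auto intro!: integrable_continuous_real cont_rho\<close>)
  then show ?thesis using assms by (simp add: \<tau>_def)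
qed

lemma R_le_R0:
  assumes "0 \<le> t" "t < M" shows "R t \<le> R 0"
proof -
  have "(\<lambda>t. - R t) 0 \<le> (\<lambda>t. - R t) t"
  proof (rule mono_finite_exceptions[OF assms(1), of "{}"])
    show "continuous_on {0..t} (\<lambda>t. - R t)"
      by (intro continuous_intros continuous_on_subset[OF cont_R]) (use assms in auto)
    fix x assume x: "0 < x" "x < t"
    have "((\<lambda>t. - R t) has_real_derivative - (- (\<gamma> x * \<mu> x) / (n * (R x)\<^sup>2))) (at x)"
      by (intro DERIV_minus R_deriv) (use x assms in auto)
    moreover have "0 \<le> - (- (\<gamma> x * \<mu> x) / (n * (R x)\<^sup>2))" using gm_pos[of x] x assms pos by simp
    ultimately show "\<exists>d\<ge>0. ((\<lambda>t. - R t) has_real_derivative d) (at x)" by blast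
  qed auto
  then show ?thesis by simp
qed

text \<open>Comparison with the rearranged function \<open>\<tau>\<close> on an interval of length \<open>R 0\<close>: on an interval
  shorter than \<open>pi / (2 k)\<close> the mixed problem has no eigenvalue up to \<open>k\<^sup>2\<close>, which is witnessed by
  the function \<open>tan\<close>.\<close>
lemma rearrangement:
  assumes k: "0 < k" "k * R 0 < pi / 2" and r: "0 \<le> r" "r < M"
  shows "2 * k\<^sup>2 * integral {0..r} (\<lambda>t. \<tau> t * \<mu> t) \<le> integral {0..r} P"
proof -
  \<comment> \<open>Two boundary terms at level \<open>t\<close>. The one with \<open>tan\<close>
    comes from the Riccati substitution with the positive solution \<open>cos (k * R)\<close> on the
    interval, the subtracted one from integrating the squared norm by parts. Up to a nonnegative
    square divided by \<open>P\<close>, the integrand \<open>q\<close> is the derivative of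
    \<open>X\<close>.\<close>
  define X where "X t = n * k * (tan (k * R t) - k * R t) * (\<tau> t)\<^sup>2" for t
  define q where "q t = P t - 2 * k\<^sup>2 * (\<tau> t * \<mu> t)" for t
  have cM: "continuous_on {0..r} \<mu>" "continuous_on {0..r} P" "continuous_on {0..r} R" "continuous_on {0..r} \<tau>"
    using continuous_on_subset[OF cont(1)] continuous_on_subset[OF cont(2)] continuous_on_subset[OF cont_R] cont_tau r by auto
  have cq: "continuous_on {0..r} q" unfolding q_def by (intro continuous_intros cM)
  have kR: "0 < k * R t" "k * R t < pi / 2" "0 < cos (k * R t)" if t: "0 \<le> t" "t \<le> r" for t
  proof -
    show 1: "0 < k * R t" using R_pos[of t] t r k by simp
    have "k * R t \<le> k * R 0" by (intro mult_left_mono R_le_R0) (use t r k in auto)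
    then show 2: "k * R t < pi / 2" using k(2) by (rule le_less_trans)
    show "0 < cos (k * R t)" using 1 2 by (intro cos_gt_zero) auto
  qed
  have "(\<lambda>t. integral {0..t} q - X t) 0 \<le> (\<lambda>t. integral {0..t} q - X t) r"
  proof (rule mono_finite_exceptions[OF r(1), of "{}"])
    have "continuous_on {0..r} X" unfolding X_def
      by (intro continuous_intros cM) (use kR in \<open>force\<close>)
    then show "continuous_on {0..r} (\<lambda>t. integral {0..t} q - X t)"
      by (intro continuous_intros indefinite_integral_continuous_1 integrable_continuous_real cq)
    fix t assume t: "0 < t" "t < r"
    have t': "0 < t" "t < M" using t r by auto
    have ct: "cos (k * R t) \<noteq> 0" using kR(3)[of t] t by simp
    define z where "z = tan (k * R t)"
    define R' where "R' = - (\<gamma> t * \<mu> t) / (n * (R t)\<^sup>2)"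
    have dR: "(R has_real_derivative R') (at t)" unfolding R'_def by (rule R_deriv[OF t'])
    have dkR: "((\<lambda>t. k * R t) has_real_derivative k * R') (at t)" by (rule DERIV_cmult[OF dR])
    have dtan: "((\<lambda>t. tan (k * R t)) has_real_derivative inverse ((cos (k * R t))\<^sup>2) * (k * R')) (at t)"
      by (rule DERIV_chain2[OF DERIV_tan[OF ct] dkR])
    have sec: "inverse ((cos (k * R t))\<^sup>2) = 1 + z\<^sup>2" using tan_sec[OF ct] by (simp add: z_def power_inverse)
    have d1: "((\<lambda>t. n * k * (tan (k * R t) - k * R t)) has_real_derivative n * k * ((1 + z\<^sup>2) * (k * R') - k * R')) (at t)"
      using dtan unfolding sec by (intro DERIV_cmult DERIV_diff dkR)
    have d2: "((\<lambda>t. (\<tau> t)\<^sup>2) has_real_derivative 2 * (\<rho> t * \<tau> t)) (at t)"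
      using DERIV_power[OF tau_deriv[OF t'], of 2] by simp
    have dX: "(X has_real_derivative n * k * ((1 + z\<^sup>2) * (k * R') - k * R') * (\<tau> t)\<^sup>2 + 2 * (\<rho> t * \<tau> t) * (n * k * (z - k * R t))) (at t)"
      using DERIV_mult[OF d1 d2] unfolding X_def[abs_def] z_def by simp
    have p: "0 < P t" "0 < \<mu> t" "0 < R t" using mP R_pos t' by auto
    have R'eq: "R' = - n * (\<rho> t)\<^sup>2 / P t"
      unfolding R'_def \<rho>_def using \<gamma>[of t] t' p pos by (simp add: field_simps power2_eq_square)
    have rho_eq: "n * R t * \<rho> t = \<mu> t" unfolding \<rho>_def using p pos by simp
    have "n * k * ((1 + z\<^sup>2) * (k * R') - k * R') * (\<tau> t)\<^sup>2 + 2 * (\<rho> t * \<tau> t) * (n * k * (z - k * R t))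
      = n * k\<^sup>2 * z\<^sup>2 * R' * (\<tau> t)\<^sup>2 + 2 * n * k * z * \<rho> t * \<tau> t - 2 * k\<^sup>2 * \<tau> t * (n * R t * \<rho> t)"
      by (simp add: power2_eq_square algebra_simps)
    also have "\<dots> = q t - (P t - n * k * z * \<rho> t * \<tau> t)\<^sup>2 / P t"
      unfolding rho_eq R'eq q_def using p by (simp add: field_simps power2_eq_square)
    finally have dX': "(X has_real_derivative q t - (P t - n * k * z * \<rho> t * \<tau> t)\<^sup>2 / P t) (at t)"
      using dX by simp
    have "((\<lambda>t. integral {0..t} q - X t) has_real_derivative q t - (q t - (P t - n * k * z * \<rho> t * \<tau> t)\<^sup>2 / P t)) (at t)"
      by (intro DERIV_diff dX' integral_deriv_interior[OF cq t])
    moreover have "0 \<le> q t - (q t - (P t - n * k * z * \<rho> t * \<tau> t)\<^sup>2 / P t)" using p by simp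
    ultimately show "\<exists>d\<ge>0. ((\<lambda>t. integral {0..t} q - X t) has_real_derivative d) (at t)" by blast
  qed auto
  moreover have "X 0 = 0" by (simp add: X_def \<tau>_def)
  moreover have "0 \<le> X r" unfolding X_def using le_tan[of "k * R r"] kR(1,2)[of r] k pos r by simp
  ultimately have "0 \<le> integral {0..r} q" by simp
  also have "\<dots> = integral {0..r} P - 2 * k\<^sup>2 * integral {0..r} (\<lambda>t. \<tau> t * \<mu> t)"
    unfolding q_def by (subst Henstock_Kurzweil_Integration.integral_diff)
      (auto intro!: integrable_continuous_real continuous_intros cM)
  finally show ?thesis by simp
qed

text \<open>\<open>\<rho>\<close> and \<open>\<tau>\<close> are controlled only below
  \<open>M\<close>, where \<open>R\<close> is positive. Estimates are therefore proved up to levels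
  \<open>r < M\<close> and then passed to the limit.\<close>

lemma integral_tail_limit:
  fixes g :: "real \<Rightarrow> real"
  assumes "continuous_on {0..M} g" "\<And>r. 0 \<le> r \<Longrightarrow> r < M \<Longrightarrow> a \<le> integral {0..r} g"
  shows "a \<le> integral {0..M} g"
proof -
  have c: "continuous_on {0..M} (\<lambda>r. integral {0..r} g)"
    by (intro indefinite_integral_continuous_1 integrable_continuous_real assms)
  have "a \<le> (\<lambda>r. integral {0..r} g) x" if "x \<in> closure {0..<M}" for x
    by (rule continuous_ge_on_closure[OF _ that]) (use c pos assms(2) in auto)
  then show ?thesis using pos by auto
qed

text \<open>If \<open>R 0\<close> were smaller, the rearrangement inequality would hold for some
  \<open>k\<close> with \<open>k\<^sup>2 > \<kappa>\<close>. With \<open>\<tau> t \<ge> t\<close> it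
  gives \<open>2 * k\<^sup>2 * \<integral> t * \<mu> \<le> \<integral> P\<close>, and the right-hand
  side equals \<open>2 * \<kappa> * \<integral> t * \<mu>\<close>, which is positive.\<close>

lemma R0_ge: "pi / (2 * sqrt \<kappa>) \<le> R 0"
proof (rule ccontr)
  assume "\<not> ?thesis"
  then have less: "R 0 < pi / (2 * sqrt \<kappa>)" by simp
  have R0: "0 < R 0" using R_pos[of 0] pos by simp
  have scaled_sin: "0 < sqrt \<kappa>" using pos by simp
  have "sqrt \<kappa> < pi / (2 * R 0)" using less R0 scaled_sin by (simp add: field_simps)
  then obtain k where k: "sqrt \<kappa> < k" "k < pi / (2 * R 0)" using dense by blast
  have kR: "k * R 0 < pi / 2" using k R0 by (simp add: field_simps)
  have k0: "0 < k" using k scaled_sin by linarith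
  have ct: "continuous_on {0..M} (\<lambda>t. P t - 2 * k\<^sup>2 * (t * \<mu> t))" by (intro continuous_intros cont)
  have it: "(\<lambda>t. t * \<mu> t) integrable_on {0..M}" by (intro integrable_continuous_real continuous_intros cont)
  have iP: "P integrable_on {0..M}" by (intro integrable_continuous_real cont)
  have "0 \<le> integral {0..M} (\<lambda>t. P t - 2 * k\<^sup>2 * (t * \<mu> t))"
  proof (rule integral_tail_limit[OF ct])
    fix r assume r: "0 \<le> r" "r < M"
    have c: "continuous_on {0..r} \<mu>" "continuous_on {0..r} P"
      using continuous_on_subset[OF cont(1)] continuous_on_subset[OF cont(2)] r by auto
    have "integral {0..r} (\<lambda>t. t * \<mu> t) \<le> integral {0..r} (\<lambda>t. \<tau> t * \<mu> t)"
    proof (rule integral_le)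
      fix t assume "t \<in> {0..r}"
      then show "t * \<mu> t \<le> \<tau> t * \<mu> t" using r tau_ge[of t] mP(1)[of t] by (intro mult_right_mono) auto
    qed (auto intro!: integrable_continuous_real continuous_intros c cont_tau r)
    then have "2 * k\<^sup>2 * integral {0..r} (\<lambda>t. t * \<mu> t) \<le> 2 * k\<^sup>2 * integral {0..r} (\<lambda>t. \<tau> t * \<mu> t)"
      by (rule mult_left_mono) simp
    also have "\<dots> \<le> integral {0..r} P" by (rule rearrangement[OF k0 kR r])
    finally show "0 \<le> integral {0..r} (\<lambda>t. P t - 2 * k\<^sup>2 * (t * \<mu> t))"
      by (subst Henstock_Kurzweil_Integration.integral_diff) (auto intro!: integrable_continuous_real continuous_intros c)
  qed
  also have "\<dots> = integral {0..M} P - 2 * k\<^sup>2 * integral {0..M} (\<lambda>t. t * \<mu> t)"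
    using it iP by (subst Henstock_Kurzweil_Integration.integral_diff) (auto intro: integrable_on_mult_right)
  finally have 1: "k\<^sup>2 * (2 * integral {0..M} (\<lambda>t. t * \<mu> t)) \<le> \<kappa> * (2 * integral {0..M} (\<lambda>t. t * \<mu> t))"
    using energy by simp
  have "0 < integral {0..M} P"
  proof -
    have "0 \<le> integral {0..M} P"
    proof (rule integral_tail_limit[OF cont(2)])
      show "0 \<le> integral {0..r} P" if "0 \<le> r" "r < M" for r
        by (rule Henstock_Kurzweil_Integration.integral_nonneg)
          (use that mP(2) continuous_on_subset[OF cont(2)] in \<open>auto intro!: integrable_continuous_real simp: less_imp_le\<close>)
    qed
    moreover have "integral {0..M} P \<noteq> 0"
    proof
      assume "integral {0..M} P = 0"
      moreover have "0 \<le> P t" if "t \<in> {0..M}" for t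
      proof -
        have "t \<in> closure {0..<M}" using that pos by auto
        then show ?thesis by (rule continuous_ge_on_closure[rotated]) (use cont(2) pos mP(2) in \<open>auto simp: less_imp_le\<close>)
      qed
      ultimately have "\<forall>t\<in>{0..M}. P t = 0" using integral_eq_0_iff[OF cont(2)] pos by simp
      then show False using mP(2)[of 0] pos by auto
    qed
    ultimately show ?thesis by simp
  qed
  then have "0 < 2 * integral {0..M} (\<lambda>t. t * \<mu> t)" using energy pos by (simp add: zero_less_mult_iff)
  then have "k\<^sup>2 \<le> \<kappa>" using 1 by simp
  moreover have "\<kappa> < k\<^sup>2" using k scaled_sin pos by (metis power2_less_imp_less not_less real_sqrt_pow2 less_imp_le abs_of_pos real_sqrt_abs real_sqrt_le_mono k0)
  ultimately show False by simp
qed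

lemma T0_R: "T0 = n * R 0 ^ 3 / 3"
  using R_cube[of 0] T_0 pos by simp

theorem T0_ge: "n * (pi / (2 * sqrt \<kappa>)) ^ 3 / 3 \<le> T0"
  unfolding T0_R using R0_ge pos by (intro divide_right_mono mult_left_mono power_mono) auto

text \<open>Equality forces \<open>\<integral> (\<tau> - t) * \<mu> = 0\<close>, hence
  \<open>\<tau> t = t\<close>, hence \<open>\<rho> = 1\<close>, that is
  \<open>\<mu> = n * R\<close>. Then \<open>cube_le\<close> is an identity in the level, and
  differentiating it gives the claim.\<close>

theorem T0_eq_imp:
  assumes eq: "T0 = n * (pi / (2 * sqrt \<kappa>)) ^ 3 / 3" and t: "0 < t" "t < M" "t \<notin> C"
  shows "s t * P t = n\<^sup>2"
proof -
  have R0: "0 < R 0" using R_pos[of 0] pos by simp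
  have scaled_sin: "0 < sqrt \<kappa>" using pos by simp
  have "R 0 ^ 3 = (pi / (2 * sqrt \<kappa>)) ^ 3" using eq pos unfolding T0_R by simp
  then have R0e: "R 0 = pi / (2 * sqrt \<kappa>)" using R0 scaled_sin by (subst (asm) power_eq_iff_eq_base) auto
  have re: "2 * \<kappa> * integral {0..r} (\<lambda>t. \<tau> t * \<mu> t) \<le> integral {0..r} P" if r: "0 \<le> r" "r < M" for r
  proof -
    let ?J = "integral {0..r} (\<lambda>t. \<tau> t * \<mu> t)"
    \<comment> \<open>Now \<open>sqrt \<kappa> * R 0 = pi / 2\<close> is a pole of
      \<open>tan\<close>, so the inequality is first proved for smaller \<open>k\<close> and
      extended by continuity.\<close>
    have "2 * k\<^sup>2 * ?J \<le> integral {0..r} P" if k: "k \<in> {0<..<sqrt \<kappa>}" for k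
    proof (rule rearrangement[OF _ _ r])
      have "k * R 0 < sqrt \<kappa> * R 0" by (rule mult_strict_right_mono) (use k R0 in auto)
      then show "k * R 0 < pi / 2" using scaled_sin by (simp add: R0e)
    qed (use k in auto)
    then have "2 * k\<^sup>2 * ?J \<le> integral {0..r} P" if "k \<in> closure {0<..<sqrt \<kappa>}" for k
      by (intro continuous_le_on_closure[OF _ that, where f = "\<lambda>k. 2 * k\<^sup>2 * ?J"]) (auto intro!: continuous_intros)
    from this[of "sqrt \<kappa>"] show ?thesis using scaled_sin pos by simp
  qed
  define w where "w t = (\<tau> t - t) * \<mu> t" for t
  have w0: "0 \<le> w x" if "0 \<le> x" "x < M" for x unfolding w_def using tau_ge[OF that] mP(1)[OF that] by simp
  have cw: "continuous_on {0..r} w" if "r < M" for r unfolding w_def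
    by (intro continuous_intros cont_tau that continuous_on_subset[OF cont(1)]) (use that in auto)
  have wz: "integral {0..r} w = 0" if r: "0 \<le> r" "r < M" for r
  proof (rule antisym)
    show "0 \<le> integral {0..r} w"
      by (rule Henstock_Kurzweil_Integration.integral_nonneg) (use r w0 cw in \<open>auto intro!: integrable_continuous_real\<close>)
    \<comment> \<open>By the energy identity the integral of \<open>g\<close> over all levels is
      zero, while up to any level below \<open>M\<close> it dominates that of
      \<open>2 * \<kappa> * w\<close>; letting the level tend to \<open>M\<close> squeezes
      \<open>w\<close>.\<close>
    define g where "g t = P t - 2 * \<kappa> * (t * \<mu> t)" for t
    have cg: "continuous_on {0..M} g" unfolding g_def by (intro continuous_intros cont)
    have g0: "integral {0..M} g = 0"
      unfolding g_def using energy by (subst Henstock_Kurzweil_Integration.integral_diff)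
        (auto intro!: integrable_continuous_real continuous_intros cont)
    have gw: "2 * \<kappa> * integral {0..q} w \<le> integral {0..q} g" if q: "0 \<le> q" "q < M" for q
    proof -
      have c: "continuous_on {0..q} \<mu>" "continuous_on {0..q} P"
        using continuous_on_subset[OF cont(1)] continuous_on_subset[OF cont(2)] q by auto
      have "integral {0..q} g = integral {0..q} P - 2 * \<kappa> * integral {0..q} (\<lambda>t. t * \<mu> t)"
        unfolding g_def by (subst Henstock_Kurzweil_Integration.integral_diff)
          (auto intro!: integrable_continuous_real continuous_intros c)
      moreover have "integral {0..q} w = integral {0..q} (\<lambda>t. \<tau> t * \<mu> t) - integral {0..q} (\<lambda>t. t * \<mu> t)"
        unfolding w_def left_diff_distrib by (subst Henstock_Kurzweil_Integration.integral_diff)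
          (auto intro!: integrable_continuous_real continuous_intros c cont_tau q)
      then have "2 * \<kappa> * integral {0..q} w = 2 * \<kappa> * integral {0..q} (\<lambda>t. \<tau> t * \<mu> t) - 2 * \<kappa> * integral {0..q} (\<lambda>t. t * \<mu> t)"
        by (simp only: right_diff_distrib)
      ultimately show ?thesis using re[OF q] by linarith
    qed
    have mono: "integral {0..r} w \<le> integral {0..q} w" if q: "r \<le> q" "q < M" for q
      by (rule integral_subset_le) (use r q w0 cw in \<open>auto intro!: integrable_continuous_real\<close>)
    have "2 * \<kappa> * integral {0..r} w \<le> integral {0..q} g" if q: "q \<in> {r..<M}" for q
    proof -
      have "2 * \<kappa> * integral {0..r} w \<le> 2 * \<kappa> * integral {0..q} w"
        by (intro mult_left_mono mono) (use q pos in auto)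
      also have "\<dots> \<le> integral {0..q} g" by (rule gw) (use q r in auto)
      finally show ?thesis .
    qed
    moreover have "continuous_on {r..M} (\<lambda>q. integral {0..q} g)"
      by (rule continuous_on_subset[of "{0..M}"]) (use r in \<open>auto intro!: indefinite_integral_continuous_1 integrable_continuous_real cg\<close>)
    ultimately have "2 * \<kappa> * integral {0..r} w \<le> integral {0..q} g" if "q \<in> closure {r..<M}" for q
      by (intro continuous_ge_on_closure[OF _ that, where f = "\<lambda>q. integral {0..q} g"]) (use r in auto)
    from this[of M] show "integral {0..r} w \<le> 0" using g0 r pos by (simp add: mult_le_0_iff)
  qed
  have tau_eq: "\<tau> x = x" if x: "0 \<le> x" "x < M" for x
  proof -
    define r where "r = (x + M) / 2"
    have r: "x \<le> r" "r < M" "0 < r" using x by (auto simp: r_def)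
    have "\<forall>y\<in>{0..r}. w y = 0"
      using wz[of r] r w0 integral_eq_0_iff[of 0 r w] cw[of r] by auto
    then have "w x = 0" using x r by auto
    then show ?thesis using mP(1)[OF x] by (simp add: w_def)
  qed
  have rho1: "\<rho> x = 1" if x: "0 < x" "x < M" for x
  proof -
    have "((\<lambda>x. x) has_real_derivative 1) (at x)" by (rule DERIV_ident)
    moreover have "\<forall>\<^sub>F y in nhds x. y \<in> {0<..<M}" by (rule eventually_nhds_in_open) (use x in auto)
    then have "\<forall>\<^sub>F y in nhds x. y = \<tau> y" by eventually_elim (use tau_eq in force)
    ultimately have "(\<tau> has_real_derivative 1) (at x)"
      by (subst DERIV_cong_ev[of x x \<tau> "\<lambda>x. x" 1 1]) (auto elim: eventually_mono)
    then show ?thesis using tau_deriv[OF x] DERIV_unique by blast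
  qed
  have cube: "\<mu> x ^ 3 - 3 * n\<^sup>2 * T x = 0" if x: "0 < x" "x < M" for x
  proof -
    have "\<mu> x = n * R x" using rho1[OF x] R_pos[of x] x pos by (simp add: \<rho>_def field_simps)
    then have "\<mu> x ^ 3 = n ^ 3 * (3 * T x / n)" by (simp add: power_mult_distrib R_cube)
    then show ?thesis using pos by (simp add: power2_eq_square power3_eq_cube)
  qed
  have "((\<lambda>t. \<mu> t ^ 3 - 3 * n\<^sup>2 * T t) has_real_derivative 3 * \<mu> t ^ 2 * - s t - 3 * n\<^sup>2 * - (\<gamma> t * \<mu> t)) (at t)"
    using T_deriv[OF t(1,2)] deriv[OF t] by (auto intro!: derivative_eq_intros)
  moreover have "((\<lambda>t. \<mu> t ^ 3 - 3 * n\<^sup>2 * T t) has_real_derivative 0) (at t)"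
  proof -
    have "\<forall>\<^sub>F y in nhds t. y \<in> {0<..<M}" by (rule eventually_nhds_in_open) (use t in auto)
    then have "\<forall>\<^sub>F y in nhds t. \<mu> y ^ 3 - 3 * n\<^sup>2 * T y = 0" by eventually_elim (use cube in force)
    then show ?thesis by (subst DERIV_cong_ev[of t t _ "\<lambda>x. 0" 0 0]) (auto elim: eventually_mono)
  qed
  ultimately have 0: "3 * \<mu> t ^ 2 * - s t - 3 * n\<^sup>2 * - (\<gamma> t * \<mu> t) = 0" by (rule DERIV_unique)
  have p: "0 < P t" "0 < \<mu> t" using mP t by auto
  have "3 * \<mu> t ^ 2 * - s t - 3 * n\<^sup>2 * - (\<gamma> t * \<mu> t) = 3 * \<mu> t ^ 2 / P t * (n\<^sup>2 - s t * P t)"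
    using \<gamma>[of t] t p by (simp add: field_simps power2_eq_square)
  then show ?thesis using 0 p by simp
qed

end

section \<open>Vertex conditions of a ground state\<close>

lemma zero_of_quadratic_nonneg:
  fixes a b :: real
  assumes "\<And>r. 0 \<le> 2 * r * a + r\<^sup>2 * b" shows "a = 0"
proof -
  define c where "c = \<bar>b\<bar> + 1"
  have c: "0 < c" "b < c" by (auto simp: c_def)
  have "0 \<le> 2 * (- a / c) * a + (- a / c)\<^sup>2 * b" by (rule assms)
  also have "\<dots> = (a\<^sup>2 / c\<^sup>2) * (b - 2 * c)" using c by (simp add: power2_eq_square field_simps)
  finally have "0 \<le> (a\<^sup>2 / c\<^sup>2) * (b - 2 * c)" .
  moreover have "b - 2 * c < 0" using c by simp
  ultimately have "a\<^sup>2 / c\<^sup>2 \<le> 0" by (metis mult_pos_neg not_le)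
  then show ?thesis using c by (simp add: divide_le_0_iff)
qed

lemma formsI:
  "H10_deriv G f f' u \<Longrightarrow> (gint G (\<lambda>e x. (f' e x)\<^sup>2), gint G (\<lambda>e x. (f e x)\<^sup>2), gint G f) \<in> forms G"
  unfolding forms_def by (intro CollectI exI[of _ f] exI[of _ f'] exI[of _ u]) simp

lemma gint_square_lin:
  assumes "\<And>e. e \<in> medges G \<Longrightarrow> (\<lambda>x. (a e x)\<^sup>2) integrable_on {0..len G e}"
    "\<And>e. e \<in> medges G \<Longrightarrow> (\<lambda>x. (b e x)\<^sup>2) integrable_on {0..len G e}"
    "\<And>e. e \<in> medges G \<Longrightarrow> (\<lambda>x. a e x * b e x) integrable_on {0..len G e}"
  shows "gint G (\<lambda>e x. (a e x + r * b e x)\<^sup>2) =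
     gint G (\<lambda>e x. (a e x)\<^sup>2) + 2 * r * gint G (\<lambda>e x. a e x * b e x) + r\<^sup>2 * gint G (\<lambda>e x. (b e x)\<^sup>2)"
  unfolding gint_def sum_distrib_left sum.distrib[symmetric]
proof (rule sum.cong[OF refl])
  fix e assume e: "e \<in> medges G"
  have "((\<lambda>x. (a e x)\<^sup>2 + 2 * r * (a e x * b e x) + r\<^sup>2 * (b e x)\<^sup>2) has_integral
    integral {0..len G e} (\<lambda>x. (a e x)\<^sup>2) + 2 * r * integral {0..len G e} (\<lambda>x. a e x * b e x) + r\<^sup>2 * integral {0..len G e} (\<lambda>x. (b e x)\<^sup>2)) {0..len G e}"
    by (intro has_integral_add has_integral_mult_right integrable_integral assms e)
  moreover have "(a e x)\<^sup>2 + 2 * r * (a e x * b e x) + r\<^sup>2 * (b e x)\<^sup>2 = (a e x + r * b e x)\<^sup>2" for x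
    by (simp add: power2_eq_square algebra_simps)
  ultimately show "integral {0..len G e} (\<lambda>x. (a e x + r * b e x)\<^sup>2) =
    integral {0..len G e} (\<lambda>x. (a e x)\<^sup>2) + 2 * r * integral {0..len G e} (\<lambda>x. a e x * b e x) + r\<^sup>2 * integral {0..len G e} (\<lambda>x. (b e x)\<^sup>2)"
    by (simp add: has_integral_iff)
qed

lemma ground_stateD:
  assumes "ground_state G \<kappa> f f' u"
  shows "0 < \<kappa>" "H10_deriv G f f' u"
    "\<And>e x. e \<in> medges G \<Longrightarrow> (f e has_real_derivative f' e x) (at x)"
    "\<And>e x. e \<in> medges G \<Longrightarrow> (f' e has_real_derivative - \<kappa> * f e x) (at x)"
    "\<And>e x. e \<in> medges G \<Longrightarrow> 0 \<le> x \<Longrightarrow> x \<le> len G e \<Longrightarrow> 0 \<le> f e x"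
    "\<And>e. e \<in> medges G \<Longrightarrow> (\<forall>x\<in>{0<..<len G e}. 0 < f e x) \<or> (\<forall>x\<in>{0..len G e}. f e x = 0)"
    "0 < gint G (\<lambda>e x. (f e x)\<^sup>2)" "gint G (\<lambda>e x. (f' e x)\<^sup>2) = \<kappa> * gint G (\<lambda>e x. (f e x)\<^sup>2)"
    "\<And>E F I. (E, F, I) \<in> forms G \<Longrightarrow> \<kappa> * F \<le> E"
    "\<And>e S. e \<in> medges G \<Longrightarrow> continuous_on S (f e)" "\<And>e S. e \<in> medges G \<Longrightarrow> continuous_on S (f' e)"
proof -
  show *: "0 < \<kappa>" "H10_deriv G f f' u"
    "\<And>e x. e \<in> medges G \<Longrightarrow> (f e has_real_derivative f' e x) (at x)"
    "\<And>e x. e \<in> medges G \<Longrightarrow> (f' e has_real_derivative - \<kappa> * f e x) (at x)"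
    "\<And>e x. e \<in> medges G \<Longrightarrow> 0 \<le> x \<Longrightarrow> x \<le> len G e \<Longrightarrow> 0 \<le> f e x"
    "\<And>e. e \<in> medges G \<Longrightarrow> (\<forall>x\<in>{0<..<len G e}. 0 < f e x) \<or> (\<forall>x\<in>{0..len G e}. f e x = 0)"
    "0 < gint G (\<lambda>e x. (f e x)\<^sup>2)" "gint G (\<lambda>e x. (f' e x)\<^sup>2) = \<kappa> * gint G (\<lambda>e x. (f e x)\<^sup>2)"
    using assms unfolding ground_state_def by auto
  show "\<And>E F I. (E, F, I) \<in> forms G \<Longrightarrow> \<kappa> * F \<le> E" using assms unfolding ground_state_def by blast
  show "\<And>e S. e \<in> medges G \<Longrightarrow> continuous_on S (f e)" "\<And>e S. e \<in> medges G \<Longrightarrow> continuous_on S (f' e)"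
    using *(3,4) by (meson DERIV_isCont continuous_at_imp_continuous_on)+
qed

text \<open>The first variation of the energy in the direction of the edgewise linear function with
  vertex values \<open>\<xi>\<close>. Keeping \<open>\<xi>\<close> general gives Kirchhoff's law
  summed over any set of non-Dirichlet vertices at once.\<close>

lemma kirchhoff:
  assumes G: "finite_metric_graph G" and gs: "ground_state G \<kappa> f f' u" and D: "\<And>w. w \<in> dirichlet G \<Longrightarrow> \<xi> w = 0"
  shows "(\<Sum>e\<in>medges G. f' e (len G e) * \<xi> (mhead G e) - f' e 0 * \<xi> (mtail G e)) = 0"
proof -
  note fG = finite_metric_graphD[OF G] and g = ground_stateD[OF gs]
  note fD = H10_derivD[OF g(2)]
  define p' where "p' e = (\<xi> (mhead G e) - \<xi> (mtail G e)) / len G e" for e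
  define p where "p e x = \<xi> (mtail G e) + p' e * x" for e x
  have dp: "(p e has_real_derivative p' e) (at x)" for e x
    unfolding p_def[abs_def] by (auto intro!: derivative_eq_intros)
  have cp: "continuous_on S (p e)" for S e unfolding p_def[abs_def] by (intro continuous_intros)
  have ends: "p e 0 = \<xi> (mtail G e)" "p e (len G e) = \<xi> (mhead G e)" if "e \<in> medges G" for e
    using fG(3)[OF that] by (auto simp: p_def p'_def)
  have Hp: "H1_deriv (len G e) (p e) (\<lambda>x. p' e)" if "e \<in> medges G" for e
    using fG(3)[OF that] by (intro H1_deriv_C1 dp) auto
  let ?X = "gint G (\<lambda>e x. f' e x * p' e)" and ?Y = "gint G (\<lambda>e x. f e x * p e x)"
  have "0 \<le> 2 * r * (?X - \<kappa> * ?Y) + r\<^sup>2 * (gint G (\<lambda>e x. (p' e)\<^sup>2) - \<kappa> * gint G (\<lambda>e x. (p e x)\<^sup>2))" for r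
  proof -
    have "H10_deriv G (\<lambda>e x. f e x + r * p e x) (\<lambda>e x. f' e x + r * p' e) (\<lambda>v. u v + r * \<xi> v)"
      unfolding H10_deriv_def vertex_values_def
    proof (intro conjI ballI)
      fix e assume e: "e \<in> medges G"
      show "H1_deriv (len G e) (\<lambda>x. f e x + r * p e x) (\<lambda>x. f' e x + r * p' e)"
        using H1_deriv_lin[OF fD(1)[OF e] Hp[OF e], of 1 r] by simp
      show "f e 0 + r * p e 0 = u (mtail G e) + r * \<xi> (mtail G e)" by (simp add: fD(2)[OF e] ends(1)[OF e])
      show "f e (len G e) + r * p e (len G e) = u (mhead G e) + r * \<xi> (mhead G e)" by (simp add: fD(3)[OF e] ends(2)[OF e])
    qed (simp add: D fD(4))
    from formsI[OF this] have "\<kappa> * gint G (\<lambda>e x. (f e x + r * p e x)\<^sup>2) \<le> gint G (\<lambda>e x. (f' e x + r * p' e)\<^sup>2)"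
      by (rule g(9))
    moreover have "gint G (\<lambda>e x. (f e x + r * p e x)\<^sup>2) = gint G (\<lambda>e x. (f e x)\<^sup>2) + 2 * r * ?Y + r\<^sup>2 * gint G (\<lambda>e x. (p e x)\<^sup>2)"
      by (rule gint_square_lin) (auto intro!: integrable_continuous_real continuous_intros g(10) cp)
    moreover have "gint G (\<lambda>e x. (f' e x + r * p' e)\<^sup>2) = gint G (\<lambda>e x. (f' e x)\<^sup>2) + 2 * r * ?X + r\<^sup>2 * gint G (\<lambda>e x. (p' e)\<^sup>2)"
      by (rule gint_square_lin) (auto intro!: integrable_continuous_real continuous_intros g(11))
    ultimately show ?thesis using g(8) by (simp add: algebra_simps)
  qed
  then have XY: "?X - \<kappa> * ?Y = 0" by (rule zero_of_quadratic_nonneg)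
  have "(\<Sum>e\<in>medges G. f' e (len G e) * \<xi> (mhead G e) - f' e 0 * \<xi> (mtail G e)) = ?X - \<kappa> * ?Y"
    unfolding gint_def sum_distrib_left sum_subtractf[symmetric]
  proof (rule sum.cong[OF refl])
    fix e assume e: "e \<in> medges G"
    have "((\<lambda>x. f' e x * p' e + (- \<kappa> * f e x) * p e x) has_integral f' e (len G e) * p e (len G e) - f' e 0 * p e 0) {0..len G e}"
      by (rule fundamental_theorem_of_calculus)
        (use fG(3)[OF e] in \<open>auto simp: has_real_derivative_iff_has_vector_derivative[symmetric]
           intro!: has_field_derivative_at_within DERIV_mult'[OF g(4)[OF e] dp, simplified]\<close>)
    moreover have "((\<lambda>x. f' e x * p' e + (- \<kappa>) * (f e x * p e x)) has_integral integral {0..len G e} (\<lambda>x. f' e x * p' e) + (- \<kappa>) * integral {0..len G e} (\<lambda>x. f e x * p e x)) {0..len G e}"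
      by (intro has_integral_add has_integral_mult_right integrable_integral integrable_continuous_real continuous_intros g(10,11) e cp)
    ultimately show "f' e (len G e) * \<xi> (mhead G e) - f' e 0 * \<xi> (mtail G e) =
        integral {0..len G e} (\<lambda>x. f' e x * p' e) - \<kappa> * integral {0..len G e} (\<lambda>x. f e x * p e x)"
      by (simp add: ends[OF e] has_integral_iff mult.assoc)
  qed
  then show ?thesis using XY by simp
qed

section \<open>Clamped inverse of a monotone function\<close>

text \<open>Clamping makes the inverse total and continuous: it is \<open>0\<close> for levels below
  the edge and \<open>l\<close> for levels above. Sums over all edges then need no case distinction
  by level.\<close>

definition clamp_inv :: "real \<Rightarrow> (real \<Rightarrow> real) \<Rightarrow> real \<Rightarrow> real" where
  "clamp_inv l f t = inv_into {0..l} f (max (f 0) (min (f l) t))"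

text \<open>The derivative is required to be positive only inside the edge, because at an end
  created by cutting at a critical point it vanishes.\<close>

locale increasing_edge =
  fixes l :: real and f f' :: "real \<Rightarrow> real"
  assumes l: "0 < l" and d: "\<And>x. (f has_real_derivative f' x) (at x)" and p: "\<And>x. 0 < x \<Longrightarrow> x < l \<Longrightarrow> 0 < f' x"
begin

abbreviation y where "y \<equiv> clamp_inv l f"

lemma cont: "continuous_on S f" using d by (meson DERIV_isCont continuous_at_imp_continuous_on)

lemma strict: assumes "0 \<le> a" "a < b" "b \<le> l" shows "f a < f b"
  by (rule DERIV_pos_imp_increasing_open[OF assms(2)]) (use assms d p cont in \<open>auto intro!: exI\<close>)

lemma inj: "inj_on f {0..l}"
  by (rule inj_onI) (metis atLeastAtMost_iff less_irrefl linorder_less_linear strict)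

lemma mono: assumes "0 \<le> a" "a \<le> b" "b \<le> l" shows "f a \<le> f b"
  using strict[of a b] assms by (cases "a = b") auto

lemma image: "f ` {0..l} = {f 0..f l}"
proof
  show "f ` {0..l} \<subseteq> {f 0..f l}" using mono by auto
  show "{f 0..f l} \<subseteq> f ` {0..l}"
  proof
    fix t assume "t \<in> {f 0..f l}"
    then obtain x where "0 \<le> x" "x \<le> l" "f x = t" using IVT'[of f 0 t l] l cont by auto
    then show "t \<in> f ` {0..l}" by auto
  qed
qed

lemma y_in: "y t \<in> {0..l}" and f_y: "f (y t) = max (f 0) (min (f l) t)"
proof -
  have "max (f 0) (min (f l) t) \<in> f ` {0..l}" using image mono[of 0 l] l by auto
  then show "y t \<in> {0..l}" "f (y t) = max (f 0) (min (f l) t)"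
    unfolding clamp_inv_def by (rule inv_into_into f_inv_into_f)+
qed

lemma y_f: "x \<in> {0..l} \<Longrightarrow> max (f 0) (min (f l) t) = f x \<Longrightarrow> y t = x"
  unfolding clamp_inv_def by (simp add: inj)

lemma y_low: "t \<le> f 0 \<Longrightarrow> y t = 0" using y_f[of 0 t] l by simp

lemma y_high: "f l \<le> t \<Longrightarrow> y t = l" using y_f[of l t] l mono[of 0 l] by simp

lemma y_lt: "t < f l \<Longrightarrow> y t < l"
  using f_y[of t] y_in[of t] strict[of 0 l] l by (cases "y t = l") auto

lemma y_gt: "f 0 < t \<Longrightarrow> 0 < y t"
  using f_y[of t] y_in[of t] strict[of 0 l] l by (cases "y t = 0") auto

lemma le_f_y: "t < f l \<Longrightarrow> t \<le> f (y t)" using f_y[of t] by simp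

lemma cont_y: "continuous_on S y"
proof -
  have "continuous_on (f ` {0..l}) (inv_into {0..l} f)"
    by (rule continuous_on_inv[OF cont]) (auto simp: inj)
  then have c: "continuous_on {f 0..f l} (inv_into {0..l} f)" by (simp add: image)
  have "continuous_on S (\<lambda>t. inv_into {0..l} f (max (f 0) (min (f l) t)))"
    by (rule continuous_on_compose2[OF c]) (use mono[of 0 l] l in \<open>auto intro!: continuous_intros\<close>)
  then show ?thesis by (simp add: clamp_inv_def[abs_def])
qed

lemma y_deriv:
  assumes "f 0 < t" "t < f l" shows "(y has_real_derivative inverse (f' (y t))) (at t)"
proof (rule DERIV_inverse_function[where f = f and a = "f 0" and b = "f l"])
  show "f' (y t) \<noteq> 0" using p[of "y t"] y_lt y_gt assms by auto
  show "f (y z) = z" if "f 0 < z" "z < f l" for z using f_y[of z] that by simp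
  show "isCont y t" using cont_y[of UNIV] by (simp add: continuous_on_eq_continuous_at)
qed (use assms d in auto)

text \<open>Off the range of \<open>f\<close> the clamped inverse is locally constant, so only edges
  crossing the level contribute to a derivative with respect to the level.\<close>

lemma comp_deriv:
  assumes A: "\<And>x. 0 < x \<Longrightarrow> x < l \<Longrightarrow> (A has_real_derivative a x) (at x)" and t: "t \<noteq> f 0" "t \<noteq> f l"
  shows "((\<lambda>t. A (y t)) has_real_derivative (if f 0 < t \<and> t < f l then a (y t) * inverse (f' (y t)) else 0)) (at t)"
proof (cases "f 0 < t \<and> t < f l")
  case True
  then show ?thesis using DERIV_chain2[OF A[of "y t"] y_deriv[of t]] y_lt[of t] y_gt[of t] by simp
next
  case False
  have "\<exists>c. \<forall>\<^sub>F z in nhds t. A (y z) = c"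
  proof (cases "t < f 0")
    case True
    have "\<forall>\<^sub>F z in nhds t. z \<in> {..<f 0}" by (rule eventually_nhds_in_open) (use True in auto)
    then have "\<forall>\<^sub>F z in nhds t. A (y z) = A 0" by eventually_elim (auto simp: y_low)
    then show ?thesis by blast
  next
    case F: False
    have "\<forall>\<^sub>F z in nhds t. z \<in> {f l<..}" by (rule eventually_nhds_in_open) (use F False t in auto)
    then have "\<forall>\<^sub>F z in nhds t. A (y z) = A l" by eventually_elim (auto simp: y_high)
    then show ?thesis by blast
  qed
  then obtain c where "\<forall>\<^sub>F z in nhds t. A (y z) = c" by blast
  then have "((\<lambda>t. A (y t)) has_real_derivative 0) (at t)"
    by (subst DERIV_cong_ev[of t t _ "\<lambda>z. c" 0 0]) auto
  then show ?thesis unfolding if_not_P[OF False] .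
qed

lemma comp_cont:
  assumes "continuous_on {0..l} A" shows "continuous_on S (\<lambda>t. A (y t))"
  by (rule continuous_on_compose2[OF assms cont_y]) (use y_in in auto)

end

text \<open>Lagrange's identity instead of the Cauchy-Schwarz inequality: the explicit remainder
  also yields the case of equality, in which all \<open>a i\<close> agree.\<close>

lemma sum_mult_sum_inverse:
  fixes a :: "'a \<Rightarrow> real"
  assumes "finite S" "\<And>i. i \<in> S \<Longrightarrow> 0 < a i"
  shows "(\<Sum>i\<in>S. inverse (a i)) * (\<Sum>i\<in>S. a i) = (real (card S))\<^sup>2 + (\<Sum>i\<in>S. \<Sum>j\<in>S. (a i - a j)\<^sup>2 / (a i * a j)) / 2"
proof -
  have "(\<Sum>i\<in>S. \<Sum>j\<in>S. (a i - a j)\<^sup>2 / (a i * a j)) = (\<Sum>i\<in>S. \<Sum>j\<in>S. a i * inverse (a j) + inverse (a i) * a j - 2)"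
  proof (intro sum.cong refl)
    fix i j assume "i \<in> S" "j \<in> S"
    then have "0 < a i" "0 < a j" using assms(2) by auto
    then show "(a i - a j)\<^sup>2 / (a i * a j) = a i * inverse (a j) + inverse (a i) * a j - 2"
      by (simp add: field_simps power2_eq_square)
  qed
  also have "\<dots> = (\<Sum>i\<in>S. a i) * (\<Sum>i\<in>S. inverse (a i)) + (\<Sum>i\<in>S. inverse (a i)) * (\<Sum>i\<in>S. a i) - 2 * (real (card S))\<^sup>2"
    by (simp add: sum.distrib sum_subtractf sum_product power2_eq_square)
  finally have "(\<Sum>i\<in>S. \<Sum>j\<in>S. (a i - a j)\<^sup>2 / (a i * a j)) = 2 * ((\<Sum>i\<in>S. inverse (a i)) * (\<Sum>i\<in>S. a i)) - 2 * (real (card S))\<^sup>2"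
    by (simp add: mult.commute)
  then show ?thesis by linarith
qed

section \<open>The level functions of a monotone ground state\<close>

locale monotone_state =
  fixes G :: "('v, 'e) metric_graph" and N :: nat and \<kappa> :: real and f f' :: "'e \<Rightarrow> real \<Rightarrow> real" and u :: "'v \<Rightarrow> real"
  assumes G: "finite_metric_graph G" and N: "1 \<le> N" and cut: "cut_ge N G" and gs: "ground_state G \<kappa> f f' u"
    and mono: "\<And>e. e \<in> medges G \<Longrightarrow> (\<forall>x\<in>{0<..<len G e}. 0 < f e x \<and> 0 < f' e x) \<or> (\<forall>x\<in>{0..len G e}. f e x = 0)"
begin

lemmas fG = finite_metric_graphD[OF G]
lemmas g = ground_stateD[OF gs]
lemmas fD = H10_derivD[OF g(2)]

definition A where "A = {e\<in>medges G. \<forall>x\<in>{0<..<len G e}. 0 < f e x \<and> 0 < f' e x}"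

lemma A_medges: "e \<in> A \<Longrightarrow> e \<in> medges G" by (simp add: A_def)

lemma finite_A: "finite A" using fG(2) by (simp add: A_def)

lemma not_A: "e \<in> medges G \<Longrightarrow> e \<notin> A \<Longrightarrow> x \<in> {0..len G e} \<Longrightarrow> f e x = 0"
  using mono unfolding A_def by blast

lemma inc: "e \<in> A \<Longrightarrow> increasing_edge (len G e) (f e) (f' e)"
  using fG(3) g(3) by unfold_locales (auto simp: A_def)

abbreviation Y where "Y e \<equiv> clamp_inv (len G e) (f e)"

definition crossing where "crossing t = {e\<in>A. f e 0 < t \<and> t < f e (len G e)}"
text \<open>Contains every level at which one of the clamped inverses may have a kink.\<close>

definition crit where "crit = u ` mverts G"
definition M where "M = Max crit"
definition \<mu> where "\<mu> t = (\<Sum>e\<in>A. len G e - Y e t)"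
text \<open>Since \<open>f'' = - \<kappa> * f\<close>, each summand is the integral of
  \<open>\<kappa> * f\<close> over the part of the edge above level \<open>t\<close>.\<close>

definition P where "P t = (\<Sum>e\<in>A. f' e (Y e t) - f' e (len G e))"
definition s where "s t = (\<Sum>e\<in>crossing t. inverse (f' e (Y e t)))"
text \<open>At the top level \<open>\<mu>\<close> and \<open>P\<close> both vanish; the assigned
  value is the limit of their quotient, found by the squeeze in \<open>level_bounds\<close>.\<close>

definition \<gamma> where "\<gamma> t = (if t < M then \<mu> t / P t else 1 / (\<kappa> * M))"

lemma finite_crit: "finite crit" using fG(1) by (simp add: crit_def)

lemma ends_crit: "e \<in> medges G \<Longrightarrow> f e 0 \<in> crit" "e \<in> medges G \<Longrightarrow> f e (len G e) \<in> crit"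
  using fD(2,3) fG(4,5) by (auto simp: crit_def)

lemma le_M: "e \<in> medges G \<Longrightarrow> f e (len G e) \<le> M" "v \<in> mverts G \<Longrightarrow> u v \<le> M"
  unfolding M_def using ends_crit finite_crit by (auto simp: crit_def)

lemma f0_nonneg: "e \<in> medges G \<Longrightarrow> 0 \<le> f e 0" using g(5)[of e 0] fG(3)[of e] by simp

lemma A_nonempty: "A \<noteq> {}"
proof
  assume "A = {}"
  then have "f e x = 0" if "e \<in> medges G" "x \<in> {0..len G e}" for e x using not_A that by auto
  then have "\<not> nonzero_on G f" by (auto simp: nonzero_on_def)
  then show False using gint_square_eq_0_iff[OF G fD(5)] g(7) by simp
qed

lemma M_pos: "0 < M"
proof -
  obtain e where e: "e \<in> A" using A_nonempty by blast
  interpret increasing_edge "len G e" "f e" "f' e" by (rule inc[OF e])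
  show ?thesis using strict[of 0 "len G e"] l f0_nonneg le_M(1) A_medges[OF e] by (smt (verit))
qed

lemma M_vertex: obtains v where "v \<in> mverts G" "u v = M"
proof -
  have "crit \<noteq> {}" using A_nonempty ends_crit A_medges by blast
  then have "M \<in> crit" unfolding M_def by (rule Max_in[OF finite_crit])
  then show ?thesis using that by (auto simp: crit_def)
qed

lemma boundary_crossing:
  assumes t: "0 \<le> t" "t \<notin> crit" shows "boundary G {v \<in> mverts G. t < u v} = crossing t"
proof
  show "crossing t \<subseteq> boundary G {v \<in> mverts G. t < u v}"
    using fD(2,3) fG(4,5) by (auto simp: crossing_def boundary_def A_def)
  show "boundary G {v \<in> mverts G. t < u v} \<subseteq> crossing t"
  proof
    fix e assume e: "e \<in> boundary G {v \<in> mverts G. t < u v}"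
    then have em: "e \<in> medges G" and ne: "(t < f e 0) \<noteq> (t < f e (len G e))"
      using fG(4,5) fD(2,3) by (auto simp: boundary_def)
    have ts: "t \<noteq> f e 0" "t \<noteq> f e (len G e)" using ends_crit[OF em] t by auto
    show "e \<in> crossing t"
    proof (cases "e \<in> A")
      case True
      interpret increasing_edge "len G e" "f e" "f' e" by (rule inc[OF True])
      show ?thesis using True ne ts strict[of 0 "len G e"] l by (auto simp: crossing_def)
    next
      case False
      then show ?thesis using not_A[OF em False, of 0] not_A[OF em False, of "len G e"] ne fG(3)[OF em] by simp
    qed
  qed
qed

text \<open>Edge connectivity becomes a count of points on a level: the vertices above
  \<open>t\<close> form a nonempty set without Dirichlet vertices, and its boundary edges are
  exactly those crossing \<open>t\<close>.\<close>

lemma card_crossing: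
  assumes t: "0 \<le> t" "t < M" "t \<notin> crit" shows "N \<le> card (crossing t)"
proof -
  obtain v where "v \<in> mverts G" "u v = M" by (rule M_vertex)
  then have "{v \<in> mverts G. t < u v} \<noteq> {}" using t by auto
  moreover have "{v \<in> mverts G. t < u v} \<subseteq> mverts G - dirichlet G" using fD(4) t by auto
  ultimately show ?thesis using cut boundary_crossing[OF t(1,3)] unfolding cut_ge_def by metis
qed

lemma finite_crossing: "finite (crossing t)" using finite_A by (simp add: crossing_def)

lemma speed_pos: "e \<in> crossing t \<Longrightarrow> 0 < f' e (Y e t)"
proof -
  assume e: "e \<in> crossing t"
  then interpret increasing_edge "len G e" "f e" "f' e" by (intro inc) (simp add: crossing_def)
  show ?thesis using p[of "y t"] y_gt y_lt e by (auto simp: crossing_def)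
qed

text \<open>The cut condition at a vertex of maximal value supplies an edge there; without it
  \<open>\<mu>\<close> might vanish below the maximum.\<close>

lemma M_edge: obtains e where "e \<in> A" "f e (len G e) = M"
proof -
  obtain v where v: "v \<in> mverts G" "u v = M" by (rule M_vertex)
  have "v \<notin> dirichlet G" using v fD(4) M_pos by auto
  then have "N \<le> card (boundary G {v})" using cut v unfolding cut_ge_def by (metis DiffI empty_iff empty_subsetI insert_not_empty insert_subset)
  then have "boundary G {v} \<noteq> {}" using N by auto
  then obtain e where "e \<in> boundary G {v}" by blast
  then have e: "e \<in> medges G" "f e 0 = M \<or> f e (len G e) = M" using v fD(2,3) by (auto simp: boundary_def)
  have eA: "e \<in> A"
    using not_A[OF e(1), of 0] not_A[OF e(1), of "len G e"] fG(3)[OF e(1)] e M_pos by fastforce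
  interpret increasing_edge "len G e" "f e" "f' e" by (rule inc[OF eA])
  have "f e 0 < f e (len G e)" by (rule strict) (use l in auto)
  then have "f e (len G e) = M" using e le_M(1)[OF e(1)] by auto
  then show ?thesis using that eA by blast
qed

text \<open>By the mean value theorem the slope drops by \<open>\<kappa> * f e z\<close> times the
  length of the upper part of the edge, and \<open>f e z\<close> lies between \<open>t\<close> and
  \<open>M\<close>.\<close>

lemma edge_bounds:
  assumes e: "e \<in> A" and t: "t < f e (len G e)"
  shows "Y e t < len G e" "f' e (len G e) < f' e (Y e t)"
    "\<kappa> * t * (len G e - Y e t) \<le> f' e (Y e t) - f' e (len G e)"
    "f' e (Y e t) - f' e (len G e) \<le> \<kappa> * M * (len G e - Y e t)"
proof -
  have em: "e \<in> medges G" using A_medges[OF e] .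
  interpret increasing_edge "len G e" "f e" "f' e" by (rule inc[OF e])
  show yl: "y t < len G e" by (rule y_lt[OF t])
  have "\<exists>z. y t < z \<and> z < len G e \<and> f' e (len G e) - f' e (y t) = (len G e - y t) * (- \<kappa> * f e z)"
    by (rule MVT2[OF yl]) (rule g(4)[OF em])
  then obtain z where z: "y t < z" "z < len G e" "f' e (len G e) - f' e (y t) = (len G e - y t) * (- \<kappa> * f e z)" by blast
  have y0: "0 \<le> y t" using y_in[of t] by simp
  have fz: "0 < f e z" using e z y0 by (auto simp: A_def)
  have tz: "t \<le> f e z" using le_f_y[OF t] strict[of "y t" z] y0 z by simp
  have zM: "f e z \<le> M" using mono[of z "len G e"] z y0 le_M(1)[OF em] by simp
  have eq: "f' e (y t) - f' e (len G e) = \<kappa> * f e z * (len G e - y t)" using z(3) by (simp add: algebra_simps)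
  have d: "0 \<le> len G e - y t" using yl by simp
  show "\<kappa> * t * (len G e - y t) \<le> f' e (y t) - f' e (len G e)"
    unfolding eq by (intro mult_right_mono mult_left_mono tz d) (use g(1) in simp)
  show "f' e (y t) - f' e (len G e) \<le> \<kappa> * M * (len G e - y t)"
    unfolding eq by (intro mult_right_mono mult_left_mono zM d) (use g(1) in simp)
  have "0 < \<kappa> * f e z * (len G e - y t)" using fz g(1) yl by simp
  then show "f' e (len G e) < f' e (y t)" using eq by simp
qed

lemma edge_high: "e \<in> A \<Longrightarrow> f e (len G e) \<le> t \<Longrightarrow> Y e t = len G e"
  using increasing_edge.y_high[OF inc] by blast

lemma level_bounds:
  shows "\<kappa> * t * \<mu> t \<le> P t" "P t \<le> \<kappa> * M * \<mu> t"
proof -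
  have "\<kappa> * t * (len G e - Y e t) \<le> f' e (Y e t) - f' e (len G e) \<and> f' e (Y e t) - f' e (len G e) \<le> \<kappa> * M * (len G e - Y e t)" if "e \<in> A" for e
    using edge_bounds(3,4)[OF that, of t] edge_high[OF that, of t] by (cases "t < f e (len G e)") auto
  then show "\<kappa> * t * \<mu> t \<le> P t" "P t \<le> \<kappa> * M * \<mu> t"
    unfolding \<mu>_def P_def sum_distrib_left by (auto intro!: sum_mono)
qed

lemma mu_P_pos:
  assumes "t < M" shows "0 < \<mu> t" "0 < P t"
proof -
  obtain e where e: "e \<in> A" "f e (len G e) = M" by (rule M_edge)
  have nn: "0 \<le> len G e - Y e t \<and> 0 \<le> f' e (Y e t) - f' e (len G e)" if "e \<in> A" for e
    using edge_bounds(1,2)[OF that, of t] edge_high[OF that, of t] by (cases "t < f e (len G e)") auto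
  show "0 < \<mu> t" unfolding \<mu>_def
    by (rule sum_pos2[OF finite_A e(1)]) (use edge_bounds(1)[OF e(1)] nn e assms in auto)
  show "0 < P t" unfolding P_def
    by (rule sum_pos2[OF finite_A e(1)]) (use edge_bounds(2)[OF e(1)] nn e assms in auto)
qed

lemma mu_P_M: "\<mu> M = 0" "P M = 0"
  unfolding \<mu>_def P_def using edge_high le_M(1) A_medges by (auto intro!: sum.neutral)

lemma cont_mu_P: "continuous_on S \<mu>" "continuous_on S P"
proof -
  show "continuous_on S \<mu>" unfolding \<mu>_def[abs_def]
    by (intro continuous_on_sum continuous_on_diff continuous_on_const increasing_edge.cont_y[OF inc])
  show "continuous_on S P" unfolding P_def[abs_def]
    by (intro continuous_on_sum continuous_on_diff continuous_on_const increasing_edge.comp_cont[OF inc] g(11) A_medges)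
qed

lemma cont_gamma: "continuous_on {0..M} \<gamma>"
  unfolding continuous_on_eq_continuous_within
proof
  fix t assume t: "t \<in> {0..M}"
  show "continuous (at t within {0..M}) \<gamma>"
  proof (cases "t < M")
    case True
    have "continuous_on {..<M} (\<lambda>t. \<mu> t / P t)"
      by (intro continuous_intros cont_mu_P) (use mu_P_pos in force)
    then have "isCont (\<lambda>t. \<mu> t / P t) t" using True by (auto simp: continuous_on_eq_continuous_at)
    moreover have "\<forall>\<^sub>F z in nhds t. z \<in> {..<M}" by (rule eventually_nhds_in_open) (use True in auto)
    then have "\<forall>\<^sub>F z in nhds t. \<gamma> z = \<mu> z / P z" by eventually_elim (simp add: \<gamma>_def)
    ultimately have "isCont \<gamma> t" by (simp add: isCont_cong)
    then show ?thesis by (rule continuous_at_imp_continuous_within)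
  next
    case False
    then have tM: "t = M" using t by auto
    have "(\<gamma> \<longlongrightarrow> 1 / (\<kappa> * M)) (at M within {0..M})"
    proof (rule tendsto_sandwich)
      have ev: "\<forall>\<^sub>F z in at M within {0..M}. z \<in> {0<..<M}"
        unfolding eventually_at using M_pos by (intro exI[of _ M]) (auto simp: dist_real_def)
      show "\<forall>\<^sub>F z in at M within {0..M}. 1 / (\<kappa> * M) \<le> \<gamma> z"
        using ev
      proof eventually_elim
        case (elim z)
        then show ?case using level_bounds(2)[of z] mu_P_pos[of z] g(1) M_pos
          by (simp add: \<gamma>_def field_simps)
      qed
      show "\<forall>\<^sub>F z in at M within {0..M}. \<gamma> z \<le> 1 / (\<kappa> * z)"
        using ev
      proof eventually_elim
        case (elim z)
        then show ?case using level_bounds(1)[of z] mu_P_pos[of z] g(1) M_pos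
          by (simp add: \<gamma>_def field_simps)
      qed
      show "((\<lambda>z. 1 / (\<kappa> * z)) \<longlongrightarrow> 1 / (\<kappa> * M)) (at M within {0..M})"
        by (intro tendsto_intros) (use g(1) M_pos in auto)
    qed simp
    then show ?thesis using tM by (simp add: continuous_within \<gamma>_def)
  qed
qed

lemma sum_A_crossing: "(\<Sum>e\<in>A. if f e 0 < t \<and> t < f e (len G e) then h e else 0) = sum h (crossing t)"
  unfolding crossing_def by (subst sum.inter_filter[symmetric]) (auto simp: finite_A)

lemma comp_deriv_sum:
  assumes B: "\<And>e x. e \<in> A \<Longrightarrow> 0 < x \<Longrightarrow> x < len G e \<Longrightarrow> (B e has_real_derivative b e x) (at x)" and t: "t \<notin> crit"
  shows "((\<lambda>t. \<Sum>e\<in>A. B e (Y e t)) has_real_derivative (\<Sum>e\<in>crossing t. b e (Y e t) * inverse (f' e (Y e t)))) (at t)"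
proof -
  have "((\<lambda>t. \<Sum>e\<in>A. B e (Y e t)) has_real_derivative (\<Sum>e\<in>A. if f e 0 < t \<and> t < f e (len G e) then b e (Y e t) * inverse (f' e (Y e t)) else 0)) (at t)"
    using t ends_crit A_medges by (intro DERIV_sum increasing_edge.comp_deriv[OF inc] B) auto
  then show ?thesis by (simp only: sum_A_crossing)
qed

lemma mu_deriv:
  assumes t: "t \<notin> crit" shows "(\<mu> has_real_derivative - s t) (at t)"
proof -
  have "((\<lambda>t. \<Sum>e\<in>A. Y e t) has_real_derivative (\<Sum>e\<in>crossing t. 1 * inverse (f' e (Y e t)))) (at t)"
    by (rule comp_deriv_sum[where B = "\<lambda>e x. x", OF _ t]) (rule DERIV_ident)
  from DERIV_diff[OF DERIV_const this, of "\<Sum>e\<in>A. len G e"] show ?thesis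
    by (simp add: \<mu>_def[abs_def] s_def sum_subtractf)
qed

lemma crossing_value: "e \<in> crossing t \<Longrightarrow> f e (Y e t) = t"
  using increasing_edge.f_y[OF inc, of e t] by (simp add: crossing_def)

lemma P_deriv:
  assumes t: "t \<notin> crit" shows "(P has_real_derivative - \<kappa> * t * s t) (at t)"
proof -
  have "((\<lambda>t. \<Sum>e\<in>A. f' e (Y e t)) has_real_derivative (\<Sum>e\<in>crossing t. - \<kappa> * f e (Y e t) * inverse (f' e (Y e t)))) (at t)"
    by (rule comp_deriv_sum[OF _ t]) (use g(4) A_medges in auto)
  moreover have "(\<Sum>e\<in>crossing t. - \<kappa> * f e (Y e t) * inverse (f' e (Y e t))) = - \<kappa> * t * s t"
    unfolding s_def sum_distrib_left by (intro sum.cong refl) (simp add: crossing_value)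
  ultimately have "((\<lambda>t. (\<Sum>e\<in>A. f' e (Y e t)) - (\<Sum>e\<in>A. f' e (len G e))) has_real_derivative - \<kappa> * t * s t - 0) (at t)"
    by (intro DERIV_diff DERIV_const) simp
  then show ?thesis by (simp add: P_def[abs_def] sum_subtractf)
qed

text \<open>The flux through a level is computed by Kirchhoff's law at the vertices above it.\<close>
lemma P_crossing:
  assumes t: "0 \<le> t" "t \<notin> crit" shows "P t = (\<Sum>e\<in>crossing t. f' e (Y e t))"
proof -
  define \<xi> where "\<xi> v = (if t < u v then 1 else 0 :: real)" for v
  have "(\<Sum>e\<in>medges G. f' e (len G e) * \<xi> (mhead G e) - f' e 0 * \<xi> (mtail G e)) = 0"
    by (rule kirchhoff[OF G gs]) (use fD(4) t in \<open>auto simp: \<xi>_def\<close>)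
  moreover have "(\<Sum>e\<in>medges G. f' e (len G e) * \<xi> (mhead G e) - f' e 0 * \<xi> (mtail G e)) =
      (\<Sum>e\<in>A. f' e (len G e) * \<xi> (mhead G e) - f' e 0 * \<xi> (mtail G e))"
  proof (rule sum.mono_neutral_right[OF fG(2)])
    show "\<forall>e\<in>medges G - A. f' e (len G e) * \<xi> (mhead G e) - f' e 0 * \<xi> (mtail G e) = 0"
    proof
      fix e assume e: "e \<in> medges G - A"
      then have "u (mhead G e) = 0" "u (mtail G e) = 0"
        using not_A[of e 0] not_A[of e "len G e"] fD(2,3)[of e] fG(3)[of e] by auto
      then show "f' e (len G e) * \<xi> (mhead G e) - f' e 0 * \<xi> (mtail G e) = 0" using t by (simp add: \<xi>_def)
    qed
  qed (auto simp: A_def)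
  ultimately have "P t = (\<Sum>e\<in>A. f' e (Y e t) - f' e (len G e)) + (\<Sum>e\<in>A. f' e (len G e) * \<xi> (mhead G e) - f' e 0 * \<xi> (mtail G e))"
    by (simp add: P_def)
  also have "\<dots> = (\<Sum>e\<in>A. if f e 0 < t \<and> t < f e (len G e) then f' e (Y e t) else 0)"
    unfolding sum.distrib[symmetric]
  proof (rule sum.cong[OF refl])
    fix e assume e: "e \<in> A"
    then have em: "e \<in> medges G" by (rule A_medges)
    interpret increasing_edge "len G e" "f e" "f' e" by (rule inc[OF e])
    have lt: "f e 0 < f e (len G e)" by (rule strict) (use l in auto)
    have ne: "f e 0 \<noteq> t" "f e (len G e) \<noteq> t" using ends_crit[OF em] t by auto
    show "f' e (y t) - f' e (len G e) + (f' e (len G e) * \<xi> (mhead G e) - f' e 0 * \<xi> (mtail G e)) =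
        (if f e 0 < t \<and> t < f e (len G e) then f' e (y t) else 0)"
      unfolding \<xi>_def fD(2)[OF em, symmetric] fD(3)[OF em, symmetric]
      using lt ne y_low[of t] y_high[of t] by auto
  qed
  finally show ?thesis by (simp only: sum_A_crossing)
qed

text \<open>Lagrange's identity for the slopes at the crossing points bounds \<open>s * P\<close>
  below by the square of their number, which is at least \<open>N\<close>. Equality fixes the number
  and makes the remainder vanish, so the slopes agree.\<close>

lemma iso:
  assumes t: "0 \<le> t" "t < M" "t \<notin> crit"
  shows "(real N)\<^sup>2 \<le> s t * P t"
    "s t * P t = (real N)\<^sup>2 \<Longrightarrow> card (crossing t) = N"
    "s t * P t = (real N)\<^sup>2 \<Longrightarrow> e1 \<in> crossing t \<Longrightarrow> e2 \<in> crossing t \<Longrightarrow> f' e1 (Y e1 t) = f' e2 (Y e2 t)"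
proof -
  let ?a = "\<lambda>e. f' e (Y e t)" and ?S = "crossing t"
  let ?Q = "\<Sum>i\<in>?S. \<Sum>j\<in>?S. (?a i - ?a j)\<^sup>2 / (?a i * ?a j)"
  have eq: "s t * P t = (real (card ?S))\<^sup>2 + ?Q / 2"
    unfolding P_crossing[OF t(1,3)] s_def by (rule sum_mult_sum_inverse[OF finite_crossing speed_pos])
  have nn: "0 \<le> (?a i - ?a j)\<^sup>2 / (?a i * ?a j)" if "i \<in> ?S" "j \<in> ?S" for i j
    using speed_pos[OF that(1)] speed_pos[OF that(2)] by simp
  have Q: "0 \<le> ?Q" by (intro sum_nonneg nn)
  have c: "(real N)\<^sup>2 \<le> (real (card ?S))\<^sup>2" using card_crossing[OF t] by (intro power_mono) auto
  show "(real N)\<^sup>2 \<le> s t * P t" using eq Q c by linarith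
  assume e: "s t * P t = (real N)\<^sup>2"
  then have "(real N)\<^sup>2 = (real (card ?S))\<^sup>2" and Q0: "?Q = 0" using eq Q c by linarith+
  then show "card ?S = N" by simp
  assume e12: "e1 \<in> ?S" "e2 \<in> ?S"
  have "\<forall>i\<in>?S. (\<Sum>j\<in>?S. (?a i - ?a j)\<^sup>2 / (?a i * ?a j)) = 0"
    using Q0 by (subst (asm) sum_nonneg_eq_0_iff) (auto intro!: finite_crossing sum_nonneg nn)
  then have "(\<Sum>j\<in>?S. (?a e1 - ?a j)\<^sup>2 / (?a e1 * ?a j)) = 0" using e12 by blast
  then have "\<forall>j\<in>?S. (?a e1 - ?a j)\<^sup>2 / (?a e1 * ?a j) = 0"
    using e12 by (subst (asm) sum_nonneg_eq_0_iff) (auto intro!: finite_crossing nn)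
  then have "(?a e1 - ?a e2)\<^sup>2 / (?a e1 * ?a e2) = 0" using e12 by blast
  then show "?a e1 = ?a e2" using speed_pos[OF e12(1)] speed_pos[OF e12(2)] by simp
qed

text \<open>The eigenvalue identity in the level variable: the left-hand side is the energy of the
  ground state and \<open>2 * \<integral> t * \<mu>\<close> its squared norm. It is proved directly
  from \<open>P' = - \<kappa> * t * s\<close> and \<open>\<mu>' = - s\<close>, as
  \<open>\<kappa> * t\<^sup>2 * \<mu> - t * P\<close> vanishes at both extreme levels.\<close>

lemma energy: "integral {0..M} P = 2 * \<kappa> * integral {0..M} (\<lambda>t. t * \<mu> t)"
proof -
  have "((\<lambda>t. 2 * \<kappa> * (t * \<mu> t) - P t) has_integral (\<kappa> * M\<^sup>2 * \<mu> M - M * P M) - (\<kappa> * 0\<^sup>2 * \<mu> 0 - 0 * P 0)) {0..M}"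
  proof (rule integral_eq_finite_exceptions[OF _ finite_crit, where F = "\<lambda>t. \<kappa> * t\<^sup>2 * \<mu> t - t * P t"])
    show "continuous_on {0..M} (\<lambda>t. \<kappa> * t\<^sup>2 * \<mu> t - t * P t)" by (intro continuous_intros cont_mu_P)
    fix t assume t: "0 < t" "t < M" "t \<notin> crit"
    have "((\<lambda>t. \<kappa> * t\<^sup>2 * \<mu> t - t * P t) has_real_derivative ((\<kappa> * (2 * t)) * \<mu> t + - s t * (\<kappa> * t\<^sup>2)) - (1 * P t + (- \<kappa> * t * s t) * t)) (at t)"
      by (intro DERIV_diff DERIV_mult mu_deriv P_deriv t DERIV_ident DERIV_cmult) (auto intro!: derivative_eq_intros)
    then show "((\<lambda>t. \<kappa> * t\<^sup>2 * \<mu> t - t * P t) has_real_derivative 2 * \<kappa> * (t * \<mu> t) - P t) (at t)"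
      by (simp add: power2_eq_square algebra_simps)
  qed (use M_pos in auto)
  then have "((\<lambda>t. 2 * \<kappa> * (t * \<mu> t) - P t) has_integral 0) {0..M}" by (simp add: mu_P_M)
  moreover have "((\<lambda>t. 2 * \<kappa> * (t * \<mu> t) - P t) has_integral 2 * \<kappa> * integral {0..M} (\<lambda>t. t * \<mu> t) - integral {0..M} P) {0..M}"
    by (intro has_integral_diff has_integral_mult_right integrable_integral integrable_continuous_real continuous_intros cont_mu_P)
  ultimately have "0 = 2 * \<kappa> * integral {0..M} (\<lambda>t. t * \<mu> t) - integral {0..M} P" by (rule has_integral_unique)
  then show ?thesis by simp
qed

sublocale L: level_functions M \<kappa> "real N" \<mu> P s \<gamma> crit
proof
  show "0 < M" by (rule M_pos)
  show "0 < \<kappa>" by (rule g(1))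
  show "0 < real N" using N by simp
  show "continuous_on {0..M} \<mu>" "continuous_on {0..M} P" by (rule cont_mu_P)+
  show "integral {0..M} P = 2 * \<kappa> * integral {0..M} (\<lambda>t. t * \<mu> t)" by (rule energy)
  show "finite crit" by (rule finite_crit)
  show "continuous_on {0..M} \<gamma>" by (rule cont_gamma)
qed (auto simp: mu_P_pos mu_P_M \<gamma>_def mu_deriv iso)

section \<open>The competitor for the torsional rigidity\<close>

text \<open>Extends \<open>\<gamma>\<close> continuously to the line. The functions
  \<open>f e\<close> have derivatives on the whole line and may leave the range from
  \<open>0\<close> to \<open>M\<close> there, and the chain rule is applied at every point.\<close>

definition gm :: "real \<Rightarrow> real" where "gm t = \<gamma> (max 0 (min M t))"

lemma cont_gm: "continuous_on S gm"
  unfolding gm_def by (rule continuous_on_compose2[OF cont_gamma]) (use M_pos in \<open>auto intro!: continuous_intros\<close>)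

definition pr :: "real \<Rightarrow> real" where "pr = (SOME g. g 0 = 0 \<and> (\<forall>t. (g has_real_derivative gm t) (at t)))"

lemma pr: "pr 0 = 0" "(pr has_real_derivative gm t) (at t)"
proof -
  have "\<exists>F. \<forall>x :: real. -\<infinity> < ereal x \<longrightarrow> ereal x < \<infinity> \<longrightarrow> (F has_vector_derivative gm x) (at x)"
    by (rule einterval_antiderivative) (use cont_gm[of UNIV] in \<open>auto simp: continuous_on_eq_continuous_at\<close>)
  then obtain F where F: "\<And>x. (F has_real_derivative gm x) (at x)"
    by (auto simp: has_real_derivative_iff_has_vector_derivative)
  have "((\<lambda>x. F x - F 0) has_real_derivative gm t) (at t)" for t
    using DERIV_diff[OF F[of t] DERIV_const[of "F 0"]] by simp
  then have "\<exists>g. g 0 = 0 \<and> (\<forall>t. (g has_real_derivative gm t) (at t))" by (intro exI[of _ "\<lambda>x. F x - F 0"]) simp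
  from someI_ex[OF this] show "pr 0 = 0" "(pr has_real_derivative gm t) (at t)" unfolding pr_def by auto
qed

lemma cont_pr: "continuous_on S pr" using pr(2) by (meson DERIV_isCont continuous_at_imp_continuous_on)

definition \<phi> where "\<phi> e x = pr (f e x)"
definition \<phi>' where "\<phi>' e x = gm (f e x) * f' e x"

lemma phi_deriv: "e \<in> medges G \<Longrightarrow> (\<phi> e has_real_derivative \<phi>' e x) (at x)"
  unfolding \<phi>_def[abs_def] \<phi>'_def using DERIV_chain2[OF pr(2) g(3)] by blast

lemma cont_phi: "e \<in> medges G \<Longrightarrow> continuous_on S (\<phi> e)" "e \<in> medges G \<Longrightarrow> continuous_on S (\<phi>' e)"
proof -
  show "e \<in> medges G \<Longrightarrow> continuous_on S (\<phi> e)" unfolding \<phi>_def[abs_def]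
    by (rule continuous_on_compose2[OF cont_pr[of UNIV] g(10)]) auto
  show "e \<in> medges G \<Longrightarrow> continuous_on S (\<phi>' e)" unfolding \<phi>'_def[abs_def]
    by (intro continuous_on_mult g(11) continuous_on_compose2[OF cont_gm[of UNIV] g(10)]) auto
qed

lemma phi_H10: "H10_deriv G \<phi> \<phi>' (\<lambda>v. pr (u v))"
  unfolding H10_deriv_def vertex_values_def
proof (intro conjI ballI)
  fix e assume e: "e \<in> medges G"
  show "H1_deriv (len G e) (\<phi> e) (\<phi>' e)" using fG(3)[OF e] by (intro H1_deriv_C1 phi_deriv cont_phi e) auto
  show "\<phi> e 0 = pr (u (mtail G e))" "\<phi> e (len G e) = pr (u (mhead G e))" using fD(2,3)[OF e] by (auto simp: \<phi>_def)
qed (simp add: fD(4) pr(1))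

lemma phi_not_A:
  assumes "e \<in> medges G" "e \<notin> A"
  shows "x \<in> {0..len G e} \<Longrightarrow> \<phi> e x = 0" "x \<in> {0<..<len G e} \<Longrightarrow> \<phi>' e x = 0"
proof -
  show z: "\<phi> e x = 0" if "x \<in> {0..len G e}" for x using not_A[OF assms that] pr(1) by (simp add: \<phi>_def)
  assume x: "x \<in> {0<..<len G e}"
  have "\<forall>\<^sub>F z in nhds x. z \<in> {0<..<len G e}" by (rule eventually_nhds_in_open) (use x in auto)
  then have "\<forall>\<^sub>F z in nhds x. \<phi> e z = 0" by eventually_elim (auto intro: z)
  then have "(\<phi> e has_real_derivative 0) (at x)"
    by (subst DERIV_cong_ev[of x x _ "\<lambda>z. 0" 0 0]) auto
  then show "\<phi>' e x = 0" using phi_deriv[OF assms(1), of x] DERIV_unique by blast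
qed

lemma A_ends: "e \<in> A \<Longrightarrow> Y e 0 = 0" "e \<in> A \<Longrightarrow> Y e M = len G e"
  using increasing_edge.y_low[OF inc] increasing_edge.y_high[OF inc] f0_nonneg le_M(1) A_medges by auto

text \<open>A change of variables from position to level: the energy \<open>B\<close> collected
  along each edge up to level \<open>t\<close> has total derivative
  \<open>\<gamma>\<^sup>2 * P\<close>, which equals \<open>\<gamma> * \<mu>\<close> by the choice of
  \<open>\<gamma>\<close>.\<close>

lemma phi_energy: "gint G (\<lambda>e x. (\<phi>' e x)\<^sup>2) = L.T0"
proof -
  define B where "B e x = integral {0..x} (\<lambda>x. (\<phi>' e x)\<^sup>2)" for e x
  have cB: "continuous_on {0..len G e} (B e)" if "e \<in> A" for e unfolding B_def
    by (intro indefinite_integral_continuous_1 integrable_continuous_real continuous_intros cont_phi A_medges that)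
  have "((\<lambda>t. \<gamma> t * \<mu> t) has_integral (\<Sum>e\<in>A. B e (Y e M)) - (\<Sum>e\<in>A. B e (Y e 0))) {0..M}"
  proof (rule integral_eq_finite_exceptions[OF _ finite_crit, where F = "\<lambda>t. \<Sum>e\<in>A. B e (Y e t)"])
    show "continuous_on {0..M} (\<lambda>t. \<Sum>e\<in>A. B e (Y e t))"
      by (intro continuous_on_sum increasing_edge.comp_cont[OF inc] cB)
    fix t assume t: "0 < t" "t < M" "t \<notin> crit"
    have "((\<lambda>t. \<Sum>e\<in>A. B e (Y e t)) has_real_derivative (\<Sum>e\<in>crossing t. (\<phi>' e (Y e t))\<^sup>2 * inverse (f' e (Y e t)))) (at t)"
    proof (rule comp_deriv_sum[OF _ t(3)])
      fix e x assume "e \<in> A" "0 < x" "x < len G e"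
      then show "(B e has_real_derivative (\<phi>' e x)\<^sup>2) (at x)" unfolding B_def[abs_def]
        by (intro integral_deriv_interior[of 0 "len G e"] continuous_intros cont_phi A_medges)
    qed
    also have "(\<Sum>e\<in>crossing t. (\<phi>' e (Y e t))\<^sup>2 * inverse (f' e (Y e t))) = (\<gamma> t)\<^sup>2 * P t"
      unfolding P_crossing[OF less_imp_le[OF t(1)] t(3)] sum_distrib_left
    proof (rule sum.cong[OF refl])
      fix e assume e: "e \<in> crossing t"
      have "\<phi>' e (Y e t) = \<gamma> t * f' e (Y e t)" using t by (simp add: \<phi>'_def crossing_value[OF e] gm_def)
      then show "(\<phi>' e (Y e t))\<^sup>2 * inverse (f' e (Y e t)) = (\<gamma> t)\<^sup>2 * f' e (Y e t)"
        using speed_pos[OF e] by (simp add: power2_eq_square)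
    qed
    also have "\<dots> = \<gamma> t * \<mu> t" using t mu_P_pos[of t] by (simp add: \<gamma>_def power2_eq_square)
    finally show "((\<lambda>t. \<Sum>e\<in>A. B e (Y e t)) has_real_derivative \<gamma> t * \<mu> t) (at t)" .
  qed (use M_pos in auto)
  then have "L.T0 = (\<Sum>e\<in>A. integral {0..len G e} (\<lambda>x. (\<phi>' e x)\<^sup>2))"
    by (simp add: L.T0_def has_integral_iff A_ends B_def)
  also have "\<dots> = gint G (\<lambda>e x. (\<phi>' e x)\<^sup>2)" unfolding gint_def
  proof (rule sum.mono_neutral_left[OF fG(2)])
    show "\<forall>e\<in>medges G - A. integral {0..len G e} (\<lambda>x. (\<phi>' e x)\<^sup>2) = 0"
    proof
      fix e assume e: "e \<in> medges G - A"
      have "((\<lambda>x. (\<phi>' e x)\<^sup>2) has_integral 0) {0..len G e}"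
        by (rule has_integral_spike_finite[of "{0, len G e}" _ _ "\<lambda>x. 0"]) (use phi_not_A(2)[of e] e in auto)
      then show "integral {0..len G e} (\<lambda>x. (\<phi>' e x)\<^sup>2) = 0" by (rule integral_unique)
    qed
  qed (auto simp: A_def)
  finally show ?thesis by simp
qed

text \<open>Layer-cake formula. The part of the integral below level \<open>t\<close> has derivative
  \<open>pr t * s t\<close>; adding \<open>pr t * \<mu> t\<close>, which vanishes at both extreme
  levels, cancels this and leaves \<open>\<gamma> * \<mu>\<close>. Energy and integral thus agree,
  so that twice the integral minus the energy is again \<open>T0\<close>.\<close>

lemma phi_integral: "gint G \<phi> = L.T0"
proof -
  define B where "B e x = integral {0..x} (\<phi> e)" for e x
  have cB: "continuous_on {0..len G e} (B e)" if "e \<in> A" for e unfolding B_def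
    by (intro indefinite_integral_continuous_1 integrable_continuous_real cont_phi A_medges that)
  have "((\<lambda>t. \<gamma> t * \<mu> t) has_integral ((\<Sum>e\<in>A. B e (Y e M)) + pr M * \<mu> M) - ((\<Sum>e\<in>A. B e (Y e 0)) + pr 0 * \<mu> 0)) {0..M}"
  proof (rule integral_eq_finite_exceptions[OF _ finite_crit, where F = "\<lambda>t. (\<Sum>e\<in>A. B e (Y e t)) + pr t * \<mu> t"])
    show "continuous_on {0..M} (\<lambda>t. (\<Sum>e\<in>A. B e (Y e t)) + pr t * \<mu> t)"
      by (intro continuous_on_add continuous_on_mult continuous_on_sum increasing_edge.comp_cont[OF inc] cB cont_pr cont_mu_P)
    fix t assume t: "0 < t" "t < M" "t \<notin> crit"
    have "((\<lambda>t. \<Sum>e\<in>A. B e (Y e t)) has_real_derivative (\<Sum>e\<in>crossing t. \<phi> e (Y e t) * inverse (f' e (Y e t)))) (at t)"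
    proof (rule comp_deriv_sum[OF _ t(3)])
      fix e x assume "e \<in> A" "0 < x" "x < len G e"
      then show "(B e has_real_derivative \<phi> e x) (at x)" unfolding B_def[abs_def]
        by (intro integral_deriv_interior[of 0 "len G e"] cont_phi A_medges)
    qed
    moreover have "(\<Sum>e\<in>crossing t. \<phi> e (Y e t) * inverse (f' e (Y e t))) = pr t * s t"
      unfolding s_def sum_distrib_left by (intro sum.cong refl) (simp add: \<phi>_def crossing_value)
    moreover have "((\<lambda>t. pr t * \<mu> t) has_real_derivative gm t * \<mu> t + - s t * pr t) (at t)"
      by (rule DERIV_mult[OF pr(2) mu_deriv[OF t(3)]])
    ultimately have "((\<lambda>t. (\<Sum>e\<in>A. B e (Y e t)) + pr t * \<mu> t) has_real_derivative pr t * s t + (gm t * \<mu> t + - s t * pr t)) (at t)"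
      by (intro DERIV_add) simp_all
    then show "((\<lambda>t. (\<Sum>e\<in>A. B e (Y e t)) + pr t * \<mu> t) has_real_derivative \<gamma> t * \<mu> t) (at t)"
      using t by (simp add: gm_def)
  qed (use M_pos in auto)
  then have "L.T0 = (\<Sum>e\<in>A. integral {0..len G e} (\<phi> e))"
    by (simp add: L.T0_def has_integral_iff A_ends B_def mu_P_M pr(1))
  also have "\<dots> = gint G \<phi>" unfolding gint_def
  proof (rule sum.mono_neutral_left[OF fG(2)])
    show "\<forall>e\<in>medges G - A. integral {0..len G e} (\<phi> e) = 0"
      using phi_not_A(1) by (auto intro!: integral_unique has_integral_is_0)
  qed (auto simp: A_def)
  finally show ?thesis by simp
qed

lemma torsion_ge_T0: "L.T0 \<le> torsional_rigidity G"
  using torsional_rigidity_max(1)[OF G cut_ge_mono[OF cut N] formsI[OF phi_H10]]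
  by (simp add: phi_energy phi_integral)

theorem torsion_ge: "real N * (pi / (2 * sqrt \<kappa>)) ^ 3 / 3 \<le> torsional_rigidity G"
  using L.T0_ge torsion_ge_T0 by simp

text \<open>An edge on which the ground state vanishes would allow the torsion energy to be increased by
  adding a bump on that edge.\<close>
lemma no_zero_edge:
  assumes T: "torsional_rigidity G = L.T0" shows "A = medges G"
proof (rule ccontr)
  assume "A \<noteq> medges G"
  then obtain a where a: "a \<in> medges G" "a \<notin> A" by (auto simp: A_def)
  define l where "l = len G a"
  have l: "0 < l" using fG(3)[OF a(1)] by (simp add: l_def)
  \<comment> \<open>The torsion function of the edge with Dirichlet conditions at both ends; it adds
    \<open>l ^ 3 / 12\<close> both to the integral and to the energy, a net gain.\<close>
  define b where "b x = (x * (l - x)) / 2" for x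
  define b' where "b' x = (l - 2 * x) / 2" for x
  have db: "(b has_real_derivative b' x) (at x)" for x
    unfolding b_def[abs_def] b'_def by (auto intro!: derivative_eq_intros simp: field_simps)
  define h h' where "h = \<phi>(a := b)" and "h' = \<phi>'(a := b')"
  have H: "H10_deriv G h h' (\<lambda>v. pr (u v))"
    unfolding H10_deriv_def vertex_values_def
  proof (intro conjI ballI)
    fix e assume e: "e \<in> medges G"
    have "H1_deriv l b b'" using l by (intro H1_deriv_C1 db) (auto simp: b'_def[abs_def] intro!: continuous_intros)
    then show "H1_deriv (len G e) (h e) (h' e)" using H10_derivD(1)[OF phi_H10 e] by (simp add: h_def h'_def l_def)
    show "h e 0 = pr (u (mtail G e))"
      using H10_derivD(2)[OF phi_H10 e] phi_not_A(1)[OF a, of 0] l by (auto simp: h_def h'_def b_def l_def)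
    show "h e (len G e) = pr (u (mhead G e))"
      using H10_derivD(3)[OF phi_H10 e] phi_not_A(1)[OF a, of l] l by (auto simp: h_def h'_def b_def l_def)
  qed (simp add: fD(4) pr(1))
  have b_int: "(b has_integral l ^ 3 / 12) {0..l}"
  proof -
    have "(b has_integral (l * l\<^sup>2 / 4 - l ^ 3 / 6) - (l * 0\<^sup>2 / 4 - 0 ^ 3 / 6)) {0..l}"
      by (rule fundamental_theorem_of_calculus) (use l in \<open>auto simp: b_def field_simps power2_eq_square has_real_derivative_iff_has_vector_derivative[symmetric] intro!: derivative_eq_intros\<close>)
    then show ?thesis by (simp add: power2_eq_square power3_eq_cube mult.assoc)
  qed
  have b'_int: "((\<lambda>x. (b' x)\<^sup>2) has_integral l ^ 3 / 12) {0..l}"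
  proof -
    have "((\<lambda>x. (b' x)\<^sup>2) has_integral (- ((l - 2 * l) ^ 3) / 24) - (- ((l - 2 * 0) ^ 3) / 24)) {0..l}"
      by (rule fundamental_theorem_of_calculus) (use l in \<open>auto simp: b'_def field_simps power2_eq_square has_real_derivative_iff_has_vector_derivative[symmetric] intro!: derivative_eq_intros\<close>)
    then show ?thesis by (simp add: power3_eq_cube mult.assoc)
  qed
  have upd: "gint G (k(a := q)) = gint G k + integral {0..l} q" if "integral {0..l} (k a) = 0" for k :: "'e \<Rightarrow> real \<Rightarrow> real" and q
  proof -
    have "gint G (k(a := q)) = integral {0..l} q + (\<Sum>e\<in>medges G - {a}. integral {0..len G e} (k e))"
      unfolding gint_def using a(1) fG(2) by (subst sum.remove[of _ a]) (auto simp: l_def intro!: sum.cong)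
    moreover have "gint G k = (\<Sum>e\<in>medges G - {a}. integral {0..len G e} (k e))"
      unfolding gint_def using a(1) fG(2) that by (subst sum.remove[of _ a]) (auto simp: l_def)
    ultimately show ?thesis by simp
  qed
  have z: "integral {0..l} (\<phi> a) = 0"
    using phi_not_A(1)[OF a] by (intro integral_unique has_integral_is_0) (auto simp: l_def)
  have z': "integral {0..l} (\<lambda>x. (\<phi>' a x)\<^sup>2) = 0"
    by (rule integral_unique, rule has_integral_spike_finite[of "{0, l}" _ _ "\<lambda>x. 0"]) (use phi_not_A(2)[OF a] in \<open>auto simp: l_def\<close>)
  have I: "gint G h = L.T0 + l ^ 3 / 12"
    using upd[of \<phi> b] z b_int by (simp add: h_def h'_def phi_integral has_integral_iff)
  have "(\<lambda>e x. (h' e x)\<^sup>2) = (\<lambda>e x. (\<phi>' e x)\<^sup>2)(a := \<lambda>x. (b' x)\<^sup>2)" by (auto simp: h_def h'_def fun_eq_iff)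
  then have E: "gint G (\<lambda>e x. (h' e x)\<^sup>2) = L.T0 + l ^ 3 / 12"
    using upd[of "\<lambda>e x. (\<phi>' e x)\<^sup>2" "\<lambda>x. (b' x)\<^sup>2"] z' b'_int by (simp add: phi_energy has_integral_iff)
  have "2 * gint G h - gint G (\<lambda>e x. (h' e x)\<^sup>2) \<le> torsional_rigidity G"
    by (rule torsional_rigidity_max(1)[OF G cut_ge_mono[OF cut N] formsI[OF H]])
  then show False using I E T l by simp
qed

text \<open>The data on which the combinatorial analysis rests. For the equality of lengths: two
  edges between the same levels have equal slopes at each common level, so their inverse functions
  differ by a constant, and they start together at zero.\<close>

theorem torsion_eq_imp:
  assumes T: "torsional_rigidity G = real N * (pi / (2 * sqrt \<kappa>)) ^ 3 / 3"
  shows "\<And>e. e \<in> medges G \<Longrightarrow> u (mtail G e) < u (mhead G e)"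
    "\<And>t. 0 < t \<Longrightarrow> t < M \<Longrightarrow> t \<notin> crit \<Longrightarrow> card {e\<in>medges G. u (mtail G e) < t \<and> t < u (mhead G e)} = N"
    "\<And>a b. a \<in> medges G \<Longrightarrow> b \<in> medges G \<Longrightarrow> u (mtail G a) = u (mtail G b) \<Longrightarrow> u (mhead G a) = u (mhead G b) \<Longrightarrow> len G a = len G b"
proof -
  have T0: "L.T0 = real N * (pi / (2 * sqrt \<kappa>)) ^ 3 / 3" using T torsion_ge_T0 L.T0_ge by simp
  have A: "A = medges G" by (rule no_zero_edge) (simp add: T T0)
  have sP: "s t * P t = (real N)\<^sup>2" if "0 < t" "t < M" "t \<notin> crit" for t by (rule L.T0_eq_imp[OF T0 that])
  show inc_ends: "u (mtail G e) < u (mhead G e)" if e: "e \<in> medges G" for e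
  proof -
    interpret increasing_edge "len G e" "f e" "f' e" by (rule inc) (simp add: A e)
    show ?thesis using strict[of 0 "len G e"] l by (simp add: fD(2)[OF e] fD(3)[OF e])
  qed
  have cr: "crossing t = {e\<in>medges G. u (mtail G e) < t \<and> t < u (mhead G e)}" for t
    unfolding crossing_def A using fD(2,3) by auto
  show "card {e\<in>medges G. u (mtail G e) < t \<and> t < u (mhead G e)} = N" if "0 < t" "t < M" "t \<notin> crit" for t
    using iso(2)[of t] sP that unfolding cr by simp
  have le: "len G a \<le> len G b" if ab: "a \<in> medges G" "b \<in> medges G" "u (mtail G a) = u (mtail G b)" "u (mhead G a) = u (mhead G b)" for a b
  proof -
    interpret a: increasing_edge "len G a" "f a" "f' a" by (rule inc) (simp add: A ab)
    interpret b: increasing_edge "len G b" "f b" "f' b" by (rule inc) (simp add: A ab)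
    have e: "f a 0 = f b 0" "f a (len G a) = f b (len G b)" using fD(2,3) ab by auto
    have lt: "f b 0 < f b (len G b)" using b.strict[of 0 "len G b"] b.l by simp
    have "(\<lambda>t. Y b t - Y a t) (f b 0) \<le> (\<lambda>t. Y b t - Y a t) (f b (len G b))"
    proof (rule mono_finite_exceptions[OF less_imp_le[OF lt] finite_crit])
      show "continuous_on {f b 0..f b (len G b)} (\<lambda>t. Y b t - Y a t)"
        by (intro continuous_on_diff a.cont_y b.cont_y)
      fix t assume t: "f b 0 < t" "t < f b (len G b)" "t \<notin> crit"
      have t': "0 < t" "t < M" using t f0_nonneg[OF ab(2)] le_M(1)[OF ab(2)] by auto
      have "f' a (Y a t) = f' b (Y b t)"
        by (rule iso(3)) (use t t' sP ab e A in \<open>auto simp: crossing_def\<close>)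
      then have "((\<lambda>t. Y b t - Y a t) has_real_derivative 0) (at t)"
        using DERIV_diff[OF b.y_deriv[of t] a.y_deriv[of t]] t e by simp
      then show "\<exists>d\<ge>0. ((\<lambda>t. Y b t - Y a t) has_real_derivative d) (at t)" by blast
    qed
    moreover have "Y b (f b 0) = 0" "Y b (f b (len G b)) = len G b" by (simp_all add: b.y_low b.y_high)
    moreover have "Y a (f b 0) = 0" "Y a (f b (len G b)) = len G a" unfolding e[symmetric] by (simp_all add: a.y_low a.y_high)
    ultimately show ?thesis by simp
  qed
  show "len G a = len G b" if "a \<in> medges G" "b \<in> medges G" "u (mtail G a) = u (mtail G b)" "u (mhead G a) = u (mhead G b)" for a b
    using le[of a b] le[of b a] that by auto
qed

end

section \<open>Normalisation by subdivision and reorientation\<close>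

abbreviation identification_step :: "(nat, nat) metric_graph \<Rightarrow> (nat, nat) metric_graph \<Rightarrow> bool" where
  "identification_step A B \<equiv> glues_to A B \<or> subdivides_to A B"

abbreviation chain :: "(nat, nat) metric_graph \<Rightarrow> (nat, nat) metric_graph \<Rightarrow> bool" where
  "chain \<equiv> equivclp identification_step"

lemma identification_step_invariants:
  assumes "identification_step A B"
  shows "finite_metric_graph A" "finite_metric_graph B" "forms A = forms B" "n \<le> 2 \<Longrightarrow> cut_ge n A \<longleftrightarrow> cut_ge n B"
proof -
  show "finite_metric_graph A" using assms by (auto simp: glues_to_def subdivides_to_def)
  show "finite_metric_graph B" using assms finite_metric_graph_subdivide unfolding subdivides_to_iff by (auto simp: glues_to_def)
  show "forms A = forms B" using assms glues_to_forms subdivides_to_forms by blast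
  show "cut_ge n A \<longleftrightarrow> cut_ge n B" if "n \<le> 2" using assms cut_ge_glues_to cut_ge_subdivides_to that by blast
qed

lemma chain_invariants:
  assumes "chain A B" "finite_metric_graph A"
  shows "finite_metric_graph B \<and> forms A = forms B \<and> (\<forall>n\<le>2. cut_ge n A \<longleftrightarrow> cut_ge n B)"
  using assms(1)
proof (induction rule: equivclp_induct)
  case (step B C)
  then show ?case using identification_step_invariants[of B C] identification_step_invariants[of C B] by auto
qed (use assms in simp)

lemma chain_glues: "glues_to A B \<Longrightarrow> chain A B" by (simp add: r_into_equivclp)
lemma chain_subdivides: "subdivides_to A B \<Longrightarrow> chain A B" by (simp add: r_into_equivclp)

definition relabel :: "('v \<Rightarrow> 'w) \<Rightarrow> ('e \<Rightarrow> 'f) \<Rightarrow> ('v, 'e) metric_graph \<Rightarrow> ('w, 'f) metric_graph" where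
  "relabel p q G = \<lparr> skeleton = \<lparr> verts = p ` mverts G, arcs = q ` medges G,
       tail = (\<lambda>b. p (mtail G (inv_into (medges G) q b))), head = (\<lambda>b. p (mhead G (inv_into (medges G) q b))) \<rparr>,
     len = (\<lambda>b. len G (inv_into (medges G) q b)), dirichlet = p ` dirichlet G \<rparr>"

lemma glues_to_relabel:
  assumes G: "finite_metric_graph G" and p: "inj_on p (mverts G)" and q: "inj_on q (medges G)"
  shows "glues_to G (relabel p q G)"
proof -
  note fG = finite_metric_graphD[OF G]
  have "fin_digraph (skeleton (relabel p q G))"
    by unfold_locales (use fG q in \<open>auto simp: relabel_def\<close>)
  then have H: "finite_metric_graph (relabel p q G)"
    unfolding finite_metric_graph_def using fG q by (auto simp: relabel_def)
  have "bij_betw p (mverts G - dirichlet G) (p ` mverts G - p ` dirichlet G)"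
    unfolding bij_betw_def using p fG(6) inj_on_image_set_diff[OF p, of "mverts G" "dirichlet G"]
    by (auto intro: inj_on_subset)
  moreover have "bij_betw q (medges G) (q ` medges G)" using q by (simp add: inj_on_imp_bij_betw)
  ultimately show ?thesis unfolding glues_to_def using G H q
    by (intro conjI exI[of _ p] exI[of _ q]) (auto simp: relabel_def ends_def)
qed

lemma glues_to_nat_copy:
  fixes G :: "('v, 'e) metric_graph"
  assumes G: "finite_metric_graph G"
  obtains G' :: "(nat, nat) metric_graph" where "glues_to G G'"
proof -
  obtain p :: "'v \<Rightarrow> nat" where "inj_on p (mverts G)"
    using finite_imp_inj_to_nat_seg[OF finite_metric_graphD(1)[OF G]] by blast
  moreover obtain q :: "'e \<Rightarrow> nat" where "inj_on q (medges G)"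
    using finite_imp_inj_to_nat_seg[OF finite_metric_graphD(2)[OF G]] by blast
  ultimately show ?thesis using glues_to_relabel[OF G] that by blast
qed

definition flip :: "'e set \<Rightarrow> ('v, 'e) metric_graph \<Rightarrow> ('v, 'e) metric_graph" where
  "flip R G = \<lparr> skeleton = \<lparr> verts = mverts G, arcs = medges G,
       tail = (\<lambda>e. if e \<in> R then mhead G e else mtail G e), head = (\<lambda>e. if e \<in> R then mtail G e else mhead G e) \<rparr>,
     len = len G, dirichlet = dirichlet G \<rparr>"

lemma flip_simps [simp]:
  "mverts (flip R G) = mverts G" "medges (flip R G) = medges G" "len (flip R G) = len G" "dirichlet (flip R G) = dirichlet G"
  "mtail (flip R G) e = (if e \<in> R then mhead G e else mtail G e)" "mhead (flip R G) e = (if e \<in> R then mtail G e else mhead G e)"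
  by (auto simp: flip_def)

text \<open>\<open>glues_to\<close> compares edges through the unordered pair of their ends, so
  reversing edges is gluing along the identity maps.\<close>

lemma glues_to_flip:
  assumes G: "finite_metric_graph G" shows "glues_to G (flip R G)"
proof -
  note fG = finite_metric_graphD[OF G]
  have "fin_digraph (skeleton (flip R G))" by unfold_locales (use fG in auto)
  then have H: "finite_metric_graph (flip R G)" unfolding finite_metric_graph_def using fG by auto
  then show ?thesis unfolding glues_to_def using G
    by (intro conjI exI[of _ "\<lambda>x. x"] exI[of _ "\<lambda>x. x"]) (auto simp: ends_def bij_betw_def)
qed

lemma glues_to_glue_dirichlet:
  assumes G: "finite_metric_graph G" and D: "dirichlet G \<noteq> {}"
  obtains d where "glues_to G (glue_dirichlet G)" "dirichlet (glue_dirichlet G) = {d}"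
proof -
  note fG = finite_metric_graphD[OF G]
  let ?H = "glue_dirichlet G"
  define d where "d = (SOME d. d \<in> dirichlet G)"
  have d: "d \<in> dirichlet G" unfolding d_def using D some_in_eq by blast
  have gm: "glue_map G w = (if w \<in> dirichlet G then d else w)" for w by (simp add: glue_map_def d_def)
  have Dd: "dirichlet ?H = {d}" using d by (auto simp: glue_dirichlet_def gm)
  have v: "mverts ?H = insert d (mverts G - dirichlet G)"
    using d fG(6) by (auto simp: glue_dirichlet_def gm image_iff)
  have "fin_digraph (skeleton ?H)" by unfold_locales (use fG in \<open>auto simp: glue_dirichlet_def\<close>)
  then have H: "finite_metric_graph ?H" unfolding finite_metric_graph_def using fG by (auto simp: glue_dirichlet_def)
  have vD: "mverts ?H - dirichlet ?H = mverts G - dirichlet G" using v Dd d by auto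
  have "bij_betw (glue_map G) (mverts G - dirichlet G) (mverts ?H - dirichlet ?H)"
    unfolding vD by (rule bij_betw_cong[THEN iffD1, OF _ bij_betw_id]) (auto simp: gm)
  moreover have "bij_betw (\<lambda>x. x) (medges G) (medges ?H)" by (simp add: glue_dirichlet_def bij_betw_def)
  ultimately have "glues_to G ?H" unfolding glues_to_def using G H
    by (intro conjI exI[of _ "glue_map G"] exI[of _ "\<lambda>x. x"]) (auto simp: glue_dirichlet_def ends_def)
  then show ?thesis using that Dd by blast
qed

lemma fresh_subdivision_point:
  fixes G :: "(nat, nat) metric_graph"
  assumes "finite_metric_graph G" "e \<in> medges G" "0 < s" "s < len G e"
  obtains e' w where "subdivision_point G e e' w s"
proof -
  obtain e' where "e' \<notin> medges G" using finite_metric_graphD(2)[OF assms(1)] ex_new_if_finite infinite_UNIV_nat by blast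
  moreover obtain w where "w \<notin> mverts G" using finite_metric_graphD(1)[OF assms(1)] ex_new_if_finite infinite_UNIV_nat by blast
  ultimately show ?thesis using that assms by (auto simp: subdivision_point_def)
qed

lemma chain_subdivide: "subdivision_point G e e' w s \<Longrightarrow> chain G (subdivide G e e' w s)"
  by (rule chain_subdivides) (auto simp: subdivides_to_iff)

text \<open>The induction measure counts the cuts still to be made. Cutting off a piece of length
  exactly \<open>d\<close> leaves a first piece that needs none and lowers the count for the
  rest.\<close>

lemma refine:
  fixes G :: "(nat, nat) metric_graph"
  assumes "finite_metric_graph G" "0 < d"
  shows "\<exists>H. chain G H \<and> finite_metric_graph H \<and> (\<forall>e\<in>medges H. len H e \<le> d)"
  using assms(1)
proof (induction "\<Sum>e\<in>medges G. nat (\<lceil>len G e / d\<rceil> - 1)" arbitrary: G rule: less_induct)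
  case less
  note fG = finite_metric_graphD[OF less.prems]
  show ?case
  proof (cases "\<forall>e\<in>medges G. len G e \<le> d")
    case True then show ?thesis using less.prems by (intro exI[of _ G]) auto
  next
    case False
    then obtain e where e: "e \<in> medges G" "d < len G e" by auto
    obtain e' w where sp: "subdivision_point G e e' w d" by (rule fresh_subdivision_point[OF less.prems e(1) assms(2) e(2)])
    let ?H = "subdivide G e e' w d"
    have ne: "e' \<notin> medges G" "e \<noteq> e'" using sp e by (auto simp: subdivision_point_def)
    let ?c = "\<lambda>x. nat (\<lceil>x / d\<rceil> - 1)"
    have c1: "?c d = 0" using assms(2) by simp
    have c2: "?c (len G e - d) < ?c (len G e)"
    proof -
      have "(len G e - d) / d = len G e / d - 1" using assms(2) by (simp add: field_simps)
      moreover have "1 < len G e / d" using e assms(2) by simp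
      then have "2 \<le> \<lceil>len G e / d\<rceil>" by linarith
      ultimately show ?thesis by simp
    qed
    have "(\<Sum>a\<in>medges ?H. ?c (len ?H a)) = ?c (len G e - d) + (\<Sum>a\<in>medges G. ?c (((len G)(e := d, e' := len G e - d)) a))"
      using fG(2) ne by simp
    also have "(\<Sum>a\<in>medges G. ?c (((len G)(e := d, e' := len G e - d)) a)) = (\<Sum>a\<in>medges G - {e}. ?c (((len G)(e := d, e' := len G e - d)) a))"
      using fG(2) e(1) ne c1 by (subst sum.remove[of _ e]) auto
    also have "\<dots> = (\<Sum>a\<in>medges G - {e}. ?c (len G a))"
    proof (rule sum.cong[OF refl])
      fix a assume "a \<in> medges G - {e}"
      then have "a \<noteq> e" "a \<noteq> e'" using ne by auto
      then show "?c (((len G)(e := d, e' := len G e - d)) a) = ?c (len G a)" by simp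
    qed
    also have "?c (len G e - d) + \<dots> < ?c (len G e) + (\<Sum>a\<in>medges G - {e}. ?c (len G a))" using c2 by simp
    also have "\<dots> = (\<Sum>a\<in>medges G. ?c (len G a))"
      using fG(2) e(1) by (subst (2) sum.remove[of _ e]) auto
    finally obtain H where H: "chain ?H H" "finite_metric_graph H" "\<forall>e\<in>medges H. len H e \<le> d"
      using less.hyps[of ?H] finite_metric_graph_subdivide[OF sp] by blast
    have "chain G H" by (rule equivclp_trans[OF chain_subdivide[OF sp] H(1)])
    then show ?thesis using H by blast
  qed
qed

lemma bump_form:
  assumes G: "finite_metric_graph G" and e: "e \<in> medges G"
  obtains E F I where "(E, F, I) \<in> forms G" "0 < F"
proof -
  note fG = finite_metric_graphD[OF G]
  define f f' where "f a x = (if a = e then x * (len G e - x) else 0)" and "f' a x = (if a = e then len G e - 2 * x else 0)" for a x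
  have H: "H10_deriv G f f' (\<lambda>v. 0)"
    unfolding H10_deriv_def vertex_values_def
  proof (intro conjI ballI)
    fix a assume a: "a \<in> medges G"
    show "H1_deriv (len G a) (f a) (f' a)"
    proof (rule H1_deriv_C1)
      show "(f a has_real_derivative f' a x) (at x)" for x
        unfolding f_def[abs_def] f'_def by (cases "a = e") (auto intro!: derivative_eq_intros)
      show "continuous_on UNIV (f' a)" unfolding f'_def[abs_def] by (cases "a = e") (auto intro!: continuous_intros)
    qed (use fG(3)[OF a] in simp)
  qed (auto simp: f_def)
  have "nonzero_on G f" unfolding nonzero_on_def using e fG(3)[OF e] by (intro bexI[of _ e] bexI[of _ "len G e / 2"]) (auto simp: f_def)
  then have "gint G (\<lambda>e x. (f e x)\<^sup>2) \<noteq> 0" using gint_square_eq_0_iff[OF G H10_derivD(5)[OF H]] by simp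
  moreover have "0 \<le> gint G (\<lambda>e x. (f e x)\<^sup>2)" by (rule gint_nonneg) simp
  ultimately show ?thesis using that[OF formsI[OF H]] by simp
qed

lemma chain_ground_state:
  fixes G :: "(nat, nat) metric_graph"
  assumes G: "finite_metric_graph G" and cut: "cut_ge 1 G" and e: "medges G \<noteq> {}"
  obtains H \<kappa> f f' u where "chain G H" "finite_metric_graph H" "ground_state H \<kappa> f f' u"
proof -
  obtain E F I where t: "(E, F, I) \<in> forms G" "0 < F" using bump_form[OF G] e by blast
  have E: "0 \<le> E" using t by (auto simp: forms_def intro!: gint_nonneg)
  \<comment> \<open>Chosen so that \<open>E * d\<^sup>2 < F\<close>, as the existence of a ground
    state demands; adding one to \<open>E\<close> avoids a zero denominator. Refining to edges of
    length at most \<open>d\<close> leaves \<open>forms\<close>, and with it the trial triple,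
    unchanged.\<close>
  define d where "d = sqrt (F / (E + 1)) / 2"
  have d: "0 < d" using t E by (simp add: d_def)
  have "E * d\<^sup>2 = E / (E + 1) * F / 4" using t E by (simp add: d_def power_divide)
  also have "\<dots> < F"
  proof -
    have "E / (E + 1) * F \<le> 1 * F" using t E by (intro mult_right_mono) auto
    then have "E / (E + 1) * F / 4 \<le> 1 * F / 4" by (rule divide_right_mono) simp
    also have "\<dots> < F" using t by simp
    finally show ?thesis .
  qed
  finally have Ed: "E * d\<^sup>2 < F" .
  obtain H where H: "chain G H" "finite_metric_graph H" "\<And>e. e \<in> medges H \<Longrightarrow> len H e \<le> d"
    using refine[OF G d] by blast
  have inv: "forms G = forms H" "cut_ge 1 H" using chain_invariants[OF H(1) G] cut by auto
  have "\<exists>\<kappa> f f' u. ground_state H \<kappa> f f' u"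
    by (rule ground_state_exists[OF H(2) inv(2) H(3) d t(1)[unfolded inv(1)] t(2) Ed])
  then show ?thesis using that H(1,2) by blast
qed

lemma ground_state_subdivide:
  assumes gs: "ground_state G \<kappa> f f' u" and sp: "subdivision_point G e e' w s"
  defines "h \<equiv> f(e' := \<lambda>x. f e (x + s))" and "h' \<equiv> f'(e' := \<lambda>x. f' e (x + s))"
  shows "ground_state (subdivide G e e' w s) \<kappa> h h' (u(w := f e s))"
proof -
  let ?H = "subdivide G e e' w s"
  have G: "finite_metric_graph G" and *: "e \<in> medges G" "e' \<notin> medges G" "w \<notin> mverts G" "0 < s" "s < len G e"
    using sp by (auto simp: subdivision_point_def)
  note g = ground_stateD[OF gs]
  note sub = subdivide_H10_deriv[OF sp g(2), folded h_def h'_def]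
  have fm: "forms ?H = forms G" using subdivides_to_forms[of G ?H] sp by (auto simp: subdivides_to_iff)
  have ne: "e \<noteq> e'" using * by auto
  have d: "(h a has_real_derivative h' a x) (at x) \<and> (h' a has_real_derivative - \<kappa> * h a x) (at x)" if a: "a \<in> medges ?H" for a x
  proof (cases "a = e'")
    case True
    have "((\<lambda>x. x + s) has_real_derivative 1) (at x)" by (auto intro!: derivative_eq_intros)
    from DERIV_chain2[OF g(3)[OF *(1)] this] DERIV_chain2[OF g(4)[OF *(1)] this]
    show ?thesis using True by (simp add: h_def h'_def)
  next
    case False
    then show ?thesis using a g(3,4) by (simp add: h_def h'_def)
  qed
  have sgn: "(\<forall>x\<in>{0..len ?H a}. 0 \<le> h a x) \<and> ((\<forall>x\<in>{0<..<len ?H a}. 0 < h a x) \<or> (\<forall>x\<in>{0..len ?H a}. h a x = 0))" if a: "a \<in> medges ?H" for a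
  proof -
    consider "a = e'" | "a = e" | "a \<in> medges G" "a \<noteq> e" "a \<noteq> e'" using a by auto
    then show ?thesis
    proof cases
      case 1
      then show ?thesis using g(5)[OF *(1)] g(6)[OF *(1)] * by (auto simp: h_def)
    next
      case 2
      then show ?thesis using g(5)[OF *(1)] g(6)[OF *(1)] * ne by (auto simp: h_def)
    next
      case 3
      then show ?thesis using g(5)[OF 3(1)] g(6)[OF 3(1)] by (auto simp: h_def)
    qed
  qed
  show ?thesis unfolding ground_state_def
    using g(1) sub(1) d sgn g(7,8) sub(2,3) gs[unfolded ground_state_def] by (simp add: fm)
qed

lemma ground_state_deriv_decreasing:
  assumes G: "finite_metric_graph G" and gs: "ground_state G \<kappa> f f' u" and e: "e \<in> medges G"
    and p: "\<And>x. 0 < x \<Longrightarrow> x < len G e \<Longrightarrow> 0 < f e x" and xy: "0 \<le> x" "x < y" "y \<le> len G e"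
  shows "f' e y < f' e x"
proof (rule DERIV_neg_imp_decreasing_open[OF xy(2)])
  note g = ground_stateD[OF gs]
  show "\<exists>d. (f' e has_real_derivative d) (at z) \<and> d < 0" if "x < z" "z < y" for z
    using g(4)[OF e, of z] p[of z] g(1) that xy by (intro exI[of _ "- \<kappa> * f e z"]) auto
  show "continuous_on {x..y} (f' e)" by (rule g(11)[OF e])
qed

definition critical_edges :: "('v, 'e) metric_graph \<Rightarrow> ('e \<Rightarrow> real \<Rightarrow> real) \<Rightarrow> ('e \<Rightarrow> real \<Rightarrow> real) \<Rightarrow> 'e set" where
  "critical_edges G f f' = {e\<in>medges G. (\<forall>x\<in>{0<..<len G e}. 0 < f e x) \<and> (\<exists>x\<in>{0<..<len G e}. f' e x = 0)}"

text \<open>Where the ground state is positive its derivative strictly decreases along the edge, so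
  an edge has at most one interior critical point. Cutting there turns the edge into two noncritical
  ones.\<close>

lemma chain_noncritical:
  fixes G :: "(nat, nat) metric_graph"
  assumes "finite_metric_graph G" "ground_state G \<kappa> f f' u"
  shows "\<exists>H f f' u. chain G H \<and> finite_metric_graph H \<and> ground_state H \<kappa> f f' u \<and> critical_edges H f f' = {}"
  using assms
proof (induction "card (critical_edges G f f')" arbitrary: G f f' u rule: less_induct)
  case less
  note G = less.prems(1) and gs = less.prems(2)
  note fG = finite_metric_graphD[OF G] and g = ground_stateD[OF gs]
  have fin: "finite (critical_edges G f f')" using fG(2) by (simp add: critical_edges_def)
  show ?case
  proof (cases "critical_edges G f f' = {}")
    case True then show ?thesis using less.prems by (intro exI[of _ G] exI) auto
  next
    case False
    then obtain e where ec: "e \<in> critical_edges G f f'" by blast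
    then obtain s where es: "e \<in> critical_edges G f f'" "s \<in> {0<..<len G e}" "f' e s = 0" unfolding critical_edges_def by blast
    then have e: "e \<in> medges G" and s: "0 < s" "s < len G e" and p: "\<And>x. 0 < x \<Longrightarrow> x < len G e \<Longrightarrow> 0 < f e x"
      by (auto simp: critical_edges_def)
    obtain e' w where sp: "subdivision_point G e e' w s" by (rule fresh_subdivision_point[OF G e s])
    have ne: "e' \<notin> medges G" "e \<noteq> e'" using sp e by (auto simp: subdivision_point_def)
    let ?H = "subdivide G e e' w s" and ?h = "f(e' := \<lambda>x. f e (x + s))" and ?h' = "f'(e' := \<lambda>x. f' e (x + s))"
    have "critical_edges ?H ?h ?h' \<subseteq> critical_edges G f f' - {e}"
    proof
      fix a assume a: "a \<in> critical_edges ?H ?h ?h'"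
      have dec: "f' e y < f' e x" if "0 \<le> x" "x < y" "y \<le> len G e" for x y
        by (rule ground_state_deriv_decreasing[OF G gs e p that])
      have "a \<noteq> e"
      proof
        assume "a = e"
        then obtain x where "0 < x" "x < s" "f' e x = 0" using a ne s by (auto simp: critical_edges_def)
        then show False using dec[of x s] es s by simp
      qed
      moreover have "a \<noteq> e'"
      proof
        assume "a = e'"
        then obtain x where "0 < x" "x < len G e - s" "f' e (x + s) = 0" using a ne s by (auto simp: critical_edges_def)
        then show False using dec[of s "x + s"] es s by simp
      qed
      ultimately show "a \<in> critical_edges G f f' - {e}" using a by (auto simp: critical_edges_def)
    qed
    then have "critical_edges ?H ?h ?h' \<subset> critical_edges G f f'" using es(1) by blast
    then have "card (critical_edges ?H ?h ?h') < card (critical_edges G f f')" by (rule psubset_card_mono[OF fin])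
    from less.hyps[OF this finite_metric_graph_subdivide[OF sp] ground_state_subdivide[OF gs sp]]
    obtain H f f' u where H: "chain ?H H" "finite_metric_graph H" "ground_state H \<kappa> f f' u" "critical_edges H f f' = {}" by blast
    have "chain G H" by (rule equivclp_trans[OF chain_subdivide[OF sp] H(1)])
    then show ?thesis using H by blast
  qed
qed

definition monotone_edges :: "('v, 'e) metric_graph \<Rightarrow> ('e \<Rightarrow> real \<Rightarrow> real) \<Rightarrow> ('e \<Rightarrow> real \<Rightarrow> real) \<Rightarrow> bool" where
  "monotone_edges G f f' \<longleftrightarrow>
    (\<forall>e\<in>medges G. (\<forall>x\<in>{0<..<len G e}. 0 < f e x \<and> 0 < f' e x) \<or> (\<forall>x\<in>{0..len G e}. f e x = 0))"

text \<open>Without interior zeros the derivative has constant sign on each edge where the state is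
  positive, by the intermediate value theorem; the decreasing edges are reversed.\<close>

lemma flip_monotone:
  assumes G: "finite_metric_graph G" and gs: "ground_state G \<kappa> f f' u" and nc: "critical_edges G f f' = {}"
  shows "\<exists>R f f'. ground_state (flip R G) \<kappa> f f' u \<and> monotone_edges (flip R G) f f'"
proof -
  note fG = finite_metric_graphD[OF G] and g = ground_stateD[OF gs]
  note fD = H10_derivD[OF g(2)]
  define R where "R = {e\<in>medges G. \<forall>x\<in>{0<..<len G e}. f' e x < 0}"
  define h h' where "h e = (if e \<in> R then (\<lambda>x. f e (len G e - x)) else f e)"
    and "h' e = (if e \<in> R then (\<lambda>x. - f' e (len G e - x)) else f' e)" for e
  have H: "H10_deriv (flip R G) h h' u"
    unfolding H10_deriv_def vertex_values_def
  proof (intro conjI ballI)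
    fix e assume "e \<in> medges (flip R G)"
    then have e: "e \<in> medges G" by simp
    show "H1_deriv (len (flip R G) e) (h e) (h' e)"
      using fD(1)[OF e] H1_deriv_reflect[OF fD(1)[OF e]] fG(3)[OF e] by (auto simp: h_def h'_def)
    show "h e 0 = u (mtail (flip R G) e)" "h e (len (flip R G) e) = u (mhead (flip R G) e)"
      using fD(2,3)[OF e] by (simp_all add: h_def)
  qed (use fD(4) in auto)
  have int: "gint (flip R G) (\<lambda>e x. k (h e x)) = gint G (\<lambda>e x. k (f e x))" for k :: "real \<Rightarrow> real"
    unfolding gint_def flip_simps
  proof (rule sum.cong[OF refl])
    fix e show "integral {0..len G e} (\<lambda>x. k (h e x)) = integral {0..len G e} (\<lambda>x. k (f e x))"
      using integral_reflect_Icc[of "len G e" "\<lambda>x. k (f e x)"] by (simp add: h_def)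
  qed
  have int': "gint (flip R G) (\<lambda>e x. (h' e x)\<^sup>2) = gint G (\<lambda>e x. (f' e x)\<^sup>2)"
    unfolding gint_def flip_simps
  proof (rule sum.cong[OF refl])
    fix e show "integral {0..len G e} (\<lambda>x. (h' e x)\<^sup>2) = integral {0..len G e} (\<lambda>x. (f' e x)\<^sup>2)"
      using integral_reflect_Icc[of "len G e" "\<lambda>x. (f' e x)\<^sup>2"] by (simp add: h'_def)
  qed
  have d: "(h e has_real_derivative h' e x) (at x) \<and> (h' e has_real_derivative - \<kappa> * h e x) (at x)" if e: "e \<in> medges G" for e x
  proof -
    have m: "((\<lambda>x. len G e - x) has_real_derivative - 1) (at x)" by (auto intro!: derivative_eq_intros)
    show ?thesis
      using DERIV_chain2[OF g(3)[OF e] m] DERIV_minus[OF DERIV_chain2[OF g(4)[OF e] m]] g(3,4)[OF e]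
      by (auto simp: h_def h'_def)
  qed
  have sgn: "(\<forall>x\<in>{0..len G e}. 0 \<le> h e x) \<and> ((\<forall>x\<in>{0<..<len G e}. 0 < h e x) \<or> (\<forall>x\<in>{0..len G e}. h e x = 0))" if e: "e \<in> medges G" for e
    using g(5)[OF e] g(6)[OF e] by (auto simp: h_def)
  have fm: "forms (flip R G) = forms G" using glues_to_forms[OF glues_to_flip[OF G]] by simp
  have "ground_state (flip R G) \<kappa> h h' u"
    unfolding ground_state_def using g(1) H d sgn g(7,8) int[of "\<lambda>x. x\<^sup>2"] int' gs[unfolded ground_state_def] by (simp add: fm)
  moreover have "monotone_edges (flip R G) h h'"
    unfolding monotone_edges_def
  proof
    fix e assume "e \<in> medges (flip R G)"
    then have e: "e \<in> medges G" by simp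
    show "(\<forall>x\<in>{0<..<len (flip R G) e}. 0 < h e x \<and> 0 < h' e x) \<or> (\<forall>x\<in>{0..len (flip R G) e}. h e x = 0)"
    proof (cases "\<forall>x\<in>{0..len G e}. f e x = 0")
      case True then show ?thesis by (auto simp: h_def)
    next
      case False
      then have p: "\<forall>x\<in>{0<..<len G e}. 0 < f e x" using g(6)[OF e] by blast
      then have nz: "f' e x \<noteq> 0" if "x \<in> {0<..<len G e}" for x using nc e that by (auto simp: critical_edges_def)
      show ?thesis
      proof (cases "e \<in> R")
        case True then show ?thesis using p by (auto simp: h_def h'_def R_def)
      next
        case False
        then obtain y where y: "y \<in> {0<..<len G e}" "0 < f' e y" using nz e unfolding R_def by force
        have "0 < f' e x" if x: "x \<in> {0<..<len G e}" for x
        proof (rule ccontr)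
          assume "\<not> 0 < f' e x"
          then have fx: "f' e x < 0" using nz[OF x] by simp
          have "y \<noteq> x" using fx y by auto
          then consider "x < y" | "y < x" by linarith
          then have "\<exists>z. min x y \<le> z \<and> z \<le> max x y \<and> f' e z = 0"
          proof cases
            case 1 then show ?thesis using IVT'[of "f' e" x 0 y] fx y g(11)[OF e] by auto
          next
            case 2 then show ?thesis using IVT2'[of "f' e" x 0 y] fx y g(11)[OF e] by auto
          qed
          then obtain z where "min x y \<le> z" "z \<le> max x y" "f' e z = 0" by blast
          then show False using nz[of z] x y by (auto simp: min_def max_def split: if_splits)
        qed
        then show ?thesis using p False by (auto simp: h_def h'_def)
      qed
    qed
  qed
  ultimately show ?thesis by blast
qed

definition level_pairs :: "('v, 'e) metric_graph \<Rightarrow> ('v \<Rightarrow> real) \<Rightarrow> ('e \<times> real) set" where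
  "level_pairs G u = {(e, c). e \<in> medges G \<and> c \<in> u ` mverts G \<and> u (mtail G e) < c \<and> c < u (mhead G e)}"

lemma finite_level_pairs: "finite_metric_graph G \<Longrightarrow> finite (level_pairs G u)"
  using finite_metric_graphD(1,2)[of G] by (intro finite_subset[of "level_pairs G u" "medges G \<times> u ` mverts G"]) (auto simp: level_pairs_def)

text \<open>Cutting an edge at a level already taken by a vertex creates no new level. Each
  remaining pair of an edge and an intermediate level stems from a pair before the cut, and the pair
  that caused the cut is gone.\<close>

lemma chain_levels:
  fixes G :: "(nat, nat) metric_graph"
  assumes "finite_metric_graph G" "ground_state G \<kappa> f f' u" "monotone_edges G f f'"
  shows "\<exists>H f f' u. chain G H \<and> finite_metric_graph H \<and> ground_state H \<kappa> f f' u \<and> monotone_edges H f f' \<and> level_pairs H u = {}"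
  using assms
proof (induction "card (level_pairs G u)" arbitrary: G f f' u rule: less_induct)
  case less
  note G = less.prems(1) and gs = less.prems(2) and mono = less.prems(3)
  note fG = finite_metric_graphD[OF G] and g = ground_stateD[OF gs]
  note fD = H10_derivD[OF g(2)]
  show ?case
  proof (cases "level_pairs G u = {}")
    case True then show ?thesis using less.prems by (intro exI[of _ G] exI) auto
  next
    case False
    then obtain e c where ec: "(e, c) \<in> level_pairs G u" by fast
    then have e: "e \<in> medges G" and cv: "c \<in> u ` mverts G" and c: "u (mtail G e) < c" "c < u (mhead G e)" by (auto simp: level_pairs_def)
    obtain s where s: "0 \<le> s" "s \<le> len G e" "f e s = c"
      using IVT'[of "f e" 0 c "len G e"] c fD(2,3)[OF e] g(10)[OF e] fG(3)[OF e] by auto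
    then have s': "0 < s" "s < len G e" using c fD(2,3)[OF e] by (auto simp: less_le)
    obtain e' w where sp: "subdivision_point G e e' w s" by (rule fresh_subdivision_point[OF G e s'])
    have ne: "e' \<notin> medges G" "e \<noteq> e'" "w \<notin> mverts G" using sp e by (auto simp: subdivision_point_def)
    have nw: "mtail G a \<noteq> w" "mhead G a \<noteq> w" if "a \<in> medges G" for a using fG(4,5)[OF that] ne by auto
    let ?H = "subdivide G e e' w s" and ?h = "f(e' := \<lambda>x. f e (x + s))" and ?h' = "f'(e' := \<lambda>x. f' e (x + s))" and ?u = "u(w := f e s)"
    have crit: "?u ` mverts ?H = u ` mverts G" using cv s ne by (auto simp: image_iff)
    have m: "monotone_edges ?H ?h ?h'" unfolding monotone_edges_def
    proof
      fix a assume "a \<in> medges ?H"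
      then consider "a = e'" | "a = e" | "a \<in> medges G" "a \<noteq> e" "a \<noteq> e'" by auto
      then show "(\<forall>x\<in>{0<..<len ?H a}. 0 < ?h a x \<and> 0 < ?h' a x) \<or> (\<forall>x\<in>{0..len ?H a}. ?h a x = 0)"
      proof cases
        case 1
        then show ?thesis using mono[unfolded monotone_edges_def, rule_format, OF e] s' by auto
      next
        case 2
        then show ?thesis using mono[unfolded monotone_edges_def, rule_format, OF e] s' ne by auto
      next
        case 3
        then show ?thesis using mono[unfolded monotone_edges_def, rule_format, OF 3(1)] by auto
      qed
    qed
    \<comment> \<open>Maps pairs after the cut to pairs before it. It is injective because the
      pieces \<open>e\<close> and \<open>e'\<close> lie on different sides of the level
      \<open>c\<close>.\<close>
    define j where "j = (\<lambda>(a, c'). (if a = e' then e else a, c' :: real))"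
    have sub: "j ` level_pairs ?H ?u \<subseteq> level_pairs G u - {(e, c)}"
    proof
      fix z assume "z \<in> j ` level_pairs ?H ?u"
      then obtain a c' where z: "z = j (a, c')" "(a, c') \<in> level_pairs ?H ?u" by auto
      then have a: "a = e' \<or> a \<in> medges G" "c' \<in> u ` mverts G" "?u (mtail ?H a) < c'" "c' < ?u (mhead ?H a)"
        unfolding level_pairs_def crit by auto
      show "z \<in> level_pairs G u - {(e, c)}"
        using a z(1) ne nw c s(3) e by (auto simp: j_def level_pairs_def split: if_splits)
    qed
    have inj: "inj_on j (level_pairs ?H ?u)"
    proof (rule inj_onI)
      fix z1 z2 assume z: "z1 \<in> level_pairs ?H ?u" "z2 \<in> level_pairs ?H ?u" "j z1 = j z2"
      obtain a1 c1 a2 c2 where zz: "z1 = (a1, c1)" "z2 = (a2, c2)" by fastforce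
      have "c1 = c2" using z(3) zz by (auto simp: j_def)
      moreover have "a1 = a2"
        using z zz ne nw s(3) e by (auto simp: j_def level_pairs_def split: if_splits)
      ultimately show "z1 = z2" using zz by simp
    qed
    have "card (level_pairs ?H ?u) = card (j ` level_pairs ?H ?u)" using card_image[OF inj] by simp
    also have "\<dots> \<le> card (level_pairs G u - {(e, c)})" by (rule card_mono[OF _ sub]) (use finite_level_pairs[OF G] in auto)
    also have "\<dots> < card (level_pairs G u)" by (rule psubset_card_mono[OF finite_level_pairs[OF G]]) (use ec in auto)
    finally have "card (level_pairs ?H ?u) < card (level_pairs G u)" .
    from less.hyps[OF this finite_metric_graph_subdivide[OF sp] ground_state_subdivide[OF gs sp] m]
    obtain H f f' u where H: "chain ?H H" "finite_metric_graph H" "ground_state H \<kappa> f f' u" "monotone_edges H f f'" "level_pairs H u = {}" by blast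
    have "chain G H" by (rule equivclp_trans[OF chain_subdivide[OF sp] H(1)])
    then show ?thesis using H by blast
  qed
qed

lemma chain_normalise:
  fixes G :: "(nat, nat) metric_graph"
  assumes G: "finite_metric_graph G" and cut: "cut_ge 1 G" and e: "medges G \<noteq> {}"
  obtains H \<kappa> f f' u where "chain G H" "finite_metric_graph H" "ground_state H \<kappa> f f' u" "monotone_edges H f f'" "level_pairs H u = {}"
proof -
  obtain H1 \<kappa> f f' u where H1: "chain G H1" "finite_metric_graph H1" "ground_state H1 \<kappa> f f' u"
    by (rule chain_ground_state[OF assms])
  obtain H2 f f' u where H2: "chain H1 H2" "finite_metric_graph H2" "ground_state H2 \<kappa> f f' u" "critical_edges H2 f f' = {}"
    using chain_noncritical[OF H1(2,3)] by blast
  obtain R f f' where H3: "ground_state (flip R H2) \<kappa> f f' u" "monotone_edges (flip R H2) f f'"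
    using flip_monotone[OF H2(2,3,4)] by blast
  have H3': "glues_to H2 (flip R H2)" by (rule glues_to_flip[OF H2(2)])
  then have H3'': "finite_metric_graph (flip R H2)" by (simp add: glues_to_def)
  obtain H4 f f' u where H4: "chain (flip R H2) H4" "finite_metric_graph H4" "ground_state H4 \<kappa> f f' u" "monotone_edges H4 f f'" "level_pairs H4 u = {}"
    using chain_levels[OF H3'' H3] by blast
  have "chain G H4" using H1(1) H2(1) chain_glues[OF H3'] H4(1) by (meson equivclp_trans)
  then show ?thesis using that H4 by blast
qed

section \<open>The equality case\<close>

definition in_edges :: "('v, 'e) metric_graph \<Rightarrow> 'v \<Rightarrow> 'e set" where
  "in_edges G v = {e\<in>medges G. mhead G e = v}"

definition out_edges :: "('v, 'e) metric_graph \<Rightarrow> 'v \<Rightarrow> 'e set" where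
  "out_edges G v = {e\<in>medges G. mtail G e = v}"

text \<open>Covers both extremal families: \<open>n = 2\<close> describes caterpillars, and
  \<open>n = 1\<close> paths with the Dirichlet condition at one end.\<close>

definition pumpkin_chain :: "nat \<Rightarrow> nat \<Rightarrow> (nat \<Rightarrow> 'v) \<Rightarrow> ('v, 'e) metric_graph \<Rightarrow> bool" where
  "pumpkin_chain n m v G \<longleftrightarrow> 1 \<le> m \<and> inj_on v {0..m} \<and> mverts G = v ` {0..m} \<and> dirichlet G = {v 0} \<and>
     (\<forall>e\<in>medges G. \<exists>j\<in>{1..m}. ends G e = {v (j - 1), v j}) \<and>
     (\<forall>j\<in>{1..m}. card {e\<in>medges G. ends G e = {v (j - 1), v j}} = n) \<and>
     (\<forall>a\<in>medges G. \<forall>b\<in>medges G. ends G a = ends G b \<longrightarrow> len G a = len G b)"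

text \<open>The structure to which equality forces a monotone ground state, with \<open>h\<close> its vertex values.\<close>
locale leveled =
  fixes n :: nat and G :: "('v, 'e) metric_graph" and h :: "'v \<Rightarrow> real" and d :: 'v
  assumes G: "finite_metric_graph G" and n: "1 \<le> n" and cut: "cut_ge n G" and ne: "medges G \<noteq> {}"
    and d: "dirichlet G = {d}" "h d = 0" and h0: "\<And>v. v \<in> mverts G \<Longrightarrow> 0 \<le> h v"
    and up: "\<And>e. e \<in> medges G \<Longrightarrow> h (mtail G e) < h (mhead G e)"
    and gap: "\<And>e v. e \<in> medges G \<Longrightarrow> v \<in> mverts G \<Longrightarrow> h (mtail G e) < h v \<Longrightarrow> h (mhead G e) \<le> h v"
    and len_eq: "\<And>a b. a \<in> medges G \<Longrightarrow> b \<in> medges G \<Longrightarrow> h (mtail G a) = h (mtail G b) \<Longrightarrow> h (mhead G a) = h (mhead G b) \<Longrightarrow> len G a = len G b"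
    and class_card: "\<And>e. e \<in> medges G \<Longrightarrow> card {a\<in>medges G. h (mtail G a) = h (mtail G e) \<and> h (mhead G a) = h (mhead G e)} = n"
begin

lemmas fG = finite_metric_graphD[OF G]

lemma d_vert: "d \<in> mverts G" using fG(6) d by simp

text \<open>Of two edges ending at the same level, one starting lower than the other would pass over
  the tail of the other, against \<open>gap\<close>.\<close>

lemma same_head_same_tail:
  assumes "a \<in> medges G" "b \<in> medges G" "h (mhead G a) = h (mhead G b)"
  shows "h (mtail G a) = h (mtail G b)"
proof (rule ccontr)
  assume "h (mtail G a) \<noteq> h (mtail G b)"
  then consider "h (mtail G a) < h (mtail G b)" | "h (mtail G b) < h (mtail G a)" by linarith
  then show False
  proof cases
    case 1 then show ?thesis using gap[OF assms(1) fG(4)[OF assms(2)] 1] up[OF assms(2)] assms(3) by simp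
  next
    case 2 then show ?thesis using gap[OF assms(2) fG(4)[OF assms(1)] 2] up[OF assms(1)] assms(3) by simp
  qed
qed

lemma same_tail_same_head:
  assumes "a \<in> medges G" "b \<in> medges G" "h (mtail G a) = h (mtail G b)"
  shows "h (mhead G a) = h (mhead G b)"
  using gap[OF assms(1) fG(5)[OF assms(2)]] gap[OF assms(2) fG(5)[OF assms(1)]] up[OF assms(1)] up[OF assms(2)] assms(3)
  by simp

definition IN where "IN c = {e\<in>medges G. h (mhead G e) = c}"
definition OUT where "OUT c = {e\<in>medges G. h (mtail G e) = c}"

lemma finite_IN_OUT: "finite (IN c)" "finite (OUT c)" "finite (in_edges G v)" "finite (out_edges G v)"
  using fG(2) by (auto simp: IN_def OUT_def in_edges_def out_edges_def)

lemma card_IN: "e \<in> IN c \<Longrightarrow> card (IN c) = n"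
proof -
  assume e: "e \<in> IN c"
  then have "IN c = {a\<in>medges G. h (mtail G a) = h (mtail G e) \<and> h (mhead G a) = h (mhead G e)}"
    using same_head_same_tail by (auto simp: IN_def)
  then show ?thesis using class_card[of e] e by (simp add: IN_def)
qed

lemma card_OUT: "e \<in> OUT c \<Longrightarrow> card (OUT c) = n"
proof -
  assume e: "e \<in> OUT c"
  then have "OUT c = {a\<in>medges G. h (mtail G a) = h (mtail G e) \<and> h (mhead G a) = h (mhead G e)}"
    using same_tail_same_head by (auto simp: OUT_def)
  then show ?thesis using class_card[of e] e by (simp add: OUT_def)
qed

lemma card_IN_le: "card (IN c) \<le> n" using card_IN by (cases "IN c = {}") auto
lemma card_OUT_le: "card (OUT c) \<le> n" using card_OUT by (cases "OUT c = {}") auto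

lemma in_sub: "in_edges G v \<subseteq> IN (h v)" and out_sub: "out_edges G v \<subseteq> OUT (h v)"
  by (auto simp: in_edges_def out_edges_def IN_def OUT_def)

lemma in_le: "card (in_edges G v) \<le> n"
  using card_mono[OF finite_IN_OUT(1) in_sub, of v] card_IN_le[of "h v"] by simp

lemma out_le: "card (out_edges G v) \<le> n"
  using card_mono[OF finite_IN_OUT(2) out_sub, of v] card_OUT_le[of "h v"] by simp

lemma cutD: "S \<subseteq> mverts G - {d} \<Longrightarrow> S \<noteq> {} \<Longrightarrow> n \<le> card (boundary G S)"
  using cut d by (simp add: cut_ge_def)

lemma degree:
  assumes "v \<in> mverts G" "v \<noteq> d" shows "n \<le> card (in_edges G v) + card (out_edges G v)"
proof -
  have "n \<le> card (boundary G {v})" by (rule cutD) (use assms in auto)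
  also have "\<dots> \<le> card (in_edges G v \<union> out_edges G v)"
    by (rule card_mono) (use fG(2) in \<open>auto simp: boundary_def in_edges_def out_edges_def\<close>)
  also have "\<dots> \<le> card (in_edges G v) + card (out_edges G v)" by (rule card_Un_le)
  finally show ?thesis .
qed

text \<open>Cut around \<open>v\<close> together with all strictly higher vertices. The boundary
  consists of edges into \<open>v\<close> and of edges that leave the level of \<open>v\<close> from
  other vertices; since a level emits at most \<open>n\<close> edges, \<open>v\<close> has at least
  as many incoming as outgoing ones.\<close>

lemma above:
  assumes v: "v \<in> mverts G" "v \<noteq> d"
  shows "n + card (out_edges G v) \<le> card (in_edges G v) + card (OUT (h v))"
proof -
  define S where "S = insert v {x\<in>mverts G. h v < h x}"
  have "d \<notin> S" using v(2) d(2) h0[OF v(1)] by (simp add: S_def)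
  then have "S \<subseteq> mverts G - {d}" "S \<noteq> {}" using v(1) by (auto simp: S_def)
  then have "n \<le> card (boundary G S)" by (rule cutD)
  also have "\<dots> \<le> card (in_edges G v \<union> (OUT (h v) - out_edges G v))"
  proof (rule card_mono)
    show "boundary G S \<subseteq> in_edges G v \<union> (OUT (h v) - out_edges G v)"
    proof
      fix e assume e: "e \<in> boundary G S"
      then have em: "e \<in> medges G" and x: "(mtail G e \<in> S) \<noteq> (mhead G e \<in> S)" by (auto simp: boundary_def)
      have t: "mtail G e \<notin> S" using x up[OF em] fG(5)[OF em] by (auto simp: S_def)
      show "e \<in> in_edges G v \<union> (OUT (h v) - out_edges G v)"
      proof (cases "mhead G e = v")
        case True then show ?thesis using em by (simp add: in_edges_def)
      next
        case False
        then have hv: "h v < h (mhead G e)" using x t by (auto simp: S_def)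
        have "\<not> h (mtail G e) < h v" using gap[OF em v(1)] hv by auto
        moreover have "\<not> h v < h (mtail G e)" using t fG(4)[OF em] by (auto simp: S_def)
        ultimately have "h (mtail G e) = h v" by simp
        moreover have "mtail G e \<noteq> v" using t by (auto simp: S_def)
        ultimately show ?thesis using em by (simp add: OUT_def out_edges_def)
      qed
    qed
  qed (use finite_IN_OUT in auto)
  also have "\<dots> \<le> card (in_edges G v) + card (OUT (h v) - out_edges G v)" by (rule card_Un_le)
  also have "card (OUT (h v) - out_edges G v) = card (OUT (h v)) - card (out_edges G v)"
    by (rule card_Diff_subset[OF finite_IN_OUT(4) out_sub])
  finally show ?thesis using card_mono[OF finite_IN_OUT(2) out_sub, of v] by simp
qed

text \<open>A further vertex at level zero has no incoming edges, so by the cut above it no outgoing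
  ones either, and the cut around it alone is too small.\<close>

lemma h_pos:
  assumes v: "v \<in> mverts G" "v \<noteq> d" shows "0 < h v"
proof (rule ccontr)
  assume "\<not> 0 < h v"
  then have z: "h v = 0" using h0[OF v(1)] by simp
  have i: "in_edges G v = {}" using up h0 fG(4) z by (force simp: in_edges_def)
  have "n + card (out_edges G v) \<le> n" using above[OF v] card_OUT_le[of "h v"] i by simp
  then show False using degree[OF v] n i by simp
qed

text \<open>The counterpart of \<open>above\<close>: cut around the vertices at or above the level
  of \<open>v\<close>, leaving out \<open>v\<close> itself. The extra vertex \<open>x\<close> keeps
  this set nonempty. Together the two cuts balance incoming and outgoing edges at every vertex that
  is not alone at the top.\<close>

lemma below:
  assumes v: "v \<in> mverts G" "v \<noteq> d" and x: "x \<in> mverts G" "x \<noteq> v" "h v \<le> h x"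
  shows "n + card (in_edges G v) \<le> card (out_edges G v) + card (IN (h v))"
proof -
  define S where "S = {x\<in>mverts G. h v \<le> h x} - {v}"
  have "d \<notin> S" using d(2) h_pos[OF v] by (simp add: S_def)
  then have "S \<subseteq> mverts G - {d}" "S \<noteq> {}" using x by (auto simp: S_def)
  then have "n \<le> card (boundary G S)" by (rule cutD)
  also have "\<dots> \<le> card (out_edges G v \<union> (IN (h v) - in_edges G v))"
  proof (rule card_mono)
    show "boundary G S \<subseteq> out_edges G v \<union> (IN (h v) - in_edges G v)"
    proof
      fix e assume e: "e \<in> boundary G S"
      then have em: "e \<in> medges G" and x: "(mtail G e \<in> S) \<noteq> (mhead G e \<in> S)" by (auto simp: boundary_def)
      have t: "mtail G e \<notin> S" "mhead G e \<in> S" using x up[OF em] fG(5)[OF em] by (auto simp: S_def)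
      show "e \<in> out_edges G v \<union> (IN (h v) - in_edges G v)"
      proof (cases "mtail G e = v")
        case True then show ?thesis using em by (simp add: out_edges_def)
      next
        case False
        then have hv: "h (mtail G e) < h v" using t fG(4)[OF em] by (auto simp: S_def)
        have "h (mhead G e) \<le> h v" by (rule gap[OF em v(1) hv])
        then show ?thesis using t em by (auto simp: S_def IN_def in_edges_def)
      qed
    qed
  qed (use finite_IN_OUT in auto)
  also have "\<dots> \<le> card (out_edges G v) + card (IN (h v) - in_edges G v)" by (rule card_Un_le)
  also have "card (IN (h v) - in_edges G v) = card (IN (h v)) - card (in_edges G v)"
    by (rule card_Diff_subset[OF finite_IN_OUT(3) in_sub])
  finally show ?thesis using card_mono[OF finite_IN_OUT(1) in_sub, of v] by simp
qed

lemma out_le_in: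
  assumes v: "v \<in> mverts G" "v \<noteq> d" shows "card (out_edges G v) \<le> card (in_edges G v)"
  using above[OF v] card_OUT_le[of "h v"] by simp

lemma in_eq_out:
  assumes v: "v \<in> mverts G" "v \<noteq> d" and x: "x \<in> mverts G" "x \<noteq> v" "h v \<le> h x"
  shows "card (in_edges G v) = card (out_edges G v)"
  using below[OF assms] card_IN_le[of "h v"] out_le_in[OF v] by simp

lemma in_nonempty:
  assumes v: "v \<in> mverts G" "v \<noteq> d" shows "in_edges G v \<noteq> {}"
  using degree[OF v] out_le_in[OF v] n by auto

lemma same_level_in_lt:
  assumes v: "v \<in> mverts G" "v \<noteq> d" and x: "x \<in> mverts G" "x \<noteq> v" "h x = h v"
  shows "card (in_edges G v) + card (in_edges G x) \<le> n"
proof -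
  have "card (in_edges G v) + card (in_edges G x) = card (in_edges G v \<union> in_edges G x)"
    by (rule card_Un_disjoint[symmetric]) (use x finite_IN_OUT in \<open>auto simp: in_edges_def\<close>)
  also have "\<dots> \<le> card (IN (h v))"
    by (rule card_mono[OF finite_IN_OUT(1)]) (use in_sub[of v] in_sub[of x] x in auto)
  finally show ?thesis using card_IN_le[of "h v"] by simp
qed

text \<open>If two vertices share a level, the first is balanced and, having all \<open>n\<close>
  outgoing edges, absorbs all \<open>n\<close> edges arriving at that level. Nothing is left for the
  second.\<close>

lemma injective:
  assumes full: "\<And>v. v \<in> mverts G \<Longrightarrow> v \<noteq> d \<Longrightarrow> out_edges G v \<noteq> {} \<Longrightarrow> card (out_edges G v) = n"
  shows "inj_on h (mverts G)"
proof (rule inj_onI, rule ccontr)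
  fix v x assume v: "v \<in> mverts G" and x: "x \<in> mverts G" and e: "h v = h x" and nq: "v \<noteq> x"
  have vd: "v \<noteq> d" "x \<noteq> d" using h_pos v x e nq d(2) by force+
  have "card (in_edges G v) = card (out_edges G v)" by (rule in_eq_out[OF v vd(1) x]) (use e nq in auto)
  moreover have "card (in_edges G v) > 0" using in_nonempty[OF v vd(1)] finite_IN_OUT(3)[of v] by (simp add: card_gt_0_iff)
  moreover have "card (in_edges G x) > 0" using in_nonempty[OF x vd(2)] finite_IN_OUT(3)[of x] by (simp add: card_gt_0_iff)
  ultimately have "card (in_edges G v) = n" using full[OF v vd(1)] by force
  then show False using same_level_in_lt[OF v vd(1) x] nq e \<open>card (in_edges G x) > 0\<close> by simp
qed

lemma enumerate:
  assumes inj: "inj_on h (mverts G)"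
  shows "\<exists>m v. pumpkin_chain n m v G"
proof -
  define V where "V = mverts G"
  \<comment> \<open>The rank of a vertex by height. As no edge passes over a vertex level, edges
    join consecutive ranks.\<close>
  define r where "r v = card {x\<in>V. h x < h v}" for v
  have finV: "finite V" using fG(1) by (simp add: V_def)
  have r_mono: "r a < r b" if "a \<in> V" "h a < h b" for a b
    unfolding r_def by (rule psubset_card_mono) (use that finV in auto)
  have r_inj: "inj_on r V"
  proof (rule inj_onI)
    fix a b assume ab: "a \<in> V" "b \<in> V" "r a = r b"
    then have "h a = h b" using r_mono[of a b] r_mono[of b a] by (metis less_irrefl linorder_less_linear)
    then show "a = b" using inj ab by (auto simp: inj_on_def V_def)
  qed
  have r_lt: "r a < card V" if "a \<in> V" for a
    unfolding r_def by (rule psubset_card_mono) (use that finV in auto)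
  define m where "m = card V - 1"
  obtain e0 where e0: "e0 \<in> medges G" using ne by blast
  have "mtail G e0 \<in> V" "mhead G e0 \<in> V" "mtail G e0 \<noteq> mhead G e0" using fG(4,5)[OF e0] up[OF e0] by (auto simp: V_def)
  then have "card {mtail G e0, mhead G e0} \<le> card V" by (intro card_mono finV) auto
  then have m: "1 \<le> m" "card V = Suc m" using \<open>mtail G e0 \<noteq> mhead G e0\<close> by (auto simp: m_def)
  have img: "r ` V = {0..m}"
  proof (rule card_subset_eq)
    show "r ` V \<subseteq> {0..m}" using r_lt m by (auto simp: less_Suc_eq_le)
    show "card (r ` V) = card {0..m}" using card_image[OF r_inj] m by simp
  qed simp
  define v where "v = inv_into V r"
  have vr: "v (r a) = a" if "a \<in> V" for a unfolding v_def using r_inj that by simp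
  have rv: "r (v j) = j" "v j \<in> V" if "j \<in> {0..m}" for j
    using that img unfolding v_def by (metis f_inv_into_f, metis inv_into_into)
  have v_inj: "inj_on v {0..m}" using rv by (metis inj_onI)
  have v_img: "mverts G = v ` {0..m}"
  proof
    show "mverts G \<subseteq> v ` {0..m}"
    proof
      fix a assume "a \<in> mverts G"
      then show "a \<in> v ` {0..m}" using vr[of a] img by (metis V_def image_eqI)
    qed
    show "v ` {0..m} \<subseteq> mverts G" using rv(2) by (auto simp: V_def)
  qed
  have "r d = 0" unfolding r_def using h0 d(2) finV by (auto simp: V_def not_less)
  then have v0: "v 0 = d" using vr[of d] d_vert by (simp add: V_def)
  have step: "r (mhead G e) = Suc (r (mtail G e))" if e: "e \<in> medges G" for e
  proof -
    have "{x\<in>V. h x < h (mhead G e)} = insert (mtail G e) {x\<in>V. h x < h (mtail G e)}"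
    proof (intro set_eqI iffI)
      fix x assume x: "x \<in> {x\<in>V. h x < h (mhead G e)}"
      then have "\<not> h (mtail G e) < h x" using gap[OF e, of x] by (auto simp: V_def)
      then have "h x < h (mtail G e) \<or> x = mtail G e" using inj x fG(4)[OF e] by (force simp: V_def inj_on_def)
      then show "x \<in> insert (mtail G e) {x\<in>V. h x < h (mtail G e)}" using x by auto
    next
      fix x assume "x \<in> insert (mtail G e) {x\<in>V. h x < h (mtail G e)}"
      then show "x \<in> {x\<in>V. h x < h (mhead G e)}" using up[OF e] fG(4)[OF e] by (auto simp: V_def)
    qed
    then show ?thesis unfolding r_def using finV by simp
  qed
  have edges: "\<exists>j\<in>{1..m}. mtail G e = v (j - 1) \<and> mhead G e = v j" if e: "e \<in> medges G" for e
  proof (intro bexI[of _ "r (mhead G e)"] conjI)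
    show "mtail G e = v (r (mhead G e) - 1)" using step[OF e] vr fG(4)[OF e] by (simp add: V_def)
    show "mhead G e = v (r (mhead G e))" using vr fG(5)[OF e] by (simp add: V_def)
    have "r (mhead G e) \<in> {0..m}" unfolding img[symmetric] using fG(5)[OF e] by (simp add: V_def)
    then show "r (mhead G e) \<in> {1..m}" using step[OF e] by simp
  qed
  have ends_iff: "ends G a = ends G b \<longleftrightarrow> mtail G a = mtail G b \<and> mhead G a = mhead G b" if "a \<in> medges G" "b \<in> medges G" for a b
    using up[OF that(1)] up[OF that(2)] by (auto simp: ends_def doubleton_eq_iff)
  have cards: "card {e\<in>medges G. ends G e = {v (j - 1), v j}} = n" if j: "j \<in> {1..m}" for j
  proof -
    have jV: "v j \<in> V" "r (v j) = j" using rv[of j] j by auto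
    then have "v j \<noteq> d" using j \<open>r d = 0\<close> by auto
    then obtain e where e: "e \<in> medges G" "mhead G e = v j" using in_nonempty[of "v j"] jV by (auto simp: V_def in_edges_def)
    then have t: "mtail G e = v (j - 1)" using step[OF e(1)] jV vr[of "mtail G e"] fG(4)[OF e(1)] by (auto simp: V_def)
    have "{a\<in>medges G. ends G a = {v (j - 1), v j}} = {a\<in>medges G. h (mtail G a) = h (mtail G e) \<and> h (mhead G a) = h (mhead G e)}"
    proof (intro set_eqI iffI)
      fix a assume a: "a \<in> {a\<in>medges G. ends G a = {v (j - 1), v j}}"
      then have "ends G a = ends G e" using e t by (simp add: ends_def)
      then show "a \<in> {a\<in>medges G. h (mtail G a) = h (mtail G e) \<and> h (mhead G a) = h (mhead G e)}"
        using ends_iff[of a e] a e by auto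
    next
      fix a assume a: "a \<in> {a\<in>medges G. h (mtail G a) = h (mtail G e) \<and> h (mhead G a) = h (mhead G e)}"
      then have "mtail G a = mtail G e" "mhead G a = mhead G e" using inj fG(4,5) e(1) by (auto simp: inj_on_def)
      then show "a \<in> {a\<in>medges G. ends G a = {v (j - 1), v j}}" using a e t by (simp add: ends_def)
    qed
    then show ?thesis using class_card[OF e(1)] by simp
  qed
  have "\<exists>j\<in>{1..m}. ends G e = {v (j - 1), v j}" if "e \<in> medges G" for e
    using edges[OF that] by (auto simp: ends_def)
  note ends_v = this
  have len_ends: "len G a = len G b" if "a \<in> medges G" "b \<in> medges G" "ends G a = ends G b" for a b
    using len_eq[OF that(1,2)] ends_iff[OF that(1,2)] that(3) by simp
  have "pumpkin_chain n m v G"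
    unfolding pumpkin_chain_def
  proof (intro conjI ballI impI)
    show "dirichlet G = {v 0}" unfolding v0 by (rule d(1))
  qed (rule m(1) v_inj v_img ends_v cards len_ends; assumption)+
  then show ?thesis by blast
qed

end

lemma leveled_caterpillar:
  assumes L: "leveled 2 G h d" and inj: "inj_on h (mverts G)"
  shows "caterpillar G"
proof -
  interpret leveled 2 G h d by (rule L)
  obtain m v where "pumpkin_chain 2 m v G" using enumerate[OF inj] by blast
  note e = this[unfolded pumpkin_chain_def]
  have "\<exists>a b. a \<noteq> b \<and> {e\<in>medges G. ends G e = {v (j - 1), v j}} = {a, b} \<and> len G a = len G b" if j: "j \<in> {1..m}" for j
  proof -
    have "card {e\<in>medges G. ends G e = {v (j - 1), v j}} = 2" using e j by blast
    then obtain a b where ab: "{e\<in>medges G. ends G e = {v (j - 1), v j}} = {a, b}" "a \<noteq> b"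
      by (auto simp: card_2_iff)
    then have "a \<in> medges G" "b \<in> medges G" "ends G a = ends G b" by blast+
    then have "len G a = len G b" using e by blast
    then show ?thesis using ab by blast
  qed
  moreover have "1 \<le> m" "inj_on v {0..m}" "mverts G = v ` {0..m}" "dirichlet G = {v 0}"
    "\<forall>e\<in>medges G. \<exists>j\<in>{1..m}. ends G e = {v (j - 1), v j}" using e by auto
  ultimately show ?thesis unfolding caterpillar_def using G by (intro conjI exI[of _ m] exI[of _ v] ballI) auto
qed

section \<open>Removing vertices of degree two\<close>

text \<open>Undoes a subdivision at a vertex \<open>v\<close> entered by \<open>a\<close> and left
  by \<open>b\<close>; see \<open>subdivide_merge\<close>.\<close>

definition merge :: "('v, 'e) metric_graph \<Rightarrow> 'v \<Rightarrow> 'e \<Rightarrow> 'e \<Rightarrow> ('v, 'e) metric_graph" where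
  "merge G v a b = \<lparr> skeleton = \<lparr> verts = mverts G - {v}, arcs = medges G - {b}, tail = mtail G, head = (mhead G)(a := mhead G b) \<rparr>,
     len = (len G)(a := len G a + len G b), dirichlet = dirichlet G \<rparr>"

lemma merge_simps [simp]:
  "mverts (merge G v a b) = mverts G - {v}" "medges (merge G v a b) = medges G - {b}" "mtail (merge G v a b) = mtail G"
  "mhead (merge G v a b) = (mhead G)(a := mhead G b)" "len (merge G v a b) = (len G)(a := len G a + len G b)"
  "dirichlet (merge G v a b) = dirichlet G"
  by (auto simp: merge_def)

lemma subdivide_merge:
  assumes G: "finite_metric_graph G" and v: "v \<in> mverts G - dirichlet G" and ab: "a \<noteq> b"
    and i: "in_edges G v = {a}" and o: "out_edges G v = {b}"
  shows "subdivision_point (merge G v a b) a b v (len G a)" "subdivide (merge G v a b) a b v (len G a) = G"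
proof -
  note fG = finite_metric_graphD[OF G]
  have e: "a \<in> medges G" "b \<in> medges G" "mhead G a = v" "mtail G b = v" using i o by (auto simp: in_edges_def out_edges_def)
  have io: "mhead G x = v \<longleftrightarrow> x = a" "mtail G x = v \<longleftrightarrow> x = b" if "x \<in> medges G" for x
    using i o that by (auto simp: in_edges_def out_edges_def)
  have "fin_digraph (skeleton (merge G v a b))"
    by unfold_locales (use fG io e ab in auto)
  then have "finite_metric_graph (merge G v a b)" unfolding finite_metric_graph_def
    using fG v e by (auto intro: add_pos_pos)
  then show "subdivision_point (merge G v a b) a b v (len G a)"
    unfolding subdivision_point_def using fG e ab v by auto
  have "mhead G = (mhead G)(a := v, b := mhead G b)" using e by (auto simp: fun_eq_iff)
  moreover have "mtail G = (mtail G)(b := v)" using e by (auto simp: fun_eq_iff)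
  moreover have "len G = (len G)(a := len G a, b := len G a + len G b - len G a)" by (auto simp: fun_eq_iff)
  ultimately show "subdivide (merge G v a b) a b v (len G a) = G"
    unfolding subdivide_def using e v ab by (cases G, cases "skeleton G") (auto simp: merge_def insert_absorb fun_upd_twist)
qed

lemma chain_merge:
  fixes G :: "(nat, nat) metric_graph"
  assumes "finite_metric_graph G" "v \<in> mverts G - dirichlet G" "a \<noteq> b" "in_edges G v = {a}" "out_edges G v = {b}"
  shows "chain G (merge G v a b)" "finite_metric_graph (merge G v a b)" "n \<le> 2 \<Longrightarrow> cut_ge n G \<Longrightarrow> cut_ge n (merge G v a b)"
proof -
  note s = subdivide_merge[OF assms]
  show "chain G (merge G v a b)" using chain_subdivide[OF s(1)] unfolding s(2) by (rule equivclp_sym)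
  show "finite_metric_graph (merge G v a b)" using s(1) by (simp add: subdivision_point_def)
  show "cut_ge n (merge G v a b)" if "n \<le> 2" "cut_ge n G" using cut_ge_subdivide[OF s(1) that(1)] s(2) that(2) by simp
qed

text \<open>With one edge per level gap, a non-Dirichlet vertex with an outgoing edge has exactly
  one incoming and one outgoing edge and can be merged away. When no such vertex is left, the chain
  has a single edge.\<close>

lemma leveled_1_mixed_interval:
  fixes G :: "(nat, nat) metric_graph"
  assumes "leveled 1 G h d"
  shows "\<exists>H. chain G H \<and> mixed_interval H"
  using assms
proof (induction "card (mverts G)" arbitrary: G rule: less_induct)
  case less
  interpret leveled 1 G h d by (rule less.prems)
  show ?case
  proof (cases "\<exists>v. v \<in> mverts G \<and> v \<noteq> d \<and> out_edges G v \<noteq> {}")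
    case True
    then obtain v where v: "v \<in> mverts G" "v \<noteq> d" "out_edges G v \<noteq> {}" by blast
    have "card (out_edges G v) = 1" using v(3) out_le[of v] finite_IN_OUT(4)[of v] by (simp add: le_Suc_eq)
    moreover have "card (in_edges G v) = 1" using in_nonempty[OF v(1,2)] in_le[of v] finite_IN_OUT(3)[of v] by (simp add: le_Suc_eq)
    ultimately obtain a b where ab: "in_edges G v = {a}" "out_edges G v = {b}" by (auto simp: card_1_singleton_iff)
    have e: "a \<in> medges G" "b \<in> medges G" "mhead G a = v" "mtail G b = v" using ab by (auto simp: in_edges_def out_edges_def)
    have nab: "a \<noteq> b" using up[OF e(1)] e by auto
    have vD: "v \<in> mverts G - dirichlet G" using v d by simp
    let ?H = "merge G v a b"
    note cm = chain_merge[OF G vD nab ab]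
    have uniq: "x = v" if x: "x \<in> mverts G" "h x = h v" for x
    proof (rule ccontr)
      assume xv: "x \<noteq> v"
      have xd: "x \<noteq> d" using h_pos[OF v(1,2)] d x by auto
      have "card (in_edges G x) > 0" using in_nonempty[OF x(1) xd] finite_IN_OUT(3)[of x] by (simp add: card_gt_0_iff)
      then show False using same_level_in_lt[OF v(1,2) x(1) xv x(2)] ab by simp
    qed
    have lv: "h (mtail G a) < h v" "h v < h (mhead G b)" using up[OF e(1)] up[OF e(2)] e by auto
    have single: "x = y" if "x \<in> medges G" "y \<in> medges G" "h (mtail G x) = h (mtail G y)" for x y
    proof -
      have "card (OUT (h (mtail G y))) \<le> 1" by (rule card_OUT_le)
      moreover have "x \<in> OUT (h (mtail G y))" "y \<in> OUT (h (mtail G y))" using that by (auto simp: OUT_def)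
      ultimately show ?thesis using finite_IN_OUT(2) by (metis One_nat_def card_le_Suc0_iff_eq)
    qed
    have "leveled 1 ?H h d"
    proof
      show "finite_metric_graph ?H" by (rule cm(2))
      show "cut_ge 1 ?H" by (rule cm(3)[OF _ cut]) simp
      show "medges ?H \<noteq> {}" using e nab by auto
      show "h (mtail ?H x) < h (mhead ?H x)" if "x \<in> medges ?H" for x using that up[of x] lv by auto
      show "h (mhead ?H x) \<le> h y" if x: "x \<in> medges ?H" and y: "y \<in> mverts ?H" and l: "h (mtail ?H x) < h y" for x y
      proof (cases "x = a")
        case True
        then have "h v \<le> h y" using gap[OF e(1), of y] e y l by auto
        moreover have "h y \<noteq> h v" using uniq[of y] y by auto
        ultimately have "h (mtail G b) < h y" using e by simp
        then show ?thesis using gap[OF e(2), of y] y True by simp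
      next
        case False
        then show ?thesis using gap[of x y] x y l by auto
      qed
      show "len ?H x = len ?H y" if "x \<in> medges ?H" "y \<in> medges ?H" "h (mtail ?H x) = h (mtail ?H y)" "h (mhead ?H x) = h (mhead ?H y)" for x y
        using single[of x y] that by auto
      show "card {x\<in>medges ?H. h (mtail ?H x) = h (mtail ?H y) \<and> h (mhead ?H x) = h (mhead ?H y)} = 1" if y: "y \<in> medges ?H" for y
      proof -
        have "{x\<in>medges ?H. h (mtail ?H x) = h (mtail ?H y) \<and> h (mhead ?H x) = h (mhead ?H y)} = {y}"
          using single[of _ y] y by auto
        then show ?thesis by simp
      qed
    qed (use d h0 in auto)
    moreover have "card (mverts ?H) < card (mverts G)" using card_Diff1_less[OF fG(1) v(1)] by simp
    ultimately obtain H where "chain ?H H" "mixed_interval H" using less.hyps by blast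
    then show ?thesis using equivclp_trans[OF cm(1)] by blast
  next
    case False
    then have "inj_on h (mverts G)" by (intro injective) auto
    then obtain m v where "pumpkin_chain 1 m v G" using enumerate by blast
    note e' = this[unfolded pumpkin_chain_def]
    have e: "1 \<le> m" "inj_on v {0..m}" "mverts G = v ` {0..m}" "v 0 = d" using e' d by auto
    have e6: "card {e\<in>medges G. ends G e = {v (j - 1), v j}} = 1" if "j \<in> {1..m}" for j using e' that by blast
    have v_eq: "v i = v k \<longleftrightarrow> i = k" if "i \<le> m" "k \<le> m" for i k using e(2) that by (auto simp: inj_on_def)
    have m1: "m = 1"
    proof (rule ccontr)
      assume "m \<noteq> 1"
      then have m2: "2 \<in> {1..m}" using e(1) by simp
      have "card {e\<in>medges G. ends G e = {v 1, v 2}} = 1" using e6[OF m2] by simp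
      then obtain a where a: "a \<in> medges G" "ends G a = {v 1, v 2}" by (auto simp: card_1_singleton_iff)
      then have "a \<in> out_edges G (v 1) \<or> a \<in> out_edges G (v 2)" by (auto simp: ends_def out_edges_def doubleton_eq_iff)
      moreover have "v 1 \<noteq> d" "v 2 \<noteq> d" using v_eq[of 1 0] v_eq[of 2 0] m2 e(4) by auto
      moreover have "v 1 \<in> mverts G" "v 2 \<in> mverts G" unfolding e(3) using m2 by auto
      ultimately show False using False by blast
    qed
    have v: "mverts G = {d, v 1}" "v 1 \<noteq> d" using e(3,4) v_eq[of 1 0] unfolding m1 by (auto simp: atLeast0_atMost_Suc)
    obtain a where a: "{e\<in>medges G. ends G e = {v 0, v 1}} = {a}" using e6[of 1] m1 by (auto simp: card_1_singleton_iff)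
    have "medges G = {a}"
    proof -
      have "ends G x = {v 0, v 1}" if "x \<in> medges G" for x using e' that m1 by auto
      then show ?thesis using a by blast
    qed
    moreover have "ends G a = {d, v 1}" using a e(4) by auto
    ultimately have "d \<noteq> v 1 \<and> mverts G = {d, v 1} \<and> medges G = {a} \<and> ends G a = {d, v 1} \<and> dirichlet G = {d}" using v d by simp
    then have "mixed_interval G" unfolding mixed_interval_def using G by blast
    then show ?thesis by (intro exI[of _ G]) simp
  qed
qed

lemma card_2_partner:
  assumes "card S = 2" "a \<in> S" shows "\<exists>b. S = {a, b} \<and> a \<noteq> b"
proof -
  have "card (S - {a}) = 1" using assms by simp
  then obtain b where "S - {a} = {b}" by (auto simp: card_1_singleton_iff)
  then show ?thesis using assms(2) by blast
qed

text \<open>A non-Dirichlet vertex \<open>v\<close> with one outgoing edge has one incoming edge,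
  and exactly one other vertex \<open>w\<close>, also of degree two, lies on its level. The two are
  merged away together: removing \<open>v\<close> alone would leave an edge passing over the level
  of \<open>w\<close>. Equal lengths of the paired edges add up to equal lengths again.\<close>

lemma leveled_2_caterpillar:
  fixes G :: "(nat, nat) metric_graph"
  assumes "leveled 2 G h d"
  shows "\<exists>H. chain G H \<and> caterpillar H"
  using assms
proof (induction "card (mverts G)" arbitrary: G rule: less_induct)
  case less
  interpret leveled 2 G h d by (rule less.prems)
  show ?case
  proof (cases "\<exists>v. v \<in> mverts G \<and> v \<noteq> d \<and> card (out_edges G v) = 1")
    case False
    have "inj_on h (mverts G)"
    proof (rule injective)
      fix v assume v: "v \<in> mverts G" "v \<noteq> d" "out_edges G v \<noteq> {}"
      then have "0 < card (out_edges G v)" using finite_IN_OUT(4)[of v] by (simp add: card_gt_0_iff)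
      then show "card (out_edges G v) = 2" using False v out_le[of v] by (metis One_nat_def Suc_1 le_SucE le_antisym Suc_leI)
    qed
    then have "caterpillar G" by (rule leveled_caterpillar[OF less.prems])
    then show ?thesis by (intro exI[of _ G]) simp
  next
    case True
    then obtain v where v: "v \<in> mverts G" "v \<noteq> d" "card (out_edges G v) = 1" by blast
    obtain b where b: "out_edges G v = {b}" using v(3) by (auto simp: card_1_singleton_iff)
    then have bm: "b \<in> medges G" "mtail G b = v" by (auto simp: out_edges_def)
    have in_v: "card (in_edges G v) = 1"
      using in_eq_out[OF v(1,2) fG(5)[OF bm(1)]] up[OF bm(1)] bm v(3) by fastforce
    obtain a where a: "in_edges G v = {a}" using in_v by (auto simp: card_1_singleton_iff)
    then have am: "a \<in> medges G" "mhead G a = v" by (auto simp: in_edges_def)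
    have "card (IN (h v)) = 2" by (rule card_IN[of a]) (use am in \<open>auto simp: IN_def\<close>)
    then obtain a' where a': "IN (h v) = {a, a'}" "a \<noteq> a'"
      using card_2_partner[of "IN (h v)" a] am by (auto simp: IN_def)
    have "card (OUT (h v)) = 2" by (rule card_OUT[of b]) (use bm in \<open>auto simp: OUT_def\<close>)
    then obtain b' where b': "OUT (h v) = {b, b'}" "b \<noteq> b'"
      using card_2_partner[of "OUT (h v)" b] bm by (auto simp: OUT_def)
    have a'm: "a' \<in> medges G" "h (mhead G a') = h v" and b'm: "b' \<in> medges G" "h (mtail G b') = h v"
      using a' b' by (auto simp: IN_def OUT_def)
    define w where "w = mhead G a'"
    have w: "w \<in> mverts G" "h w = h v" using fG(5)[OF a'm(1)] a'm by (auto simp: w_def)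
    have wv: "w \<noteq> v" using a a' a'm by (auto simp: w_def in_edges_def)
    have wd: "w \<noteq> d" using h_pos[OF v(1,2)] d w by auto
    have level: "x = v \<or> x = w" if x: "x \<in> mverts G" "h x = h v" for x
    proof -
      have "x \<noteq> d" using h_pos[OF v(1,2)] d x by auto
      then obtain e where "e \<in> in_edges G x" using in_nonempty[OF x(1)] by blast
      then have "e \<in> IN (h v)" "mhead G e = x" using in_sub[of x] x by (auto simp: in_edges_def)
      then show ?thesis using a' am by (auto simp: w_def)
    qed
    have in_w: "in_edges G w = {a'}"
    proof -
      have "in_edges G w \<subseteq> {a, a'}" using in_sub[of w] w a' by simp
      then show ?thesis using am wv a'm by (auto simp: in_edges_def w_def)
    qed
    have tb': "mtail G b' = w"
    proof -
      have "mtail G b' \<noteq> v" using b b' b'm by (auto simp: out_edges_def)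
      then show ?thesis using level[OF fG(4)[OF b'm(1)] b'm(2)] by blast
    qed
    have out_w: "out_edges G w = {b'}"
    proof -
      have "out_edges G w \<subseteq> {b, b'}" using out_sub[of w] w b' by simp
      then show ?thesis using bm wv b'm tb' by (auto simp: out_edges_def)
    qed
    have lt: "h (mtail G a) < h v" "h (mtail G a') < h v" "h v < h (mhead G b)" "h v < h (mhead G b')"
      using up[OF am(1)] up[OF a'm(1)] up[OF bm(1)] up[OF b'm(1)] am a'm bm b'm by auto
    have ne: "a \<noteq> b" "a' \<noteq> b'" "a \<noteq> b'" "a' \<noteq> b" using lt am a'm bm b'm by auto
    have vD: "v \<in> mverts G - dirichlet G" using v d by simp
    let ?H1 = "merge G v a b"
    note c1 = chain_merge[OF G vD ne(1) a b]
    have wD: "w \<in> mverts ?H1 - dirichlet ?H1" using w wd wv d by simp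
    have i1: "in_edges ?H1 w = {a'}"
    proof -
      have "mhead G b \<noteq> w" using lt w by auto
      then show ?thesis using in_w ne am a' by (auto simp: in_edges_def)
    qed
    have o1: "out_edges ?H1 w = {b'}" using out_w b' bm wv by (auto simp: out_edges_def)
    let ?H = "merge ?H1 w a' b'"
    note c2 = chain_merge[OF c1(2) wD ne(2) i1 o1]
    have tl: "h (mtail G a) = h (mtail G a')" by (rule same_head_same_tail[OF am(1) a'm(1)]) (use am a'm in simp)
    have hd: "h (mhead G b) = h (mhead G b')" by (rule same_tail_same_head[OF bm(1) b'm(1)]) (use bm b'm in simp)
    have la: "len G a = len G a'" by (rule len_eq[OF am(1) a'm(1) tl]) (use am a'm in simp)
    have lb: "len G b = len G b'" by (rule len_eq[OF bm(1) b'm(1) _ hd]) (use bm b'm in simp)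
    have Hm: "medges ?H = medges G - {b, b'}" "mverts ?H = mverts G - {v, w}" "mtail ?H = mtail G" by auto
    have Ha: "mhead ?H a = mhead G b" "mhead ?H a' = mhead G b'" "len ?H a = len G a + len G b" "len ?H a' = len G a' + len G b'"
      using ne a' b' by auto
    have Ho: "mhead ?H x = mhead G x" "len ?H x = len G x" if "x \<noteq> a" "x \<noteq> a'" for x using that by auto
    \<comment> \<open>The merged edges \<open>a\<close> and \<open>a'\<close> are the only ones
      between their end levels, so all other classes of parallel edges are unchanged.\<close>
    have old: "h (mtail G x) \<noteq> h (mtail G a) \<and> h (mhead G x) \<noteq> h (mhead G b)" if x: "x \<in> medges ?H" "x \<noteq> a" "x \<noteq> a'" for x
    proof
      have xm: "x \<in> medges G" "x \<notin> {b, b'}" using x Hm by auto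
      show "h (mtail G x) \<noteq> h (mtail G a)"
      proof
        assume "h (mtail G x) = h (mtail G a)"
        then have "h (mhead G x) = h v" using same_tail_same_head[OF xm(1) am(1)] am by simp
        then have "x \<in> IN (h v)" using xm by (simp add: IN_def)
        then show False using a' x by auto
      qed
      show "h (mhead G x) \<noteq> h (mhead G b)"
      proof
        assume "h (mhead G x) = h (mhead G b)"
        then have "h (mtail G x) = h v" using same_head_same_tail[OF xm(1) bm(1)] bm by simp
        then have "x \<in> OUT (h v)" using xm by (simp add: OUT_def)
        then show False using b' xm by auto
      qed
    qed
    have "leveled 2 ?H h d"
    proof
      show "finite_metric_graph ?H" by (rule c2(2))
      show "cut_ge 2 ?H" by (rule c2(3)[OF _ c1(3)[OF _ cut]]) simp_all
      show "medges ?H \<noteq> {}" using am ne Hm by blast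
      show "h (mtail ?H x) < h (mhead ?H x)" if x: "x \<in> medges ?H" for x
      proof -
        have "x \<in> medges G" using x Hm by auto
        then show ?thesis using up[of x] lt Ha Ho[of x] Hm(3) by (cases "x = a"; cases "x = a'") auto
      qed
      show "h (mhead ?H x) \<le> h y" if x: "x \<in> medges ?H" and y: "y \<in> mverts ?H" and l: "h (mtail ?H x) < h y" for x y
      proof -
        have xm: "x \<in> medges G" and ym: "y \<in> mverts G" "h y \<noteq> h v" using x y Hm level by auto
        have l': "h (mtail G x) < h y" using l Hm(3) by simp
        have aa: "h (mhead G b) \<le> h y" if "h (mtail G a) < h y"
        proof -
          have "h v < h y" using gap[OF am(1) ym(1) that] am ym by simp
          then show ?thesis using gap[OF bm(1) ym(1)] bm by simp
        qed
        show ?thesis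
        proof (cases "x = a \<or> x = a'")
          case True then show ?thesis using aa l' tl hd Ha by auto
        next
          case False then show ?thesis using Ho[of x] gap[OF xm ym(1) l'] by simp
        qed
      qed
      show "len ?H x = len ?H y" if xy: "x \<in> medges ?H" "y \<in> medges ?H" "h (mtail ?H x) = h (mtail ?H y)" "h (mhead ?H x) = h (mhead ?H y)" for x y
      proof -
        have t: "h (mtail G x) = h (mtail G y)" using xy(3) Hm(3) by simp
        have m: "x \<in> medges G" "y \<in> medges G" using xy(1,2) Hm by auto
        have o: "z \<in> {a, a'} \<longleftrightarrow> h (mtail G z) = h (mtail G a)" if "z \<in> medges ?H" for z
        proof
          show "z \<in> {a, a'} \<Longrightarrow> h (mtail G z) = h (mtail G a)" using tl by auto
          show "h (mtail G z) = h (mtail G a) \<Longrightarrow> z \<in> {a, a'}" using old[OF that] by blast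
        qed
        have iff: "x \<in> {a, a'} \<longleftrightarrow> y \<in> {a, a'}" unfolding o[OF xy(1)] o[OF xy(2)] t ..
        show ?thesis
        proof (cases "x \<in> {a, a'}")
          case True then show ?thesis using iff Ha la lb by auto
        next
          case False
          then show ?thesis using iff Ho[of x] Ho[of y] len_eq[OF m t same_tail_same_head[OF m t]] by auto
        qed
      qed
      show "card {x\<in>medges ?H. h (mtail ?H x) = h (mtail ?H y) \<and> h (mhead ?H x) = h (mhead ?H y)} = 2" (is "card ?C = 2") if y: "y \<in> medges ?H" for y
      proof (cases "y \<in> {a, a'}")
        case True
        then have "h (mtail ?H y) = h (mtail G a)" "h (mhead ?H y) = h (mhead G b)" using Ha tl hd by auto
        moreover have "{x\<in>medges ?H. h (mtail ?H x) = h (mtail G a) \<and> h (mhead ?H x) = h (mhead G b)} = {a, a'}"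
          using old Ha am a'm ne tl hd Hm(1,3) by auto
        ultimately have "?C = {a, a'}" by simp
        then show ?thesis using a' by simp
      next
        case False
        have ym: "y \<in> medges G" using y Hm by auto
        have "?C = {x\<in>medges G. h (mtail G x) = h (mtail G y) \<and> h (mhead G x) = h (mhead G y)}"
        proof (intro set_eqI iffI)
          fix x assume x: "x \<in> ?C"
          then have t: "h (mtail G x) = h (mtail G y)" and m: "x \<in> medges G" using Hm by auto
          then show "x \<in> {x\<in>medges G. h (mtail G x) = h (mtail G y) \<and> h (mhead G x) = h (mhead G y)}"
            using same_tail_same_head[OF m ym t] by auto
        next
          fix x assume x: "x \<in> {x\<in>medges G. h (mtail G x) = h (mtail G y) \<and> h (mhead G x) = h (mhead G y)}"
          have yn: "y \<noteq> a" "y \<noteq> a'" using False by auto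
          have "x \<notin> {b, b'}"
          proof
            assume "x \<in> {b, b'}"
            then have "y \<in> OUT (h v)" using x bm b'm ym by (auto simp: OUT_def)
            then show False using b' y Hm by auto
          qed
          moreover have "h (mtail G y) \<noteq> h (mtail G a)" using old[of y] y yn by blast
          then have "x \<notin> {a, a'}" using x tl by auto
          ultimately show "x \<in> ?C" using x Ho[of x] Ho[of y] yn Hm by auto
        qed
        then show ?thesis using class_card[OF ym] by simp
      qed
    qed (use d h0 in auto)
    moreover have "card (mverts ?H) < card (mverts G)" using v fG(1) by (intro psubset_card_mono) auto
    ultimately obtain H where H: "chain ?H H" "caterpillar H" using less.hyps by blast
    have "chain G H" by (rule equivclp_trans[OF c1(1) equivclp_trans[OF c2(1) H(1)]])
    then show ?thesis using H(2) by blast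
  qed
qed

section \<open>Values on pumpkin chains\<close>

locale pumpkin =
  fixes n m :: nat and v :: "nat \<Rightarrow> 'v" and G :: "('v, 'e) metric_graph"
  assumes G: "finite_metric_graph G" and n: "1 \<le> n" and pc: "pumpkin_chain n m v G"
begin

lemmas fG = finite_metric_graphD[OF G]

lemma pcD: "1 \<le> m" "inj_on v {0..m}" "mverts G = v ` {0..m}" "dirichlet G = {v 0}"
  "\<And>e. e \<in> medges G \<Longrightarrow> \<exists>j\<in>{1..m}. ends G e = {v (j - 1), v j}"
  "\<And>j. j \<in> {1..m} \<Longrightarrow> card {e\<in>medges G. ends G e = {v (j - 1), v j}} = n"
  "\<And>a b. a \<in> medges G \<Longrightarrow> b \<in> medges G \<Longrightarrow> ends G a = ends G b \<Longrightarrow> len G a = len G b"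
  using pc unfolding pumpkin_chain_def by blast+

lemma v_eq: "i \<le> m \<Longrightarrow> j \<le> m \<Longrightarrow> v i = v j \<longleftrightarrow> i = j"
  using pcD(2) by (auto simp: inj_on_def)

definition ix where "ix e = (SOME j. j \<in> {1..m} \<and> ends G e = {v (j - 1), v j})"

lemma ix: assumes "e \<in> medges G" shows "ix e \<in> {1..m}" "ends G e = {v (ix e - 1), v (ix e)}"
proof -
  have "ix e \<in> {1..m} \<and> ends G e = {v (ix e - 1), v (ix e)}"
    unfolding ix_def by (rule someI_ex) (use pcD(5)[OF assms] in blast)
  then show "ix e \<in> {1..m}" "ends G e = {v (ix e - 1), v (ix e)}" by auto
qed

lemma ix_iff: assumes "e \<in> medges G" "j \<in> {1..m}" shows "ix e = j \<longleftrightarrow> ends G e = {v (j - 1), v j}"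
proof
  show "ix e = j \<Longrightarrow> ends G e = {v (j - 1), v j}" using ix(2)[OF assms(1)] by auto
  assume "ends G e = {v (j - 1), v j}"
  then have "{v (ix e - 1), v (ix e)} = {v (j - 1), v j}" using ix(2)[OF assms(1)] by simp
  then show "ix e = j"
    using v_eq[of "ix e" j] v_eq[of "ix e" "j - 1"] v_eq[of "ix e - 1" j] v_eq[of "ix e - 1" "j - 1"] ix(1)[OF assms(1)] assms(2)
    by (auto simp: doubleton_eq_iff)
qed

lemma card_ix: "j \<in> {1..m} \<Longrightarrow> card {e\<in>medges G. ix e = j} = n"
proof -
  assume j: "j \<in> {1..m}"
  then have "{e\<in>medges G. ix e = j} = {e\<in>medges G. ends G e = {v (j - 1), v j}}" using ix_iff by blast
  then show ?thesis using pcD(6)[OF j] by simp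
qed

lemma sum_ix: "(\<Sum>e\<in>medges G. c (ix e)) = real n * (\<Sum>j\<in>{1..m}. c j)" for c :: "nat \<Rightarrow> real"
proof -
  have "(\<Sum>e\<in>medges G. c (ix e)) = (\<Sum>j\<in>{1..m}. \<Sum>e\<in>{e\<in>medges G. ix e = j}. c (ix e))"
    by (rule sum.group[symmetric]) (use fG(2) ix(1) in auto)
  also have "\<dots> = (\<Sum>j\<in>{1..m}. real n * c j)"
  proof (rule sum.cong[OF refl])
    fix j assume j: "j \<in> {1..m}"
    have "(\<Sum>e\<in>{e\<in>medges G. ix e = j}. c (ix e)) = (\<Sum>e\<in>{e\<in>medges G. ix e = j}. c j)" by (rule sum.cong) auto
    then show "(\<Sum>e\<in>{e\<in>medges G. ix e = j}. c (ix e)) = real n * c j" by (simp add: card_ix[OF j])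
  qed
  finally show ?thesis by (simp add: sum_distrib_left)
qed

definition lv where "lv j = len G (SOME e. e \<in> medges G \<and> ix e = j)"

lemma lv: assumes "e \<in> medges G" shows "len G e = lv (ix e)"
proof -
  let ?a = "SOME a. a \<in> medges G \<and> ix a = ix e"
  have a: "?a \<in> medges G \<and> ix ?a = ix e" by (rule someI[of _ e]) (use assms in simp)
  then have "ends G e = ends G ?a" using ix(2)[OF assms] ix(2)[of ?a] by simp
  then show ?thesis unfolding lv_def using pcD(7)[OF assms, of ?a] a by simp
qed

lemma lv_pos: "j \<in> {1..m} \<Longrightarrow> 0 < lv j"
proof -
  assume j: "j \<in> {1..m}"
  have "card {e\<in>medges G. ix e = j} \<noteq> 0" using card_ix[OF j] n by simp
  then have "{e\<in>medges G. ix e = j} \<noteq> {}" by (metis card.empty)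
  then obtain e where "e \<in> medges G" "ix e = j" by blast
  then show ?thesis using lv[of e] fG(3)[of e] by simp
qed

text \<open>The distance of \<open>v j\<close> from the Dirichlet vertex.\<close>

definition X where "X j = (\<Sum>i\<in>{1..j}. lv i)"
definition L where "L = X m"

lemma X_0: "X 0 = 0" by (simp add: X_def)

lemma X_step: "j \<in> {1..m} \<Longrightarrow> X j = X (j - 1) + lv j"
  unfolding X_def by (cases j) auto

lemma telescope: "(\<Sum>j\<in>{1..m}. c j - c (j - 1)) = c m - c 0" for c :: "nat \<Rightarrow> real"
  using sum_telescope''[of 0 m c] by simp

lemma L_pos: "0 < L"
  unfolding L_def X_def by (rule sum_pos) (use lv_pos pcD(1) in auto)

definition hgt where "hgt w = X (inv_into {0..m} v w)"

lemma hgt_v: "j \<le> m \<Longrightarrow> hgt (v j) = X j"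
  unfolding hgt_def using pcD(2) by (simp add: inv_into_f_f)

definition \<sigma> :: "'e \<Rightarrow> real" where "\<sigma> e = (if mtail G e = v (ix e - 1) then 1 else -1)"

lemma sigma_cases:
  assumes "e \<in> medges G"
  shows "(\<sigma> e = 1 \<and> mtail G e = v (ix e - 1) \<and> mhead G e = v (ix e) \<and> hgt (mtail G e) = X (ix e - 1) \<and> hgt (mhead G e) = X (ix e)) \<or>
     (\<sigma> e = -1 \<and> mtail G e = v (ix e) \<and> mhead G e = v (ix e - 1) \<and> hgt (mtail G e) = X (ix e) \<and> hgt (mhead G e) = X (ix e - 1))"
proof -
  have i: "ix e \<le> m" "ix e - 1 \<le> m" "1 \<le> ix e" using ix(1)[OF assms] by auto
  have "v (ix e) \<noteq> v (ix e - 1)" using v_eq[OF i(1,2)] i by auto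
  moreover have "(mtail G e = v (ix e - 1) \<and> mhead G e = v (ix e)) \<or> (mtail G e = v (ix e) \<and> mhead G e = v (ix e - 1))"
    using ix(2)[OF assms] by (auto simp: ends_def doubleton_eq_iff)
  ultimately show ?thesis using hgt_v[OF i(1)] hgt_v[OF i(2)] by (auto simp: \<sigma>_def)
qed

text \<open>The distance from the Dirichlet vertex as a coordinate. It folds the chain onto the
  interval from \<open>0\<close> to \<open>L\<close>, covering it \<open>n\<close> times, so
  functions on that interval lift to the chain.\<close>

abbreviation pos where "pos e x \<equiv> hgt (mtail G e) + \<sigma> e * x"

lemma pos_end: "e \<in> medges G \<Longrightarrow> pos e (len G e) = hgt (mhead G e)"
  using sigma_cases[of e] lv[of e] X_step[OF ix(1)[of e]] by auto

text \<open>Integrals of lifted functions telescope over the chain to \<open>n\<close> times the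
  integral over the interval. Stating this with a primitive \<open>Q\<close> makes the orientation
  of the edges cancel.\<close>

lemma gint_pos:
  assumes d: "\<And>z. (Q has_real_derivative q z) (at z)"
  shows "gint G (\<lambda>e x. q (pos e x)) = real n * (Q L - Q 0)"
proof -
  have "gint G (\<lambda>e x. q (pos e x)) = (\<Sum>e\<in>medges G. (\<lambda>j. Q (X j) - Q (X (j - 1))) (ix e))"
    unfolding gint_def
  proof (rule sum.cong[OF refl])
    fix e assume e: "e \<in> medges G"
    have s2: "\<sigma> e * \<sigma> e = 1" by (simp add: \<sigma>_def)
    have "((\<lambda>x. q (pos e x)) has_integral \<sigma> e * Q (pos e (len G e)) - \<sigma> e * Q (pos e 0)) {0..len G e}"
    proof (rule fundamental_theorem_of_calculus)
      fix x
      have "((\<lambda>x. pos e x) has_real_derivative \<sigma> e) (at x within {0..len G e})" by (auto intro!: derivative_eq_intros)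
      from DERIV_cmult[OF DERIV_chain2[OF d this], of "\<sigma> e"]
      have "((\<lambda>x. \<sigma> e * Q (pos e x)) has_real_derivative q (pos e x) * (\<sigma> e * \<sigma> e)) (at x within {0..len G e})" by (simp add: algebra_simps)
      then show "((\<lambda>x. \<sigma> e * Q (pos e x)) has_vector_derivative q (pos e x)) (at x within {0..len G e})"
        by (simp add: s2 has_real_derivative_iff_has_vector_derivative)
    qed (use fG(3)[OF e] in simp)
    then have "integral {0..len G e} (\<lambda>x. q (pos e x)) = \<sigma> e * Q (hgt (mhead G e)) - \<sigma> e * Q (hgt (mtail G e))"
      using pos_end[OF e] by (simp add: has_integral_iff)
    then show "integral {0..len G e} (\<lambda>x. q (pos e x)) = (\<lambda>j. Q (X j) - Q (X (j - 1))) (ix e)"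
      using sigma_cases[OF e] by auto
  qed
  also have "\<dots> = real n * (\<Sum>j\<in>{1..m}. Q (X j) - Q (X (j - 1)))" by (rule sum_ix)
  also have "(\<Sum>j\<in>{1..m}. Q (X j) - Q (X (j - 1))) = Q L - Q 0"
    using telescope[of "\<lambda>j. Q (X j)"] by (simp add: L_def X_0)
  finally show ?thesis .
qed

lemma pos_H10:
  assumes d: "\<And>z. (p has_real_derivative p' z) (at z)" and c: "continuous_on UNIV p'" and p0: "p 0 = 0"
  shows "H10_deriv G (\<lambda>e x. p (pos e x)) (\<lambda>e x. \<sigma> e * p' (pos e x)) (\<lambda>w. p (hgt w))"
  unfolding H10_deriv_def vertex_values_def
proof (intro conjI ballI)
  fix e assume e: "e \<in> medges G"
  show "H1_deriv (len G e) (\<lambda>x. p (pos e x)) (\<lambda>x. \<sigma> e * p' (pos e x))"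
  proof (rule H1_deriv_C1)
    fix x
    have "((\<lambda>x. pos e x) has_real_derivative \<sigma> e) (at x)" by (auto intro!: derivative_eq_intros)
    from DERIV_chain2[OF d this] show "((\<lambda>x. p (pos e x)) has_real_derivative \<sigma> e * p' (pos e x)) (at x)" by (simp add: mult.commute)
  next
    have "continuous_on UNIV (\<lambda>x. p' (pos e x))" by (rule continuous_on_compose2[OF c]) (auto intro!: continuous_intros)
    then show "continuous_on UNIV (\<lambda>x. \<sigma> e * p' (pos e x))" by (intro continuous_intros)
  qed (use fG(3)[OF e] in simp)
  show "p (pos e 0) = p (hgt (mtail G e))" by simp
  show "p (pos e (len G e)) = p (hgt (mhead G e))" by (simp only: pos_end[OF e])
qed (use pcD(4) hgt_v[of 0] X_0 p0 in auto)

lemma sigma_square: "(\<sigma> e * a)\<^sup>2 = a\<^sup>2" by (simp add: \<sigma>_def power_mult_distrib)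

text \<open>Lifts the lowest eigenfunction of the mixed interval of length \<open>L\<close>. It
  bounds the lowest eigenvalue from above, which is the direction left open by the general
  inequality.\<close>

lemma sine_form:
  obtains F I where "((pi / (2 * L))\<^sup>2 * F, F, I) \<in> forms G" "0 < F"
proof -
  define k where "k = pi / (2 * L)"
  have k: "0 < k" "k * L = pi / 2" using L_pos by (auto simp: k_def)
  define p where "p z = sin (k * z)" for z
  define p' where "p' z = k * cos (k * z)" for z
  have H: "H10_deriv G (\<lambda>e x. p (pos e x)) (\<lambda>e x. \<sigma> e * p' (pos e x)) (\<lambda>w. p (hgt w))"
    by (rule pos_H10) (auto simp: p_def[abs_def] p'_def[abs_def] intro!: derivative_eq_intros continuous_intros)
  have "2 * k * L = pi" using k(2) by simp
  then have s2: "sin (2 * k * L) = 0" by (simp only: sin_pi)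
  have F: "gint G (\<lambda>e x. (p (pos e x))\<^sup>2) = real n * (L / 2)"
  proof -
    have "gint G (\<lambda>e x. (p (pos e x))\<^sup>2) = real n * ((L / 2 - sin (2 * k * L) / (4 * k)) - (0 / 2 - sin (2 * k * 0) / (4 * k)))"
    proof (rule gint_pos)
      fix z
      have "((\<lambda>z. z / 2 - sin (2 * k * z) / (4 * k)) has_real_derivative 1 / 2 - cos (2 * k * z) / 2) (at z)"
        using k(1) by (auto intro!: derivative_eq_intros)
      moreover have "1 / 2 - cos (2 * k * z) / 2 = (p z)\<^sup>2"
        using cos_double_sin[of "k * z"] by (simp add: p_def mult.assoc field_simps)
      ultimately show "((\<lambda>z. z / 2 - sin (2 * k * z) / (4 * k)) has_real_derivative (p z)\<^sup>2) (at z)" by simp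
    qed
    then show ?thesis using s2 by simp
  qed
  have E: "gint G (\<lambda>e x. (\<sigma> e * p' (pos e x))\<^sup>2) = k\<^sup>2 * (real n * (L / 2))"
  proof -
    have "gint G (\<lambda>e x. (p' (pos e x))\<^sup>2) = real n * (k\<^sup>2 * (L / 2 + sin (2 * k * L) / (4 * k)) - k\<^sup>2 * (0 / 2 + sin (2 * k * 0) / (4 * k)))"
    proof (rule gint_pos)
      fix z
      have "((\<lambda>z. k\<^sup>2 * (z / 2 + sin (2 * k * z) / (4 * k))) has_real_derivative k\<^sup>2 * (1 / 2 + cos (2 * k * z) / 2)) (at z)"
        using k(1) by (auto intro!: derivative_eq_intros)
      moreover have "k\<^sup>2 * (1 / 2 + cos (2 * k * z) / 2) = (p' z)\<^sup>2"
        using cos_double_cos[of "k * z"] by (simp add: p'_def mult.assoc power_mult_distrib field_simps)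
      ultimately show "((\<lambda>z. k\<^sup>2 * (z / 2 + sin (2 * k * z) / (4 * k))) has_real_derivative (p' z)\<^sup>2) (at z)" by simp
    qed
    then show ?thesis using s2 by (simp add: sigma_square)
  qed
  show ?thesis
    by (rule that[of "real n * (L / 2)" "gint G (\<lambda>e x. p (pos e x))"]) (use formsI[OF H] E F L_pos n in \<open>auto simp: k_def\<close>)
qed

lemma torsion_form: "\<exists>b. (real n * (L ^ 3 / 3), b, real n * (L ^ 3 / 3)) \<in> forms G"
proof -
  define p where "p z = L * z - z\<^sup>2 / 2" for z
  define p' where "p' z = L - z" for z
  have H: "H10_deriv G (\<lambda>e x. p (pos e x)) (\<lambda>e x. \<sigma> e * p' (pos e x)) (\<lambda>w. p (hgt w))"
    by (rule pos_H10) (auto simp: p_def[abs_def] p'_def[abs_def] intro!: derivative_eq_intros continuous_intros)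
  have "gint G (\<lambda>e x. p (pos e x)) = real n * ((L * L\<^sup>2 / 2 - L ^ 3 / 6) - (L * 0\<^sup>2 / 2 - 0 ^ 3 / 6))"
    by (rule gint_pos) (auto simp: p_def power2_eq_square field_simps intro!: derivative_eq_intros)
  moreover have "gint G (\<lambda>e x. (p' (pos e x))\<^sup>2) = real n * (- ((L - L) ^ 3 / 3) - (- ((L - 0) ^ 3 / 3)))"
    by (rule gint_pos) (auto simp: p'_def power2_eq_square field_simps intro!: derivative_eq_intros)
  ultimately have I: "gint G (\<lambda>e x. p (pos e x)) = real n * (L ^ 3 / 3)"
    and E: "gint G (\<lambda>e x. (\<sigma> e * p' (pos e x))\<^sup>2) = real n * (L ^ 3 / 3)"
    by (simp_all add: sigma_square) (simp add: power2_eq_square power3_eq_cube)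
  show ?thesis using formsI[OF H] unfolding I E by blast
qed

text \<open>The variational argument with the explicit derivative \<open>L - z\<close> of the
  interval's torsion function. Its vertex conditions appear as a telescoping sum whose end terms
  vanish by the Dirichlet condition at \<open>v 0\<close> and the zero slope at
  \<open>v m\<close>.\<close>

lemma torsion_upper:
  assumes z: "(a, b, c) \<in> forms G" shows "2 * c - a \<le> real n * (L ^ 3 / 3)"
proof -
  obtain f f' w where f: "H10_deriv G f f' w" and a: "a = gint G (\<lambda>e x. (f' e x)\<^sup>2)" and c: "c = gint G f"
    using z unfolding forms_def by blast
  note fD = H10_derivD[OF f]
  define p where "p e x = \<sigma> e * (L - pos e x)" for e x
  have dp: "(p e has_real_derivative -1) (at x)" for e x
  proof -
    have "((\<lambda>x. \<sigma> e * (L - pos e x)) has_real_derivative - (\<sigma> e * \<sigma> e)) (at x)" by (auto intro!: derivative_eq_intros)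
    then show ?thesis by (simp add: p_def[abs_def] \<sigma>_def split: if_splits)
  qed
  have p2: "gint G (\<lambda>e x. (p e x)\<^sup>2) = real n * (L ^ 3 / 3)"
  proof -
    have "gint G (\<lambda>e x. (L - pos e x)\<^sup>2) = real n * (- ((L - L) ^ 3 / 3) - (- ((L - 0) ^ 3 / 3)))"
      by (rule gint_pos) (auto simp: power2_eq_square field_simps intro!: derivative_eq_intros)
    then show ?thesis by (simp add: p_def sigma_square)
  qed
  have cp: "continuous_on S (p e)" for S e using dp by (meson DERIV_isCont continuous_at_imp_continuous_on)
  have edge: "2 * (integral {0..len G e} (f e) + (w (v (ix e)) * (L - X (ix e)) - w (v (ix e - 1)) * (L - X (ix e - 1))))
      \<le> integral {0..len G e} (\<lambda>x. (f' e x)\<^sup>2) + integral {0..len G e} (\<lambda>x. (p e x)\<^sup>2)" if e: "e \<in> medges G" for e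
  proof -
    have fi: "f e integrable_on {0..len G e}" by (intro integrable_continuous_real fD(5) e)
    have "((\<lambda>x. f e x * (-1) + f' e x * p e x) has_integral f e (len G e) * p e (len G e) - f e 0 * p e 0) {0..len G e}"
      by (rule H1_deriv_by_parts[OF fD(1)[OF e] dp]) (use fG(3)[OF e] in auto)
    from has_integral_add[OF this integrable_integral[OF fi]]
    have hi: "((\<lambda>x. f' e x * p e x) has_integral (f e (len G e) * p e (len G e) - f e 0 * p e 0) + integral {0..len G e} (f e)) {0..len G e}"
      by simp
    have be: "f e (len G e) * p e (len G e) - f e 0 * p e 0 = w (v (ix e)) * (L - X (ix e)) - w (v (ix e - 1)) * (L - X (ix e - 1))"
      unfolding p_def pos_end[OF e] fD(2)[OF e] fD(3)[OF e] using sigma_cases[OF e] by (auto simp: algebra_simps)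
    have "((\<lambda>x. 2 * (f' e x * p e x)) has_integral 2 * (integral {0..len G e} (f e) + (w (v (ix e)) * (L - X (ix e)) - w (v (ix e - 1)) * (L - X (ix e - 1))))) {0..len G e}"
      using has_integral_mult_right[OF hi, of 2] be by (simp add: algebra_simps)
    moreover have "((\<lambda>x. (f' e x)\<^sup>2 + (p e x)\<^sup>2) has_integral integral {0..len G e} (\<lambda>x. (f' e x)\<^sup>2) + integral {0..len G e} (\<lambda>x. (p e x)\<^sup>2)) {0..len G e}"
      by (intro has_integral_add integrable_integral H1_derivD(2)[OF fD(1)[OF e]] integrable_continuous_real continuous_intros cp)
    moreover have "2 * (f' e x * p e x) \<le> (f' e x)\<^sup>2 + (p e x)\<^sup>2" for x
      using zero_le_power2[of "f' e x - p e x"] by (simp add: power2_diff)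
    ultimately show ?thesis by (rule has_integral_le)
  qed
  have "(\<Sum>e\<in>medges G. 2 * (integral {0..len G e} (f e) + (w (v (ix e)) * (L - X (ix e)) - w (v (ix e - 1)) * (L - X (ix e - 1)))))
      \<le> (\<Sum>e\<in>medges G. integral {0..len G e} (\<lambda>x. (f' e x)\<^sup>2) + integral {0..len G e} (\<lambda>x. (p e x)\<^sup>2))"
    by (rule sum_mono) (rule edge)
  moreover have "(\<Sum>e\<in>medges G. w (v (ix e)) * (L - X (ix e)) - w (v (ix e - 1)) * (L - X (ix e - 1))) = 0"
  proof -
    have "(\<Sum>e\<in>medges G. (\<lambda>j. w (v j) * (L - X j) - w (v (j - 1)) * (L - X (j - 1))) (ix e)) =
       real n * (\<Sum>j\<in>{1..m}. w (v j) * (L - X j) - w (v (j - 1)) * (L - X (j - 1)))" by (rule sum_ix)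
    also have "(\<Sum>j\<in>{1..m}. w (v j) * (L - X j) - w (v (j - 1)) * (L - X (j - 1))) = w (v m) * (L - X m) - w (v 0) * (L - X 0)"
      by (rule telescope)
    also have "\<dots> = 0" using fD(4)[of "v 0"] pcD(4) by (simp add: L_def)
    finally show ?thesis by simp
  qed
  ultimately show ?thesis
    unfolding a c p2[symmetric] gint_def sum_distrib_left[symmetric] sum.distrib by simp
qed

lemma torsion_value:
  assumes cut: "cut_ge 1 G" shows "torsional_rigidity G = real n * (L ^ 3 / 3)"
proof (rule antisym)
  show "torsional_rigidity G \<le> real n * (L ^ 3 / 3)"
    using torsional_rigidity_max(2)[OF G cut] torsion_upper by auto
  show "real n * (L ^ 3 / 3) \<le> torsional_rigidity G"
    using torsion_form torsional_rigidity_max(1)[OF G cut] by force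
qed

end

lemma mixed_interval_pumpkin:
  assumes "mixed_interval G" shows "\<exists>m v. pumpkin_chain 1 m v G"
proof -
  obtain a b e where *: "a \<noteq> b" "mverts G = {a, b}" "medges G = {e}" "ends G e = {a, b}" "dirichlet G = {a}"
    using assms unfolding mixed_interval_def by blast
  define v where "v j = (if j = 0 then a else b)" for j :: nat
  have v: "v 0 = a" "v 1 = b" by (auto simp: v_def)
  have "{x\<in>medges G. ends G x = {v (1 - 1), v 1}} = {e}" using * v by auto
  then have "pumpkin_chain 1 1 v G" unfolding pumpkin_chain_def
    using * v by (auto simp: inj_on_def atLeast0_atMost_Suc)
  then show ?thesis by blast
qed

lemma caterpillar_pumpkin:
  assumes "caterpillar G" shows "\<exists>m v. pumpkin_chain 2 m v G"
proof -
  obtain m v where *: "1 \<le> (m::nat)" "inj_on v {0..m}" "mverts G = v ` {0..m}" "dirichlet G = {v 0}"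
    "\<forall>j\<in>{1..m}. \<exists>a b. a \<noteq> b \<and> {e\<in>medges G. ends G e = {v (j - 1), v j}} = {a, b} \<and> len G a = len G b"
    "\<forall>e\<in>medges G. \<exists>j\<in>{1..m}. ends G e = {v (j - 1), v j}"
    using assms unfolding caterpillar_def by auto
  have c: "card {e\<in>medges G. ends G e = {v (j - 1), v j}} = 2" if j: "j \<in> {1..m}" for j
  proof -
    obtain a b where "a \<noteq> b" "{e\<in>medges G. ends G e = {v (j - 1), v j}} = {a, b}"
      using bspec[OF *(5) j] by (elim exE conjE) (rule that)
    then show ?thesis by simp
  qed
  have l: "len G x = len G y" if xy: "x \<in> medges G" "y \<in> medges G" "ends G x = ends G y" for x y
  proof -
    obtain j where j: "j \<in> {1..m}" "ends G x = {v (j - 1), v j}" using bspec[OF *(6) xy(1)] by blast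
    obtain a b where "a \<noteq> b" "{e\<in>medges G. ends G e = {v (j - 1), v j}} = {a, b}" "len G a = len G b"
      using bspec[OF *(5) j(1)] by (elim exE conjE) (rule that)
    moreover have "x \<in> {e\<in>medges G. ends G e = {v (j - 1), v j}}" "y \<in> {e\<in>medges G. ends G e = {v (j - 1), v j}}"
      using xy(1,2) j(2) xy(3)[symmetric] by simp_all
    ultimately show ?thesis by auto
  qed
  have "pumpkin_chain 2 m v G" unfolding pumpkin_chain_def
  proof (intro conjI ballI impI)
    show "1 \<le> m" "inj_on v {0..m}" "mverts G = v ` {0..m}" "dirichlet G = {v 0}" by (rule *(1-4))+
    show "\<exists>j\<in>{1..m}. ends G e = {v (j - 1), v j}" if "e \<in> medges G" for e by (rule *(6)[rule_format, OF that])
    show "card {e\<in>medges G. ends G e = {v (j - 1), v j}} = 2" if "j \<in> {1..m}" for j by (rule c[OF that])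
    show "len G x = len G y" if "x \<in> medges G" "y \<in> medges G" "ends G x = ends G y" for x y by (rule l[OF that])
  qed
  then show ?thesis by blast
qed

section \<open>From the comparison to the product of eigenvalue and torsion\<close>

text \<open>The constant \<open>24\<close> is \<open>3 * 2 ^ 3\<close>: the \<open>3\<close> from
  the rigidity \<open>R ^ 3 / 3\<close> of an interval and the \<open>2\<close> from its length
  \<open>R = pi / (2 * sqrt \<kappa>)\<close> at eigenvalue \<open>\<kappa>\<close>. With
  \<open>N\<close> copies it becomes \<open>24 / N\<close>.\<close>

lemma kohler_jobin_arith:
  fixes \<kappa> T N :: real
  assumes k: "0 < \<kappa>" and N: "0 < N"
  shows "\<kappa> * (N * (pi / (2 * sqrt \<kappa>)) ^ 3 / 3) powr (2 / 3) = (pi / root 3 (24 / N))\<^sup>2"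
    "N * (pi / (2 * sqrt \<kappa>)) ^ 3 / 3 \<le> T \<Longrightarrow> (pi / root 3 (24 / N))\<^sup>2 \<le> \<kappa> * T powr (2 / 3)"
    "N * (pi / (2 * sqrt \<kappa>)) ^ 3 / 3 \<le> T \<Longrightarrow> (pi / root 3 (24 / N))\<^sup>2 = \<kappa> * T powr (2 / 3) \<Longrightarrow> T = N * (pi / (2 * sqrt \<kappa>)) ^ 3 / 3"
proof -
  define T1 where "T1 = N * (pi / (2 * sqrt \<kappa>)) ^ 3 / 3"
  define r where "r = root 3 (24 / N)"
  have r: "0 < r" "r ^ 3 = 24 / N" using N by (auto simp: r_def)
  define q where "q = pi / r / sqrt \<kappa>"
  have q: "0 < q" using r k by (simp add: q_def)
  have "q ^ 3 = pi ^ 3 / r ^ 3 / sqrt \<kappa> ^ 3" by (simp add: q_def power_divide power_mult_distrib)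
  then have T1q: "T1 = q ^ 3" unfolding r(2) T1_def using N k by (simp add: power_divide field_simps)
  have T1: "0 < T1" using q by (simp add: T1q)
  have "T1 powr (2 / 3) = (q powr 3) powr (2 / 3)" unfolding T1q powr_numeral[OF order_less_imp_le[OF q]] ..
  also have "\<dots> = q powr 2" unfolding powr_powr by simp
  also have "\<dots> = q\<^sup>2" using q by (simp add: powr_numeral)
  finally have "T1 powr (2 / 3) = q\<^sup>2" .
  then show 1: "\<kappa> * (N * (pi / (2 * sqrt \<kappa>)) ^ 3 / 3) powr (2 / 3) = (pi / root 3 (24 / N))\<^sup>2"
    unfolding T1_def[symmetric] r_def[symmetric] using k by (simp add: q_def power_divide power_mult_distrib)
  assume le: "N * (pi / (2 * sqrt \<kappa>)) ^ 3 / 3 \<le> T"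
  have "T1 powr (2 / 3) \<le> T powr (2 / 3)" using le T1 unfolding T1_def[symmetric] by (intro powr_mono2) auto
  then show "(pi / root 3 (24 / N))\<^sup>2 \<le> \<kappa> * T powr (2 / 3)"
    unfolding 1[symmetric] T1_def[symmetric] using k by (intro mult_left_mono) auto
  assume eq: "(pi / root 3 (24 / N))\<^sup>2 = \<kappa> * T powr (2 / 3)"
  then have "T1 powr (2 / 3) = T powr (2 / 3)" unfolding 1[symmetric] T1_def[symmetric] using k by simp
  then have "\<not> T1 < T" using powr_less_mono2[of "2 / 3" T1 T] T1 by auto
  then show "T = N * (pi / (2 * sqrt \<kappa>)) ^ 3 / 3" using le unfolding T1_def[symmetric] by simp
qed

text \<open>The sine form bounds \<open>\<kappa>\<close> by the eigenvalue of the mixed interval of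
  length \<open>L\<close>, and the torsional rigidity is \<open>n\<close> times that of the same
  interval; the product of these two values is the constant.\<close>

lemma pumpkin_product_le:
  assumes G: "finite_metric_graph G" and cut: "cut_ge 1 G" and n: "1 \<le> n" and pc: "pumpkin_chain n m v G"
    and k: "0 < \<kappa>" "\<And>E F I. (E, F, I) \<in> forms G \<Longrightarrow> \<kappa> * F \<le> E"
  shows "\<kappa> * torsional_rigidity G powr (2 / 3) \<le> (pi / root 3 (24 / real n))\<^sup>2"
proof -
  interpret pumpkin n m v G by unfold_locales (rule G n pc)+
  define k1 where "k1 = (pi / (2 * L))\<^sup>2"
  have k1: "0 < k1" "sqrt k1 = pi / (2 * L)" using L_pos by (auto simp: k1_def)
  obtain F I where F: "(k1 * F, F, I) \<in> forms G" "0 < F" using sine_form unfolding k1_def by blast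
  have "\<kappa> * F \<le> k1 * F" by (rule k(2)[OF F(1)])
  then have "\<kappa> \<le> k1" using F(2) by simp
  then have "\<kappa> * torsional_rigidity G powr (2 / 3) \<le> k1 * torsional_rigidity G powr (2 / 3)" by (rule mult_right_mono) simp
  also have "\<dots> = k1 * (real n * (pi / (2 * sqrt k1)) ^ 3 / 3) powr (2 / 3)"
    unfolding torsion_value[OF cut] k1(2) using L_pos by simp
  also have "\<dots> = (pi / root 3 (24 / real n))\<^sup>2"
    by (rule kohler_jobin_arith(1)) (use k1 n in auto)
  finally show ?thesis .
qed

text \<open>Hands the equality information over to combinatorics. Gluing all Dirichlet vertices
  first provides a single bottom vertex.\<close>

lemma leveled_of_equality:
  fixes H :: "(nat, nat) metric_graph"
  assumes m: "monotone_state H n \<kappa> f f' u" and lp: "level_pairs H u = {}"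
    and eq: "torsional_rigidity H = real n * (pi / (2 * sqrt \<kappa>)) ^ 3 / 3" and n2: "n \<le> 2"
  obtains H' d where "chain H H'" "leveled n H' u d"
proof -
  interpret monotone_state H n \<kappa> f f' u by (rule m)
  note t = torsion_eq_imp[OF eq]
  have ne: "medges H \<noteq> {}" using A_nonempty A_medges by blast
  have D: "dirichlet H \<noteq> {}"
  proof
    assume "dirichlet H = {}"
    moreover have "mverts H \<noteq> {}" using ne fG(4) by blast
    ultimately have "n \<le> card (boundary H (mverts H))" using cut unfolding cut_ge_def by auto
    moreover have "boundary H (mverts H) = {}" using fG(4,5) by (auto simp: boundary_def)
    ultimately show False using N by simp
  qed
  obtain d where gl: "glues_to H (glue_dirichlet H)" and d: "dirichlet (glue_dirichlet H) = {d}"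
    using glues_to_glue_dirichlet[OF G D] by blast
  let ?K = "glue_dirichlet H"
  \<comment> \<open>The state vanishes at all Dirichlet vertices, so gluing them does not change
    vertex values.\<close>
  have gm: "u (glue_map H w) = u w" for w
    using fD(4) D some_in_eq[of "dirichlet H"] by (auto simp: glue_map_def)
  have K: "medges ?K = medges H" "len ?K = len H" "\<And>e. u (mtail ?K e) = u (mtail H e)" "\<And>e. u (mhead ?K e) = u (mhead H e)"
    "mverts ?K = glue_map H ` mverts H"
    by (auto simp: glue_dirichlet_def gm)
  have nn: "0 \<le> u w" if w: "w \<in> mverts H" for w
  proof (cases "w \<in> dirichlet H")
    case True then show ?thesis using fD(4) by simp
  next
    case False
    then have "n \<le> card (boundary H {w})" using cut w unfolding cut_ge_def by auto
    then have "boundary H {w} \<noteq> {}" using N by auto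
    then obtain e where "e \<in> medges H" "mtail H e = w \<or> mhead H e = w" by (auto simp: boundary_def)
    then show ?thesis using f0_nonneg[of e] t(1)[of e] fD(2)[of e] by auto
  qed
  have lev: "\<not> (u (mtail H e) < u w \<and> u w < u (mhead H e))" if "e \<in> medges H" "w \<in> mverts H" for e w
    using lp that unfolding level_pairs_def by blast
  have "leveled n ?K u d"
  proof
    show "finite_metric_graph ?K" using gl by (simp add: glues_to_def)
    show "1 \<le> n" by (rule N)
    show "cut_ge n ?K" using cut cut_ge_glues_to[OF gl] by simp
    show "medges ?K \<noteq> {}" using ne K by simp
    show "dirichlet ?K = {d}" by (rule d)
    have "d \<in> glue_map H ` dirichlet H" using d by (simp add: glue_dirichlet_def)
    then show "u d = 0" using gm fD(4) by auto
    show "0 \<le> u w" if "w \<in> mverts ?K" for w using that nn gm K by auto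
    show "u (mtail ?K e) < u (mhead ?K e)" if "e \<in> medges ?K" for e using that t(1) K by simp
    show "u (mhead ?K e) \<le> u w" if a: "e \<in> medges ?K" "w \<in> mverts ?K" "u (mtail ?K e) < u w" for e w
    proof -
      obtain x where x: "x \<in> mverts H" "w = glue_map H x" using a(2) K(5) by auto
      have "\<not> u x < u (mhead H e)" using lev[of e x] x(1) a(1,3) unfolding K x(2) gm by blast
      then show ?thesis unfolding K x(2) gm by simp
    qed
    show "len ?K a = len ?K b" if "a \<in> medges ?K" "b \<in> medges ?K" "u (mtail ?K a) = u (mtail ?K b)" "u (mhead ?K a) = u (mhead ?K b)" for a b
      using t(3)[of a b] that K by simp
    show "card {a\<in>medges ?K. u (mtail ?K a) = u (mtail ?K e) \<and> u (mhead ?K a) = u (mhead ?K e)} = n" if "e \<in> medges ?K" for e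
    proof -
      have e: "e \<in> medges H" using that K by simp
      \<comment> \<open>Picks a level \<open>r\<close> inside \<open>e\<close> that carries no
        vertex. Since no edge passes over a vertex level, the edges crossing \<open>r\<close> are
        exactly those with the same end levels as \<open>e\<close>, and their number is
        known.\<close>
      have "infinite ({u (mtail H e)<..<u (mhead H e)} - crit)"
        using t(1)[OF e] finite_crit by (intro Diff_infinite_finite) auto
      then obtain r where r: "u (mtail H e) < r" "r < u (mhead H e)" "r \<notin> crit"
        by (metis DiffE greaterThanLessThan_iff infinite_imp_nonempty ex_in_conv)
      have r0: "0 < r" "r < M" using r nn[OF fG(4)[OF e]] le_M(2)[OF fG(5)[OF e]] by auto
      have "{a\<in>medges H. u (mtail H a) = u (mtail H e) \<and> u (mhead H a) = u (mhead H e)} = {a\<in>medges H. u (mtail H a) < r \<and> r < u (mhead H a)}"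
      proof (intro set_eqI iffI)
        fix a assume a: "a \<in> {a\<in>medges H. u (mtail H a) < r \<and> r < u (mhead H a)}"
        then have am: "a \<in> medges H" by simp
        have "u (mtail H a) = u (mtail H e)"
          using lev[OF am fG(4)[OF e]] lev[OF e fG(4)[OF am]] a r by auto
        moreover have "u (mhead H a) = u (mhead H e)"
          using lev[OF am fG(5)[OF e]] lev[OF e fG(5)[OF am]] a r by auto
        ultimately show "a \<in> {a\<in>medges H. u (mtail H a) = u (mtail H e) \<and> u (mhead H a) = u (mhead H e)}" using am by simp
      qed (use r in auto)
      then show ?thesis using t(2)[OF r0 r(3)] K by simp
    qed
  qed
  then show ?thesis using that chain_glues[OF gl] by blast
qed

text \<open>Both theorems at once, for \<open>n = 1\<close> and \<open>n = 2\<close>. Eigenvalue and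
  torsion are computed on the normalised copy \<open>H\<close>, which has the same
  \<open>forms\<close>. The last claim applies the same invariance to an arbitrary chain of
  identifications ending in a pumpkin chain, where the reverse inequality is known.\<close>

lemma kohler_jobin_graph:
  fixes G :: "('v, 'e) metric_graph"
  assumes G: "finite_metric_graph G" and ne: "medges G \<noteq> {}" and cut: "cut_ge n G" and n: "1 \<le> n" "n \<le> 2"
  defines "q \<equiv> ground_state_energy G * torsional_rigidity G powr (2 / 3)"
  shows "(pi / root 3 (24 / real n))\<^sup>2 \<le> q"
    "(pi / root 3 (24 / real n))\<^sup>2 = q \<Longrightarrow> \<exists>G' H u d. glues_to G G' \<and> chain G' H \<and> leveled n H u d"
    "glues_to G G' \<Longrightarrow> chain G' H \<Longrightarrow> pumpkin_chain n m v H \<Longrightarrow> (pi / root 3 (24 / real n))\<^sup>2 = q"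
proof -
  obtain G0 :: "(nat, nat) metric_graph" where G0: "glues_to G G0" by (rule glues_to_nat_copy[OF G])
  have f0: "finite_metric_graph G0" using G0 by (simp add: glues_to_def)
  have fm0: "forms G = forms G0" by (rule glues_to_forms[OF G0])
  have c0: "cut_ge n G0" using cut cut_ge_glues_to[OF G0] by simp
  have ne0: "medges G0 \<noteq> {}" using G0 ne by (auto simp: glues_to_def bij_betw_def)
  obtain H \<kappa> f f' u where H: "chain G0 H" "finite_metric_graph H" "ground_state H \<kappa> f f' u" "monotone_edges H f f'" "level_pairs H u = {}"
    by (rule chain_normalise[OF f0 cut_ge_mono[OF c0 n(1)] ne0])
  have inv: "forms G = forms H" "cut_ge n H" using chain_invariants[OF H(1) f0] fm0 c0 n(2) by auto
  have m: "monotone_state H n \<kappa> f f' u"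
    by unfold_locales (use H inv n in \<open>auto simp: monotone_edges_def\<close>)
  have k: "ground_state_energy G = \<kappa>"
    using ground_state_energy_forms_eq[OF G H(2) inv(1)] ground_state_energy_eq[OF H(2,3)] by simp
  have T: "torsional_rigidity G = torsional_rigidity H"
    by (rule torsional_rigidity_forms_eq[OF G cut_ge_mono[OF cut n(1)] H(2) cut_ge_mono[OF inv(2) n(1)] inv(1)])
  have k0: "0 < \<kappa>" using ground_stateD(1)[OF H(3)] .
  have n0: "0 < real n" using n by simp
  have ge: "real n * (pi / (2 * sqrt \<kappa>)) ^ 3 / 3 \<le> torsional_rigidity G"
    unfolding T by (rule monotone_state.torsion_ge[OF m])
  show lower: "(pi / root 3 (24 / real n))\<^sup>2 \<le> q"
    unfolding q_def k by (rule kohler_jobin_arith(2)[OF k0 n0 ge])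
  show "\<exists>G' H u d. glues_to G G' \<and> chain G' H \<and> leveled n H u d" if "(pi / root 3 (24 / real n))\<^sup>2 = q"
  proof -
    have "torsional_rigidity G = real n * (pi / (2 * sqrt \<kappa>)) ^ 3 / 3"
      by (rule kohler_jobin_arith(3)[OF k0 n0 ge]) (use that in \<open>simp add: q_def k\<close>)
    then have "torsional_rigidity H = real n * (pi / (2 * sqrt \<kappa>)) ^ 3 / 3" using T by simp
    then obtain H' d where H': "chain H H'" "leveled n H' u d"
      by (rule leveled_of_equality[OF m H(5) _ n(2)])
    have "chain G0 H'" by (rule equivclp_trans[OF H(1) H'(1)])
    then show ?thesis using G0 H'(2) by blast
  qed
  show "(pi / root 3 (24 / real n))\<^sup>2 = q" if "glues_to G G'" "chain G' H'" "pumpkin_chain n m v H'" for G' H' v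
  proof (rule antisym[OF lower])
    have f': "finite_metric_graph G'" using that(1) by (simp add: glues_to_def)
    have fm': "forms G = forms G'" by (rule glues_to_forms[OF that(1)])
    have c': "cut_ge n G'" using cut cut_ge_glues_to[OF that(1)] by simp
    have inv': "finite_metric_graph H'" "forms G = forms H'" "cut_ge n H'" using chain_invariants[OF that(2) f'] fm' c' n(2) by auto
    have c1: "cut_ge 1 H'" by (rule cut_ge_mono[OF inv'(3) n(1)])
    have "torsional_rigidity G = torsional_rigidity H'"
      by (rule torsional_rigidity_forms_eq[OF G cut_ge_mono[OF cut n(1)] inv'(1) c1 inv'(2)])
    moreover have "\<kappa> * torsional_rigidity H' powr (2 / 3) \<le> (pi / root 3 (24 / real n))\<^sup>2"
      by (rule pumpkin_product_le[OF inv'(1) c1 n(1) that(3) k0]) (use ground_stateD(9)[OF H(3)] inv(1) inv'(2) in auto)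
    ultimately show "q \<le> (pi / root 3 (24 / real n))\<^sup>2" by (simp add: q_def k)
  qed
qed

theorem theorem5p8:
  fixes G :: "('v, 'e) metric_graph"
  assumes "connected_metric_graph G" and "dirichlet G \<noteq> {}"
  shows "(pi / root 3 24)\<^sup>2 \<le> ground_state_energy G * torsional_rigidity G powr (2 / 3) \<and>
    ((pi / root 3 24)\<^sup>2 = ground_state_energy G * torsional_rigidity G powr (2 / 3) \<longleftrightarrow>
      (\<exists>H. mixed_interval H \<and> identified G H)) \<and>
    (doubly_connected (glue_dirichlet G) \<longrightarrow>
      (pi / root 3 12)\<^sup>2 \<le> ground_state_energy G * torsional_rigidity G powr (2 / 3) \<and>
      ((pi / root 3 12)\<^sup>2 = ground_state_energy G * torsional_rigidity G powr (2 / 3) \<longleftrightarrow>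
        (\<exists>H. caterpillar H \<and> identified G H)))"
proof -
  have G: "finite_metric_graph G" "medges G \<noteq> {}" using assms by (auto simp: connected_metric_graph_def)
  let ?q = "ground_state_energy G * torsional_rigidity G powr (2 / 3)"
  have c1: "cut_ge 1 G" by (rule cut_ge_1_connected[OF assms])
  note K1 = kohler_jobin_graph[OF G c1 order.refl one_le_numeral, unfolded of_nat_1 div_by_1]
  have "(pi / root 3 24)\<^sup>2 = ?q \<longleftrightarrow> (\<exists>H. mixed_interval H \<and> identified G H)"
  proof
    assume "(pi / root 3 24)\<^sup>2 = ?q"
    then obtain G' H u d where *: "glues_to G G'" "chain G' H" "leveled 1 H u d" using K1(2) by blast
    obtain H' where H': "chain H H'" "mixed_interval H'" using leveled_1_mixed_interval[OF *(3)] by blast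
    have "identified G H'" unfolding identified_def using *(1) equivclp_trans[OF *(2) H'(1)] by blast
    then show "\<exists>H. mixed_interval H \<and> identified G H" using H'(2) by blast
  next
    assume "\<exists>H. mixed_interval H \<and> identified G H"
    then obtain H G' where *: "mixed_interval H" "glues_to G G'" "chain G' H" unfolding identified_def by blast
    obtain m v where "pumpkin_chain 1 m v H" using mixed_interval_pumpkin[OF *(1)] by blast
    then show "(pi / root 3 24)\<^sup>2 = ?q" using K1(3)[OF *(2,3)] by blast
  qed
  moreover have "(pi / root 3 12)\<^sup>2 \<le> ?q \<and> ((pi / root 3 12)\<^sup>2 = ?q \<longleftrightarrow> (\<exists>H. caterpillar H \<and> identified G H))"
    if dc: "doubly_connected (glue_dirichlet G)"
  proof -
    have c2: "cut_ge 2 G" by (rule cut_ge_2_doubly_connected[OF assms dc])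
    have "24 / real 2 = 12" by simp
    note K2 = kohler_jobin_graph[OF G c2 one_le_numeral order.refl, unfolded this]
    have "(pi / root 3 12)\<^sup>2 = ?q \<longleftrightarrow> (\<exists>H. caterpillar H \<and> identified G H)"
    proof
      assume "(pi / root 3 12)\<^sup>2 = ?q"
      then obtain G' H u d where *: "glues_to G G'" "chain G' H" "leveled 2 H u d" using K2(2) by blast
      obtain H' where H': "chain H H'" "caterpillar H'" using leveled_2_caterpillar[OF *(3)] by blast
      have "identified G H'" unfolding identified_def using *(1) equivclp_trans[OF *(2) H'(1)] by blast
      then show "\<exists>H. caterpillar H \<and> identified G H" using H'(2) by blast
    next
      assume "\<exists>H. caterpillar H \<and> identified G H"
      then obtain H G' where *: "caterpillar H" "glues_to G G'" "chain G' H" unfolding identified_def by blast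
      obtain m v where "pumpkin_chain 2 m v H" using caterpillar_pumpkin[OF *(1)] by blast
      then show "(pi / root 3 12)\<^sup>2 = ?q" using K2(3)[OF *(2,3)] by blast
    qed
    then show ?thesis using K2(1) by blast
  qed
  ultimately show ?thesis using K1(1) by blast
qed

end
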